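(* Let $L_1$ be an analytic Jordan curve and let $\widehat\rho<\sigma<\rho<1$, $a_1,\dots,a_s\in L_\rho$, $\lambda_1,\dots,\lambda_s$, $u$, $\omega$ and the weight $$h(z)=|\omega(z)|^{-2}\prod_{k=1}^s|z-a_k|^{2\lambda_k},\quad z\in L_1,$$ be as specified in the context, together with the associated objects $P_n$, $\phi$, $\Delta_e$, $\Delta_i$, $W$, $\Sigma_\sigma$, $\alpha_k$. (a) For all $z\in G_1\setminus\partial\Sigma_\sigma$, $$\frac{\Delta_e(\infty)P_n(z)}{[\phi'(\infty)]^{-n-1/2}}=\left\{\begin{array}{ll}\Delta_e(z)\sqrt{\phi'(z)}[\phi(z)]^n, & z\in G_1\cap\Sigma_\sigma,\\ 0, & z\in G_\sigma,\end{array}\right\}+\binom{n}{\lambda_1-1}\Delta_i(z)^{-1}\left(\sum_{k=1}^u\alpha_k\Delta_i(a_k)W(a_k,z)[\phi(a_k)]^{n+1}+\rho^nr_n(z)\right),$$ where $r_n(z)$ converges to $0$ locally uniformly on $G_1\setminus\partial\Sigma_\sigma$ as $n\to\infty$. (b) For every $1\le j\le s$, $$\frac{\Delta_e(\infty)P_n(a_j)}{[\phi'(\infty)]^{-n-1/2}}=\binom{n}{\lambda_j}\alpha_j\phi'(a_j)\phi(a_j)^n+\binom{n}{\lambda_1-1}\Delta_i(a_j)^{-1}\sum_{1\le k\le u,\,k\ne j}\alpha_k\Delta_i(a_k)W(a_k,a_j)[\phi(a_k)]^{n+1}+o\left(n^{\max\{\lambda_j,\lambda_1-1\}}\rho^n\right)$$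 as $n\to\infty$.
   Context: Notation: $\mathbb{T}_s=\{|w|=s\}$, $\mathbb{E}_s=\{w: s<|w|\le\infty\}$, $\mathbb{D}_s=\{|w|<s\}$. A function is called analytic on a closed set if it is analytic on a neighborhood of it (possibly after analytic continuation). Exterior map. $L_1$ is an analytic Jordan curve in $\mathbb{C}$. $\Omega_1$ is the unbounded component of $\overline{\mathbb{C}}\setminus L_1$; $\psi$ is the conformal map of $\mathbb{E}_1$ onto $\Omega_1$ with $\psi(\infty)=\infty$, $\psi'(\infty)>0$. $\widehat\rho\ge0$ is the smallest number such that $\psi$ has an analytic and univalent continuation to $\mathbb{E}_{\widehat\rho}$ (so $\widehat\rho<1$). For $\widehat\rho\le t<\infty$: $\Omega_t=\psi(\mathbb{E}_t)$, $L_t=\partial\Omega_t$, $G_t=\mathbb{C}\setminus\overline{\Omega}_t$. $\phi:\Omega_{\widehat\rho}\to\mathbb{E}_{\widehat\rho}$ is the inverse of $\psi$; $\sqrt{\phi'}$, and more generally real powers of $\phi'$, are the analytic branches on $\Omega_{\widehat\rho}$ positive at $\infty$. Weight. $a_1,\dots,a_s$ ($s\ge1$) are distinct points of $L_\rho$, where $\widehat\rho<\rho<1$. $\lambda_1\ge\lambda_2\ge\cdots\ge\lambda_s$ are real numbers, none in $\{0,-1,-2,\dots\}$, and $u$ is the number of indices $k$ with $\lambda_k=\lambda_1$, so $\lambda_1=\cdots=\lambda_u>\lambda_{u+1}\ge\cdots\ge\lambda_s$. For some $\sigma$ with $\widehat\rho<\sigma<\rho$, $\omega$ is analytic on $\overline{\Omega}_\sigma$,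 positive at $\infty$ and never zero on $\overline{\Omega}_1\cup\{a_1,\dots,a_s\}$; such a $\sigma$ is fixed. The weight is $h(z)=|\omega(z)|^{-2}\prod_{k=1}^s|z-a_k|^{2\lambda_k}$, $z\in L_1$. Orthogonal polynomials. $P_n$ is the monic polynomial of degree $n$ with $\oint_{L_1}P_n(z)\overline{z^m}h(z)|dz|=0$ for $0\le m<n$. Sets. $\phi(a_k)=\rho_k=\rho e^{i\Theta_k}$, $0\le\Theta_k<2\pi$, $\sigma_k=\sigma e^{i\Theta_k}$; $[\sigma_k,\rho_k]$ is the segment joining $\sigma_k$ and $\rho_k$. With $\mathbb{N}=\{1,2,\dots\}$, $$\Gamma_\sigma=\mathbb{T}_\sigma\cup\{\rho_k:\lambda_k\in\mathbb{N}\}\cup\Big(\bigcup_{\lambda_k\notin\mathbb{N}}[\sigma_k,\rho_k]\Big),\qquad \Sigma_\sigma=\{z\in\Omega_\sigma:\phi(z)\notin\Gamma_\sigma\}.$$ Szegő functions. The exterior Szegő function $\Delta_e$ of $h$ (the unique function analytic and never zero on $\overline\Omega_1$ with $\Delta_e(\infty)>0$ and $|\Delta_e|^{-2}=h$ on $L_1$) is analytic on $\Sigma_\sigma$, where $$\Delta_e(z)=\omega(z)\prod_{k=1}^s\left(\frac{\phi(z)}{z-a_k}\right)^{\lambda_k},\quad z\in\Sigma_\sigma,$$ with the branches of the $\lambda_k$-powers chosen so that their values $[\phi'(\infty)]^{\lambda_k}$ at $\infty$ are positive. An interior Szegő function $\Delta_i$ is a function analytic and never zero on $\overline{G}_1$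 with $|\Delta_i|^2=h$ on $L_1$; it is unique up to a multiplicative constant of modulus 1, and one is fixed. Kernel. For a conformal map $\varphi$ of $G_1$ onto $\mathbb{D}_1$, $W(\zeta,z)=\frac{\sqrt{\varphi'(z)}\sqrt{\varphi'(\zeta)}}{\varphi(\zeta)-\varphi(z)}$, $\zeta,z\in G_1$ (same branch of $\sqrt{\varphi'}$ in both factors); it does not depend on the choice of $\varphi$. Constants. With the same branches of the powers, $$\alpha_k=[\phi'(a_k)]^{\lambda_k-1/2}\lim_{z\to a_k}\left\{\left(\frac{\phi(z)}{z-a_k}\right)^{-\lambda_k}\Delta_e(z)\right\},\quad 1\le k\le s,$$ and $\binom{a}{b}=\frac{\Gamma(a+1)}{\Gamma(b+1)\Gamma(a-b+1)}$ is the generalized binomial coefficient (with $1/\Gamma=0$ at the poles of the Gamma function $\Gamma$). The formula in (a), which defines $r_n$, is understood for all sufficiently large $n$ (so that $\binom{n}{\lambda_1-1}\ne0$). *)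

theory Defs
  imports "HOL-Complex_Analysis.Complex_Analysis" "HOL-Library.Landau_Symbols"
begin

text \<open>
  All sets are subsets of the finite plane: a domain of the Riemann sphere containing
  \<open>\<infinity>\<close> is represented by its finite part, and conditions at \<open>\<infinity>\<close> are stated through limits
  along \<open>at_infinity\<close>.  A function holomorphic near \<open>\<infinity>\<close> with a finite limit there is analytic
  at \<open>\<infinity>\<close> (removable singularity).
\<close>

definition pos_at_inf :: "(complex \<Rightarrow> complex) \<Rightarrow> bool" where
  "pos_at_inf f \<longleftrightarrow> (\<exists>c::real. c > 0 \<and> (f \<longlongrightarrow> complex_of_real c) at_infinity)"

definition val_inf :: "(complex \<Rightarrow> complex) \<Rightarrow> complex" where
  "val_inf f = Lim at_infinity f"

definition analytic_jordan_curve :: "(real \<Rightarrow> complex) \<Rightarrow> bool" where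
  "analytic_jordan_curve \<gamma> \<longleftrightarrow>
     (\<exists>g S. open S \<and> sphere 0 1 \<subseteq> S \<and> g holomorphic_on S \<and> inj_on g S \<and>
            \<gamma> = g \<circ> circlepath 0 1)"

text \<open>The integral of \<open>f(z) |dz|\<close> along \<open>\<gamma>\<close>.\<close>

definition arclength_integral :: "(real \<Rightarrow> complex) \<Rightarrow> (complex \<Rightarrow> complex) \<Rightarrow> complex" where
  "arclength_integral \<gamma> f =
     integral {0..1}
       (\<lambda>t. f (\<gamma> t) * complex_of_real (norm (vector_derivative \<gamma> (at t within {0..1}))))"

definition ext_disk :: "real \<Rightarrow> complex set" where
  "ext_disk r = {w. r < norm w}"

text \<open>
  For a map \<open>f\<close> with a simple pole at \<open>\<infinity>\<close>, \<open>f'(\<infinity>)\<close> is the value at \<open>\<infinity>\<close> of its derivative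
  (the leading coefficient \<open>c\<close> in \<open>f(w) = c w + c\<^sub>0 + c\<^sub>1 / w + \<dots>\<close>).
\<close>

definition exterior_map :: "complex set \<Rightarrow> (complex \<Rightarrow> complex) \<Rightarrow> bool" where
  "exterior_map L \<psi> \<longleftrightarrow>
     \<psi> holomorphic_on ext_disk 1 \<and> inj_on \<psi> (ext_disk 1) \<and>
     \<psi> ` ext_disk 1 = outside L \<and>
     filterlim \<psi> at_infinity at_infinity \<and> pos_at_inf (deriv \<psi>)"

text \<open>
  \<open>r0\<close> is the smallest nonnegative number such that the restriction of \<open>\<psi>\<close> to the exterior of the
  unit disk has an analytic and univalent continuation to \<open>ext_disk r0\<close>; the function \<open>\<psi>\<close>
  itself already denotes that continuation.
\<close>

definition minimal_univalence_radius :: "(complex \<Rightarrow> complex) \<Rightarrow> real \<Rightarrow> bool" where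
  "minimal_univalence_radius \<psi> r0 \<longleftrightarrow>
     0 \<le> r0 \<and> \<psi> holomorphic_on ext_disk r0 \<and> inj_on \<psi> (ext_disk r0) \<and>
     (\<forall>r \<Psi>. 0 \<le> r \<and> \<Psi> holomorphic_on ext_disk r \<and> inj_on \<Psi> (ext_disk r) \<and>
            (\<forall>w \<in> ext_disk r \<inter> ext_disk 1. \<Psi> w = \<psi> w) \<longrightarrow> r0 \<le> r)"

definition Omega :: "(complex \<Rightarrow> complex) \<Rightarrow> real \<Rightarrow> complex set" where
  "Omega \<psi> t = \<psi> ` ext_disk t"

definition level_curve :: "(complex \<Rightarrow> complex) \<Rightarrow> real \<Rightarrow> complex set" where
  "level_curve \<psi> t = frontier (Omega \<psi> t)"

definition interior_dom :: "(complex \<Rightarrow> complex) \<Rightarrow> real \<Rightarrow> complex set" where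
  "interior_dom \<psi> t = - closure (Omega \<psi> t)"

text \<open>
  \<open>g\<close> is an analytic branch on \<open>U\<close> of the (in general multivalued) power \<open>f\<^sup>x\<close>, positive at \<open>\<infinity>\<close>.
  The logarithm \<open>l\<close> is chosen pointwise, so for integral \<open>x\<close> no global
  logarithm of \<open>f\<close> is required.  If \<open>U\<close> is open, connected and contains a neighbourhood
  of \<open>\<infinity>\<close>, and \<open>f\<close> is analytic without zeros there and at \<open>\<infinity>\<close>, there is at most one such \<open>g\<close> on \<open>U\<close>:
  locally, any two of them have a continuous quotient with values in the countable
  set of all \<open>exp (2 \<pi> \<i> x m)\<close> with \<open>m\<close> an integer.
\<close>

definition is_power_branch ::
  "complex set \<Rightarrow> (complex \<Rightarrow> complex) \<Rightarrow> real \<Rightarrow> (complex \<Rightarrow> complex) \<Rightarrow> bool" where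
  "is_power_branch U f x g \<longleftrightarrow>
     g holomorphic_on U \<and>
     (\<forall>z\<in>U. \<exists>l. exp l = f z \<and> g z = exp (complex_of_real x * l)) \<and>
     pos_at_inf g"

definition power_branch ::
  "complex set \<Rightarrow> (complex \<Rightarrow> complex) \<Rightarrow> real \<Rightarrow> complex \<Rightarrow> complex" where
  "power_branch U f x = (SOME g. is_power_branch U f x g)"

definition weight ::
  "(complex \<Rightarrow> complex) \<Rightarrow> nat \<Rightarrow> (nat \<Rightarrow> complex) \<Rightarrow> (nat \<Rightarrow> real) \<Rightarrow> complex \<Rightarrow> real" where
  "weight \<omega> s a lam z =
     norm (\<omega> z) powr (-2) * (\<Prod>k=1..s. norm (z - a k) powr (2 * lam k))"

definition monic_orthogonal_poly ::
  "(real \<Rightarrow> complex) \<Rightarrow> (complex \<Rightarrow> real) \<Rightarrow> nat \<Rightarrow> complex poly \<Rightarrow> bool" where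
  "monic_orthogonal_poly \<gamma> h n p \<longleftrightarrow>
     degree p = n \<and> lead_coeff p = 1 \<and>
     (\<forall>m<n. arclength_integral \<gamma>
              (\<lambda>z. poly p z * cnj (z ^ m) * complex_of_real (h z)) = 0)"

text \<open>
  Below \<open>\<phi>\<close> is the inverse of \<open>\<psi>\<close>.  The set \<open>{1, 2, \<dots>}\<close> is \<open>\<nat> - {0}\<close>, and
  \<open>rcis \<sigma> (Arg2pi (\<phi> (a k)))\<close> is the point of modulus \<open>\<sigma>\<close> on the ray from \<open>0\<close> through \<open>\<phi> (a k)\<close>.
\<close>

definition slit_set ::
  "(complex \<Rightarrow> complex) \<Rightarrow> real \<Rightarrow> nat \<Rightarrow> (nat \<Rightarrow> complex) \<Rightarrow> (nat \<Rightarrow> real) \<Rightarrow> complex set" where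
  "slit_set \<phi> \<sigma> s a lam =
     sphere 0 \<sigma> \<union>
     {\<phi> (a k) | k. k \<in> {1..s} \<and> lam k \<in> \<nat> - {0}} \<union>
     (\<Union>k \<in> {k \<in> {1..s}. lam k \<notin> \<nat> - {0}}.
        closed_segment (rcis \<sigma> (Arg2pi (\<phi> (a k)))) (\<phi> (a k)))"

definition slit_domain ::
  "(complex \<Rightarrow> complex) \<Rightarrow> (complex \<Rightarrow> complex) \<Rightarrow> real \<Rightarrow> nat \<Rightarrow> (nat \<Rightarrow> complex) \<Rightarrow> (nat \<Rightarrow> real)
     \<Rightarrow> complex set" where
  "slit_domain \<psi> \<phi> \<sigma> s a lam = {z \<in> Omega \<psi> \<sigma>. \<phi> z \<notin> slit_set \<phi> \<sigma> s a lam}"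

text \<open>
  \<open>\<Omega>\<close> is the exterior domain and \<open>S\<close> is a domain containing its closure, to which the exterior
  Szego function is analytically continued.
\<close>

definition exterior_szego ::
  "complex set \<Rightarrow> complex set \<Rightarrow> complex set \<Rightarrow> (complex \<Rightarrow> real) \<Rightarrow> (complex \<Rightarrow> complex) \<Rightarrow> bool" where
  "exterior_szego L \<Omega> S h De \<longleftrightarrow>
     De holomorphic_on S \<and> De analytic_on closure \<Omega> \<and> (\<forall>z \<in> closure \<Omega>. De z \<noteq> 0) \<and>
     pos_at_inf De \<and> (\<forall>z\<in>L. norm (De z) powr (-2) = h z)"

definition interior_szego ::
  "complex set \<Rightarrow> complex set \<Rightarrow> (complex \<Rightarrow> real) \<Rightarrow> (complex \<Rightarrow> complex) \<Rightarrow> bool" where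
  "interior_szego L G h Di \<longleftrightarrow>
     Di analytic_on closure G \<and> (\<forall>z \<in> closure G. Di z \<noteq> 0) \<and>
     (\<forall>z\<in>L. (norm (Di z))\<^sup>2 = h z)"

definition conformal_onto_disk :: "complex set \<Rightarrow> (complex \<Rightarrow> complex) \<Rightarrow> bool" where
  "conformal_onto_disk G \<theta> \<longleftrightarrow> \<theta> holomorphic_on G \<and> inj_on \<theta> G \<and> \<theta> ` G = ball 0 1"

text \<open>In the kernel, \<open>q\<close> is a branch of the square root of \<open>\<theta>'\<close>.\<close>

definition is_sqrt_deriv :: "complex set \<Rightarrow> (complex \<Rightarrow> complex) \<Rightarrow> (complex \<Rightarrow> complex) \<Rightarrow> bool" where
  "is_sqrt_deriv G \<theta> q \<longleftrightarrow> q holomorphic_on G \<and> (\<forall>z\<in>G. (q z)\<^sup>2 = deriv \<theta> z)"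

definition kernel_W ::
  "(complex \<Rightarrow> complex) \<Rightarrow> (complex \<Rightarrow> complex) \<Rightarrow> complex \<Rightarrow> complex \<Rightarrow> complex" where
  "kernel_W \<theta> q \<zeta> z = q z * q \<zeta> / (\<theta> \<zeta> - \<theta> z)"

text \<open>\<open>rGamma\<close> is the entire function \<open>1 / \<Gamma>\<close>, with value \<open>0\<close> at the poles of \<open>\<Gamma>\<close>.\<close>

definition gen_binomial :: "real \<Rightarrow> real \<Rightarrow> real" where
  "gen_binomial x y = Gamma (x + 1) * rGamma (y + 1) * rGamma (x - y + 1)"

text \<open>
  \<open>U0\<close> is the domain of the powers of \<open>\<phi>'\<close>, and \<open>S\<close> the slit domain, on which the powers of
  \<open>\<phi>(z) / (z - b)\<close> are taken; \<open>b\<close> lies on its boundary.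
\<close>

definition szego_const ::
  "complex set \<Rightarrow> complex set \<Rightarrow> (complex \<Rightarrow> complex) \<Rightarrow> (complex \<Rightarrow> complex) \<Rightarrow> complex \<Rightarrow> real
     \<Rightarrow> complex" where
  "szego_const U0 S \<phi> De b x =
     power_branch U0 (deriv \<phi>) (x - 1/2) b *
     Lim (at b within S) (\<lambda>z. power_branch S (\<lambda>z. \<phi> z / (z - b)) (- x) z * De z)"

definition locally_uniform_limit ::
  "complex set \<Rightarrow> (nat \<Rightarrow> complex \<Rightarrow> complex) \<Rightarrow> (complex \<Rightarrow> complex) \<Rightarrow> bool" where
  "locally_uniform_limit A f l \<longleftrightarrow>
     (\<forall>z\<in>A. \<exists>e>0. uniform_limit (ball z e \<inter> A) f l sequentially)"

end

theory Submission
 imports Defs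
begin

text \<open>
 Work in the exterior coordinate \<open>v = \<phi> z\<close> and the interior coordinate \<open>w = \<theta> z\<close>, which are related near the
 unit circle by the reflection-continued map \<open>\<eta> = \<theta> \<circ> \<psi>\<close>.  On the curve, the functions
 \<open>e\<^sub>n = \<Delta>\<^sub>e \<sqrt>\<phi>' \<phi>\<^sup>n\<close> have norm one in \<open>L\<^sup>2(h |dz|)\<close>, and pairing with them extracts the leading coefficient of a
 polynomial.  The inner Cauchy transform \<open>J\<^sub>n\<close> of \<open>e\<^sub>n\<close> differs from \<open>e\<^sub>n\<close> by a function orthogonal to all
 polynomials and is approximable by polynomials of degree \<open>n\<close> up to \<open>O(\<tau>\<^sup>n)\<close> with \<open>\<tau> < \<rho>\<close>; hence the normalized
 \<open>P\<^sub>n\<close> equals \<open>J\<^sub>n\<close> up to such an error.  Moving the contour of \<open>J\<^sub>n\<close> inwards to radius \<open>\<rho> + O(1/n)\<close> produces the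
 residue \<open>e\<^sub>n(z)\<close> and Darboux-type contributions of the branch points \<open>\<phi>(a\<^sub>k)\<close>.  The bounds blow up like a power
 of \<open>1 / ||\<phi> z| - \<rho>|\<close>, which the maximum principle with a suitable weight removes.
\<close>

text \<open>The analytic errors are kept one power of \<open>n\<close> below the leading size
  \<open>\<rho>^n n^(\<Lambda>-1)\<close>, where \<open>\<Lambda>\<close> is the largest exponent.
  The normalization enters only through squares: the distance from \<open>e_n\<close> to the
  polynomials is \<open>O(\<rho>'^n)\<close> with \<open>\<rho>'\<close> slightly above
  \<open>\<rho>\<close>, its square governs the change of norm, and
  \<open>\<rho>'^2 < \<rho>\<close> can be arranged. The approximation of \<open>J_n\<close> itself
  must have a rate strictly below \<open>\<rho>\<close>; the gain comes from estimating on one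
  circle outside the unit circle and evaluating on a smaller one. On the radius
  \<open>r = \<rho> + t / (2n)\<close> the factor \<open>r^n\<close> costs a constant,
  \<open>m\<close> integrations by parts gain \<open>n^(-m)\<close>, and the derivatives near the
  branch points lose \<open>n^(p+m-2)\<close>, so \<open>m\<close> cancels. The pole of the Cauchy
  kernel at \<open>\<phi> z\<close> limits \<open>t\<close>, which causes the blow-up. At
  \<open>z = a_j\<close> this pole meets a branch point and raises its exponent by one; hence the
  different order in (b).\<close>

lemmas hol_subset = holomorphic_on_subset
lemmas hol_imp_cont = holomorphic_on_imp_continuous_on

lemma hol_cont: "f holomorphic_on S ==> A \<subseteq> S ==> continuous_on A f"
 by (rule continuous_on_subset[OF hol_imp_cont])

subsection \<open>Mean values over circles\<close>

text \<open>Integration against \<open>dv / (2 pi i v)\<close>. This is why a factor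
  \<open>v\<close> accompanies the Cauchy kernels and why exponents are shifted by one against
  contour integrals; a mean is bounded by a supremum with no length factor.\<close>

definition cmean :: "real \<Rightarrow> (complex \<Rightarrow> complex) \<Rightarrow> complex" where
 "cmean r f = integral {0..1} (%t. f (circlepath 0 r t))"

lemma circlepath_norm: "r \<ge> 0 ==> norm (circlepath 0 r t) = r"
 by (simp add: circlepath norm_mult)

lemma circlepath_in_sphere: "r \<ge> 0 ==> circlepath 0 r t \<in> sphere 0 r"
 by (simp add: circlepath_norm)

lemma circlepath_nz: "r > 0 ==> circlepath 0 r t ~= 0"
 by (simp add: circlepath)

lemma continuous_on_circlepath: "continuous_on A (circlepath 0 r)"
 unfolding circlepath by (intro continuous_intros)

lemma continuous_on_compose_circlepath:
 assumes "continuous_on (sphere 0 r) f" "r \<ge> 0"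
 shows "continuous_on A (%t. f (circlepath 0 r t))"
 by (rule continuous_on_compose2[OF assms(1) continuous_on_circlepath[of A r]])
   (use circlepath_in_sphere[OF assms(2)] in blast)

lemma circle_integrable:
 fixes f :: "complex \<Rightarrow> 'a::euclidean_space"
 assumes "continuous_on (sphere 0 r) f" "r \<ge> 0"
 shows "(%t. f (circlepath 0 r t)) integrable_on {0..1}"
 using continuous_on_compose_circlepath[OF assms] by (rule integrable_continuous_real)

lemma contour_integral_cmean:
 "contour_integral (circlepath 0 r) f = 2 * of_real pi * \<i> * cmean r (%v. v * f v)"
proof -
 have "contour_integral (circlepath 0 r) f
   = integral {0..1} (%x. (2 * of_real pi * \<i>) * (circlepath 0 r x * f (circlepath 0 r x)))"
  unfolding contour_integral_integral
 proof (rule integral_cong)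
  fix x :: real
  have "vector_derivative (circlepath 0 r) (at x) = 2 * of_real pi * \<i> * circlepath 0 r x"
   unfolding vector_derivative_circlepath by (simp add: circlepath mult_ac)
  thus "f (circlepath 0 r x) * vector_derivative (circlepath 0 r) (at x)
    = (2 * of_real pi * \<i>) * (circlepath 0 r x * f (circlepath 0 r x))" by (simp add: mult_ac)
 qed
 thus ?thesis by (simp add: cmean_def)
qed

lemma cmean_contour:
 assumes "r > 0"
 shows "cmean r f = contour_integral (circlepath 0 r) (%v. f v / v) / (2 * of_real pi * \<i>)"
proof -
 have "cmean r (%v. v * (f v / v)) = cmean r f"
  unfolding cmean_def by (intro integral_cong) (auto simp: circlepath_nz[OF assms])
 thus ?thesis using contour_integral_cmean[of r "%v. f v / v"] by simp
qed

lemma cmean_cong: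
 assumes "!!v. norm v = r ==> f v = g v" "r \<ge> 0" shows "cmean r f = cmean r g"
 unfolding cmean_def by (intro integral_cong) (use assms circlepath_norm in auto)

lemma cmean_const [simp]: "cmean r (%v. c) = c"
 by (simp add: cmean_def)

lemma cmean_mult_left: "cmean r (%v. c * f v) = c * cmean r f"
 by (simp add: cmean_def)

lemma cmean_add:
 assumes "continuous_on (sphere 0 r) f" "continuous_on (sphere 0 r) g" "r \<ge> 0"
 shows "cmean r (%v. f v + g v) = cmean r f + cmean r g"
 unfolding cmean_def by (intro integral_add circle_integrable assms)

lemma cmean_diff:
 assumes "continuous_on (sphere 0 r) f" "continuous_on (sphere 0 r) g" "r \<ge> 0"
 shows "cmean r (%v. f v - g v) = cmean r f - cmean r g"
 unfolding cmean_def by (intro integral_diff circle_integrable assms)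

lemma cmean_sum:
 assumes "finite K" "!!k. k \<in> K ==> continuous_on (sphere 0 r) (f k)" "r \<ge> 0"
 shows "cmean r (%v. \<Sum>k\<in>K. f k v) = (\<Sum>k\<in>K. cmean r (f k))"
 unfolding cmean_def by (intro integral_sum circle_integrable assms)

lemma cmean_norm_bound_integral:
 assumes "continuous_on (sphere 0 r) f" "continuous_on (sphere 0 r) g" "r \<ge> 0"
  "!!v. norm v = r ==> norm (f v) <= g v"
 shows "norm (cmean r f) <= integral {0..1} (%t. g (circlepath 0 r t))"
 unfolding cmean_def
 by (intro integral_norm_bound_integral circle_integrable assms) (use circlepath_norm assms in auto)

lemma cmean_bound:
 assumes "continuous_on (sphere 0 r) f" "r \<ge> 0" "!!v. norm v = r ==> norm (f v) <= B"
 shows "norm (cmean r f) <= B"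
 using cmean_norm_bound_integral[OF assms(1) continuous_on_const assms(2), of B] assms(3) by auto

lemma homotopic_circlepaths:
 assumes "0 < r" "r <= r'" "!!v. r <= norm v ==> norm v <= r' ==> v \<in> S"
 shows "homotopic_loops S (circlepath 0 r) (circlepath 0 r')"
proof (rule homotopic_loops_linear)
 fix t :: real
 show "closed_segment (circlepath 0 r t) (circlepath 0 r' t) \<subseteq> S"
 proof
  fix x assume "x \<in> closed_segment (circlepath 0 r t) (circlepath 0 r' t)"
  then obtain u where u: "0 <= u" "u <= 1"
   and x: "x = (1 - u) *\<^sub>R circlepath 0 r t + u *\<^sub>R circlepath 0 r' t"
   by (auto simp: closed_segment_def)
  have "x = of_real ((1 - u) * r + u * r') * exp (2 * of_real pi * \<i> * of_real t)"
   by (simp add: x circlepath scaleR_conv_of_real algebra_simps)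
  hence "norm x = \<bar>(1 - u) * r + u * r'\<bar>"
   by (simp add: norm_mult flip: of_real_add of_real_mult of_real_diff)
  moreover have "(1 - u) * r + u * r' = r + u * (r' - r)" by (simp add: algebra_simps)
  moreover have "u * (r' - r) <= 1 * (r' - r)" using u assms by (intro mult_right_mono) auto
  moreover have "0 <= u * (r' - r)" using u assms by simp
  ultimately have "r <= norm x" "norm x <= r'" using assms(1) by auto
  thus "x \<in> S" using assms(3) by auto
 qed
qed auto

lemma cmean_radius:
 assumes "open S" "f holomorphic_on S" "0 < r" "r <= r'"
  "!!v. r <= norm v ==> norm v <= r' ==> v \<in> S"
 shows "cmean r f = cmean r' f"
proof -
 have *: "homotopic_loops (S - {0}) (circlepath 0 r) (circlepath 0 r')"
  by (rule homotopic_circlepaths) (use assms in auto)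
 have "contour_integral (circlepath 0 r) (%v. f v / v) = contour_integral (circlepath 0 r') (%v. f v / v)"
  by (rule Cauchy_theorem_homotopic_loops[OF *])
    (use assms in "auto intro!: holomorphic_intros hol_subset[OF assms(2)]")
 thus ?thesis using assms by (simp add: cmean_contour)
qed

text \<open>The mean does not change when the radius grows, and on large circles the integrand is
  uniformly close to its limit at infinity.\<close>

lemma cmean_exterior:
 assumes "open S" "f holomorphic_on S" "0 < r" "!!v. r <= norm v ==> v \<in> S"
  "(f \<longlongrightarrow> l) at_infinity"
 shows "cmean r f = l"
proof (rule ccontr)
 assume "cmean r f ~= l"
 hence e: "norm (cmean r f - l) / 2 > 0" by simp
 from tendstoD[OF assms(5) e] obtain b where b: "!!x. b <= norm x ==> dist (f x) l < norm (cmean r f - l) / 2"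
  by (auto simp: eventually_at_infinity)
 define R where "R = max r b"
 have cont: "continuous_on (sphere 0 R) f"
  by (rule hol_cont[OF assms(2)])
    (use assms in "auto simp: R_def")
 have "cmean r f - l = cmean R f - cmean R (%_. l)"
  using cmean_radius[OF assms(1,2,3), of R] assms by (auto simp: R_def)
 also have "... = cmean R (%v. f v - l)"
  using cont assms by (intro cmean_diff[symmetric] continuous_intros) (auto simp: R_def)
 also have "norm ... <= norm (cmean r f - l) / 2"
  by (rule cmean_bound) (use b cont assms in "auto intro!: continuous_intros less_imp_le simp: R_def dist_norm")
 finally show False using e by auto
qed

lemma cmean_Cauchy:
 assumes "open S" "f holomorphic_on S" "0 < r" "cball 0 r \<subseteq> S" "norm w < r"
 shows "cmean r (%v. v * f v / (v - w)) = f w"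
proof -
 have "((%u. f u/(u-w)) has_contour_integral (2 * of_real pi * \<i> * f w)) (circlepath 0 r)"
  by (rule Cauchy_integral_circlepath_simple) (use assms hol_subset in auto)
 hence "contour_integral (circlepath 0 r) (%u. f u/(u-w)) = 2 * of_real pi * \<i> * f w"
  by (rule contour_integral_unique)
 thus ?thesis by (simp add: contour_integral_cmean)
qed

lemma cmean_Cauchy_0:
 assumes "open S" "f holomorphic_on S" "0 < r" "cball 0 r \<subseteq> S"
 shows "cmean r f = f 0"
proof -
 have "cmean r f = cmean r (%v. v * f v / (v - 0))"
  by (rule cmean_cong) (use assms in auto)
 thus ?thesis using cmean_Cauchy[OF assms, of 0] assms by simp
qed

lemma holomorphic_removable_quotient:
 assumes "f holomorphic_on S" "open S" "y \<in> S"
 shows "(%v. if v = y then deriv f y else (f v - f y) / (v - y)) holomorphic_on S"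
 using pole_theorem_open[OF assms(1,2), of y "%v. deriv f y" ] assms
  pole_lemma_open[of f S y] by auto

text \<open>Write \<open>f v = f y + (v - y) * g v\<close>. The part with \<open>g\<close> has the
  same mean on both circles, while \<open>v / (v - y)\<close> has mean 1 on the outer and 0 on the
  inner one.\<close>

lemma cmean_annulus_Cauchy:
 assumes "open S" "f holomorphic_on S" "0 < s" "s < norm y" "norm y < t"
  "!!v. s <= norm v ==> norm v <= t ==> v \<in> S"
 shows "cmean t (%v. v * f v / (v - y)) = cmean s (%v. v * f v / (v - y)) + f y"
proof -
 define g where "g = (%v. if v = y then deriv f y else (f v - f y) / (v - y))"
 have yS: "y \<in> S" using assms by auto
 have holg: "g holomorphic_on S" unfolding g_def by (rule holomorphic_removable_quotient) (use assms yS in auto)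
 have cont: "continuous_on (sphere 0 r) g" "continuous_on (sphere 0 r) f" if "s <= r" "r <= t" for r
  using that assms(6) by (auto intro!: continuous_on_subset[OF hol_imp_cont] holg assms(2))
 have eq: "cmean r (%v. v * f v / (v - y)) = cmean r (%v. v * g v) + f y * cmean r (%v. v / (v - y))"
  if "r = s \<or> r = t" for r
 proof -
  have ne: "v ~= y" if "norm v = r" for v using that assms \<open>r = s \<or> r = t\<close> by auto
  have r: "r \<ge> 0" "s <= r" "r <= t" using that assms by auto
  have "cmean r (%v. v * f v / (v - y)) = cmean r (%v. v * g v + f y * (v / (v - y)))"
  proof (rule cmean_cong)
   fix v :: complex assume "norm v = r"
   hence "v - y ~= 0" "v ~= y" using ne by auto
   thus "v * f v / (v - y) = v * g v + f y * (v / (v - y))"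
    unfolding g_def by (simp add: divide_simps) (simp add: algebra_simps)
  qed (use r in auto)
  also have "... = cmean r (%v. v * g v) + cmean r (%v. f y * (v / (v - y)))"
   by (rule cmean_add) (use ne r in "auto intro!: continuous_intros cont")
  finally show ?thesis by (simp only: cmean_mult_left)
 qed
 have 1: "cmean t (%v. v / (v - y)) = 1"
  using cmean_Cauchy[of UNIV "%_. 1" t y] assms by auto
 have 2: "cmean s (%v. v / (v - y)) = 0"
 proof -
  have "(%v. v / (v - y)) holomorphic_on ball 0 (norm y)" by (auto intro!: holomorphic_intros)
  moreover have "cball 0 s \<subseteq> ball 0 (norm y)" using assms by auto
  ultimately show ?thesis using cmean_Cauchy_0[of "ball 0 (norm y)" "%v. v / (v - y)" s] assms(3) by auto
 qed
 have 3: "cmean s (%v. v * g v) = cmean t (%v. v * g v)"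
  by (rule cmean_radius[OF assms(1)]) (use assms holg in "auto intro!: holomorphic_intros")
 show ?thesis using eq[of t] eq[of s] 1 2 3 by simp
qed

text \<open>The mean hides a factor \<open>1 / v\<close>, so the exponent \<open>Suc n\<close>
  stands for \<open>v ^ n dv\<close>; the primitive that closes up over the circle is
  \<open>f v * v ^ Suc n\<close>.\<close>

lemma cmean_by_parts:
 assumes "open S" "f holomorphic_on S" "0 < r" "sphere 0 r \<subseteq> S"
 shows "cmean r (%v. f v * v ^ Suc n) = - cmean r (%v. deriv f v * v ^ (Suc (Suc n))) / of_nat (Suc n)"
proof -
 have d: "((%v. f v * v ^ Suc n) has_field_derivative
    (deriv f v * v ^ Suc n + of_nat (Suc n) * f v * v ^ n)) (at v within S)" if "v \<in> S" for v
  using DERIV_mult[OF holomorphic_derivI[OF assms(2,1) that, of S] DERIV_power[OF DERIV_ident, of "Suc n"]]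
  by (simp add: mult_ac)
 have "((%v. deriv f v * v ^ Suc n + of_nat (Suc n) * f v * v ^ n) has_contour_integral 0) (circlepath 0 r)"
  by (rule Cauchy_theorem_primitive[of S "%v. f v * v ^ Suc n"]) (use d assms in auto)
 hence "cmean r (%v. v * (deriv f v * v ^ Suc n + of_nat (Suc n) * f v * v ^ n)) = 0"
  using contour_integral_unique contour_integral_cmean[of r] by fastforce
 also have "cmean r (%v. v * (deriv f v * v ^ Suc n + of_nat (Suc n) * f v * v ^ n))
   = cmean r (%v. deriv f v * v ^ (Suc (Suc n)) + of_nat (Suc n) * (f v * v ^ Suc n))"
  by (simp add: algebra_simps)
 also have "... = cmean r (%v. deriv f v * v ^ (Suc (Suc n))) + cmean r (%v. of_nat (Suc n) * (f v * v ^ Suc n))"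
  using assms by (intro cmean_add continuous_intros continuous_on_subset[OF hol_imp_cont]
    assms(2) holomorphic_deriv) (auto)
 finally have "cmean r (%v. deriv f v * v ^ (Suc (Suc n))) + of_nat (Suc n) * cmean r (%v. f v * v ^ Suc n) = 0"
  by (simp only: cmean_mult_left)
 moreover have "of_nat (Suc n) ~= (0::complex)" using of_nat_neq_0 by blast
 ultimately show ?thesis by (simp add: field_simps add_eq_0_iff del: of_nat_Suc power_Suc)
qed

lemma cmean_by_parts_iterated:
 assumes "open S" "f holomorphic_on S" "0 < r" "sphere 0 r \<subseteq> S"
 shows "cmean r (%v. f v * v ^ Suc n)
    = (-1) ^ m * fact n / fact (n + m) * cmean r (%v. (deriv ^^ m) f v * v ^ (Suc n + m))"
proof (induction m)
 case (Suc m)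
 have "(deriv ^^ m) f holomorphic_on S" using assms by (simp add: holomorphic_higher_deriv)
 from cmean_by_parts[OF assms(1) this assms(3,4), of "n + m"]
 show ?case using Suc.IH by (simp add: fact_Suc)
qed simp

text \<open>On the circle \<open>cnj (v - b) = (r^2 - cnj b * v) / v\<close>, so the integrand is a
  Cauchy kernel at \<open>b\<close> applied to a function holomorphic in the closed disc. This is
  the normalization of the Poisson kernel.\<close>

lemma circle_integral_inverse_square:
 assumes "norm b < r"
 shows "integral {0..1} (%t. 1 / (norm (circlepath 0 r t - b))\<^sup>2) = 1 / (r\<^sup>2 - (norm b)\<^sup>2)"
proof -
 have r: "r > 0" using assms norm_ge_zero[of b] by linarith
 have pos: "r\<^sup>2 - (norm b)\<^sup>2 > 0" using assms power_strict_mono[of "norm b" r 2] by auto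
 have ne: "of_real (r\<^sup>2) - cnj b * v ~= 0" if "norm v <= r" for v
 proof
  assume "of_real (r\<^sup>2) - cnj b * v = 0"
  hence "of_real (r\<^sup>2) = cnj b * v" by simp
  hence "norm (of_real (r\<^sup>2) :: complex) = norm (cnj b * v)" by simp
  hence "r\<^sup>2 = norm b * norm v" by (simp add: norm_mult norm_power)
  also have "... <= norm b * r" using that by (intro mult_left_mono) auto
  also have "... < r * r" using assms r by simp
  finally show False by (simp add: power2_eq_square)
 qed
 define S where "S = {v. of_real (r\<^sup>2) - cnj b * v ~= 0}"
 have oS: "open S" unfolding S_def by (intro open_Collect_neq continuous_intros)
 have "cmean r (%v. v * (1 / (of_real (r\<^sup>2) - cnj b * v)) / (v - b)) = 1 / (of_real (r\<^sup>2) - cnj b * b)"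
  by (rule cmean_Cauchy[OF oS]) (use r assms ne in "auto simp del: right_minus_eq simp: S_def intro!: holomorphic_intros")
 moreover have "cmean r (%v. v * (1 / (of_real (r\<^sup>2) - cnj b * v)) / (v - b))
   = cmean r (%v. of_real (1 / (norm (v - b))\<^sup>2))"
 proof (rule cmean_cong)
  fix v :: complex assume v: "norm v = r"
  hence "v ~= 0" using r by auto
  have "of_real ((norm (v - b))\<^sup>2) = (v - b) * cnj (v - b)" using complex_norm_square by metis
  hence 1: "complex_of_real (1 / (norm (v - b))\<^sup>2) = 1 / ((v - b) * cnj (v - b))"
   by (simp only: of_real_divide of_real_1)
  have "of_real (r\<^sup>2) = v * cnj v" using complex_norm_square[of v] v by simp
  hence 2: "of_real (r\<^sup>2) - cnj b * v = v * cnj (v - b)" by (simp add: algebra_simps)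
  show "v * (1 / (of_real (r\<^sup>2) - cnj b * v)) / (v - b) = of_real (1 / (norm (v - b))\<^sup>2)"
   unfolding 1 2 using \<open>v ~= 0\<close> by (simp add: mult.commute)
 qed (use r in auto)
 moreover have "cmean r (%v. of_real (1 / (norm (v - b))\<^sup>2))
   = of_real (integral {0..1} (%t. 1 / (norm (circlepath 0 r t - b))\<^sup>2))"
  unfolding cmean_def
 proof (rule integral_unique, rule has_integral_of_real)
  have "(%t. 1 / (norm (circlepath 0 r t - b))\<^sup>2) integrable_on {0..1}"
   by (rule circle_integrable[of r "%v. 1 / (norm (v - b))\<^sup>2"]) (use assms r in "auto intro!: continuous_intros")
  thus "((%t. 1 / (norm (circlepath 0 r t - b))\<^sup>2) has_integral
     integral {0..1} (%t. 1 / (norm (circlepath 0 r t - b))\<^sup>2)) {0..1}" by (rule integrable_integral)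
 qed
 moreover have "cnj b * b = of_real ((norm b)\<^sup>2)" using complex_norm_square[of b] by (simp add: mult.commute)
 ultimately have "complex_of_real (integral {0..1} (%t. 1 / (norm (circlepath 0 r t - b))\<^sup>2))
   = of_real (1 / (r\<^sup>2 - (norm b)\<^sup>2))"
  by simp
 thus ?thesis using of_real_eq_iff by blast
qed

lemma cmean_holomorphic_param:
 assumes "open U" "continuous_on (sphere 0 r) g" "continuous_on (sphere 0 r) h" "r \<ge> 0"
  "!!v w. norm v = r ==> w \<in> U ==> h v ~= w"
 shows "(%w. cmean r (%v. g v / (h v - w))) holomorphic_on U"
proof -
 have "(%w. cmean r (%v. g v / (h v - w))) holomorphic_on ball w0 e" if "ball w0 e \<subseteq> U" for w0 e
 proof -
  have eq: "(%w. cmean r (%v. g v / (h v - w)))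
    = (%w. integral (cbox 0 1) (%t. g (circlepath 0 r t) / (h (circlepath 0 r t) - w)))"
   by (simp add: cmean_def fun_eq_iff cbox_interval)
  have ne: "h (circlepath 0 r t) - w ~= 0" if "w \<in> ball w0 e" for w t
   using assms(5)[of "circlepath 0 r t" w] that \<open>ball w0 e \<subseteq> U\<close> circlepath_norm[OF assms(4)] by auto
  have cg: "continuous_on A (%t. g (circlepath 0 r t))" for A
   by (rule continuous_on_compose_circlepath) (use assms in auto)
  have ch: "continuous_on A (%t. h (circlepath 0 r t))" for A
   by (rule continuous_on_compose_circlepath) (use assms in auto)
  show ?thesis unfolding eq
  proof (rule leibniz_rule_holomorphic)
   fix w t assume "w \<in> ball w0 e" "t \<in> cbox (0::real) 1"
   thus "((%w. g (circlepath 0 r t) / (h (circlepath 0 r t) - w)) has_field_derivative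
     g (circlepath 0 r t) / (h (circlepath 0 r t) - w)\<^sup>2) (at w within ball w0 e)"
    using ne[of w t] by (auto intro!: derivative_eq_intros simp: power2_eq_square)
  next
   fix w assume "w \<in> ball w0 e"
   thus "(%t. g (circlepath 0 r t) / (h (circlepath 0 r t) - w)) integrable_on cbox 0 1"
    using ne by (intro integrable_continuous continuous_intros cg ch) auto
  next
   have cg': "continuous_on (ball w0 e \<times> cbox 0 1) (%p. g (circlepath 0 r (snd p)))"
    by (rule continuous_on_compose2[OF cg[of UNIV] continuous_on_snd]) (auto intro: continuous_intros)
   have ch': "continuous_on (ball w0 e \<times> cbox 0 1) (%p. h (circlepath 0 r (snd p)))"
    by (rule continuous_on_compose2[OF ch[of UNIV] continuous_on_snd]) (auto intro: continuous_intros)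
   show "continuous_on (ball w0 e \<times> cbox 0 1)
     (%(w, t). g (circlepath 0 r t) / (h (circlepath 0 r t) - w)\<^sup>2)"
    unfolding case_prod_beta using ne by (intro continuous_intros cg' ch') auto
  qed auto
 qed
 hence "(%w. cmean r (%v. g v / (h v - w))) analytic_on U"
  using assms(1) unfolding open_contains_ball analytic_on_def by blast
 thus ?thesis by (rule analytic_imp_holomorphic)
qed

lemma open_contains_annulus:
 fixes S :: "complex set"
 assumes "open S" "sphere 0 r \<subseteq> S" "r > 0"
 obtains d where "0 < d" "d < r" "!!v. r - d < norm v ==> norm v < r + d ==> v \<in> S"
proof -
 have "compact (sphere (0::complex) r)" by simp
 then obtain e where e: "e > 0" "(\<Union>x\<in>sphere 0 r. ball x e) \<subseteq> S"
  using compact_subset_open_imp_ball_epsilon_subset[OF _ assms(1,2)] by metis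
 show ?thesis
 proof (rule that[of "min e (r/2)"])
  fix v :: complex assume v: "r - min e (r/2) < norm v" "norm v < r + min e (r/2)"
  hence nv: "norm v > 0" using assms by (auto simp: min_def split: if_splits)
  define x where "x = of_real (r / norm v) * v"
  have "norm x = r" using nv assms by (simp add: x_def norm_mult norm_divide)
  moreover have "dist x v < e"
  proof -
   have "x - v = of_real ((r - norm v) / norm v) * v"
    using nv by (simp add: x_def divide_simps) (simp add: algebra_simps)
   hence "norm (x - v) = \<bar>r - norm v\<bar>" using nv by (simp only: norm_mult norm_of_real) simp
   thus ?thesis using v by (auto simp: dist_norm min_def split: if_splits)
  qed
  ultimately show "v \<in> S" using e(2) by (metis UN_I mem_ball mem_sphere_0 subsetD)
 qed (use e assms in auto)
qed

subsection \<open>Difference quotients\<close>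

definition dquot :: "(complex \<Rightarrow> complex) \<Rightarrow> complex \<Rightarrow> complex \<Rightarrow> complex" where
 "dquot f x y = (if x = y then deriv f x else (f x - f y) / (x - y))"

text \<open>Joint continuity, diagonal included, turns injectivity into a uniform lower bound for
  difference quotients on compact sets.\<close>

lemma continuous_on_dquot:
 assumes "open U" "f holomorphic_on U"
 shows "continuous_on (U \<times> U) (%p. dquot f (fst p) (snd p))"
proof -
 have "isCont (%p. dquot f (fst p) (snd p)) p" if p: "p \<in> U \<times> U" for p
 proof (cases "fst p = snd p")
  case False
  have 1: "\<forall>\<^sub>F q in nhds p. (f (fst q) - f (snd q)) / (fst q - snd q) = dquot f (fst q) (snd q)"
  proof -
   have "open {q :: complex \<times> complex. fst q ~= snd q}"
    by (intro open_Collect_neq continuous_intros)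
   hence "\<forall>\<^sub>F q in nhds p. q \<in> {q. fst q ~= snd q}" using False by (intro eventually_nhds_in_open) auto
   thus ?thesis by eventually_elim (auto simp: dquot_def)
  qed
  have c: "isCont f (fst p)" "isCont f (snd p)"
   using p assms by (auto intro!: continuous_on_interior hol_imp_cont simp: interior_open)
  have "isCont (%q. f (fst q)) p" "isCont (%q. f (snd q)) p"
   using c by (auto intro!: isCont_o2[of _ fst] isCont_o2[of _ snd] continuous_intros)
  hence "isCont (%q. (f (fst q) - f (snd q)) / (fst q - snd q)) p"
   using False by (intro continuous_intros) auto
  thus ?thesis using isCont_cong[OF 1] by blast
 next
  case True
  then obtain a where a: "p = (a, a)" "a \<in> U" using p by (cases p) auto
  have da: "deriv f holomorphic_on U" using assms holomorphic_deriv by blast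
  show ?thesis unfolding a isCont_def
  proof (rule tendstoI)
   fix e :: real assume e: "e > 0"
   have "isCont (deriv f) a"
    using a assms da by (auto intro!: continuous_on_interior hol_imp_cont simp: interior_open)
   hence "\<forall>\<^sub>F x in nhds a. dist (deriv f x) (deriv f a) < e / 2 \<and> x \<in> U"
    using e a assms(1) unfolding isCont_def
    by (intro eventually_conj tendstoD[where e = "e/2"] eventually_nhds_in_open)
      (auto simp: tendsto_at_iff_tendsto_nhds)
   then obtain d where d: "d > 0" "!!x. dist x a < d ==> dist (deriv f x) (deriv f a) < e / 2 \<and> x \<in> U"
    by (auto simp: eventually_nhds_metric)
   have dquot_self: "dquot f a a = deriv f a" by (simp add: dquot_def)
   have main: "dist (dquot f x y) (deriv f a) < e" if "x \<in> ball a d" "y \<in> ball a d" for x y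
   proof (cases "x = y")
    case True
    thus ?thesis using d(2)[of x] that e by (auto simp: dquot_def dist_commute)
   next
    case False
    \<comment> \<open>Removing the linear part at \<open>a\<close> leaves a derivative of size at
      most \<open>e / 2\<close>, which controls the quotient for both arguments near
      \<open>a\<close> at once.\<close>
    define h where "h = (%z. f z - deriv f a * z)"
    have "norm (h x - h y) <= e / 2 * norm (x - y)"
    proof (rule field_differentiable_bound[of "ball a d" h "%z. deriv f z - deriv f a"])
     fix z assume z: "z \<in> ball a d"
     hence "z \<in> U" using d(2)[of z] by (auto simp: dist_commute)
     thus "(h has_field_derivative deriv f z - deriv f a) (at z within ball a d)"
      unfolding h_def using holomorphic_derivI[OF assms(2,1)]
      by (auto intro!: derivative_eq_intros)
     show "norm (deriv f z - deriv f a) <= e / 2" using d(2)[of z] z by (auto simp: dist_norm norm_minus_commute)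
    qed (use that in auto)
    moreover have "dquot f x y - deriv f a = (h x - h y) / (x - y)"
     using False by (simp add: dquot_def h_def divide_simps) (simp add: algebra_simps)
    hence "norm (dquot f x y - deriv f a) = norm (h x - h y) / norm (x - y)"
     by (simp only: norm_divide)
    moreover have "norm (x - y) > 0" using False by simp
    ultimately have "norm (dquot f x y - deriv f a) <= e / 2"
     by (simp add: pos_divide_le_eq)
    thus ?thesis using e by (simp add: dist_norm)
   qed
   have "\<forall>\<^sub>F q in nhds (a, a). q \<in> ball a d \<times> ball a d"
    using d by (intro eventually_nhds_in_open open_Times) auto
   hence "\<forall>\<^sub>F q in at (a, a). q \<in> ball a d \<times> ball a d"
    unfolding eventually_at_filter by (rule eventually_mono) simp
   thus "\<forall>\<^sub>F q in at (a, a). dist (dquot f (fst q) (snd q)) (dquot f (fst (a, a)) (snd (a, a))) < e"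
    by eventually_elim (use main dquot_self in auto)
  qed
 qed
 thus ?thesis by (simp add: continuous_at_imp_continuous_on)
qed

lemma dquot_nz:
 assumes "open U" "f holomorphic_on U" "inj_on f U" "x \<in> U" "y \<in> U"
 shows "dquot f x y ~= 0"
 using holomorphic_injective_imp_regular[OF assms(2,1,3)] assms inj_onD[OF assms(3)]
 by (auto simp: dquot_def)

subsection \<open>Asymptotics of binomial coefficients\<close>

text \<open>The Gauss limit for the reciprocal Gamma function; the factor \<open>n / Suc n\<close>
  accounts for the factorial of \<open>Suc n\<close>, the index produced by the Laurent
  coefficients.\<close>

lemma pochhammer_fact_asymp:
 fixes x :: real
 shows "(%n. pochhammer x (Suc n) / fact (Suc n) / real n powr (x - 1)) \<longlonglongrightarrow> rGamma x"
proof -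
 have "(%n. rGamma_series x n * (real n / real (Suc n))) \<longlonglongrightarrow> rGamma x * 1"
  by (intro tendsto_mult rGamma_series_LIMSEQ LIMSEQ_n_over_Suc_n)
 moreover have "\<forall>\<^sub>F n in sequentially. rGamma_series x n * (real n / real (Suc n))
   = pochhammer x (Suc n) / fact (Suc n) / real n powr (x - 1)"
  using eventually_gt_at_top[of 0]
 proof eventually_elim
  case (elim n)
  have "exp (x * ln (real n)) = real n powr x" using elim by (simp add: powr_def)
  moreover have "real n powr (x - 1) = real n powr x / real n" using elim by (simp add: powr_diff)
  moreover have "real n powr x > 0" "real n > 0" "real (Suc n) > 0" "(fact n :: real) > 0" using elim by auto
  ultimately show ?case
   by (simp add: rGamma_series_def fact_Suc field_simps del: pochhammer_Suc of_nat_Suc)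
 qed
 ultimately show ?thesis using Lim_transform_eventually by fastforce
qed

text \<open>For positive parameters this is the reciprocal Gauss limit. The functional equation of
  \<open>rGamma\<close> lowers the parameter by one without division, which reaches all real
  parameters and so covers \<open>2 - x\<close> for large \<open>x\<close>.\<close>

lemma rGamma_shift_asymp:
 fixes c :: real
 shows "(%n. rGamma (c + real n) * fact n * real n powr (c - 1)) \<longlonglongrightarrow> 1"
proof -
 define A where "A = (%c :: real. (%n. rGamma (c + real n) * fact n * real n powr (c - 1)) \<longlonglongrightarrow> 1)"
 have step: "A c" if "A (c + 1)" for c
 proof -
  have "(%n. (c / real n + 1) * (rGamma (c + 1 + real n) * fact n * real n powr (c + 1 - 1))) \<longlonglongrightarrow> (0 + 1) * 1"
   using that unfolding A_def by (intro tendsto_intros lim_const_over_n)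
  moreover have "\<forall>\<^sub>F n in sequentially. (c / real n + 1) * (rGamma (c + 1 + real n) * fact n * real n powr (c + 1 - 1))
    = rGamma (c + real n) * fact n * real n powr (c - 1)"
   using eventually_gt_at_top[of 0]
  proof eventually_elim
   case (elim n)
   have "(c + real n) * rGamma (c + real n + 1) = rGamma (c + real n)" by (rule rGamma_plus1)
   hence *: "rGamma (c + real n) = (c + real n) * rGamma (c + 1 + real n)" by (simp add: add_ac)
   show ?case unfolding * using elim by (simp add: powr_diff field_simps)
  qed
  ultimately show ?thesis unfolding A_def using Lim_transform_eventually by fastforce
 qed
 have pos: "A (c + 1)" if "c > 0" for c
 proof -
  have nz: "rGamma c ~= 0" using that by (auto simp: rGamma_eq_zero_iff elim!: nonpos_Ints_cases)
  hence "(%n. rGamma c / rGamma_series c n) \<longlonglongrightarrow> rGamma c / rGamma c"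
   by (intro tendsto_intros rGamma_series_LIMSEQ)
  moreover have "\<forall>\<^sub>F n in sequentially. rGamma c / rGamma_series c n
    = rGamma (c + 1 + real n) * fact n * real n powr (c + 1 - 1)"
   using eventually_gt_at_top[of 0]
  proof eventually_elim
   case (elim n)
   have "pochhammer c (Suc n) > 0" using that by (rule pochhammer_pos)
   moreover have "rGamma c = pochhammer c (Suc n) * rGamma (c + 1 + real n)"
    using pochhammer_rGamma[of c "Suc n"] by (simp add: add_ac)
   moreover have "exp (c * ln (real n)) = real n powr c" using elim by (simp add: powr_def)
   ultimately show ?case by (simp add: rGamma_series_def del: pochhammer_Suc)
  qed
  ultimately show ?thesis unfolding A_def using nz Lim_transform_eventually by fastforce
 qed
 obtain N :: nat where "real N > - c" using reals_Archimedean2 by blast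
 hence "A (c + real N + 1)" by (intro pos) auto
 moreover have "A (c + real N + 1) ==> A c"
 proof (induction N)
  case 0 thus ?case using step by simp
 next
  case (Suc N) thus ?case using step[of "c + real N + 1"] by (simp add: add_ac)
 qed
 ultimately show ?thesis by (simp add: A_def)
qed

text \<open>The limit agrees with that of \<open>pochhammer_fact_asymp\<close>, so at leading order
  the binomial may replace the Laurent coefficients.\<close>

lemma gen_binomial_asymp:
 "(%n. gen_binomial (real n) (x - 1) / real n powr (x - 1)) \<longlonglongrightarrow> rGamma x"
proof -
 have "(%n. rGamma x * (rGamma (2 - x + real n) * fact n * real n powr (2 - x - 1))) \<longlonglongrightarrow> rGamma x * 1"
  by (intro tendsto_intros rGamma_shift_asymp)
 moreover have "rGamma x * (rGamma (2 - x + real n) * fact n * real n powr (2 - x - 1))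
   = gen_binomial (real n) (x - 1) / real n powr (x - 1)" for n
 proof -
  have "2 - x - 1 = - (x - 1)" by simp
  hence "real n powr (2 - x - 1) = inverse (real n powr (x - 1))" by (simp only: powr_minus)
  moreover have "Gamma (real n + 1) = fact n" using Gamma_fact[of n, where 'a = real] by (simp add: add_ac)
  moreover have "real n - (x - 1) + 1 = 2 - x + real n" "x - 1 + 1 = x" by auto
  ultimately show ?thesis unfolding gen_binomial_def by (simp add: field_simps)
 qed
 ultimately show ?thesis by simp
qed

lemma powr_ratio_tendsto_0:
 assumes "x < y" shows "(%n. real n powr x / real n powr y) \<longlonglongrightarrow> 0"
proof -
 have "((%n. real n powr (x - y)) \<longlongrightarrow> 0) sequentially"
  using assms by (intro tendsto_neg_powr filterlim_real_sequentially) auto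
 thus ?thesis by (simp add: powr_diff)
qed

subsection \<open>Branches of powers and their Laurent coefficients\<close>

text \<open>The model singularity \<open>(v / (v - b))^x\<close> with value 1 at infinity. The
  principal branch puts the cut on the segment from 0 to \<open>b\<close>, which contains the slit
  of the exterior coordinate.\<close>

definition bpow :: "complex \<Rightarrow> real \<Rightarrow> complex \<Rightarrow> complex" where
 "bpow b x v = (1 - b / v) powr (- of_real x)"

lemma bpow_off_segment:
 fixes b v :: complex
 assumes "v ~= 0" "!!s. 0 <= s ==> s <= 1 ==> v ~= of_real s * b"
 shows "1 - b / v \<notin> \<real>\<^sub>\<le>\<^sub>0"
proof
 assume "1 - b / v \<in> \<real>\<^sub>\<le>\<^sub>0"
 then obtain x where x: "1 - b / v = of_real x" "x <= 0" by (auto elim!: nonpos_Reals_cases)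
 hence "b / v = of_real (1 - x)" by (simp add: algebra_simps)
 hence "b = of_real (1 - x) * v" using assms(1) by (simp add: divide_eq_eq)
 hence "v = of_real (1 / (1 - x)) * b" using x(2) by (simp del: of_real_diff)
 thus False using assms(2)[of "1 / (1 - x)"] x(2) by simp
qed

lemma bpow_off_disc:
 fixes b v :: complex
 assumes "norm b < norm v" shows "1 - b / v \<notin> \<real>\<^sub>\<le>\<^sub>0"
proof (rule bpow_off_segment)
 fix s :: real assume "0 <= s" "s <= 1"
 hence "norm (of_real s * b) <= norm b" by (simp add: norm_mult mult_left_le_one_le)
 thus "v ~= of_real s * b" using assms by auto
qed (use assms in auto)

lemma bpow_holomorphic:
 assumes "!!v. v \<in> S ==> v ~= 0" "!!v. v \<in> S ==> 1 - b / v \<notin> \<real>\<^sub>\<le>\<^sub>0"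
 shows "bpow b x holomorphic_on S"
 unfolding bpow_def using assms by (intro holomorphic_intros) auto

lemma bpow_holomorphic_ext:
 assumes "norm b = \<rho>" "!!v. v \<in> S ==> \<rho> < norm v"
 shows "bpow b x holomorphic_on S"
proof (rule bpow_holomorphic)
 fix v assume "v \<in> S"
 thus "1 - b / v \<notin> \<real>\<^sub>\<le>\<^sub>0" using assms by (intro bpow_off_disc) auto
 show "v ~= 0" using \<open>v \<in> S\<close> assms norm_ge_zero[of b] by force
qed

lemma norm_bpow: "norm (bpow b x v) = norm (1 - b / v) powr (- x)"
 unfolding bpow_def by (subst norm_powr_real_powr') auto

lemma bpow_nz: "1 - b / v ~= 0 ==> bpow b x v ~= 0"
 by (simp add: bpow_def)

lemma bpow_add_one: "1 - b / v ~= 0 ==> bpow b (x + 1) v * (1 - b / v) = bpow b x v"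
proof -
 assume nz: "1 - b / v ~= 0"
 have "- complex_of_real (x + 1) = - of_real x - 1" by simp
 thus ?thesis unfolding bpow_def using nz by (simp only: powr_diff) simp
qed

text \<open>The differential equation is multiplied out so that integration by parts turns it into a
  recursion between consecutive Laurent coefficients.\<close>

lemma bpow_deriv:
 assumes "v ~= 0" "1 - b / v \<notin> \<real>\<^sub>\<le>\<^sub>0"
 shows "v\<^sup>2 * deriv (bpow b x) v - b * v * deriv (bpow b x) v = - of_real x * b * bpow b x v"
proof -
 have nz: "1 - b / v ~= 0" using assms(2) by auto
 have "(bpow b x has_field_derivative (- of_real x * (1 - b / v) powr (- of_real x - 1) * (b / v\<^sup>2))) (at v)"
  unfolding bpow_def[abs_def]
  by (rule has_field_derivative_powr[THEN DERIV_chain2] derivative_eq_intros refl | use assms in "simp add: field_simps power2_eq_square")+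
 hence d: "deriv (bpow b x) v = - of_real x * (1 - b / v) powr (- of_real x - 1) * (b / v\<^sup>2)"
  by (rule DERIV_imp_deriv)
 have "(1 - b / v) powr (- of_real x - 1) = bpow b x v / (1 - b / v)"
  unfolding bpow_def using nz by (simp add: powr_diff)
 hence "deriv (bpow b x) v * (1 - b / v) = - of_real x * bpow b x v * (b / v\<^sup>2)"
  unfolding d using nz by simp
 hence "deriv (bpow b x) v * (1 - b / v) * v\<^sup>2 = - of_real x * bpow b x v * b"
  using assms(1) by simp
 moreover have "deriv (bpow b x) v * (1 - b / v) * v\<^sup>2 = v\<^sup>2 * deriv (bpow b x) v - b * v * deriv (bpow b x) v"
  using assms(1) by (simp add: field_simps power2_eq_square)
 ultimately show ?thesis by simp
qed

lemma cmean_bpow: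
 assumes "norm b < r"
 shows "cmean r (%v. bpow b x v * v ^ n) = of_real (pochhammer x n / fact n) * b ^ n"
proof -
 define S :: "complex set" where "S = {v. norm b < norm v}"
 have r: "r > 0" using assms norm_ge_zero[of b] by linarith
 have S: "open S" "bpow b x holomorphic_on S" "sphere 0 r \<subseteq> S"
  unfolding S_def using assms
  by (auto intro!: open_Collect_less continuous_intros bpow_holomorphic_ext)
 have nS: "v ~= 0" "1 - b / v \<notin> \<real>\<^sub>\<le>\<^sub>0" if "norm v = r" for v
  using bpow_off_disc[of b v] that assms r by auto
 \<comment> \<open>With the factor \<open>1 / v\<close> of the mean, \<open>v ^ Suc n\<close>
   integrates by parts with weight \<open>n\<close>; for \<open>n = 0\<close> this says that the
   integral of a derivative vanishes.\<close>
 have parts: "cmean r (%v. deriv (bpow b x) v * v ^ Suc n) = - of_nat n * cmean r (%v. bpow b x v * v ^ n)" for n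
 proof (cases n)
  case 0
  have "(deriv (bpow b x) has_contour_integral 0) (circlepath 0 r)"
   by (rule Cauchy_theorem_primitive[of S "bpow b x"])
     (use S holomorphic_derivI[OF S(2,1)] r in auto)
  hence "cmean r (%v. v * deriv (bpow b x) v) = 0"
   using contour_integral_unique contour_integral_cmean[of r] by fastforce
  thus ?thesis using 0 by (simp add: mult.commute)
 next
  case (Suc k)
  have "of_nat (Suc k) ~= (0::complex)" using of_nat_neq_0 by blast
  thus ?thesis using cmean_by_parts[OF S(1,2) r S(3), of k] Suc
   by (simp add: field_simps del: of_nat_Suc power_Suc)
 qed
 have cont: "continuous_on (sphere 0 r) (bpow b x)" "continuous_on (sphere 0 r) (deriv (bpow b x))"
  using S by (auto intro!: hol_imp_cont hol_subset[OF _ S(3)] holomorphic_deriv)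
 show ?thesis
 proof (induction n)
  case 0
  have "(bpow b x \<longlongrightarrow> (1 - 0) powr (- of_real x)) at_infinity"
   unfolding bpow_def
   by (intro tendsto_powr_complex tendsto_intros tendsto_divide_0[OF tendsto_const]) (auto simp: filterlim_ident)
  hence "cmean r (bpow b x) = 1"
   using cmean_exterior[OF S(1,2) r, of 1] assms by (auto simp: S_def)
  thus ?case by simp
 next
  case (Suc n)
  let ?a = "%n. cmean r (%v. bpow b x v * v ^ n)"
  have "- of_real x * b * ?a n = cmean r (%v. (- of_real x * b) * (bpow b x v * v ^ n))"
   by (simp only: cmean_mult_left)
  also have "... = cmean r (%v. deriv (bpow b x) v * v ^ Suc (Suc n) - b * (deriv (bpow b x) v * v ^ Suc n))"
  proof (rule cmean_cong)
   fix v :: complex assume "norm v = r"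
   from bpow_deriv[OF nS[OF this], of x]
   have "(- of_real x * b * bpow b x v) * v ^ n = (v\<^sup>2 * deriv (bpow b x) v - b * v * deriv (bpow b x) v) * v ^ n"
    by simp
   thus "(- of_real x * b) * (bpow b x v * v ^ n)
    = deriv (bpow b x) v * v ^ Suc (Suc n) - b * (deriv (bpow b x) v * v ^ Suc n)"
    by (simp add: algebra_simps power2_eq_square)
  qed (use r in auto)
  also have "... = cmean r (%v. deriv (bpow b x) v * v ^ Suc (Suc n)) - cmean r (%v. b * (deriv (bpow b x) v * v ^ Suc n))"
   using r by (intro cmean_diff continuous_intros cont) auto
  also have "... = - of_nat (Suc n) * ?a (Suc n) + b * of_nat n * ?a n"
   by (simp only: cmean_mult_left parts) simp
  finally have "of_nat (Suc n) * ?a (Suc n) = b * (of_nat n + of_real x) * ?a n"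
   by (simp add: algebra_simps)
  moreover have "of_nat (Suc n) ~= (0::complex)" using of_nat_neq_0 by blast
  ultimately have "?a (Suc n) = b * (of_nat n + of_real x) / of_nat (Suc n) * ?a n"
   by (simp add: field_simps del: of_nat_Suc)
  thus ?case unfolding Suc.IH
   by (simp add: pochhammer_Suc fact_Suc algebra_simps del: of_nat_Suc)
 qed
qed

text \<open>The exponents of the branch points may have either sign; the sum of the two end values
  serves both cases.\<close>

lemma powr_between:
 fixes x :: real assumes "0 < a" "a <= x" "x <= c"
 shows "x powr e <= a powr e + c powr e"
proof (cases "e \<ge> 0")
 case True
 hence "x powr e <= c powr e" using assms by (intro powr_mono2) auto
 thus ?thesis by (simp add: add_increasing)
next
 case False
 hence "x powr e <= a powr e" using assms by (intro powr_mono2') auto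
 thus ?thesis by (simp add: add_increasing2)
qed

text \<open>\<open>4 ^ m\<close> stems from Cauchy's inequality with radius
  \<open>dist v b / 4\<close>; on that disc \<open>norm (1 - b / w)\<close> lies between
  \<open>dist v b / (2 * R)\<close> and \<open>5 * dist v b / (2 * \<rho>)\<close>.\<close>

definition bconst :: "real \<Rightarrow> real \<Rightarrow> real \<Rightarrow> nat \<Rightarrow> real" where
 "bconst \<rho> R x m = fact m * 4 ^ m * ((1 / (2 * R)) powr (- x) + (5 / (2 * \<rho>)) powr (- x))"

lemma bconst_nonneg: "bconst \<rho> R x m \<ge> 0"
 by (simp add: bconst_def)

text \<open>
 The disc of radius \<open>dist v b / 4\<close> about a point \<open>v\<close> outside the open disc of radius \<open>norm b\<close> stays
 away from the segment from \<open>0\<close> to \<open>b\<close>, so Cauchy's inequality applies there.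
\<close>

lemma bpow_higher_deriv_bound:
 assumes "norm b = \<rho>" "0 < \<rho>" "\<rho> <= norm v" "norm v <= R" "v ~= b"
  "open U" "h holomorphic_on U" "cball v (dist v b / 4) \<subseteq> U"
  "!!w. w \<in> cball v (dist v b / 4) ==> norm (h w) <= H"
 shows "norm ((deriv ^^ m) (%w. bpow b x w * h w) v) <= bconst \<rho> R x m * H * dist v b powr (- x - real m)"
  and "!!w. w \<in> cball v (dist v b / 4) ==> w ~= 0 \<and> 1 - b / w \<notin> \<real>\<^sub>\<le>\<^sub>0"
proof -
 define d where "d = dist v b"
 have d: "d > 0" using assms by (simp add: d_def)
 have dv: "d <= 2 * norm v"
  using norm_triangle_ineq4[of v b] assms by (simp add: d_def dist_norm)
 \<comment> \<open>The distance is at least \<open>(1 - s) * \<rho>\<close> because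
   \<open>norm v\<close> is at least \<open>\<rho>\<close>, and at least
   \<open>d - (1 - s) * \<rho>\<close> by the triangle inequality; one of the two is at least
   \<open>d / 2\<close>.\<close>
 have seg: "d / 2 <= dist v (of_real s * b)" if "0 <= s" "s <= 1" for s
 proof -
  have "of_real s * b - b = of_real (s - 1) * b" by (simp add: algebra_simps)
  hence "norm (of_real s * b - b) = (1 - s) * \<rho>" using that assms by (simp only: norm_mult norm_of_real) simp
  moreover have "norm v - norm (of_real s * b) <= norm (v - of_real s * b)" by (rule norm_triangle_ineq2)
  hence "(1 - s) * \<rho> <= norm (v - of_real s * b)"
   using assms that by (simp add: norm_mult algebra_simps)
  moreover have "d <= norm (v - of_real s * b) + norm (of_real s * b - b)"
   using dist_triangle[of v b "of_real s * b"] by (simp add: d_def dist_norm)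
  ultimately show ?thesis by (simp add: dist_norm)
 qed
 have off: "w ~= 0 \<and> 1 - b / w \<notin> \<real>\<^sub>\<le>\<^sub>0" if w: "w \<in> cball v (d / 4)" for w
 proof -
  have ne: "w ~= of_real s * b" if "0 <= s" "s <= 1" for s
   using seg[OF that] w d by (auto simp: dist_commute)
  from ne[of 0] have "w ~= 0" by simp
  thus ?thesis using bpow_off_segment[of w b] ne by blast
 qed
 thus "!!w. w \<in> cball v (dist v b / 4) ==> w ~= 0 \<and> 1 - b / w \<notin> \<real>\<^sub>\<le>\<^sub>0" by (simp add: d_def)
 define B where "B = ((1 / (2 * R)) powr (- x) + (5 / (2 * \<rho>)) powr (- x)) * d powr (- x)"
 have R: "R > 0" using assms by auto
 have bnd: "norm (bpow b x w) <= B" if w: "w \<in> cball v (d / 4)" for w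
 proof -
  have wv: "norm (w - v) <= d / 4" using w by (simp add: dist_norm norm_minus_commute)
  have w1: "norm v / 2 <= norm w" using norm_triangle_ineq2[of v "v - w"] wv dv
   by (simp add: norm_minus_commute)
  have w2: "norm w <= 3 / 2 * norm v" using norm_triangle_ineq[of v "w - v"] wv dv by simp
  have b1: "3 * d / 4 <= norm (w - b)"
   using norm_triangle_ineq2[of "v - b" "v - w"] wv by (simp add: d_def dist_norm norm_minus_commute)
  have b2: "norm (w - b) <= 5 * d / 4"
   using norm_triangle_ineq[of "v - b" "w - v"] wv by (simp add: d_def dist_norm)
  have w0: "norm w > 0" using w1 assms by auto
  have "1 - b / w = (w - b) / w" using w0 by (simp add: field_simps)
  hence n: "norm (1 - b / w) = norm (w - b) / norm w" by (simp add: norm_divide)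
  have "d / (2 * R) = (3 * d / 4) / (3 / 2 * R)" by simp
  also have "... <= norm (w - b) / norm w"
   using b1 w2 assms w0 d by (intro frac_le) auto
  finally have l: "d / (2 * R) <= norm (w - b) / norm w" .
  have "norm (w - b) / norm w <= (5 * d / 4) / (\<rho> / 2)"
   using b2 w1 assms d by (intro frac_le) auto
  hence u: "norm (w - b) / norm w <= 5 * d / (2 * \<rho>)" by simp
  have "norm (bpow b x w) <= (d / (2 * R)) powr (- x) + (5 * d / (2 * \<rho>)) powr (- x)"
   unfolding norm_bpow n by (rule powr_between) (use l u d R in auto)
  also have "... = B"
  proof -
   have "(d / (2 * R)) powr (- x) = d powr (- x) * (1 / (2 * R)) powr (- x)"
    using powr_mult[of d "1 / (2 * R)" "- x"] d R by simp
   moreover have "(5 * d / (2 * \<rho>)) powr (- x) = d powr (- x) * (5 / (2 * \<rho>)) powr (- x)"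
    using powr_mult[of d "5 / (2 * \<rho>)" "- x"] d assms by (simp add: mult.commute)
   ultimately show ?thesis by (simp add: B_def algebra_simps)
  qed
  finally show ?thesis .
 qed
 have hol: "(%w. bpow b x w * h w) holomorphic_on cball v (d / 4)"
  using off by (intro holomorphic_intros bpow_holomorphic hol_subset[OF assms(7)])
   (use assms in "auto simp: d_def")
 have "norm ((deriv ^^ m) (%w. bpow b x w * h w) v) <= fact m * (B * H) / (d / 4) ^ m"
 proof (rule Cauchy_inequality)
  show "(%w. bpow b x w * h w) holomorphic_on ball v (d / 4)"
   using hol by (rule hol_subset) auto
  show "continuous_on (cball v (d / 4)) (%w. bpow b x w * h w)"
   using hol by (rule hol_imp_cont)
  fix w assume "norm (v - w) = d / 4"
  hence w: "w \<in> cball v (d / 4)" by (simp add: dist_norm)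
  have "0 <= B" unfolding B_def by simp
  thus "norm (bpow b x w * h w) <= B * H"
   unfolding norm_mult using bnd[OF w] assms(9)[of w] w by (intro mult_mono) (auto simp: d_def)
 qed (use d in auto)
 also have "... = bconst \<rho> R x m * H * (d powr (- x) / d ^ m)"
  using d by (simp add: bconst_def B_def power_divide)
 also have "d powr (- x) / d ^ m = d powr (- x - real m)"
  using d by (simp add: powr_diff powr_realpow)
 finally show "norm ((deriv ^^ m) (%w. bpow b x w * h w) v) <= bconst \<rho> R x m * H * dist v b powr (- x - real m)"
  by (simp add: d_def)
qed

lemma higher_deriv_sum:
 assumes "finite K" "open S" "!!k. k \<in> K ==> f k holomorphic_on S" "z \<in> S"
 shows "(deriv ^^ m) (%w. \<Sum>k\<in>K. f k w) z = (\<Sum>k\<in>K. (deriv ^^ m) (f k) z)"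
 using assms(1,3)
proof (induction K)
 case empty
 have "(deriv ^^ m) (%w. 0::complex) = (%w. 0)" by (induction m) auto
 thus ?case by simp
next
 case (insert k K)
 hence "(deriv ^^ m) (%w. f k w + (\<Sum>k\<in>K. f k w)) z
   = (deriv ^^ m) (f k) z + (deriv ^^ m) (%w. \<Sum>k\<in>K. f k w) z"
  using assms by (intro higher_deriv_add[of _ S] holomorphic_intros) auto
 thus ?case using insert by simp
qed

lemma bounded_holomorphic_lipschitz:
 assumes "g holomorphic_on ball b e" "!!v. v \<in> ball b e ==> norm (g v) <= C" "0 < e"
  "v \<in> ball b (3 * e / 4)"
 shows "norm (g v - g b) <= 8 * C / e * dist v b"
proof -
 have "norm (g v - g b) <= 8 * C / e * norm (v - b)"
 proof (rule field_differentiable_bound[of "ball b (3 * e / 4)" g "deriv g"])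
  fix z assume z: "z \<in> ball b (3 * e / 4)"
  have sub: "cball z (e / 8) \<subseteq> ball b e"
   using z cball_subset_ball_iff[of z "e/8" b e] assms(3) by (auto simp: dist_commute)
  show "(g has_field_derivative deriv g z) (at z within ball b (3 * e / 4))"
   using z assms(1,3) by (intro holomorphic_derivI[of _ "ball b e"]) auto
  have "norm ((deriv ^^ 1) g z) <= fact 1 * C / (e / 8) ^ 1"
   by (rule Cauchy_inequality)
     (use sub assms in "auto intro!: hol_imp_cont hol_subset[OF assms(1)] simp: dist_norm subset_eq")
  thus "norm (deriv g z) <= 8 * C / e" by (simp add: mult.commute)
 qed (use assms in auto)
 thus ?thesis by (simp add: dist_norm)
qed

subsection \<open>Darboux's method\<close>

text \<open>
 After \<open>m\<close> integrations by parts every branch point carries an exponent at least \<open>2\<close>, so that the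
 integrals over circles \<open>norm v = r\<close> close to the singularities are controlled by the Poisson integral.
\<close>

lemma darboux_bound:
 fixes b :: "'k \<Rightarrow> complex" and \<mu> :: "'k \<Rightarrow> real"
 assumes K: "finite K" and \<rho>: "0 < \<rho>" and b: "!!k. k \<in> K ==> norm (b k) = \<rho>"
  and \<delta>: "0 < \<delta>" and sep: "!!k l. k \<in> K ==> l \<in> K ==> k ~= l ==> \<delta> <= dist (b k) (b l)"
  and m: "!!k. k \<in> K ==> \<mu> k + real m \<ge> 3" and p: "!!k. k \<in> K ==> \<mu> k <= p"
  and pm: "p + real m \<ge> 3"
 obtains A where "0 < A" and
  "!!f g C r r' n. 0 <= C ==> \<rho> < r ==> r < r' ==> r <= \<rho> + 1 ==>
    f holomorphic_on {v. \<rho> < norm v \<and> norm v < r'} ==>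
    (!!k. k \<in> K ==> g k holomorphic_on ball (b k) \<delta>) ==>
    (!!k v. k \<in> K ==> v \<in> ball (b k) \<delta> ==> norm (g k v) <= C) ==>
    (!!k v. k \<in> K ==> v \<in> ball (b k) \<delta> ==> \<rho> < norm v ==> norm v < r' ==> f v = bpow (b k) (\<mu> k) v * g k v) ==>
    (!!v. norm v = r ==> (!!k. k \<in> K ==> \<delta> / 2 <= dist v (b k)) ==> norm ((deriv ^^ m) f v) <= C) ==>
    norm (cmean r (%v. f v * v ^ Suc n)
       - (\<Sum>k\<in>K. g k (b k) * of_real (pochhammer (\<mu> k) (Suc n) / fact (Suc n)) * b k ^ Suc n))
     <= A * C * r ^ n / real (Suc n) ^ m * (r - \<rho>) powr (- (p + real m - 2))"
proof -
 define R where "R = \<rho> + 1"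
 \<comment> \<open>Each branch point contributes a far term, for its singular part at distance at
   least \<open>\<delta> / 2\<close>, and a near term: \<open>8 / \<delta>\<close> is the Lipschitz
   constant of \<open>bounded_holomorphic_lipschitz\<close>, and \<open>5 / 4\<close> the growth of
   the distance on the Cauchy disc.\<close>
 define A1 where "A1 = 1 + (\<Sum>k\<in>K. bconst \<rho> R (\<mu> k) m * ((\<delta> / 2) powr (- \<mu> k - real m) + 8 / \<delta> * (5 / 4)))"
 define A where "A = R ^ Suc m * A1 * (1 + real (card K) / \<rho>)"
 have R: "R > 0" "R \<ge> 1" using \<rho> by (auto simp: R_def)
 have A1: "A1 \<ge> 1" unfolding A1_def using \<delta> by (intro add_increasing2 sum_nonneg mult_nonneg_nonneg bconst_nonneg) auto
 have card: "1 + real (card K) / \<rho> \<ge> 1" using \<rho> by simp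
 have "A > 0" unfolding A_def using R A1 card by (intro mult_pos_pos) auto
 thus ?thesis
 proof (rule that)
  fix f :: "complex \<Rightarrow> complex" and g :: "'k \<Rightarrow> complex \<Rightarrow> complex" and C r r' :: real and n :: nat
  assume C: "0 <= C" and r: "\<rho> < r" "r < r'" "r <= \<rho> + 1"
   and f: "f holomorphic_on {v. \<rho> < norm v \<and> norm v < r'}"
   and g: "!!k. k \<in> K ==> g k holomorphic_on ball (b k) \<delta>"
   and gC: "!!k v. k \<in> K ==> v \<in> ball (b k) \<delta> ==> norm (g k v) <= C"
   and loc: "!!k v. k \<in> K ==> v \<in> ball (b k) \<delta> ==> \<rho> < norm v ==> norm v < r' ==> f v = bpow (b k) (\<mu> k) v * g k v"
   and far: "!!v. norm v = r ==> (!!k. k \<in> K ==> \<delta> / 2 <= dist v (b k)) ==> norm ((deriv ^^ m) f v) <= C"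
  define S where "S = {v :: complex. \<rho> < norm v \<and> norm v < r'}"
  let ?PP = "1 + (\<Sum>k\<in>K. 1 / (r\<^sup>2 - \<rho>\<^sup>2))"
  let ?both = "%i. bconst \<rho> R (\<mu> i) m * ((\<delta> / 2) powr (- \<mu> i - real m) + 8 / \<delta> * (5 / 4))"
  let ?far = "%i. bconst \<rho> R (\<mu> i) m * (\<delta> / 2) powr (- \<mu> i - real m)"
  let ?near = "%i. bconst \<rho> R (\<mu> i) m * (8 / \<delta> * (5 / 4))"
  let ?P = "%w. 1 + (\<Sum>k\<in>K. 1 / (norm (w - b k))\<^sup>2)"
  have oS: "open S" unfolding S_def by (intro open_Collect_conj open_Collect_less continuous_intros)
  have fS: "f holomorphic_on S" using f by (simp add: S_def)
  \<comment> \<open>The singular part with \<open>g k\<close> frozen at the branch point: its mean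
    is known exactly from \<open>cmean_bpow\<close>, and subtracting it gains one power of the
    distance.\<close>
  define s where "s k v = bpow (b k) (\<mu> k) v * g k (b k)" for k v
  have bh: "bpow (b k) x holomorphic_on S" if "k \<in> K" for k x
   by (rule bpow_holomorphic_ext[OF b[OF that]]) (simp add: S_def)
  have sS: "s k holomorphic_on S" if "k \<in> K" for k
   unfolding s_def by (intro holomorphic_intros bh that)
  define rem where "rem v = f v - (\<Sum>k\<in>K. s k v)" for v
  have remS: "rem holomorphic_on S" unfolding rem_def by (intro holomorphic_intros fS sS)
  have r0: "r > 0" using r \<rho> by simp
  have sph: "sphere 0 r \<subseteq> S" using r by (auto simp: S_def)
  have contS: "continuous_on (sphere 0 r) h" if "h holomorphic_on S" for h
   using that sph hol_imp_cont continuous_on_subset by blast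
  \<comment> \<open>Two powers of the distance are kept aside as
    \<open>1 / (norm (v - b k))^2\<close>, whose mean is of size \<open>1 / (r - \<rho>)\<close>;
    only the remaining exponent is estimated pointwise. Together they give the exponent
    \<open>- (p + m - 2)\<close>.\<close>
  define E where "E = (r - \<rho>) powr (- (p + real m - 3))"
  let ?CE = "C * A1 * E * r ^ (Suc n + m)"
  have E1: "E \<ge> 1" unfolding E_def using r pm powr_mono2'[of "- (p + real m - 3)" "r - \<rho>" 1] by simp
  have nb: "v ~= b k" if "norm v = r" "k \<in> K" for v k using that b[of k] r by auto
  have gb: "norm (g k (b k)) <= C" if "k \<in> K" for k using gC[OF that, of "b k"] \<delta> by simp
  have sbound: "norm ((deriv ^^ m) (s k) v) <= C * (?far k)"
   if "norm v = r" "k \<in> K" "\<delta> / 2 <= dist v (b k)" for v k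
  proof -
   have "norm ((deriv ^^ m) (s k) v) <= bconst \<rho> R (\<mu> k) m * C * dist v (b k) powr (- \<mu> k - real m)"
    unfolding s_def
    by (rule bpow_higher_deriv_bound(1)[of _ _ _ _ UNIV]) (use b that r nb gb \<rho> in "auto simp: R_def")
   also have "... <= bconst \<rho> R (\<mu> k) m * C * (\<delta> / 2) powr (- \<mu> k - real m)"
    using that m[of k] \<delta> bconst_nonneg C by (intro mult_left_mono powr_mono2') auto
   finally show ?thesis by (simp add: mult_ac)
  qed
  have key: "norm ((deriv ^^ m) rem v) <= C * A1 * E * (?P v)"
   if v: "norm v = r" for v
  proof -
   have vS: "v \<in> S" using v r by (auto simp: S_def)
   have tpos: "C * (?far k) \<ge> 0" for k
    using C bconst_nonneg by simp
   have sq: "(\<Sum>k\<in>K. 1 / (norm (v - b k))\<^sup>2) \<ge> 0" by (intro sum_nonneg) auto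
   show ?thesis
   proof (cases "\<exists>k\<in>K. dist v (b k) < \<delta> / 2")
    case False
    hence fa: "!!k. k \<in> K ==> \<delta> / 2 <= dist v (b k)" by force
    have "(deriv ^^ m) rem v = (deriv ^^ m) f v - (\<Sum>k\<in>K. (deriv ^^ m) (s k) v)"
     unfolding rem_def using K oS vS fS sS
     by (subst higher_deriv_diff[of _ S]) (auto intro!: holomorphic_intros simp: higher_deriv_sum[of K S])
    also have "norm ... <= C + (\<Sum>k\<in>K. C * (?far k))"
     by (intro norm_triangle_le_diff add_mono far v fa order_trans[OF norm_sum] sum_mono sbound) auto
    also have "... = C * (1 + (\<Sum>k\<in>K. (?far k)))"
     by (simp add: algebra_simps sum_distrib_left)
    also have "... <= C * A1"
     unfolding A1_def using C \<delta> bconst_nonneg by (intro mult_left_mono add_left_mono sum_mono) auto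
    also have "... = C * A1 * 1 * 1" by simp
    also have "... <= C * A1 * E * (?P v)"
     using C A1 E1 sq by (intro mult_mono mult_nonneg_nonneg) auto
    finally show ?thesis .
   next
    case True
    then obtain k where k: "k \<in> K" "dist v (b k) < \<delta> / 2" by blast
    define d where "d = dist v (b k)"
    have d: "d > 0" "d < \<delta> / 2" using k nb[OF v k(1)] by (auto simp: d_def)
    have dr: "r - \<rho> <= d" using norm_triangle_ineq2[of v "b k"] v b[OF k(1)] by (simp add: d_def dist_norm)
    have others: "\<delta> / 2 <= dist v (b l)" if "l \<in> K" "l ~= k" for l
     using sep[OF that(1) k(1) that(2)] k(2) dist_triangle[of "b l" "b k" v] by (simp add: dist_commute)
    define V where "V = S \<inter> ball (b k) \<delta>"
    have V: "open V" "v \<in> V" "V \<subseteq> S" using oS vS k \<delta> by (auto simp: V_def dist_commute)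
    define lo where "lo w = bpow (b k) (\<mu> k) w * (g k w - g k (b k))" for w
    have loV: "lo holomorphic_on V" unfolding lo_def
     by (intro holomorphic_intros hol_subset[OF bh[OF k(1)]] hol_subset[OF g[OF k(1)]])
       (auto simp: V_def)
    have sumV: "(%w. \<Sum>l\<in>K - {k}. s l w) holomorphic_on V"
     using sS V(3) by (intro holomorphic_intros) (auto intro: hol_subset)
    have "norm ((deriv ^^ m) lo v)
      <= bconst \<rho> R (\<mu> k) m * (8 * C / \<delta> * (5 / 4 * d)) * d powr (- \<mu> k - real m)"
     unfolding lo_def d_def
    proof (rule bpow_higher_deriv_bound(1)[of _ _ _ _ "ball (b k) \<delta>"])
     show "(%w. g k w - g k (b k)) holomorphic_on ball (b k) \<delta>" by (intro holomorphic_intros g k)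
     have tri: "dist w (b k) <= 5 / 4 * dist v (b k)" if "w \<in> cball v (dist v (b k) / 4)" for w
      using that dist_triangle[of w "b k" v] by (simp add: dist_commute)
     show "cball v (dist v (b k) / 4) \<subseteq> ball (b k) \<delta>"
      using tri k d \<delta> by (force simp: dist_commute)
     fix w assume w: "w \<in> cball v (dist v (b k) / 4)"
     have "norm (g k w - g k (b k)) <= 8 * C / \<delta> * dist w (b k)"
      by (rule bounded_holomorphic_lipschitz[OF g[OF k(1)] gC[OF k(1)] \<delta>])
        (use tri[OF w] k \<delta> in "auto simp: dist_commute")
     also have "... <= 8 * C / \<delta> * (5 / 4 * dist v (b k))"
      using tri[OF w] C \<delta> by (intro mult_left_mono) auto
     finally show "norm (g k w - g k (b k)) <= 8 * C / \<delta> * (5 / 4 * dist v (b k))" .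
    qed (use b k \<rho> v r nb in "auto simp: R_def")
    also have "... = C * (?near k) * (1 / (norm (v - b k))\<^sup>2 * d powr (- (\<mu> k + real m - 3)))"
    proof -
     \<comment> \<open>The Lipschitz bound supplies the extra factor \<open>d\<close>; the resulting
       exponent is split into \<open>-2\<close> and a part that is nonpositive because
       \<open>\<mu> k + m\<close> is at least 3.\<close>
     have "d * d powr (- \<mu> k - real m) = d powr 1 * d powr (- \<mu> k - real m)" using d by simp
     also have "... = d powr (1 + (- \<mu> k - real m))" by (rule powr_add[symmetric])
     also have "1 + (- \<mu> k - real m) = - 2 + (- (\<mu> k + real m - 3))" by simp
     finally have e1: "d * d powr (- \<mu> k - real m) = d powr (- 2) * d powr (- (\<mu> k + real m - 3))"
      by (simp only: powr_add)
     have "d powr (- 2) = inverse (d powr 2)" by (rule powr_minus)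
     also have "d powr 2 = d\<^sup>2" using d powr_realpow[of d 2] by simp
     finally have e2: "d powr (- 2) = 1 / (norm (v - b k))\<^sup>2"
      by (simp only: inverse_eq_divide d_def dist_norm)
     have e3: "bconst \<rho> R (\<mu> k) m * (8 * C / \<delta> * (5 / 4 * d)) * d powr (- \<mu> k - real m)
      = C * (?near k) * (d * d powr (- \<mu> k - real m))" by simp
     show ?thesis by (simp only: e1 e2 e3)
    qed
    also have "... <= C * (?near k) * (1 / (norm (v - b k))\<^sup>2 * E)"
    proof (intro mult_left_mono)
     have "d powr (- (\<mu> k + real m - 3)) <= (r - \<rho>) powr (- (\<mu> k + real m - 3))"
      using m[OF k(1)] dr r by (intro powr_mono2') auto
     also have "... <= E" unfolding E_def using r p[OF k(1)] by (intro powr_mono') auto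
     finally show "d powr (- (\<mu> k + real m - 3)) <= E" .
    qed (use C \<delta> bconst_nonneg in auto)
    also have "... <= C * (?near k) * (E * (?P v))"
    proof -
     have "1 / (norm (v - b k))\<^sup>2 <= (\<Sum>k\<in>K. 1 / (norm (v - b k))\<^sup>2)"
      using K k(1) by (intro member_le_sum) auto
     hence "1 / (norm (v - b k))\<^sup>2 * E <= E * (?P v)"
      using E1 by (subst mult.commute) (intro mult_left_mono; simp)
     thus ?thesis using C \<delta> bconst_nonneg by (intro mult_left_mono) auto
    qed
    finally have lobd: "norm ((deriv ^^ m) lo v)
     <= C * (?near k) * (E * (?P v))" .
    have "(deriv ^^ m) rem v = (deriv ^^ m) (%w. lo w - (\<Sum>l\<in>K - {k}. s l w)) v"
    proof (rule higher_deriv_transform_within_open[OF _ _ V(1,2)])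
     show "rem holomorphic_on V" using remS V(3) by (rule hol_subset)
     show "(%w. lo w - (\<Sum>l\<in>K - {k}. s l w)) holomorphic_on V" by (intro holomorphic_intros loV sumV)
     fix w assume "w \<in> V"
     hence "f w = bpow (b k) (\<mu> k) w * g k w" using loc[OF k(1), of w] by (auto simp: V_def S_def)
     thus "rem w = lo w - (\<Sum>l\<in>K - {k}. s l w)"
      using K k(1) by (simp add: rem_def lo_def s_def sum.remove algebra_simps)
    qed
    also have "... = (deriv ^^ m) lo v - (\<Sum>l\<in>K - {k}. (deriv ^^ m) (s l) v)"
     using higher_deriv_diff[OF loV sumV V(1,2)] higher_deriv_sum[OF _ oS, of "K - {k}" s v m] K sS vS by simp
    also have "norm ... <= norm ((deriv ^^ m) lo v) + (\<Sum>l\<in>K - {k}. C * (?far l))"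
     using others v by (intro norm_triangle_le_diff add_mono order_trans[OF norm_sum] sum_mono sbound) auto
    also have "... <= C * (?near k) * (E * (?P v))
      + (\<Sum>l\<in>K - {k}. C * (?far l)) * (E * (?P v))"
    proof -
     have "1 * 1 <= E * (?P v)"
      using E1 sq by (intro mult_mono) auto
     moreover have "0 <= (\<Sum>l\<in>K - {k}. C * (?far l))"
      using tpos by (intro sum_nonneg) auto
     ultimately show ?thesis by (intro add_mono lobd) (simp add: mult_le_cancel_left1)
    qed
    also have "... <= C * A1 * (E * (?P v))"
    proof -
     have "C * (?near k)
       + (\<Sum>l\<in>K - {k}. C * (?far l))
      <= C * (?both k)
       + (\<Sum>l\<in>K - {k}. C * (?both l))"
      using C \<delta> bconst_nonneg by (intro add_mono mult_left_mono sum_mono) auto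
     also have "... = (\<Sum>l\<in>K. C * (?both l))"
      using K k(1) by (rule sum.remove[symmetric])
     also have "... <= C * A1" unfolding A1_def using C by (simp add: sum_distrib_left distrib_left)
     finally show ?thesis
      unfolding distrib_right[symmetric] using E1 sq by (intro mult_right_mono) auto
    qed
    finally show ?thesis by (simp add: mult.assoc)
   qed
  qed
  have drem: "(deriv ^^ m) rem holomorphic_on S" using remS oS by (rule holomorphic_higher_deriv)
  let ?dr = "%v. (deriv ^^ m) rem v * v ^ (Suc n + m)"
  have sc: "continuous_on (sphere 0 r) (%v. 1 / (norm (v - b k))\<^sup>2)" if "k \<in> K" for k
   using nb that by (intro continuous_intros) auto
  have I1: "norm (cmean r ?dr)
    <= ?CE * ?PP"
  proof -
   have "norm (cmean r ?dr)
     <= integral {0..1} (%t. (%v. ?CE * (?P v)) (circlepath 0 r t))"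
   proof (rule cmean_norm_bound_integral)
    fix v :: complex assume v: "norm v = r"
    have "norm ((deriv ^^ m) rem v * v ^ (Suc n + m)) = norm ((deriv ^^ m) rem v) * r ^ (Suc n + m)"
     by (simp add: norm_mult norm_power v)
    also have "... <= C * A1 * E * (?P v) * r ^ (Suc n + m)"
     using key[OF v] r0 by (intro mult_right_mono) auto
    finally show "norm ((deriv ^^ m) rem v * v ^ (Suc n + m))
     <= ?CE * (?P v)" by (simp add: mult_ac)
   next
    show "continuous_on (sphere 0 r) ?dr"
     by (intro contS holomorphic_intros drem)
    show "continuous_on (sphere 0 r) (%v. ?CE * (?P v))"
     by (intro continuous_on_mult_left continuous_on_add continuous_on_const continuous_on_sum sc)
   qed (use r0 in auto)
   also have "... = ?CE * ?PP"
   proof -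
    have int: "(%t. 1 / (norm (circlepath 0 r t - b k))\<^sup>2) integrable_on {0..1}" if "k \<in> K" for k
     using circle_integrable[OF sc[OF that]] r0 by simp
    have "integral {0..1} (%t. 1 + (\<Sum>k\<in>K. 1 / (norm (circlepath 0 r t - b k))\<^sup>2))
     = integral {0..1} (%t::real. 1) + (\<Sum>k\<in>K. integral {0..1} (%t. 1 / (norm (circlepath 0 r t - b k))\<^sup>2))"
     using int K by (subst integral_add) (auto intro!: integrable_sum simp: integral_sum)
    also have "... = ?PP"
     using circle_integral_inverse_square b r by (intro arg_cong2[where f = "(+)"] sum.cong) auto
    finally show ?thesis by simp
   qed
   finally show ?thesis .
  qed
  have rr: "?PP <= (1 + real (card K) / \<rho>) / (r - \<rho>)"
  proof -
   have "r\<^sup>2 - \<rho>\<^sup>2 = (r - \<rho>) * (r + \<rho>)" by (simp add: power2_eq_square algebra_simps)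
   also have "... \<ge> (r - \<rho>) * \<rho>" using r r0 by (intro mult_left_mono) auto
   finally have "1 / (r\<^sup>2 - \<rho>\<^sup>2) <= 1 / ((r - \<rho>) * \<rho>)" using r \<rho> by (intro frac_le mult_pos_pos) auto
   hence "real (card K) * (1 / (r\<^sup>2 - \<rho>\<^sup>2)) <= real (card K) * (1 / ((r - \<rho>) * \<rho>))"
    by (intro mult_left_mono) auto
   moreover have "1 <= 1 / (r - \<rho>)" using r by simp
   ultimately show ?thesis by (simp add: add_divide_distrib mult.commute)
  qed
  have fr: "fact n / fact (n + m) <= 1 / real (Suc n) ^ m"
  proof -
   have "fact n * real (Suc n) ^ m <= fact (n + m)"
   proof (induction m)
    case (Suc m)
    have "fact n * real (Suc n) ^ Suc m = (fact n * real (Suc n) ^ m) * real (Suc n)" by simp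
    also have "... <= fact (n + m) * real (Suc (n + m))"
     using Suc.IH by (intro mult_mono) auto
    finally show ?case by (simp add: fact_Suc mult.commute)
   qed simp
   thus ?thesis by (simp add: field_simps del: of_nat_Suc)
  qed
  have I2: "norm (cmean r (%v. rem v * v ^ Suc n))
    <= A * C * r ^ n / real (Suc n) ^ m * (r - \<rho>) powr (- (p + real m - 2))"
  proof -
   have "norm (cmean r (%v. rem v * v ^ Suc n))
     = fact n / fact (n + m) * norm (cmean r ?dr)"
    unfolding cmean_by_parts_iterated[OF oS remS r0 sph, of n m] by (simp add: norm_mult norm_divide norm_power)
   also have "... <= 1 / real (Suc n) ^ m * (?CE * ((1 + real (card K) / \<rho>) / (r - \<rho>)))"
   proof (intro mult_mono fr order_trans[OF I1] rr order_refl)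
    show "0 <= ?CE" using C A1 E1 r0 by simp
   qed (use C A1 E1 r0 r \<rho> card in auto)
   also have "... = (C / real (Suc n) ^ m * r ^ n * (A1 * (1 + real (card K) / \<rho>))) * (E / (r - \<rho>)) * r ^ Suc m"
    by (simp add: power_add field_simps del: of_nat_Suc)
   also have "... <= (C / real (Suc n) ^ m * r ^ n * (A1 * (1 + real (card K) / \<rho>))) * (E / (r - \<rho>)) * R ^ Suc m"
    using C A1 E1 r0 r \<rho> card by (intro mult_left_mono power_mono) (auto simp: R_def)
   also have "E / (r - \<rho>) = (r - \<rho>) powr (- (p + real m - 2))"
   proof -
    have "- (p + real m - 2) = - (p + real m - 3) - 1" by simp
    thus ?thesis unfolding E_def using r by (simp only: powr_diff) simp
   qed
   finally show ?thesis by (simp add: A_def mult_ac)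
  qed
  have "cmean r (%v. rem v * v ^ Suc n)
    = cmean r (%v. f v * v ^ Suc n - (\<Sum>k\<in>K. g k (b k) * (bpow (b k) (\<mu> k) v * v ^ Suc n)))"
   by (simp only: rem_def s_def left_diff_distrib sum_distrib_right)
     (simp add: mult_ac)
  also have "... = cmean r (%v. f v * v ^ Suc n)
    - cmean r (%v. \<Sum>k\<in>K. g k (b k) * (bpow (b k) (\<mu> k) v * v ^ Suc n))"
   using r0 by (intro cmean_diff contS holomorphic_intros fS bh) auto
  also have "cmean r (%v. \<Sum>k\<in>K. g k (b k) * (bpow (b k) (\<mu> k) v * v ^ Suc n))
    = (\<Sum>k\<in>K. cmean r (%v. g k (b k) * (bpow (b k) (\<mu> k) v * v ^ Suc n)))"
   using r0 K by (intro cmean_sum contS holomorphic_intros bh) auto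
  also have "... = (\<Sum>k\<in>K. g k (b k) * of_real (pochhammer (\<mu> k) (Suc n) / fact (Suc n)) * b k ^ Suc n)"
   using r b by (intro sum.cong refl) (simp only: cmean_mult_left cmean_bpow mult.assoc)
  finally show "norm (cmean r (%v. f v * v ^ Suc n)
       - (\<Sum>k\<in>K. g k (b k) * of_real (pochhammer (\<mu> k) (Suc n) / fact (Suc n)) * b k ^ Suc n))
     <= A * C * r ^ n / real (Suc n) ^ m * (r - \<rho>) powr (- (p + real m - 2))"
   using I2 by simp
 qed
qed

text \<open>
 On the circle \<open>dist y y1 = d\<close> the quadratic polynomial \<open>G\<close> has modulus \<open>d * \<bar>(norm y)\<^sup>2 - \<rho>\<^sup>2\<bar>\<close>,
 so multiplication by \<open>G ^ q\<close> absorbs a blow-up of order \<open>q\<close> at the circle \<open>norm y = \<rho>\<close>.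
\<close>

lemma bound_across_circle:
 assumes "f holomorphic_on S" "open S" "cball y1 d \<subseteq> S" "0 < d" "y1 ~= 0" "0 <= B"
  and q: "q > 0"
  and bd: "!!y. dist y y1 = d ==> norm y ~= \<rho> ==> norm (f y) <= B / \<bar>norm y - \<rho>\<bar> ^ q"
  and le: "!!y. dist y y1 = d ==> norm y + \<rho> <= 2" "0 <= \<rho>"
 shows "norm (f y1) <= B * (2 / (d * norm y1)) ^ q"
proof -
 \<comment> \<open>On the circle \<open>d^2 = (y - y1) * cnj (y - y1)\<close>. This identity turns
   \<open>(y - y1) * (y * cnj y - \<rho>^2)\<close> into a polynomial in \<open>y\<close>; its value
   at the centre is \<open>d^2 * y1\<close>, which is nonzero.\<close>
 define G where "G y = cnj y1 * y * (y - y1) + of_real (d\<^sup>2) * y - of_real (\<rho>\<^sup>2) * (y - y1)" for y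
 have G: "norm (G y) = d * \<bar>(norm y)\<^sup>2 - \<rho>\<^sup>2\<bar>" if "dist y y1 = d" for y
 proof -
  have d2: "of_real (d\<^sup>2) = (y - y1) * cnj (y - y1)"
   using complex_norm_square[of "y - y1"] that by (simp add: dist_norm)
  have "G y = (y - y1) * (y * cnj y - of_real (\<rho>\<^sup>2))"
   unfolding G_def d2 by (simp add: algebra_simps)
  also have "y * cnj y = of_real ((norm y)\<^sup>2)" using complex_norm_square[of y] by simp
  finally show ?thesis using that
   by (simp add: norm_mult dist_norm norm_of_real flip: of_real_diff of_real_power)
 qed
 have holfG: "(%y. f y * G y ^ q) holomorphic_on S"
  unfolding G_def by (intro holomorphic_intros assms)
 have "norm ((deriv ^^ 0) (%y. f y * G y ^ q) y1) <= fact 0 * (B * (2 * d) ^ q) / d ^ 0"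
 proof (rule Cauchy_inequality)
  show "(%y. f y * G y ^ q) holomorphic_on ball y1 d"
   by (rule hol_subset[OF holfG]) (use assms in auto)
  show "continuous_on (cball y1 d) (%y. f y * G y ^ q)"
   by (rule hol_imp_cont, rule hol_subset[OF holfG]) (use assms in auto)
  fix y assume "norm (y1 - y) = d"
  hence y: "dist y y1 = d" by (simp add: dist_norm norm_minus_commute)
  have "(norm y)\<^sup>2 - \<rho>\<^sup>2 = (norm y - \<rho>) * (norm y + \<rho>)" by (simp add: power2_eq_square algebra_simps)
  hence Gy: "norm (G y) = d * (\<bar>norm y - \<rho>\<bar> * (norm y + \<rho>))" unfolding G[OF y] using le(2) norm_ge_zero[of y] by (simp add: abs_mult)
  show "norm (f y * G y ^ q) <= B * (2 * d) ^ q"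
  proof (cases "norm y = \<rho>")
   case True
   thus ?thesis using Gy assms q by (simp add: norm_mult norm_power power_0_left)
  next
   case False
   hence pos: "\<bar>norm y - \<rho>\<bar> > 0" by simp
   have "norm (f y * G y ^ q) = norm (f y) * norm (G y) ^ q" by (simp add: norm_mult norm_power)
   also have "... <= B / \<bar>norm y - \<rho>\<bar> ^ q * (d * (\<bar>norm y - \<rho>\<bar> * (norm y + \<rho>))) ^ q"
    unfolding Gy using bd[OF y False] assms by (intro mult_right_mono) auto
   also have "... = B * (d * (norm y + \<rho>)) ^ q" using pos by (simp add: power_mult_distrib)
   also have "... <= B * (d * 2) ^ q"
    using le(1)[OF y] assms by (intro mult_left_mono power_mono) auto
   finally show ?thesis by (simp add: mult.commute)
  qed
 qed (use assms in auto)
 hence "norm (f y1) * norm (G y1) ^ q <= B * (2 * d) ^ q" by (simp add: norm_mult norm_power)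
 moreover have "norm (G y1) = d\<^sup>2 * norm y1" by (simp add: G_def norm_mult norm_power)
 ultimately have "norm (f y1) * (d * norm y1) ^ q * d ^ q <= B * 2 ^ q * d ^ q"
  by (simp add: power_mult_distrib power2_eq_square mult_ac)
 hence "norm (f y1) * (d * norm y1) ^ q <= B * 2 ^ q" using assms(4) by simp
 thus ?thesis using assms by (simp add: power_divide field_simps)
qed

subsection \<open>Schwarz reflection in a circle\<close>

lemma cmean_scale: "cmean r h = cmean 1 (%e. h (of_real r * e))"
 unfolding cmean_def by (simp add: circlepath)

text \<open>The two integrands live on mirror circles. Their kernels differ by a multiple of
  \<open>1 - r^2\<close>, and \<open>1 / cnj A - A = (1 - (norm A)^2) / cnj A\<close> is small as
  soon as the modulus of \<open>A\<close> is near one, whatever its argument.\<close>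

lemma reflection_gap:
 fixes A w e :: complex
 assumes e: "norm e = 1" and r: "0 < r" "r < 1" and \<kappa>: "0 < \<kappa>"
  and g1: "\<kappa> <= norm (e - of_real r * w)" and g2: "\<kappa> <= norm (of_real r * e - w)"
  and A: "\<bar>norm A - 1\<bar> <= \<eta>" "\<eta> <= 1 / 2" "1 - r <= \<eta>"
 shows "norm (of_real (1 / r) * e * (1 / cnj A) / (of_real (1 / r) * e - w) - of_real r * e * A / (of_real r * e - w))
   <= 5 * \<eta> / \<kappa> + 3 * norm w * \<eta> / \<kappa>\<^sup>2"
proof -
 define a where "a = e / (e - of_real r * w)"
 define b where "b = of_real r * e / (of_real r * e - w)"
 have nz: "e - of_real r * w ~= 0" "of_real r * e - w ~= 0" using g1 g2 \<kappa> by auto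
 have A0: "norm A \<ge> 1 / 2" "norm A <= 3 / 2" using A by auto
 have "of_real (1 / r) * e - w = (e - of_real r * w) / of_real r" using r by (simp add: field_simps)
 hence a: "of_real (1 / r) * e / (of_real (1 / r) * e - w) = a"
  using r nz unfolding a_def by (simp add: field_simps)
 have ab: "a - b = e * w * of_real (r\<^sup>2 - 1) / ((e - of_real r * w) * (of_real r * e - w))"
  unfolding a_def b_def using nz by (simp add: divide_simps algebra_simps power2_eq_square)
 have "r\<^sup>2 <= 1" using r by (simp add: power_le_one)
 hence "norm (of_real (r\<^sup>2 - 1) :: complex) = 1 - r\<^sup>2" by (simp only: norm_of_real)
 hence "norm (a - b) = norm w * (1 - r\<^sup>2) / (norm (e - of_real r * w) * norm (of_real r * e - w))" unfolding ab by (simp add: norm_mult norm_divide e del: of_real_diff of_real_power)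
 also have "... <= norm w * (2 * \<eta>) / (\<kappa> * \<kappa>)"
 proof (intro frac_le mult_mono mult_left_mono)
  have "1 - r\<^sup>2 = (1 - r) * (1 + r)" by (simp add: algebra_simps power2_eq_square)
  also have "... <= \<eta> * 2" using A r by (intro mult_mono) auto
  finally show "1 - r\<^sup>2 <= 2 * \<eta>" by simp
 qed (use g1 g2 \<kappa> r A in "auto simp: power_le_one")
 finally have n1: "norm (a - b) <= norm w * (2 * \<eta>) / (\<kappa> * \<kappa>)" .
 have n2: "norm a <= 1 / \<kappa>" unfolding a_def using g1 \<kappa> e by (simp add: norm_divide frac_le)
 have n3: "norm (1 / cnj A - A) <= 5 * \<eta>"
 proof -
  have cA: "cnj A ~= 0" using A0 by auto
  have "1 / cnj A - A = (1 - of_real ((norm A)\<^sup>2)) / cnj A"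
   using cA complex_norm_square[of A] by (simp add: field_simps)
  also have "norm ... = \<bar>1 - (norm A)\<^sup>2\<bar> / norm A"
   by (simp add: norm_divide flip: of_real_power) (metis norm_of_real of_real_1 of_real_diff)
  also have "\<bar>1 - (norm A)\<^sup>2\<bar> = \<bar>norm A - 1\<bar> * (1 + norm A)"
  proof -
   have "1 - (norm A)\<^sup>2 = - ((norm A - 1) * (1 + norm A))" by (simp add: algebra_simps power2_eq_square)
   thus ?thesis by (simp only: abs_minus_cancel abs_mult) simp
  qed
  also have "\<bar>norm A - 1\<bar> * (1 + norm A) / norm A <= \<eta> * (5 / 2) / (1 / 2)"
   using A A0 by (intro frac_le mult_mono) auto
  finally show ?thesis by simp
 qed
 have "of_real (1 / r) * e * (1 / cnj A) / (of_real (1 / r) * e - w) - of_real r * e * A / (of_real r * e - w)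
   = a * (1 / cnj A - A) + (a - b) * A"
 proof -
  have "of_real (1 / r) * e * (1 / cnj A) / (of_real (1 / r) * e - w) = a * (1 / cnj A)"
   unfolding a[symmetric] by simp
  moreover have "of_real r * e * A / (of_real r * e - w) = b * A" by (simp add: b_def)
  ultimately show ?thesis by (simp only:) (simp add: algebra_simps)
 qed
 also have "norm ... <= norm a * norm (1 / cnj A - A) + norm (a - b) * norm A"
  by (rule norm_triangle_le) (simp add: norm_mult)
 also have "... <= 1 / \<kappa> * (5 * \<eta>) + norm w * (2 * \<eta>) / (\<kappa> * \<kappa>) * (3 / 2)"
  using n1 n2 n3 A0 \<kappa> A by (intro add_mono mult_mono) auto
 also have "... = 5 * \<eta> / \<kappa> + 3 * norm w * \<eta> / \<kappa>\<^sup>2" by (simp add: power2_eq_square)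
 finally show ?thesis .
qed

text \<open>
 Only the moduli are assumed to converge at the circle.  This suffices: \<open>F (r e)\<close> and its reflection
 \<open>1 / cnj (F (r e))\<close> at the mirror point differ by a quantity tending to \<open>0\<close> uniformly, so the Cauchy
 integrals of \<open>F\<close> and of its reflection over the two edges glue to one function.
\<close>

lemma reflection_extend:
 assumes s: "0 < \<sigma>" "\<sigma> < s" "s < 1"
  and F: "F holomorphic_on {v. \<sigma> < norm v \<and> norm v < 1}"
  and Fnz: "!!v. \<sigma> < norm v ==> norm v < 1 ==> F v ~= 0"
  and lim: "!!e. e > 0 ==> \<exists>d>0. \<forall>v. 1 - d < norm v \<and> norm v < 1 \<longrightarrow> \<bar>norm (F v) - 1\<bar> <= e"
 obtains E where "E holomorphic_on {v. s < norm v \<and> norm v < 1 / s}"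
  "!!v. s < norm v ==> norm v < 1 ==> E v = F v"
  "!!v. 1 < norm v ==> norm v < 1 / s ==> E v = 1 / cnj (F (1 / cnj v))"
proof -
 define S where "S = {v :: complex. \<sigma> < norm v \<and> norm v < 1}"
 define S' where "S' = {v :: complex. 1 < norm v \<and> norm v < 1 / \<sigma>}"
 have oS: "open S" "open S'" unfolding S_def S'_def
  by (intro open_Collect_conj open_Collect_less continuous_intros)+
 define Fs where "Fs v = 1 / cnj (F (1 / cnj v))" for v
 have refl: "1 / cnj v \<in> S" if "v \<in> S'" for v
 proof -
  have "norm v > 0" "1 < norm v" "norm v * \<sigma> < 1" using that s by (auto simp: S'_def field_simps)
  thus ?thesis using s by (simp add: S_def norm_divide field_simps)
 qed
 have FsS: "Fs holomorphic_on S'"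
 proof -
  have FS: "F holomorphic_on S" using F by (simp add: S_def)
  have c: "cnj \<circ> F \<circ> cnj holomorphic_on S"
   by (rule holomorphic_on_compose_cnj_cnj) (use oS in "auto intro!: hol_subset[OF FS] simp: S_def")
  have "(cnj \<circ> F \<circ> cnj) \<circ> (%v. 1 / v) holomorphic_on S'"
  proof (rule holomorphic_on_compose_gen[OF _ c])
   show "(%v. 1 / v) holomorphic_on S'" by (intro holomorphic_intros) (auto simp: S'_def)
   show "(%v. 1 / v) ` S' \<subseteq> S"
    using refl by (auto simp: S_def norm_divide)
  qed
  hence "(%v. (cnj \<circ> F \<circ> cnj) (1 / v)) holomorphic_on S'" by (simp add: o_def)
  hence "(%v. 1 / (cnj \<circ> F \<circ> cnj) (1 / v)) holomorphic_on S'"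
   using Fnz refl by (intro holomorphic_intros) (auto simp: S_def)
  thus ?thesis by (rule holomorphic_transform) (auto simp: Fs_def)
 qed
 \<comment> \<open>The outer circle carries the reflected function and the inner circle
   \<open>F\<close>; on either side only one of the two integrals has to be moved across
   \<open>w\<close>.\<close>
 define E where "E w = cmean (1 / s) (%v. v * Fs v / (v - w)) - cmean s (%v. v * F v / (v - w))" for w
 have s1: "1 < 1 / s" "1 / s < 1 / \<sigma>" using s by (auto simp: field_simps)
 have FS: "F holomorphic_on S" using F by (simp add: S_def)
 have contF: "continuous_on (sphere 0 r) F" if "\<sigma> < r" "r < 1" for r
  using that by (intro hol_imp_cont hol_subset[OF FS]) (auto simp: S_def)
 have contFs: "continuous_on (sphere 0 r) Fs" if "1 < r" "r < 1 / \<sigma>" for r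
  using that by (intro hol_imp_cont hol_subset[OF FsS]) (auto simp: S'_def)
 have Ehol: "E holomorphic_on {v. s < norm v \<and> norm v < 1 / s}"
  unfolding E_def
  by (intro holomorphic_intros cmean_holomorphic_param continuous_intros contF contFs
    open_Collect_conj open_Collect_less) (use s s1 in auto)
 have FsE: "Fs (of_real (1 / r) * e) = 1 / cnj (F (of_real r * e))" if "norm e = 1" "r > 0" for r e
 proof -
  have "cnj e * e = 1" using complex_norm_square[of e] that by (simp add: mult.commute)
  moreover from this have "e ~= 0" by auto
  ultimately have "cnj e = 1 / e" by (simp add: eq_divide_eq)
  hence "1 / cnj (of_real (1 / r) * e) = of_real r * e" by simp
  thus ?thesis by (simp only: Fs_def)
 qed
 let ?I = "%r w. cmean r (%v. v * F v / (v - w))"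
 let ?O = "%r w. cmean r (%v. v * Fs v / (v - w))"
 \<comment> \<open>A quantity that equals the difference of the two Cauchy integrals for all radii
   close to one must vanish, since \<open>reflection_gap\<close> makes it arbitrarily small.\<close>
 have glue: "X = 0" if w: "norm w ~= 1" and r0: "s <= r0" "r0 < 1"
  and X: "!!r. r0 < r ==> r < 1 ==> X = ?O (1 / r) w - ?I r w" for X w r0
 proof -
  define \<kappa> where "\<kappa> = \<bar>norm w - 1\<bar> / 2"
  have \<kappa>: "0 < \<kappa>" using w by (simp add: \<kappa>_def)
  define M where "M = 5 / \<kappa> + 3 * norm w / \<kappa>\<^sup>2"
  have main: "norm X <= \<eta> * M" if \<eta>: "0 < \<eta>" "\<eta> <= 1 / 2" for \<eta>
  proof -
   obtain d where d: "d > 0" "!!v. 1 - d < norm v ==> norm v < 1 ==> \<bar>norm (F v) - 1\<bar> <= \<eta>"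
    using lim[OF \<eta>(1)] by blast
   \<comment> \<open>The term with \<open>\<kappa>\<close>, half the distance of
     \<open>norm w\<close> from one, keeps both kernel denominators at least \<open>\<kappa>\<close>
     in modulus.\<close>
   define x where "x = min (min d \<eta>) (min (1 - r0) (\<kappa> / (1 + norm w)))"
   have w1: "0 < 1 + norm w" by (rule add_pos_nonneg) auto
   have x: "0 < x" "x <= d" "x <= \<eta>" "x <= 1 - r0" "x <= \<kappa> / (1 + norm w)"
    using d \<eta> r0 \<kappa> w1 by (simp_all add: x_def min_le_iff_disj)
   define r where "r = 1 - x / 2"
   have "(1 - r) * (1 + norm w) = x * (1 + norm w) / 2" by (simp add: r_def)
   hence r: "r0 < r" "r < 1" "1 - d < r" "1 - r <= \<eta>" "0 < r" "(1 - r) * (1 + norm w) <= \<kappa>"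
    using x r0 s \<kappa> w1 unfolding r_def pos_le_divide_eq[OF w1] by linarith+
   have rr: "1 < 1 / r" "1 / r < 1 / \<sigma>" "\<sigma> < r" using r r0 s by (auto simp: field_simps)
   have gap: "\<kappa> <= norm (e - of_real r * w)" "\<kappa> <= norm (of_real r * e - w)" if e: "norm e = 1" for e
   proof -
    have "0 <= (1 - r) * norm w" using r by simp
    moreover have "(1 - r) + (1 - r) * norm w <= \<kappa>" using r(6) by (simp only: distrib_left mult_1_right)
    moreover have "\<bar>1 - r * norm w\<bar> <= norm (e - of_real r * w)"
     using norm_triangle_ineq3[of e "of_real r * w"] e r by (simp add: norm_mult)
    moreover have "\<bar>r - norm w\<bar> <= norm (of_real r * e - w)"
     using norm_triangle_ineq3[of "of_real r * e" w] e r by (simp add: norm_mult)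
    moreover have "2 * \<kappa> = \<bar>norm w - 1\<bar>" by (simp add: \<kappa>_def)
    moreover have "r * norm w = norm w - (1 - r) * norm w" by (simp add: algebra_simps)
    ultimately show "\<kappa> <= norm (e - of_real r * w)" "\<kappa> <= norm (of_real r * e - w)" using r(2) by arith+
   qed
   have nz: "of_real r * e - w ~= 0" "of_real (1 / r) * e - w ~= 0" if "norm e = 1" for e
    using gap[OF that] \<kappa> r by (auto simp: field_simps)
   let ?h = "%e. of_real (1 / r) * e * Fs (of_real (1 / r) * e) / (of_real (1 / r) * e - w)
          - of_real r * e * F (of_real r * e) / (of_real r * e - w)"
   have c: "continuous_on (sphere 0 1) (%e. of_real (1 / r) * e * Fs (of_real (1 / r) * e) / (of_real (1 / r) * e - w))"
    "continuous_on (sphere 0 1) (%e. of_real r * e * F (of_real r * e) / (of_real r * e - w))"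
    using nz r by (auto intro!: continuous_intros continuous_on_compose2[OF contFs[OF rr(1,2)]]
      continuous_on_compose2[OF contF[OF rr(3) r(2)]] simp: norm_mult norm_divide)
   have "X = cmean 1 ?h"
    unfolding X[OF r(1,2)] by (subst (1 2) cmean_scale, rule cmean_diff[symmetric, OF c]) auto
   also have "norm ... <= 5 * \<eta> / \<kappa> + 3 * norm w * \<eta> / \<kappa>\<^sup>2"
   proof (rule cmean_bound[OF continuous_on_diff[OF c]])
    fix e :: complex assume e: "norm e = 1"
    show "norm (?h e) <= 5 * \<eta> / \<kappa> + 3 * norm w * \<eta> / \<kappa>\<^sup>2"
     unfolding FsE[OF e r(5)]
     by (rule reflection_gap[OF e r(5,2) \<kappa> gap[OF e]]) (use d(2) e r \<eta> in "auto simp: norm_mult")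
   qed simp
   finally show ?thesis by (simp add: M_def algebra_simps)
  qed
  show "X = 0"
  proof (rule ccontr)
   assume "X ~= 0"
   have M: "M > 0" unfolding M_def using \<kappa> by (intro add_pos_nonneg) auto
   hence "norm X <= min (1 / 2) (norm X / (2 * M)) * M" using \<open>X ~= 0\<close> by (intro main) auto
   also have "... <= norm X / (2 * M) * M" using M by (intro mult_right_mono) auto
   also have "... = norm X / 2" using M by simp
   finally show False using \<open>X ~= 0\<close> by simp
  qed
 qed
 have in_eq: "E w = F w" if w: "s < norm w" "norm w < 1" for w
 proof -
  have "E w - F w = 0"
  proof (rule glue[of w "norm w"])
   fix r assume r: "norm w < r" "r < 1"
   have "?I r w = ?I s w + F w"
    by (rule cmean_annulus_Cauchy[OF oS(1) FS]) (use r w s in "auto simp: S_def")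
   moreover have "?O (1 / r) w = ?O (1 / s) w"
   proof (rule cmean_radius[OF oS(2)])
    show "(%v. v * Fs v / (v - w)) holomorphic_on S'"
     using w by (intro holomorphic_intros FsS) (auto simp: S'_def)
    fix v :: complex assume v: "1 / r <= norm v" "norm v <= 1 / s"
    have "1 < 1 / r" using r w s by (simp add: field_simps)
    thus "v \<in> S'" using v s1 by (auto simp: S'_def)
   qed (use r w s in "auto simp: frac_le")
   ultimately show "E w - F w = ?O (1 / r) w - ?I r w" by (simp add: E_def)
  qed (use w in auto)
  thus ?thesis by simp
 qed
 have out_eq: "E w = Fs w" if w: "1 < norm w" "norm w < 1 / s" for w
 proof -
  have "E w - Fs w = 0"
  proof (rule glue[of w "max s (1 / norm w)"])
   fix r assume r: "max s (1 / norm w) < r" "r < 1"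
   hence r0: "0 < norm w" "0 < r" using w s by linarith+
   hence r': "1 < 1 / r" "1 / r < norm w" using r by (auto simp: pos_divide_less_eq mult.commute)
   have "?O (1 / s) w = ?O (1 / r) w + Fs w"
    by (rule cmean_annulus_Cauchy[OF oS(2) FsS]) (use r0 r' w s1 less_le_trans[OF r'(1)] in "auto simp: S'_def")
   moreover have "?I s w = ?I r w"
   proof (rule cmean_radius[OF oS(1)])
    show "(%v. v * F v / (v - w)) holomorphic_on S"
     using w by (intro holomorphic_intros FS) (auto simp: S_def)
   qed (use r s in "auto simp: S_def")
   ultimately show "E w - Fs w = ?O (1 / r) w - ?I r w" by (simp add: E_def)
  qed (use w s in "auto simp: divide_less_eq_1")
  thus ?thesis by simp
 qed
 show ?thesis by (rule that[OF Ehol]) (use in_eq out_eq in "auto simp: Fs_def")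
qed

subsection \<open>Circle maps and reparametrization\<close>

text \<open>
 In the parameter \<open>t\<close> with \<open>v = e\<^sup>2\<^sup>\<pi>\<^sup>i\<^sup>t\<close> the map becomes \<open>g\<close>, which is smooth and injective once the point with
 \<open>k v = 1\<close> is removed, so the one-dimensional change of variables applies.
\<close>

lemma circle_reparam:
 fixes H :: "complex \<Rightarrow> complex"
 assumes S: "open S" "k holomorphic_on S" "sphere 0 1 \<subseteq> S"
  and inj: "inj_on k (sphere 0 1)" and onto: "k ` sphere 0 1 = sphere 0 1" and H: "continuous_on (sphere 0 1) H"
 shows "integral {0..1} (%t. H (k (circlepath 0 1 t)) * of_real (norm (deriv k (circlepath 0 1 t))))
    = integral {0..1} (%t. H (circlepath 0 1 t))"
proof -
 let ?e = "circlepath 0 1"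
 let ?n = "%t. norm (deriv k (?e t))"
 have e1: "norm (?e t) = 1" for t by (rule circlepath_norm) simp
 define u where "u t = k (?e t)" for t
 \<comment> \<open>The cut of \<open>Ln (- u)\<close> lies at \<open>u = 1\<close>, so this is the
   parameter of \<open>u t\<close> in the unit interval, smooth on \<open>T\<close>.\<close>
 define g where "g t = Im (Ln (- u t)) / (2 * pi) + 1 / 2" for t
 define d where "d t = 2 * of_real pi * \<i> * ?e t * deriv k (?e t) / u t" for t
 define T where "T = {t \<in> {0<..<1}. u t ~= 1}"
 have u1: "norm (u t) = 1" for t using onto e1[of t] by (auto simp: u_def image_subset_iff set_eq_iff)
 hence unz: "u t ~= 0" for t by (metis norm_zero zero_neq_one)
 have ReL: "Re (Ln (- u t)) = 0" for t using u1[of t] unz[of t] by (subst Re_Ln) auto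
 have ec: "continuous_on A (%t. f (?e t))" if "continuous_on (sphere 0 1) f" for A and f :: "complex \<Rightarrow> 'b::topological_space"
  by (rule continuous_on_compose_circlepath[OF that]) simp
 have contk: "continuous_on (sphere 0 1) k" "continuous_on (sphere 0 1) (deriv k)"
  using S by (auto intro!: hol_imp_cont intro: hol_subset holomorphic_deriv)
 have du: "(u has_vector_derivative d t * u t) (at t)" for t
 proof -
  have "(k has_field_derivative deriv k (?e t)) (at (?e t))" using S e1 by (intro holomorphic_derivI[OF S(2,1)]) auto
  from field_vector_diff_chain_at[OF has_vector_derivative_circlepath this]
  have "(k \<circ> ?e has_vector_derivative 2 * of_real pi * \<i> * ?e t * deriv k (?e t)) (at t)" by (simp add: circlepath)
  thus ?thesis using u1[of t] by (auto simp: d_def u_def[abs_def] o_def mult.assoc)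
 qed
 have einj: "s = t" if "?e s = ?e t" "s \<in> {0<..<1}" "t \<in> {0..1}" for s t
  using simple_path_circlepath[of 0 1] that unfolding simple_path_def loop_free_def
  by (metis atLeastAtMost_iff greaterThanLessThan_iff less_eq_real_def less_irrefl zero_neq_one)
 have T: "t \<in> {0<..<1}" "- u t \<notin> \<real>\<^sub>\<le>\<^sub>0" if "t \<in> T" for t
 proof -
  show "t \<in> {0<..<1}" using that by (simp add: T_def)
  show "- u t \<notin> \<real>\<^sub>\<le>\<^sub>0"
  proof
   assume "- u t \<in> \<real>\<^sub>\<le>\<^sub>0"
   hence "u t = 1" using u1[of t] by (auto simp: complex_nonpos_Reals_iff complex_eq_iff cmod_def)
   thus False using that by (simp add: T_def)
  qed
 qed
 have "open ({0<..<1} \<inter> u -` (- {1}))"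
  by (intro continuous_open_preimage) (auto simp: u_def[abs_def] intro: ec contk)
 hence oT: "open T" by (simp add: T_def vimage_def Int_def)
 have L: "((%t. Ln (- u t)) has_vector_derivative d t) (at t)" if "t \<in> T" for t
  using field_vector_diff_chain_at[OF has_vector_derivative_minus[OF du] has_field_derivative_Ln[OF T(2)[OF that]]]
  by (simp add: o_def mult.assoc unz)
 have dg: "(g has_field_derivative Im (d t) / (2 * pi)) (at t)" "\<bar>Im (d t) / (2 * pi)\<bar> = ?n t" if t: "t \<in> T" for t
 proof -
  have "((%t. Im (Ln (- u t))) has_field_derivative Im (d t)) (at t)"
   unfolding has_real_derivative_iff_has_vector_derivative by (rule bounded_linear.has_vector_derivative[OF bounded_linear_Im L[OF t]])
  thus "(g has_field_derivative Im (d t) / (2 * pi)) (at t)"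
   unfolding g_def[abs_def] by (rule DERIV_cong[OF DERIV_add[OF DERIV_cdivide DERIV_const]]) simp
  \<comment> \<open>The real part of \<open>Ln (- u t)\<close> vanishes identically, so
    \<open>d t\<close> is purely imaginary and its imaginary part carries the full norm.\<close>
  have "((%t. Re (Ln (- u t))) has_vector_derivative Re (d t)) (at t)"
   by (rule bounded_linear.has_vector_derivative[OF bounded_linear_Re L[OF t]])
  hence "Re (d t) = 0" unfolding ReL by (rule vector_derivative_unique_at[OF _ has_vector_derivative_const])
  hence "\<bar>Im (d t)\<bar> = norm (d t)" by (simp add: cmod_def)
  also have "... = 2 * pi * ?n t" by (simp add: d_def norm_mult norm_divide u1 e1)
  finally show "\<bar>Im (d t) / (2 * pi)\<bar> = ?n t" by (simp add: abs_divide)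
 qed
 have eg: "?e (g t) = u t" for t
 proof -
  have "exp (Ln (- u t)) = - u t" using unz by simp
  moreover have "Ln (- u t) = \<i> * of_real (Im (Ln (- u t)))" using ReL by (simp add: complex_eq_iff)
  moreover have "2 * of_real pi * \<i> * of_real (g t) = \<i> * of_real (Im (Ln (- u t))) + of_real pi * \<i>"
   by (simp add: g_def field_simps)
  ultimately show ?thesis by (simp add: circlepath exp_add)
 qed
 have ginj: "inj_on g T"
 proof (rule inj_onI)
  fix s t assume st: "s \<in> T" "t \<in> T" "g s = g t"
  hence "k (?e s) = k (?e t)" using eg[of s] eg[of t] by (simp add: u_def)
  hence "?e s = ?e t" using inj_onD[OF inj] e1 by simp
  thus "s = t" using einj T(1) st by force
 qed
 \<comment> \<open>Such an exceptional set contains at most 0, 1 and one further parameter, namely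
   that of the prescribed point \<open>c\<close>.\<close>
 have neg: "negligible (A - B)" if "!!t. t \<in> A - B ==> t \<in> {0..1} \<and> (t = 0 \<or> t = 1 \<or> ?e t = c)" for A B c
 proof -
  have "A - B - {0, 1} \<subseteq> {t}" if "t \<in> A - B - {0, 1}" for t
  proof
   fix t' assume "t' \<in> A - B - {0, 1}"
   thus "t' \<in> {t}" using that \<open>!!t. t \<in> A - B ==> _\<close>[of t] \<open>!!t. t \<in> A - B ==> _\<close>[of t'] einj[of t t'] by auto
  qed
  hence "finite (A - B - {0, 1})" by (metis finite.emptyI finite.insertI finite_subset equals0I)
  thus ?thesis by (intro negligible_finite) simp
 qed
 obtain v1 where v1: "norm v1 = 1" "k v1 = 1" using onto by (metis imageE mem_sphere_0 norm_one)
 have gT: "g ` T \<subseteq> {0..1}"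
 proof
  fix x assume "x \<in> g ` T"
  then obtain t where x: "x = g t" by blast
  have "- (1 / 2) <= Im (Ln (- u t)) / (2 * pi)" "Im (Ln (- u t)) / (2 * pi) <= 1 / 2"
   using unz[of t] mpi_less_Im_Ln[of "- u t"] Im_Ln_le_pi[of "- u t"] by (simp_all add: pos_le_divide_eq pos_divide_le_eq less_imp_le)
  thus "x \<in> {0..1}" unfolding g_def x atLeastAtMost_iff by linarith
 qed
 have n1: "negligible (T - {0..1})" "negligible ({0..1} - T)"
  using inj_onD[OF inj, of "?e _" v1] e1 v1 by (auto intro!: neg[of _ _ v1] simp: T_def u_def)
 have n2: "negligible ({0..1} - g ` T)"
 proof (rule neg[of _ _ "u 0"])
  fix x assume x: "x \<in> {0..1} - g ` T"
  obtain v where v: "norm v = 1" "k v = ?e x" using onto e1[of x] by (metis imageE mem_sphere_0)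
  have "v \<in> ?e ` {0..1}" using v(1) path_image_circlepath[of 0 1] by (simp add: path_image_def)
  then obtain t where t: "t \<in> {0..1}" "v = ?e t" by blast
  show "x \<in> {0..1} \<and> (x = 0 \<or> x = 1 \<or> ?e x = u 0)"
  proof (rule ccontr)
   assume n: "\<not> ?thesis"
   have ut: "u t = ?e x" using t v by (simp add: u_def)
   have "?e x ~= ?e 0" using einj[of x 0] x n by auto
   hence "u t ~= 1" using ut by (simp add: circlepath)
   moreover have "t ~= 0" "t ~= 1" using ut n x by (auto simp: u_def circlepath)
   ultimately have tT: "t \<in> T" using t by (simp add: T_def)
   hence "x = g t" using eg[of t] ut einj[of x "g t"] gT x n by auto
   thus False using x tT by blast
  qed
 qed
 have n3: "negligible (g ` T - {0..1})" using gT by (simp add: Diff_eq_empty_iff[THEN iffD2])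
 have mT: "T \<in> sets lebesgue" using oT by auto
 have real: "integral {0..1} (%t. ?n t * f (k (?e t))) = integral {0..1} (%t. f (?e t))"
  if f: "continuous_on (sphere 0 1) f" for f :: "complex \<Rightarrow> real"
 proof -
  have "(%t. f (?e t)) absolutely_integrable_on {0..1}"
   by (rule absolutely_integrable_continuous_real[OF ec[OF f]])
  hence "(%t. f (?e t)) absolutely_integrable_on g ` T"
   by (rule absolutely_integrable_spike_set_eq[THEN iffD1, rotated 2])
     (auto intro: negligible_subset[OF n2] negligible_subset[OF n3])
  moreover have "integral (g ` T) (%t. f (?e t)) = integral {0..1} (%t. f (?e t))"
   by (rule integral_spike_set) (auto intro: negligible_subset[OF n2] negligible_subset[OF n3])
  ultimately have "integral T (%t. \<bar>Im (d t) / (2 * pi)\<bar> * f (?e (g t))) = integral {0..1} (%t. f (?e t))"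
   using has_absolute_integral_change_of_variables_1'[OF mT has_field_derivative_at_within[OF dg(1)] ginj, of "%t. f (?e t)"] by blast
  also have "integral T (%t. \<bar>Im (d t) / (2 * pi)\<bar> * f (?e (g t))) = integral T (%t. ?n t * f (k (?e t)))"
   by (rule integral_cong) (simp only: dg(2) eg u_def)
  also have "... = integral {0..1} (%t. ?n t * f (k (?e t)))"
   by (rule integral_spike_set) (auto intro: negligible_subset[OF n1(1)] negligible_subset[OF n1(2)])
  finally show ?thesis by simp
 qed
 have i: "(%t. H (?e t)) integrable_on {0..1}" "(%t. H (k (?e t)) * of_real (?n t)) integrable_on {0..1}"
  using onto by (auto intro!: integrable_continuous_real ec H continuous_intros contk continuous_on_compose2[OF H contk(1)]
    continuous_on_compose2[OF contk(2)])
 have "continuous_on (sphere 0 1) (%v. Re (H v))" "continuous_on (sphere 0 1) (%v. Im (H v))" by (intro continuous_intros H)+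
 from this[THEN real] show ?thesis
  using integral_linear[OF i(1) bounded_linear_Re] integral_linear[OF i(1) bounded_linear_Im]
   integral_linear[OF i(2) bounded_linear_Re] integral_linear[OF i(2) bounded_linear_Im]
  by (intro complex_eqI) (simp_all add: o_def mult.commute)
qed

subsection \<open>Uniqueness of power branches\<close>

text \<open>A connected countable set of complex numbers has at most one point, so the quotient is
  constant. The constant has modulus one and is positive by the two limits at infinity.\<close>

lemma power_branch_unique:
 assumes U: "connected U" "!!z. R < norm z ==> z \<in> U"
  and g1: "is_power_branch U f x g1" and g2: "is_power_branch U f x g2" and z: "z \<in> U"
 shows "g1 z = g2 z"
proof -
 have nz: "g2 w ~= 0" if "w \<in> U" for w using g2 that by (force simp: is_power_branch_def)
 define T where "T = range (%m::int. exp (of_real x * (of_int (2 * m) * (of_real pi * \<i>))) :: complex)"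
 have T: "g1 w / g2 w \<in> T" if "w \<in> U" for w
 proof -
  obtain l1 l2 where l: "exp l1 = f w" "g1 w = exp (of_real x * l1)" "exp l2 = f w" "g2 w = exp (of_real x * l2)"
   using g1 g2 \<open>w \<in> U\<close> unfolding is_power_branch_def by blast
  then obtain m :: int where "l1 = l2 + of_int (2 * m) * (of_real pi * \<i>)" using exp_eq[of l1 l2] by auto
  hence "g1 w / g2 w = exp (of_real x * (of_int (2 * m) * (of_real pi * \<i>)))"
   unfolding l by (simp add: exp_add algebra_simps)
  thus ?thesis by (auto simp: T_def)
 qed
 have cont: "continuous_on U (%w. g1 w / g2 w)"
  using g1 g2 nz by (intro continuous_intros hol_imp_cont) (auto simp: is_power_branch_def)
 have "countable T" by (simp add: T_def)
 hence cnt: "countable ((%w. g1 w / g2 w) ` U)" using T by (meson countable_subset image_subsetI)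
 have conn: "connected ((%w. g1 w / g2 w) ` U)" using cont U(1) by (rule connected_continuous_image)
 define c where "c = g1 z / g2 z"
 have eq: "g1 w / g2 w = c" if "w \<in> U" for w
  using connected_uncountable[OF conn, of "g1 w / g2 w" c] cnt that z by (auto simp: c_def)
 obtain c1 c2 :: real where c12: "c1 > 0" "c2 > 0" "(g1 \<longlongrightarrow> of_real c1) at_infinity" "(g2 \<longlongrightarrow> of_real c2) at_infinity"
  using g1 g2 unfolding is_power_branch_def pos_at_inf_def by blast
 have "((%w. g1 w / g2 w) \<longlongrightarrow> of_real c1 / of_real c2) at_infinity"
  using c12 by (intro tendsto_divide) auto
 moreover have "\<forall>\<^sub>F w in at_infinity. g1 w / g2 w = c"
  unfolding eventually_at_infinity using U(2) eq by (intro exI[of _ "R + 1"]) auto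
 ultimately have "((%w::complex. c) \<longlongrightarrow> complex_of_real c1 / of_real c2) at_infinity"
  by (rule Lim_transform_eventually)
 hence "c = of_real (c1 / c2)"
  using tendsto_unique[OF trivial_limit_at_infinity tendsto_const] by fastforce
 moreover have "norm c = 1"
 proof -
  have "c \<in> T" using T[OF z] by (simp add: c_def)
  thus ?thesis by (auto simp: T_def)
 qed
 ultimately have "c = 1" using c12 by (metis abs_of_pos divide_pos_pos norm_of_real of_real_1)
 thus ?thesis using nz[OF z] by (simp add: c_def)
qed

lemma power_branch_eq:
 assumes "connected U" "!!z. R < norm z ==> z \<in> U" "is_power_branch U f x g" "z \<in> U"
 shows "power_branch U f x z = g z"
proof -
 have "is_power_branch U f x (power_branch U f x)"
  unfolding power_branch_def by (rule someI[of _ g]) (rule assms(3))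
 thus ?thesis using power_branch_unique assms by blast
qed

subsection \<open>The exterior map\<close>

lemma tendsto_at_infinity_inverse:
 fixes f :: "complex \<Rightarrow> complex"
 assumes "isCont f 0" shows "((%v. f (1 / v)) \<longlongrightarrow> f 0) at_infinity"
proof -
 have "((%v::complex. 1 / v) \<longlongrightarrow> 0) at_infinity"
  by (intro tendsto_divide_0[OF tendsto_const] filterlim_ident)
 from isCont_tendsto_compose[OF assms this] show ?thesis .
qed

lemma convex_scaled_disc: "convex {x :: complex. r * norm x < 1}" if "0 <= r" for r :: real
proof (cases "r = 0")
 case False
 hence "{x :: complex. r * norm x < 1} = ball 0 (1 / r)" using that by (auto simp: field_simps)
 thus ?thesis by simp
qed auto

lemma open_scaled_disc: "open {x :: complex. r * norm x < 1}"
 by (intro open_Collect_less continuous_intros)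

lemma holomorphic_log_normalized:
 assumes "convex A" "open A" "f holomorphic_on A" "!!x. x \<in> A ==> f x ~= 0" "0 \<in> A" "exp l0 = f 0"
 obtains l where "l holomorphic_on A" "!!x. x \<in> A ==> exp (l x) = f x" "l 0 = l0"
proof -
 obtain g where g: "g holomorphic_on A" "!!x. x \<in> A ==> exp (g x) = f x"
  using holomorphic_logarithm_exists[OF assms(1-5)] by blast
 show ?thesis
 proof (rule that[of "%x. g x - g 0 + l0"])
  show "exp (g x - g 0 + l0) = f x" if "x \<in> A" for x
   using g(2)[OF that] g(2)[OF assms(5)] assms(6) assms(4)[OF assms(5)] by (simp add: exp_add exp_diff)
 qed (use g in "auto intro!: holomorphic_intros")
qed

text \<open>On a connected interval the difference takes values in the multiples of
  \<open>2 pi i\<close>, a countable set.\<close>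

lemma continuous_logs_agree:
 fixes f g :: "real \<Rightarrow> complex"
 assumes "continuous_on {0..1} f" "continuous_on {0..1} g"
  "!!t. t \<in> {0..1} ==> exp (f t) = exp (g t)" "f 0 = g 0"
 shows "f 1 = g 1"
proof -
 define h where "h t = (f t - g t) / (2 * of_real pi * \<i>)" for t
 have int: "h t \<in> range of_int" if t: "t \<in> {0..1}" for t
 proof -
  obtain m :: int where "f t = g t + of_int (2 * m) * (of_real pi * \<i>)"
   using assms(3)[OF t] by (auto simp: exp_eq)
  hence "h t = of_int m" by (simp add: h_def)
  thus ?thesis by blast
 qed
 have "connected (h ` {0..1})"
  unfolding h_def by (intro connected_continuous_image continuous_intros assms(1,2)) auto
 moreover have "countable (h ` {0..1})"
  by (rule countable_subset[of _ "range of_int"]) (use int in auto)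
 ultimately have "h 1 = h 0" using connected_uncountable[of "h ` {0..1}" "h 1" "h 0"] by auto
 thus ?thesis using assms(4) by (simp add: h_def)
qed

locale ext_map =
 fixes \<psi> \<phi> :: "complex \<Rightarrow> complex" and r0 c :: real
 assumes hol: "\<psi> holomorphic_on ext_disk r0" and inj: "inj_on \<psi> (ext_disk r0)"
  and r0: "0 <= r0" and lim: "filterlim \<psi> at_infinity at_infinity"
  and dlim: "(deriv \<psi> \<longlongrightarrow> of_real c) at_infinity" and c: "0 < c"
  and \<phi>_def: "\<phi> = inv_into (ext_disk r0) \<psi>"
begin

lemma open_ext: "open (ext_disk t)"
 unfolding ext_disk_def by (intro open_Collect_less continuous_intros)

lemma ext_mono: "s <= t ==> ext_disk t \<subseteq> ext_disk s"
 by (auto simp: ext_disk_def)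

lemma connected_ext: "0 <= t ==> connected (ext_disk t)"
proof -
 assume "0 <= t"
 have "connected (- cball (0::complex) t)" by (intro connected_complement_bounded_convex) auto
 moreover have "ext_disk t = - cball 0 t" by (auto simp: ext_disk_def)
 ultimately show ?thesis by simp
qed

lemma \<phi>\<psi> [simp]: "r0 < norm v ==> \<phi> (\<psi> v) = v"
 unfolding \<phi>_def by (rule inv_into_f_f[OF inj]) (simp add: ext_disk_def)

lemma OmegaD: "z \<in> Omega \<psi> t ==> r0 <= t ==> t < norm (\<phi> z) \<and> \<psi> (\<phi> z) = z"
 by (auto simp: Omega_def ext_disk_def)

lemma OmegaI: "t < norm v ==> \<psi> v \<in> Omega \<psi> t"
 by (auto simp: Omega_def ext_disk_def)

lemma Omega_iff: "r0 < norm v ==> r0 <= t ==> \<psi> v \<in> Omega \<psi> t \<longleftrightarrow> t < norm v"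
 using OmegaD[of "\<psi> v" t] OmegaI[of t v] by auto

lemma open_image: "open A ==> A \<subseteq> ext_disk r0 ==> open (\<psi> ` A)"
 by (rule open_mapping_thm3) (use hol inj in "auto intro: hol_subset inj_on_subset")

lemma open_Omega: "r0 <= t ==> open (Omega \<psi> t)"
 unfolding Omega_def by (rule open_image[OF open_ext ext_mono])

lemma d\<psi>_nz: "r0 < norm v ==> deriv \<psi> v ~= 0"
 by (rule holomorphic_injective_imp_regular[OF hol open_ext inj]) (simp add: ext_disk_def)

lemma \<phi>_hol: "\<phi> holomorphic_on Omega \<psi> r0"
 and d\<phi>: "r0 < norm v ==> deriv \<phi> (\<psi> v) = 1 / deriv \<psi> v"
proof -
 obtain g where g: "g holomorphic_on \<psi> ` ext_disk r0"
  "!!z. z \<in> ext_disk r0 ==> deriv \<psi> z * deriv g (\<psi> z) = 1" "!!z. z \<in> ext_disk r0 ==> g (\<psi> z) = z"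
  using holomorphic_has_inverse[OF hol open_ext inj] by blast
 have eq: "g z = \<phi> z" if "z \<in> Omega \<psi> r0" for z
  using that g(3) by (auto simp: Omega_def ext_disk_def)
 show "\<phi> holomorphic_on Omega \<psi> r0"
  using g(1) eq unfolding Omega_def by (rule holomorphic_transform)
 assume v: "r0 < norm v"
 have "deriv \<phi> (\<psi> v) = deriv g (\<psi> v)"
 proof (rule deriv_cong_ev[OF _ refl])
  have "\<forall>\<^sub>F z in nhds (\<psi> v). z \<in> Omega \<psi> r0"
   using v by (intro eventually_nhds_in_open open_Omega OmegaI) auto
  thus "\<forall>\<^sub>F z in nhds (\<psi> v). \<phi> z = g z" by eventually_elim (simp add: eq)
 qed
 thus "deriv \<phi> (\<psi> v) = 1 / deriv \<psi> v" using g(2)[of v] v d\<psi>_nz[OF v]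
  by (auto simp: ext_disk_def field_simps)
qed

lemma cont\<psi>: "A \<subseteq> ext_disk r0 ==> continuous_on A \<psi>"
 using hol hol_imp_cont continuous_on_subset by blast

text \<open>Points of large modulus have images far from \<open>z\<close> because \<psi> tends to
  infinity, so nearness to \<open>z\<close> concerns only a compact ring.\<close>

lemma closed_image: assumes t: "r0 < t" shows "closed (\<psi> ` {v. t <= norm v})"
proof -
 have "\<exists>e>0. ball z e \<subseteq> - \<psi> ` {v. t <= norm v}" if z: "z \<notin> \<psi> ` {v. t <= norm v}" for z
 proof -
  have "\<forall>\<^sub>F v in at_infinity. norm z + 1 <= norm (\<psi> v)"
   using lim unfolding filterlim_at_infinity[OF order_refl]
   by (cases "norm z + 1 > 0") (auto intro: add_nonneg_pos)
  then obtain M where M: "!!v. M <= norm v ==> norm z + 1 <= norm (\<psi> v)"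
   by (auto simp: eventually_at_infinity)
  define K where "K = {v :: complex. t <= norm v} \<inter> cball 0 M"
  have "compact K" unfolding K_def
   by (intro closed_Int_compact closed_Collect_le continuous_intros compact_cball)
  moreover have "continuous_on K \<psi>" by (rule cont\<psi>) (use t in "auto simp: K_def ext_disk_def")
  ultimately have "closed (\<psi> ` K)" using compact_continuous_image compact_imp_closed by blast
  moreover have "z \<notin> \<psi> ` K" using z by (auto simp: K_def)
  ultimately obtain e where e: "e > 0" "ball z e \<subseteq> - \<psi> ` K"
   by (metis ComplI open_Compl open_contains_ball)
  show ?thesis
  proof (intro exI[of _ "min e 1"] conjI subsetI)
   fix y assume y: "y \<in> ball z (min e 1)"
   show "y \<in> - \<psi> ` {v. t <= norm v}"
   proof
    assume "y \<in> \<psi> ` {v. t <= norm v}"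
    then obtain v where v: "y = \<psi> v" "t <= norm v" by auto
    show False
    proof (cases "norm v <= M")
     case True
     hence "y \<in> \<psi> ` K" using v by (auto simp: K_def)
     thus False using e y by auto
    next
     case False
     hence "norm z + 1 <= norm y" using M[of v] v by simp
     moreover have "norm y <= norm z + dist z y" using norm_triangle_ineq2[of y z] by (simp add: dist_norm norm_minus_commute)
     ultimately show False using y by auto
    qed
   qed
  qed (use e in auto)
 qed
 hence "open (- \<psi> ` {v. t <= norm v})" unfolding open_contains_ball by blast
 thus ?thesis by (simp add: closed_def)
qed

lemma closure_ext: "closure (ext_disk t) = {v :: complex. t <= norm v}"
proof -
 have "ext_disk t = - cball 0 t" by (auto simp: ext_disk_def)
 hence "closure (ext_disk t) = - ball 0 t" by (simp add: closure_complement)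
 thus ?thesis by auto
qed

lemma closure_Omega: assumes t: "r0 < t" shows "closure (Omega \<psi> t) = \<psi> ` {v. t <= norm v}"
proof
 show "closure (Omega \<psi> t) \<subseteq> \<psi> ` {v. t <= norm v}"
  by (rule closure_minimal[OF _ closed_image[OF t]]) (auto simp: Omega_def ext_disk_def)
 have "\<psi> ` closure (ext_disk t) \<subseteq> closure (Omega \<psi> t)"
  unfolding Omega_def
  by (rule image_closure_subset[OF _ closed_closure closure_subset])
    (rule cont\<psi>, unfold closure_ext, use t in "auto simp: ext_disk_def")
 thus "\<psi> ` {v. t <= norm v} \<subseteq> closure (Omega \<psi> t)" by (simp add: closure_ext)
qed

lemma frontier_Omega: assumes t: "r0 < t" shows "frontier (Omega \<psi> t) = \<psi> ` sphere 0 t"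
proof -
 have "frontier (Omega \<psi> t) = \<psi> ` {v. t <= norm v} - \<psi> ` ext_disk t"
  unfolding frontier_def closure_Omega[OF t] using interior_open[OF open_Omega[of t]] t
  by (simp add: Omega_def)
 also have "... = \<psi> ` ({v. t <= norm v} - ext_disk t)"
  by (rule inj_on_image_set_diff[OF inj, symmetric]) (use t in "auto simp: ext_disk_def")
 also have "{v. t <= norm v} - ext_disk t = sphere 0 t" by (auto simp: ext_disk_def)
 finally show ?thesis .
qed

lemma interior_dom_eq: "r0 < t ==> interior_dom \<psi> t = - \<psi> ` {v. t <= norm v}"
 by (simp add: interior_dom_def closure_Omega)

lemma open_interior_dom: "open (interior_dom \<psi> t)"
 unfolding interior_dom_def by (intro open_Compl closed_closure)

lemma interior_dom_iff:
 assumes "r0 < norm v" "r0 < t" shows "\<psi> v \<in> interior_dom \<psi> t \<longleftrightarrow> norm v < t"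
proof -
 have "\<psi> v \<in> \<psi> ` {v. t <= norm v} \<longleftrightarrow> t <= norm v"
  using inj_onD[OF inj] assms by (force simp: ext_disk_def)
 thus ?thesis using assms by (simp add: interior_dom_eq not_le)
qed

lemma mem_interior_dom:
 assumes "r0 < t" "t < s" shows "z \<in> interior_dom \<psi> s \<longleftrightarrow> z \<in> interior_dom \<psi> t \<or> (\<exists>v. t <= norm v \<and> norm v < s \<and> z = \<psi> v)"
proof -
 have "r0 < s" using assms by simp
 show ?thesis
 proof (cases "z \<in> \<psi> ` {v. t <= norm v}")
  case True
  then obtain v where v: "z = \<psi> v" "t <= norm v" by auto
  hence "r0 < norm v" using assms by simp
  hence i: "z \<in> interior_dom \<psi> s \<longleftrightarrow> norm v < s" "z \<in> interior_dom \<psi> t \<longleftrightarrow> norm v < t"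
   using interior_dom_iff[of v s] interior_dom_iff[of v t] v assms by auto
  have "norm v < s" if "\<psi> v = \<psi> va" "t <= norm va" "norm va < s" for va
   using inj_onD[OF inj that(1)] that v assms by (auto simp: ext_disk_def)
  thus ?thesis using i v by auto
 next
  case False
  thus ?thesis using interior_dom_eq assms by auto
 qed
qed

text \<open>A connected exterior disc that meets \<open>Omega \<psi> t\<close> and avoids its
  frontier, the image of the circle of radius \<open>t\<close>, lies inside it.\<close>

lemma large_in_Omega: assumes t: "r0 < t" obtains R where "0 < R" "!!z. R <= norm z ==> z \<in> Omega \<psi> t"
proof -
 have "compact (\<psi> ` sphere 0 t)"
  using t by (intro compact_continuous_image cont\<psi>) (auto simp: ext_disk_def)
 then obtain B where B: "!!z. z \<in> \<psi> ` sphere 0 t ==> norm z <= B"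
  using compact_imp_bounded bounded_iff by metis
 define R where "R = max B 0"
 have "\<forall>\<^sub>F v in at_infinity. R + 1 <= norm (\<psi> v)"
  using lim unfolding filterlim_at_infinity[OF order_refl] by (auto simp: R_def)
 then obtain M where M: "!!v. M <= norm v ==> R + 1 <= norm (\<psi> v)"
  by (auto simp: eventually_at_infinity)
 define v :: complex where "v = of_real (max M (t + 1))"
 have v: "M <= norm v" "t < norm v" by (auto simp: v_def)
 have "connected (ext_disk R)" by (rule connected_ext) (simp add: R_def)
 moreover have "\<psi> v \<in> ext_disk R \<inter> Omega \<psi> t" using M[of v] v OmegaI[of t v] by (auto simp: ext_disk_def)
 moreover have "ext_disk R \<inter> frontier (Omega \<psi> t) = {}"
  unfolding frontier_Omega[OF t] using B by (force simp: ext_disk_def R_def)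
 ultimately have "ext_disk R \<subseteq> Omega \<psi> t"
  using connected_Int_frontier[of "ext_disk R" "Omega \<psi> t"] by blast
 hence "z \<in> Omega \<psi> t" if "R + 1 <= norm z" for z
  using that by (metis (no_types, lifting) ext_disk_def less_add_one less_le_trans mem_Collect_eq subsetD)
 thus ?thesis using that[of "R + 1"] by (auto simp: R_def)
qed

lemma \<phi>_lim: "filterlim \<phi> at_infinity at_infinity"
proof -
 have "\<forall>\<^sub>F z in at_infinity. r <= norm (\<phi> z)" if "r > 0" for r
 proof -
  have "r0 < r + r0" using that by simp
  from large_in_Omega[OF this] obtain R where "!!z. R <= norm z ==> z \<in> Omega \<psi> (r + r0)" by blast
  hence "r <= norm (\<phi> z)" if "R <= norm z" for z
   using OmegaD[of z "r + r0"] that \<open>r > 0\<close> r0 by force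
  thus ?thesis by (auto simp: eventually_at_infinity)
 qed
 thus ?thesis by (simp add: filterlim_at_infinity[OF order_refl])
qed

lemma ev_Omega: "r0 < t ==> \<forall>\<^sub>F z in at_infinity. z \<in> Omega \<psi> t"
 using large_in_Omega[of t] by (metis eventually_at_infinity)

lemma d\<phi>_lim: "(deriv \<phi> \<longlongrightarrow> of_real (1 / c)) at_infinity"
proof -
 have "((%z. 1 / deriv \<psi> (\<phi> z)) \<longlongrightarrow> 1 / of_real c) at_infinity"
  using c by (intro tendsto_divide tendsto_const filterlim_compose[OF dlim \<phi>_lim]) auto
 moreover have "\<forall>\<^sub>F z in at_infinity. 1 / deriv \<psi> (\<phi> z) = deriv \<phi> z"
  using ev_Omega[of "r0 + 1"]
 proof (rule eventually_mono)
  fix z assume "z \<in> Omega \<psi> (r0 + 1)"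
  from OmegaD[OF this] show "1 / deriv \<psi> (\<phi> z) = deriv \<phi> z" using d\<phi>[of "\<phi> z"] by simp
 qed simp
 ultimately show ?thesis using tendsto_cong[of "%z. 1 / deriv \<psi> (\<phi> z)" "deriv \<phi>"] by simp
qed

text \<open>In the coordinate \<open>x = 1 / v\<close> the simple pole of \<psi> at infinity becomes
  the regular value \<open>c\<close> at 0.\<close>

definition \<kappa> :: "complex \<Rightarrow> complex" where
 "\<kappa> x = (if x = 0 then of_real c else x * \<psi> (1 / x))"

text \<open>The image of \<open>ext_disk r0\<close> together with infinity under inversion. The
  product form covers \<open>r0 = 0\<close>, where it is the whole plane; its convexity provides
  logarithms.\<close>

abbreviation X where "X \<equiv> {x :: complex. r0 * norm x < 1}"

lemma X_iff: "v ~= 0 ==> 1 / v \<in> X \<longleftrightarrow> r0 < norm v"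
 by (simp add: norm_divide field_simps)

lemma X_ext: "x \<in> X ==> x ~= 0 ==> 1 / x \<in> ext_disk r0"
 by (simp add: ext_disk_def norm_divide field_simps)

text \<open>Far out the derivative of \<open>\<psi> v - c * v\<close> is small. The radial segment
  from the circle of radius \<open>R\<close> stays in that region, so the difference is bounded by a
  constant plus a small multiple of \<open>norm v\<close>.\<close>

lemma \<psi>_over_v: "((%v. \<psi> v / v) \<longlongrightarrow> of_real c) at_infinity"
proof (rule tendstoI)
 fix e :: real assume e: "e > 0"
 have "\<forall>\<^sub>F v in at_infinity. dist (deriv \<psi> v) (of_real c) < e / 2"
  using dlim e by (intro tendstoD) auto
 then obtain M where M: "!!v. M <= norm v ==> dist (deriv \<psi> v) (of_real c) < e / 2"
  by (auto simp: eventually_at_infinity)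
 define R where "R = max M (r0 + 1)"
 have R: "R > 0" "M <= R" "r0 < R" using r0 by (auto simp: R_def)
 define d where "d v = \<psi> v - of_real c * v" for v
 have "compact (d ` sphere 0 R)" unfolding d_def
  using R by (intro compact_continuous_image continuous_intros cont\<psi>) (auto simp: ext_disk_def)
 then obtain B where B: "!!v. norm v = R ==> norm (d v) <= B"
  using compact_imp_bounded bounded_iff by (metis imageI mem_sphere_0)
 have bd: "norm (d v) <= B + e / 2 * norm v" if v: "R <= norm v" for v
 proof -
  define v1 where "v1 = of_real (R / norm v) * v"
  have nv: "norm v > 0" using R(1) v by (rule less_le_trans)
  have v1: "norm v1 = R" using nv R by (simp add: v1_def norm_mult norm_divide)
  have far: "R <= norm z" if z: "z \<in> closed_segment v1 v" for z
  proof -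
   obtain u where u: "0 <= u" "u <= 1" "z = (1 - u) *\<^sub>R v1 + u *\<^sub>R v"
    using z by (auto simp: closed_segment_def)
   have "z = of_real ((1 - u) * (R / norm v) + u) * v"
    by (simp add: u v1_def scaleR_conv_of_real algebra_simps)
   hence "norm z = \<bar>(1 - u) * (R / norm v) + u\<bar> * norm v" by (simp only: norm_mult norm_of_real)
   also have "... = (1 - u) * R + u * norm v"
   proof -
    have "0 <= (1 - u) * (R / norm v) + u" using u nv R by (intro add_nonneg_nonneg mult_nonneg_nonneg) auto
    hence "\<bar>(1 - u) * (R / norm v) + u\<bar> * norm v = ((1 - u) * (R / norm v) + u) * norm v" by simp
    also have "... = (1 - u) * R + u * norm v" using nv by (simp add: distrib_right)
    finally show ?thesis .
   qed
   also have "... \<ge> (1 - u) * R + u * R" using u v by (intro add_left_mono mult_left_mono) auto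
   finally show ?thesis by (simp add: algebra_simps)
  qed
  have "norm (d v - d v1) <= e / 2 * norm (v - v1)"
  proof (rule field_differentiable_bound[of "closed_segment v1 v" d "%z. deriv \<psi> z - of_real c"])
   fix z assume z: "z \<in> closed_segment v1 v"
   have "(\<psi> has_field_derivative deriv \<psi> z) (at z within closed_segment v1 v)"
    using holomorphic_derivI[OF hol open_ext] far[OF z] R by (auto simp: ext_disk_def)
   thus "(d has_field_derivative deriv \<psi> z - of_real c) (at z within closed_segment v1 v)"
    unfolding d_def by (auto intro!: derivative_eq_intros)
   show "norm (deriv \<psi> z - of_real c) <= e / 2"
    using M[of z] far[OF z] R by (simp add: dist_norm)
  qed auto
  also have "v - v1 = of_real (1 - R / norm v) * v" by (simp add: v1_def algebra_simps)
  also have "norm ... = \<bar>1 - R / norm v\<bar> * norm v" by (simp only: norm_mult norm_of_real)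
  also have "... <= 1 * norm v" using v R nv by (intro mult_right_mono) (auto simp: field_simps abs_le_iff)
  finally have "norm (d v - d v1) <= e / 2 * norm v" using e by simp
  moreover have "norm (d v) <= norm (d v1) + norm (d v - d v1)" using norm_triangle_ineq[of "d v1" "d v - d v1"] by simp
  ultimately show ?thesis using B[OF v1] by simp
 qed
 show "\<forall>\<^sub>F v in at_infinity. dist (\<psi> v / v) (of_real c) < e"
  unfolding eventually_at_infinity
 proof (intro exI allI impI)
  fix v :: complex assume v: "max R (2 * \<bar>B\<bar> / e + 1) <= norm v"
  hence nv: "norm v > 0" "v ~= 0" "R <= norm v" using R by auto
  have "2 * \<bar>B\<bar> / e < norm v" using v by simp
  hence "2 * \<bar>B\<bar> < e * norm v" using e by (simp add: field_simps)
  hence "norm (d v) < e * norm v" using bd[OF nv(3)] by simp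
  moreover have "\<psi> v / v - of_real c = d v / v" using nv by (simp add: d_def field_simps)
  hence "dist (\<psi> v / v) (of_real c) = norm (d v) / norm v" by (simp only: dist_norm norm_divide)
  ultimately show "dist (\<psi> v / v) (of_real c) < e" using pos_divide_less_eq[OF nv(1)] by simp
 qed
qed

lemma \<kappa>_hol: "\<kappa> holomorphic_on X"
proof -
 have "(%x. if x = 0 then of_real c else x * \<psi> (1 / x)) holomorphic_on X"
 proof (rule removable_singularity)
  have "\<psi> \<circ> (%x. 1 / x) holomorphic_on X - {0}"
   by (rule holomorphic_on_compose_gen[OF _ hol]) (use X_ext in "auto intro!: holomorphic_intros")
  thus "(%x. x * \<psi> (1 / x)) holomorphic_on X - {0}"
   by (intro holomorphic_intros) (simp add: o_def)
  have "((%x. \<psi> (inverse x) / inverse x) \<longlongrightarrow> of_real c) (at 0)"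
   using filterlim_compose[OF \<psi>_over_v filterlim_inverse_at_infinity] .
  thus "((%x. x * \<psi> (1 / x)) \<longlongrightarrow> of_real c) (at 0)"
   by (simp add: field_simps)
 qed (rule open_scaled_disc)
 thus ?thesis by (rule holomorphic_transform) (simp add: \<kappa>_def)
qed

text \<open>The difference quotient of \<psi> at \<open>1 / x\<close> and \<open>1 / y\<close>.
  Expressed through \<kappa> it stays regular on the diagonal, where it is the derivative of \<psi>,
  and at \<open>x = 0\<close> or \<open>y = 0\<close>, where it is \<open>c\<close>.\<close>

definition kq :: "complex \<Rightarrow> complex \<Rightarrow> complex" where
 "kq x y = \<kappa> x - x * dquot \<kappa> x y"

lemma kq_0: "x \<in> X ==> kq 0 x = of_real c" "x \<in> X ==> kq x 0 = of_real c"
 by (auto simp: kq_def dquot_def \<kappa>_def)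

lemma kq_diff:
 assumes "x ~= 0" "y ~= 0" "x ~= y"
 shows "kq x y = (\<psi> (1 / x) - \<psi> (1 / y)) / (1 / x - 1 / y)"
proof -
 have "x - y ~= 0" "y - x ~= 0" using assms by auto
 thus ?thesis using assms by (simp add: kq_def dquot_def \<kappa>_def divide_simps) (simp add: algebra_simps)
qed

lemma kq_diag: assumes "x \<in> X" "x ~= 0" shows "kq x x = deriv \<psi> (1 / x)"
proof -
 have "(\<kappa> has_field_derivative (1 * \<psi> (1 / x) + deriv \<psi> (1 / x) * (- 1 / x\<^sup>2) * x)) (at x)"
 proof (rule has_field_derivative_transform_within[of "%x. x * \<psi> (1 / x)" _ _ _ "norm x"])
  have "((%x. 1 / x) has_field_derivative (- 1 / x\<^sup>2)) (at x)"
   using assms by (auto intro!: derivative_eq_intros simp: power2_eq_square)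
  moreover have "(\<psi> has_field_derivative deriv \<psi> (1 / x)) (at (1 / x))"
   using holomorphic_derivI[OF hol open_ext X_ext[OF assms]] .
  ultimately have "((%x. \<psi> (1 / x)) has_field_derivative deriv \<psi> (1 / x) * (- 1 / x\<^sup>2)) (at x)"
   by (rule DERIV_chain2[rotated])
  thus "((%x. x * \<psi> (1 / x)) has_field_derivative (1 * \<psi> (1 / x) + deriv \<psi> (1 / x) * (- 1 / x\<^sup>2) * x)) (at x)"
   by (rule DERIV_mult[OF DERIV_ident])
  show "y * \<psi> (1 / y) = \<kappa> y" if "dist y x < norm x" for y using that by (auto simp: \<kappa>_def)
 qed (use assms in auto)
 hence d: "deriv \<kappa> x = \<psi> (1 / x) - deriv \<psi> (1 / x) / x"
  using assms by (intro DERIV_imp_deriv[THEN trans]) (auto simp: power2_eq_square)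
 have "kq x x = \<kappa> x - x * deriv \<kappa> x" by (simp add: kq_def dquot_def)
 also have "... = deriv \<psi> (1 / x)" unfolding d using assms by (simp add: \<kappa>_def right_diff_distrib)
 finally show ?thesis .
qed

lemma kq_nz: assumes "x \<in> X" "y \<in> X" shows "kq x y ~= 0"
proof (cases "x = 0 \<or> y = 0")
 case True thus ?thesis using kq_0 assms c by auto
next
 case False
 show ?thesis
 proof (cases "x = y")
  case True
  thus ?thesis using kq_diag[of x] False assms d\<psi>_nz[of "1 / x"] X_ext[of x] by (auto simp: ext_disk_def)
 next
  case xy: False
  have "\<psi> (1 / x) ~= \<psi> (1 / y)"
   using inj_onD[OF inj, of "1 / x" "1 / y"] X_ext assms False xy by auto
  thus ?thesis using kq_diff[of x y] False xy by (auto simp: field_simps)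
 qed
qed

lemma kq_cont: "continuous_on (X \<times> X) (%p. kq (fst p) (snd p))"
 unfolding kq_def
 by (intro continuous_intros continuous_on_dquot[OF open_scaled_disc \<kappa>_hol]
   continuous_on_compose2[OF hol_imp_cont[OF \<kappa>_hol]]) auto

lemma kq_hol: assumes "y \<in> X" shows "(%x. kq x y) holomorphic_on X"
proof -
 have "(%x. if x = y then deriv \<kappa> y else (\<kappa> x - \<kappa> y) / (x - y)) holomorphic_on X"
  by (rule holomorphic_removable_quotient[OF \<kappa>_hol open_scaled_disc assms])
 hence "(%x. \<kappa> x - x * (if x = y then deriv \<kappa> y else (\<kappa> x - \<kappa> y) / (x - y))) holomorphic_on X"
  by (intro holomorphic_intros \<kappa>_hol)
 thus ?thesis by (rule holomorphic_transform) (auto simp: kq_def dquot_def)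
qed

lemma diag_hol: "(%x. kq x x) holomorphic_on X"
proof -
 have "(%x. \<kappa> x - x * deriv \<kappa> x) holomorphic_on X"
  by (intro holomorphic_intros \<kappa>_hol holomorphic_deriv open_scaled_disc)
 thus ?thesis by (rule holomorphic_transform) (auto simp: kq_def dquot_def)
qed

lemma X_scale: "x \<in> X ==> 0 <= t ==> t <= 1 ==> of_real t * x \<in> X"
proof -
 assume x: "x \<in> X" "0 <= t" "t <= 1"
 have "r0 * norm (of_real t * x) <= r0 * norm x"
  using x r0 by (intro mult_left_mono) (auto simp: norm_mult mult_left_le_one_le)
 thus ?thesis using x by simp
qed

lemma log_normal: "exp (- of_real (ln c)) = 1 / (of_real c :: complex)"
 using c by (simp add: exp_minus exp_of_real inverse_eq_divide)

text \<open>
 Both logarithms continue the same continuous logarithm of \<open>1 / kq (s y) (t y)\<close> on the unit square,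
 one along the diagonal and the other along two edges; \<open>kq\<close> is constant on the edges through the origin.
\<close>

lemma log_match:
 assumes y: "y \<in> X" and lp: "lp holomorphic_on X" "!!x. x \<in> X ==> exp (lp x) = 1 / kq x x" "lp 0 = - of_real (ln c)"
  and lb: "lb holomorphic_on X" "!!x. x \<in> X ==> exp (lb x) = 1 / kq x y" "lb 0 = - of_real (ln c)"
 shows "lb y = lp y"
proof -
 define Q where "Q = {0..1::real} \<times> {0..1::real}"
 define F where "F p = 1 / kq (of_real (fst p) * y) (of_real (snd p) * y)" for p :: "real \<times> real"
 have inX: "of_real (fst p) * y \<in> X" "of_real (snd p) * y \<in> X" if "p \<in> Q" for p
  using that X_scale[OF y] by (auto simp: Q_def)
 have "continuous_on Q (%p. kq (of_real (fst p) * y) (of_real (snd p) * y))"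
 proof -
  have "(%p. (of_real (fst p) * y, of_real (snd p) * y)) ` Q \<subseteq> X \<times> X" using inX by blast
  moreover have "continuous_on Q (%p. (of_real (fst p) * y, of_real (snd p) * y))" by (intro continuous_intros)
  ultimately show ?thesis
   using continuous_on_compose2[OF kq_cont, of Q "%p. (of_real (fst p) * y, of_real (snd p) * y)"] by simp
 qed
 hence contF: "continuous_on Q F" unfolding F_def using kq_nz inX by (intro continuous_intros) auto
 have nzF: "F p ~= 0" if "p \<in> Q" for p using kq_nz inX[OF that] by (simp add: F_def)
 have "contractible Q" unfolding Q_def by (intro convex_imp_contractible convex_Times) auto
 then obtain g where g: "continuous_on Q g" "!!p. p \<in> Q ==> F p = exp (g p)"
  using continuous_logarithm_on_contractible[OF contF _ nzF] by metis
 define G where "G p = g p - g (0, 0) - of_real (ln c)" for p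
 have contG: "continuous_on Q G" unfolding G_def by (intro continuous_intros g)
 have "exp (g (0, 0)) = 1 / of_real c"
  using g(2)[of "(0, 0)"] kq_0[of 0] by (auto simp: F_def Q_def)
 hence expG: "exp (G p) = F p" if "p \<in> Q" for p
 proof -
  have "exp (G p) = exp (g p) / exp (g (0, 0)) / exp (of_real (ln c))" by (simp only: G_def exp_diff)
  also have "exp (complex_of_real (ln c)) = of_real c" using c by (simp add: exp_of_real)
  finally show ?thesis using g(2)[OF that] \<open>exp (g (0, 0)) = _\<close> c by simp
 qed
 have G0: "G (0, 0) = - of_real (ln c)" by (simp add: G_def)
 have path: "continuous_on {0..1} (%t. G (p t))" if "continuous_on {0..1} p" "p ` {0..1} \<subseteq> Q" for p
  using continuous_on_compose2[OF contG that] .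
 have scont: "continuous_on {0..1} (%t. l (of_real t * y))" if "l holomorphic_on X" for l
  using X_scale[OF y] that
  by (intro continuous_on_compose2[OF hol_imp_cont[OF that]] continuous_intros) auto
 have p: "continuous_on {0..1} (%t. G (t, t))" "continuous_on {0..1} (%t. G (0, t))" "continuous_on {0..1} (%t. G (t, 1))"
  by (rule path; force intro!: continuous_intros simp: Q_def)+
 have sub: "(t, t) \<in> Q" "(0, t) \<in> Q" "(t, 1) \<in> Q" "of_real t * y \<in> X" if "t \<in> {0..1}" for t
  using that X_scale[OF y] by (auto simp: Q_def)
 have 1: "G (1, 1) = lp (of_real 1 * y)"
 proof (rule continuous_logs_agree[OF p(1) scont[OF lp(1)]])
  show "exp (G (t, t)) = exp (lp (of_real t * y))" if "t \<in> {0..1}" for t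
   using expG[OF sub(1)[OF that]] lp(2)[OF sub(4)[OF that]] by (simp add: F_def)
 qed (simp add: G0 lp(3))
 have 2: "G (0, 1) = - of_real (ln c)"
 proof (rule continuous_logs_agree[OF p(2) continuous_on_const])
  show "exp (G (0, t)) = exp (- of_real (ln c))" if "t \<in> {0..1}" for t
   using expG[OF sub(2)[OF that]] kq_0(1)[OF sub(4)[OF that]] log_normal by (simp add: F_def)
 qed (simp add: G0)
 have 3: "G (1, 1) = lb (of_real 1 * y)"
 proof (rule continuous_logs_agree[OF p(3) scont[OF lb(1)]])
  show "exp (G (t, 1)) = exp (lb (of_real t * y))" if "t \<in> {0..1}" for t
   using expG[OF sub(3)[OF that]] lb(2)[OF sub(4)[OF that]] by (simp add: F_def)
 qed (simp add: 2 lb(3))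
 show ?thesis using 1 3 by simp
qed

text \<open>In the exterior coordinate \<open>Lp\<close> is a logarithm of \<open>\<phi>'\<close>
  and \<open>Lb b\<close> one of \<open>(\<phi> z - b) / (z - \<psi> b)\<close>, with the same value
  at infinity. Their agreement at \<open>v = b\<close> matches the branch of the power of
  \<open>\<phi>'\<close> at \<open>a_k\<close> with that of the power in the Szego function.\<close>

lemma log_branches:
 obtains Lp Lb where
  "Lp holomorphic_on ext_disk r0" "!!v. r0 < norm v ==> exp (Lp v) = 1 / deriv \<psi> v"
  "(Lp \<longlongrightarrow> of_real (- ln c)) at_infinity"
  "!!b. r0 < norm b ==> Lb b holomorphic_on ext_disk r0"
  "!!b v. r0 < norm b ==> r0 < norm v ==> v ~= b ==> exp (Lb b v) = (v - b) / (\<psi> v - \<psi> b)"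
  "!!b. r0 < norm b ==> (Lb b \<longlongrightarrow> of_real (- ln c)) at_infinity"
  "!!b. r0 < norm b ==> Lb b b = Lp b"
proof -
 have X0: "0 \<in> X" by simp
 have cX: "convex X" by (rule convex_scaled_disc[OF r0])
 obtain lp where lp: "lp holomorphic_on X" "!!x. x \<in> X ==> exp (lp x) = 1 / kq x x" "lp 0 = - of_real (ln c)"
 proof (rule holomorphic_log_normalized[of X "%x. 1 / kq x x" "- of_real (ln c)"])
  show "(%x. 1 / kq x x) holomorphic_on X" using kq_nz by (intro holomorphic_intros diag_hol) auto
 qed (use cX open_scaled_disc X0 kq_nz kq_0 log_normal in auto)
 have "\<forall>y\<in>X. \<exists>lb. lb holomorphic_on X \<and> (\<forall>x\<in>X. exp (lb x) = 1 / kq x y) \<and> lb 0 = - of_real (ln c)"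
 proof
  fix y assume y: "y \<in> X"
  obtain lb where "lb holomorphic_on X" "!!x. x \<in> X ==> exp (lb x) = 1 / kq x y" "lb 0 = - of_real (ln c)"
  proof (rule holomorphic_log_normalized[of X "%x. 1 / kq x y" "- of_real (ln c)"])
   show "(%x. 1 / kq x y) holomorphic_on X" using kq_nz y by (intro holomorphic_intros kq_hol) auto
  qed (use cX open_scaled_disc X0 y kq_nz kq_0 log_normal in auto)
  thus "\<exists>lb. lb holomorphic_on X \<and> (\<forall>x\<in>X. exp (lb x) = 1 / kq x y) \<and> lb 0 = - of_real (ln c)" by blast
 qed
 from bchoice[OF this] obtain lb where lb': "\<forall>y\<in>X. lb y holomorphic_on X
  \<and> (\<forall>x\<in>X. exp (lb y x) = 1 / kq x y) \<and> lb y 0 = - of_real (ln c)" ..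
 hence lb: "!!y. y \<in> X ==> lb y holomorphic_on X"
  "!!x y. y \<in> X ==> x \<in> X ==> exp (lb y x) = 1 / kq x y" "!!y. y \<in> X ==> lb y 0 = - of_real (ln c)"
  by blast+
 have inv: "1 / v \<in> X" "v ~= 0" if "r0 < norm v" for v
 proof -
  have "0 < norm v" using that r0 by linarith
  thus "v ~= 0" by simp
  thus "1 / v \<in> X" using that X_iff by blast
 qed
 have comp: "(%v. l (1 / v)) holomorphic_on ext_disk r0" if "l holomorphic_on X" for l
 proof -
  have "l \<circ> (%v. 1 / v) holomorphic_on ext_disk r0"
   by (rule holomorphic_on_compose_gen[OF _ that]) (use inv in "auto intro!: holomorphic_intros simp: ext_disk_def")
  thus ?thesis by (simp add: o_def)
 qed
 have lm: "((%v. l (1 / v)) \<longlongrightarrow> of_real (- ln c)) at_infinity" if "l holomorphic_on X" "l 0 = - of_real (ln c)" for l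
 proof -
  have "isCont l 0"
   using that(1) X0 open_scaled_disc[of r0] by (intro continuous_on_interior[of X] hol_imp_cont) (auto simp: interior_open)
  from tendsto_at_infinity_inverse[OF this] show ?thesis using that by simp
 qed
 show ?thesis
 proof (rule that[of "%v. lp (1 / v)" "%b v. lb (1 / b) (1 / v)"])
  show "exp (lp (1 / v)) = 1 / deriv \<psi> v" if "r0 < norm v" for v
   using lp(2)[of "1 / v"] kq_diag[of "1 / v"] inv[OF that] by auto
  show "exp (lb (1 / b) (1 / v)) = (v - b) / (\<psi> v - \<psi> b)" if "r0 < norm b" "r0 < norm v" "v ~= b" for b v
   using lb(2)[of "1 / b" "1 / v"] kq_diff[of "1 / v" "1 / b"] inv[OF that(1)] inv[OF that(2)] that(3) by auto
  show "lb (1 / b) (1 / b) = lp (1 / b)" if "r0 < norm b" for b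
  proof -
   note m = inv(1)[OF that]
   show ?thesis by (rule log_match[OF m lp lb(1)[OF m] lb(2)[OF m] lb(3)[OF m]])
  qed
  show "(%v. lp (1 / v)) holomorphic_on ext_disk r0" by (rule comp[OF lp(1)])
  show "((%v. lp (1 / v)) \<longlongrightarrow> of_real (- ln c)) at_infinity" by (rule lm[OF lp(1,3)])
  show "(%v. lb (1 / b) (1 / v)) holomorphic_on ext_disk r0" if "r0 < norm b" for b
   by (rule comp[OF lb(1)[OF inv(1)[OF that]]])
  show "((%v. lb (1 / b) (1 / v)) \<longlongrightarrow> of_real (- ln c)) at_infinity" if "r0 < norm b" for b
   by (rule lm[OF lb(1,3)[OF inv(1)[OF that]]])
 qed
qed

section \<open>Cauchy integrals over the level curves\<close>

lemma kernel_limit: "((%v. v * deriv \<psi> v / (\<psi> v - z)) \<longlongrightarrow> 1) at_infinity"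
proof -
 have "((%v. deriv \<psi> v / (\<psi> v / v - z / v)) \<longlongrightarrow> of_real c / (of_real c - 0)) at_infinity"
  using c by (intro tendsto_intros dlim \<psi>_over_v tendsto_divide_0[OF tendsto_const] filterlim_ident) auto
 moreover have "\<forall>\<^sub>F v in at_infinity. deriv \<psi> v / (\<psi> v / v - z / v) = v * deriv \<psi> v / (\<psi> v - z)"
  unfolding eventually_at_infinity
 proof (intro exI[of _ 1] allI impI)
  fix v :: complex assume "1 <= norm v"
  hence "v ~= 0" by auto
  hence "\<psi> v / v - z / v = (\<psi> v - z) / v" by (simp add: diff_divide_distrib)
  thus "deriv \<psi> v / (\<psi> v / v - z / v) = v * deriv \<psi> v / (\<psi> v - z)" by (simp add: mult.commute)
 qed
 ultimately show ?thesis using c Lim_transform_eventually by fastforce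
qed

lemma d\<psi>_hol: "deriv \<psi> holomorphic_on ext_disk r0"
 using hol open_ext by (rule holomorphic_deriv)

lemma outside_kernel:
 assumes "z \<in> interior_dom \<psi> t" "r0 < t" "t <= norm v" shows "\<psi> v ~= z"
 using assms interior_dom_iff[of v t] by auto

text \<open>The mean is the winding number of the level curve about \<open>z\<close>, read off from
  the value 1 of the integrand at infinity.\<close>

lemma cmean_kernel:
 assumes "z \<in> interior_dom \<psi> t" "r0 < t"
 shows "cmean t (%v. v * deriv \<psi> v / (\<psi> v - z)) = 1"
proof (rule cmean_exterior[OF _ _ _ _ kernel_limit])
 define S where "S = ext_disk r0 \<inter> {v. \<psi> v ~= z}"
 have "open (ext_disk r0 \<inter> \<psi> -` (- {z}))"
  by (rule continuous_open_preimage[OF cont\<psi>[OF order_refl] open_ext]) auto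
 moreover have "ext_disk r0 \<inter> \<psi> -` (- {z}) = S" by (auto simp: S_def)
 ultimately show "open S" by simp
 show "(%v. v * deriv \<psi> v / (\<psi> v - z)) holomorphic_on S"
  by (intro holomorphic_intros hol_subset[OF d\<psi>_hol] hol_subset[OF hol]) (auto simp: S_def)
 show "v \<in> S" if "t <= norm v" for v
  using that assms outside_kernel[OF assms that] by (auto simp: S_def ext_disk_def)
qed (use assms r0 in auto)

lemma dquot_hol: "r0 < norm y ==> (%v. dquot \<psi> v y) holomorphic_on ext_disk r0"
proof -
 assume "r0 < norm y"
 hence "(%v. if v = y then deriv \<psi> y else (\<psi> v - \<psi> y) / (v - y)) holomorphic_on ext_disk r0"
  by (intro holomorphic_removable_quotient[OF hol open_ext]) (simp add: ext_disk_def)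
 thus ?thesis by (rule holomorphic_transform) (auto simp: dquot_def)
qed

text \<open>On a circle beyond \<open>y\<close> the value is 1 by \<open>cmean_kernel\<close>;
  moving inwards across the simple pole at \<open>v = y\<close> removes a residue 1.\<close>

lemma cmean_kernel_outside:
 assumes "r0 < t" "t < norm y"
 shows "cmean t (%v. v * deriv \<psi> v / (\<psi> v - \<psi> y)) = 0"
proof -
 have dq: "dquot \<psi> v y ~= 0" if "r0 < norm v" for v
  using dquot_nz[OF open_ext hol inj] that assms by (auto simp: ext_disk_def)
 define N where "N v = deriv \<psi> v / dquot \<psi> v y" for v
 have N: "N holomorphic_on ext_disk r0" unfolding N_def
  using dq assms by (intro holomorphic_intros d\<psi>_hol dquot_hol) (auto simp: ext_disk_def)
 have eq: "v * N v / (v - y) = v * deriv \<psi> v / (\<psi> v - \<psi> y)" if "norm v ~= norm y" for v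
 proof -
  have "v ~= y" using that by auto
  thus ?thesis by (simp add: N_def dquot_def)
 qed
 define R where "R = norm y + 1"
 have "cmean R (%v. v * N v / (v - y)) = cmean t (%v. v * N v / (v - y)) + N y"
  by (rule cmean_annulus_Cauchy[OF open_ext N]) (use assms r0 in "auto simp: R_def ext_disk_def")
 moreover have "N y = 1" using assms d\<psi>_nz[of y] by (simp add: N_def dquot_def)
 moreover have "cmean t (%v. v * N v / (v - y)) = cmean t (%v. v * deriv \<psi> v / (\<psi> v - \<psi> y))"
  by (rule cmean_cong) (use eq assms r0 in auto)
 moreover have "cmean R (%v. v * N v / (v - y)) = cmean R (%v. v * deriv \<psi> v / (\<psi> v - \<psi> y))"
  by (rule cmean_cong) (use eq assms r0 in "auto simp: R_def")
 moreover have "cmean R (%v. v * deriv \<psi> v / (\<psi> v - \<psi> y)) = 1"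
  by (rule cmean_kernel) (use assms interior_dom_iff[of y R] in "auto simp: R_def")
 ultimately show ?thesis by simp
qed

lemma contour_integral_image:
 assumes "r0 < t"
 shows "contour_integral (\<psi> \<circ> circlepath 0 t) f = 2 * of_real pi * \<i> * cmean t (%v. v * (f (\<psi> v) * deriv \<psi> v))"
proof -
 have vd: "vector_derivative (\<psi> \<circ> circlepath 0 t) (at x) = 2 * of_real pi * \<i> * circlepath 0 t x * deriv \<psi> (circlepath 0 t x)" for x
 proof (rule vector_derivative_at)
  have "circlepath 0 t x \<in> ext_disk r0" using assms r0 circlepath_norm[of t x] by (simp add: ext_disk_def)
  from field_vector_diff_chain_at[OF has_vector_derivative_circlepath holomorphic_derivI[OF hol open_ext this]]
  show "(\<psi> \<circ> circlepath 0 t has_vector_derivative 2 * of_real pi * \<i> * circlepath 0 t x * deriv \<psi> (circlepath 0 t x)) (at x)"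
   by (simp add: circlepath mult_ac)
 qed
 have "contour_integral (\<psi> \<circ> circlepath 0 t) f
   = integral {0..1} (%x. (2 * of_real pi * \<i>) * (circlepath 0 t x * (f (\<psi> (circlepath 0 t x)) * deriv \<psi> (circlepath 0 t x))))"
  unfolding contour_integral_integral vd by (intro integral_cong) (simp add: mult_ac)
 thus ?thesis by (simp add: cmean_def)
qed

text \<open>The global Cauchy formula for the image of the circle. A point outside the domain of
  \<open>f\<close> is \<open>\<psi> v\<close> with \<open>norm v\<close> at least \<open>s\<close>,
  and \<open>cmean_kernel_outside\<close> shows that the curve does not wind around it.\<close>

lemma cauchy_interior:
 assumes t: "r0 < t" "t < s" and f: "f holomorphic_on interior_dom \<psi> s" and z: "z \<in> interior_dom \<psi> t"
 shows "cmean t (%v. v * (f (\<psi> v) * deriv \<psi> v / (\<psi> v - z))) = f z"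
proof -
 let ?g = "\<psi> \<circ> circlepath 0 t"
 have t0: "t > 0" using t r0 by simp
 have img: "path_image ?g = \<psi> ` sphere 0 t" using t0 by (simp add: path_image_compose)
 have vp: "valid_path ?g"
  by (rule valid_path_compose_holomorphic[OF valid_path_circlepath hol open_ext]) (use t t0 in "auto simp: ext_disk_def")
 have wn: "winding_number ?g w = cmean t (%v. v * deriv \<psi> v / (\<psi> v - w))" if "w \<notin> \<psi> ` sphere 0 t" for w
  using winding_number_valid_path[OF vp, of w] that
  by (simp add: img contour_integral_image[OF t(1)])
 have zs: "z \<notin> \<psi> ` sphere 0 t"
 proof
  assume "z \<in> \<psi> ` sphere 0 t"
  then obtain v where "norm v = t" "z = \<psi> v" by auto
  thus False using outside_kernel[OF z t(1), of v] by simp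
 qed
 have "((%w. f w / (w - z)) has_contour_integral (2 * pi * \<i> * winding_number ?g z * f z)) ?g"
 proof (rule Cauchy_integral_formula_global[OF open_interior_dom f _ vp])
  show "z \<in> interior_dom \<psi> s" using z mem_interior_dom[OF t] by blast
  show "path_image ?g \<subseteq> interior_dom \<psi> s - {z}"
   unfolding img using zs interior_dom_iff t by auto
  show "pathfinish ?g = pathstart ?g" by (simp add: pathfinish_compose pathstart_compose)
  fix w assume "w \<notin> interior_dom \<psi> s"
  then obtain v where v: "w = \<psi> v" "s <= norm v" using interior_dom_eq[of s] t by auto
  have "w \<notin> \<psi> ` sphere 0 t" using inj_onD[OF inj] v t by (force simp: ext_disk_def)
  thus "winding_number ?g w = 0" using wn cmean_kernel_outside[OF t(1), of v] v t by simp
 qed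
 hence "contour_integral ?g (%w. f w / (w - z)) = 2 * pi * \<i> * winding_number ?g z * f z"
  by (rule contour_integral_unique)
 thus ?thesis
  using wn[OF zs] cmean_kernel[OF z t(1)] by (simp add: contour_integral_image[OF t(1)])
qed

end

subsection \<open>Mean squares on the unit circle\<close>

text \<open>The scalar product of \<open>L^2\<close> of the unit circle with normalized arc length;
  through \<open>trf\<close> it reproduces the weighted product on the curve up to the factor
  \<open>2 pi\<close>.\<close>

definition cip :: "(complex \<Rightarrow> complex) \<Rightarrow> (complex \<Rightarrow> complex) \<Rightarrow> complex" where
 "cip F G = cmean 1 (%w. F w * cnj (G w))"

definition nsq :: "(complex \<Rightarrow> complex) \<Rightarrow> real" where
 "nsq F = integral {0..1} (%t. (norm (F (circlepath 0 1 t)))\<^sup>2)"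

lemma continuous_on_cnj': "continuous_on A f ==> continuous_on A (%x. cnj (f x))"
 by (intro continuous_intros)

lemma cip_self:
 assumes "continuous_on (sphere 0 1) F" shows "cip F F = of_real (nsq F)"
proof -
 have "(%t. (norm (F (circlepath 0 1 t)))\<^sup>2) integrable_on {0..1}"
  by (rule circle_integrable[of 1 "%w. (norm (F w))\<^sup>2"]) (use assms in "auto intro!: continuous_intros")
 hence "((%t. (norm (F (circlepath 0 1 t)))\<^sup>2) has_integral nsq F) {0..1}"
  unfolding nsq_def by (rule integrable_integral)
 hence "((%t. complex_of_real ((norm (F (circlepath 0 1 t)))\<^sup>2)) has_integral of_real (nsq F)) {0..1}"
  by (rule has_integral_of_real)
 hence "((%t. F (circlepath 0 1 t) * cnj (F (circlepath 0 1 t))) has_integral of_real (nsq F)) {0..1}"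
  by (simp only: complex_norm_square)
 thus ?thesis unfolding cip_def cmean_def by (rule integral_unique)
qed

lemma nsq_nonneg: "nsq F \<ge> 0"
 unfolding nsq_def
 by (cases "(%t. (norm (F (circlepath 0 1 t)))\<^sup>2) integrable_on {0..1}")
   (auto intro!: integral_nonneg simp: not_integrable_integral)

lemma nsq_mono:
 assumes "continuous_on (sphere 0 1) F" "!!w. norm w = 1 ==> norm (F w) <= B"
 shows "nsq F <= B\<^sup>2"
proof -
 have "(%t. (norm (F (circlepath 0 1 t)))\<^sup>2) integrable_on {0..1}"
  by (rule circle_integrable[of 1 "%w. (norm (F w))\<^sup>2"]) (use assms in "auto intro!: continuous_intros")
 hence "nsq F <= integral {0..1} (%t::real. B\<^sup>2)"
  unfolding nsq_def using assms circlepath_norm[of 1]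
  by (intro integral_le) (auto intro!: power_mono)
 thus ?thesis by simp
qed

lemma nsq_add3:
 assumes "continuous_on (sphere 0 1) F" "continuous_on (sphere 0 1) G" "continuous_on (sphere 0 1) H"
 shows "nsq (%w. F w + G w + H w) <= 3 * (nsq F + nsq G + nsq H)"
proof -
 have i: "(%t. (norm (f (circlepath 0 1 t)))\<^sup>2) integrable_on {0..1}" if "continuous_on (sphere 0 1) f" for f :: "complex \<Rightarrow> complex"
  by (rule circle_integrable[of 1 "%w. (norm (f w))\<^sup>2"]) (use that in "auto intro!: continuous_intros")
 have "nsq (%w. F w + G w + H w) <= integral {0..1} (%t. 3 * ((norm (F (circlepath 0 1 t)))\<^sup>2
   + (norm (G (circlepath 0 1 t)))\<^sup>2 + (norm (H (circlepath 0 1 t)))\<^sup>2))"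
  unfolding nsq_def
 proof (rule integral_le)
  show "(%t. (norm (F (circlepath 0 1 t) + G (circlepath 0 1 t) + H (circlepath 0 1 t)))\<^sup>2) integrable_on {0..1}"
   by (rule i[of "%w. F w + G w + H w"]) (intro continuous_intros assms)
  show "(%t. 3 * ((norm (F (circlepath 0 1 t)))\<^sup>2 + (norm (G (circlepath 0 1 t)))\<^sup>2
    + (norm (H (circlepath 0 1 t)))\<^sup>2)) integrable_on {0..1}"
   by (intro integrable_on_mult_right integrable_add i assms)
  fix t :: real
  let ?a = "norm (F (circlepath 0 1 t))" and ?b = "norm (G (circlepath 0 1 t))" and ?d = "norm (H (circlepath 0 1 t))"
  have "norm (F (circlepath 0 1 t) + G (circlepath 0 1 t) + H (circlepath 0 1 t)) <= ?a + ?b + ?d"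
   by (meson add_mono norm_triangle_ineq norm_triangle_le order_refl)
  hence "(norm (F (circlepath 0 1 t) + G (circlepath 0 1 t) + H (circlepath 0 1 t)))\<^sup>2 <= (?a + ?b + ?d)\<^sup>2"
   by (rule power_mono) simp
  also have "3 * (?a\<^sup>2 + ?b\<^sup>2 + ?d\<^sup>2) - (?a + ?b + ?d)\<^sup>2 = (?a - ?b)\<^sup>2 + (?b - ?d)\<^sup>2 + (?a - ?d)\<^sup>2"
   by (simp add: power2_eq_square algebra_simps)
  hence "(?a + ?b + ?d)\<^sup>2 <= 3 * (?a\<^sup>2 + ?b\<^sup>2 + ?d\<^sup>2)"
   by (smt (verit) zero_le_power2)
  finally show "(norm (F (circlepath 0 1 t) + G (circlepath 0 1 t) + H (circlepath 0 1 t)))\<^sup>2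
    <= 3 * (?a\<^sup>2 + ?b\<^sup>2 + ?d\<^sup>2)" .
 qed
 also have "... = 3 * (nsq F + nsq G + nsq H)"
  unfolding nsq_def using i assms by (simp add: integral_add integrable_add)
 finally show ?thesis .
qed

lemma nsq_scale: "nsq (%w. c * F w) = (norm c)\<^sup>2 * nsq F"
 by (simp add: nsq_def norm_mult power_mult_distrib)

lemma cip_diff_right:
 assumes "continuous_on (sphere 0 1) F" "continuous_on (sphere 0 1) G" "continuous_on (sphere 0 1) H"
 shows "cip F (%w. G w - H w) = cip F G - cip F H"
 unfolding cip_def using cmean_diff[of 1 "%w. F w * cnj (G w)" "%w. F w * cnj (H w)"] assms
 by (simp add: right_diff_distrib continuous_on_mult continuous_on_cnj')

lemma cip_diff_left:
 assumes "continuous_on (sphere 0 1) F" "continuous_on (sphere 0 1) G" "continuous_on (sphere 0 1) H"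
 shows "cip (%w. G w - H w) F = cip G F - cip H F"
 unfolding cip_def using cmean_diff[of 1 "%w. G w * cnj (F w)" "%w. H w * cnj (F w)"] assms
 by (simp add: left_diff_distrib continuous_on_mult continuous_on_cnj')

lemma cip_scale_left: "cip (%w. c * F w) G = c * cip F G"
 unfolding cip_def by (simp add: mult.assoc cmean_mult_left)

lemma cip_scale_right: "cip F (%w. c * G w) = cnj c * cip F G"
proof -
 have "(%w. F w * cnj (c * G w)) = (%w. cnj c * (F w * cnj (G w)))" by (simp add: fun_eq_iff)
 thus ?thesis unfolding cip_def by (simp only: cmean_mult_left)
qed

lemma cip_cnj:
 assumes "continuous_on (sphere 0 1) F" "continuous_on (sphere 0 1) G"
 shows "cip G F = cnj (cip F G)"
proof -
 have "(%t. F (circlepath 0 1 t) * cnj (G (circlepath 0 1 t))) integrable_on {0..1}"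
  by (rule circle_integrable[of 1 "%w. F w * cnj (G w)"]) (use assms in "auto intro!: continuous_intros")
 from integral_cnj[of _ "%t. F (circlepath 0 1 t) * cnj (G (circlepath 0 1 t))"]
 show ?thesis unfolding cip_def cmean_def by (simp add: mult.commute)
qed

lemma nsq_diff:
 assumes "continuous_on (sphere 0 1) F" "continuous_on (sphere 0 1) G"
 shows "nsq (%w. F w - G w) = nsq F - 2 * Re (cip F G) + nsq G"
proof -
 have c: "continuous_on (sphere 0 1) (%w. F w - G w)" by (intro continuous_intros assms)
 have "of_real (nsq (%w. F w - G w)) = cip (%w. F w - G w) (%w. F w - G w)"
  by (rule cip_self[OF c, symmetric])
 also have "... = cip F F - cip F G - (cip G F - cip G G)"
  using assms c by (simp add: cip_diff_right cip_diff_left)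
 also have "cip G F = cnj (cip F G)" by (rule cip_cnj[OF assms])
 finally have "of_real (nsq (%w. F w - G w)) = of_real (nsq F) - cip F G - (cnj (cip F G) - of_real (nsq G))"
  using assms by (simp add: cip_self)
 from arg_cong[OF this, of Re] show ?thesis by simp
qed

text \<open>The last hypothesis makes \<open>G - F\<close> orthogonal to \<open>F\<close>.\<close>

lemma nsq_projection:
 assumes "continuous_on (sphere 0 1) F" "continuous_on (sphere 0 1) G" "cip F F = cip F G"
 shows "nsq F <= nsq G"
proof -
 have "Re (cip F G) = nsq F" using cip_self[OF assms(1)] assms(3) by simp
 thus ?thesis using nsq_diff[OF assms(1,2)] nsq_nonneg[of "%w. F w - G w"] by simp
qed

text \<open>Cauchy's formula applied to the square of \<open>F\<close>. It turns mean square
  estimates on the circle into locally uniform ones inside.\<close>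

lemma pointwise_le_nsq:
 assumes "open S" "F holomorphic_on S" "cball 0 1 \<subseteq> S" "norm w < 1"
 shows "(norm (F w))\<^sup>2 <= nsq F / (1 - norm w)"
proof -
 have cont: "continuous_on (sphere 0 1) F"
  by (rule hol_cont[OF assms(2)]) (use assms in auto)
 have ne: "v - w ~= 0" if "norm v = 1" for v using that assms by auto
 have "(F w)\<^sup>2 = cmean 1 (%v. v * (F v)\<^sup>2 / (v - w))"
  by (rule cmean_Cauchy[symmetric, OF assms(1)]) (use assms in "auto intro!: holomorphic_intros")
 also have "norm ... <= integral {0..1} (%t. (%v. (norm (F v))\<^sup>2 / (1 - norm w)) (circlepath 0 1 t))"
 proof (rule cmean_norm_bound_integral)
  fix v :: complex assume v: "norm v = 1"
  have "1 - norm w <= norm (v - w)" using norm_triangle_ineq2[of v w] v by simp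
  thus "norm (v * (F v)\<^sup>2 / (v - w)) <= (norm (F v))\<^sup>2 / (1 - norm w)"
   using v assms(4) by (simp add: norm_mult norm_divide norm_power frac_le)
 qed (use cont ne assms(4) in "auto intro!: continuous_intros")
 also have "... = nsq F / (1 - norm w)" by (simp add: nsq_def)
 finally show ?thesis by (simp add: norm_power)
qed

subsection \<open>Polynomial parts\<close>

context ext_map
begin

text \<open>Since \<open>B\<close> vanishes at infinity, \<open>v ^ Suc n * B v\<close> grows at
  most like \<open>v ^ n\<close>, and its Cauchy integral over the level curve is its polynomial
  part with respect to \<open>\<psi> v\<close>. A finite geometric sum in
  \<open>z / \<psi> v\<close> gives the coefficients; the integrand of the remainder is holomorphic
  outside and tends to 0, so its mean is 0.\<close>

lemma polynomial_part:
 assumes t: "r0 < t0" "t0 < t" and B: "B holomorphic_on ext_disk t0" "(B \<longlongrightarrow> 0) at_infinity"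
 obtains T where "degree T <= n"
  "!!z. z \<in> interior_dom \<psi> t ==> cmean t (%v. v * (v ^ Suc n * B v * deriv \<psi> v / (\<psi> v - z))) = poly T z"
proof -
 have "\<forall>\<^sub>F v in at_infinity. 1 <= norm (\<psi> v)"
  using lim unfolding filterlim_at_infinity[OF order_refl] by (metis zero_less_one)
 then obtain M where M: "!!v. M <= norm v ==> 1 <= norm (\<psi> v)" by (auto simp: eventually_at_infinity)
 \<comment> \<open>From this radius on \<psi> has no zeros, so division by its powers is possible;
   the mean in question is the same on this larger circle.\<close>
 define R where "R = max M t"
 have R: "t <= R" "R > 0" "t0 < R" "r0 < R" using t r0 by (auto simp: R_def)
 have nz: "\<psi> v ~= 0" if "R <= norm v" for v using M[of v] that by (auto simp: R_def)
 define cf where "cf k = cmean R (%v. v * (v ^ Suc n * B v * deriv \<psi> v / \<psi> v ^ Suc k))" for k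
 define T where "T = (\<Sum>k\<le>n. monom (cf k) k)"
 have "degree T <= n" unfolding T_def by (intro degree_sum_le) (auto intro: order_trans[OF degree_monom_le])
 moreover have "cmean t (%v. v * (v ^ Suc n * B v * deriv \<psi> v / (\<psi> v - z))) = poly T z"
  if z: "z \<in> interior_dom \<psi> t" for z
 proof -
  have rt: "r0 < t" using t by simp
  define S where "S = ext_disk t0 \<inter> {v. \<psi> v ~= z}"
  have c0: "continuous_on (ext_disk t0) \<psi>" by (rule cont\<psi>) (use t in "auto simp: ext_disk_def")
  have "open (ext_disk t0 \<inter> \<psi> -` (- {z}))"
   by (rule continuous_open_preimage[OF c0 open_ext]) auto
  moreover have "ext_disk t0 \<inter> \<psi> -` (- {z}) = S" by (auto simp: S_def)
  ultimately have oS: "open S" by simp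
  have sub: "S \<subseteq> ext_disk r0" "S \<subseteq> ext_disk t0" using t by (auto simp: S_def ext_disk_def)
  have hS: "(%v. v * (v ^ Suc n * B v * deriv \<psi> v / (\<psi> v - z))) holomorphic_on S"
   by (intro holomorphic_intros hol_subset[OF d\<psi>_hol sub(1)] hol_subset[OF hol sub(1)]
      hol_subset[OF B(1) sub(2)]) (auto simp: S_def)
  have inS: "v \<in> S" if "t <= norm v" for v
   using outside_kernel[OF z rt that] that t by (auto simp: S_def ext_disk_def)
  have sub2: "sphere 0 R \<subseteq> ext_disk r0" "sphere 0 R \<subseteq> ext_disk t0" using R by (auto simp: ext_disk_def)
  have cc: "continuous_on (sphere 0 R) B" "continuous_on (sphere 0 R) \<psi>" "continuous_on (sphere 0 R) (deriv \<psi>)"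
   using hol_cont[OF B(1) sub2(2)]
    hol_cont[OF hol sub2(1)]
    hol_cont[OF d\<psi>_hol sub2(1)] by auto
  have nzz: "\<psi> v ~= 0" "\<psi> v ~= z" if "v \<in> sphere 0 R" for v using nz[of v] inS[of v] that R by (auto simp: S_def)
  define U where "U k v = v * (v ^ Suc n * B v * deriv \<psi> v / \<psi> v ^ Suc k)" for k v
  define V where "V v = v * (v ^ Suc n * B v * deriv \<psi> v / (\<psi> v ^ Suc n * (\<psi> v - z)))" for v
  have cU: "continuous_on (sphere 0 R) (U k)" for k
   unfolding U_def using nzz by (intro continuous_intros cc) auto
  have cV: "continuous_on (sphere 0 R) V"
   unfolding V_def using nzz by (intro continuous_intros cc) auto
  have "cmean t (%v. v * (v ^ Suc n * B v * deriv \<psi> v / (\<psi> v - z)))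
    = cmean R (%v. v * (v ^ Suc n * B v * deriv \<psi> v / (\<psi> v - z)))"
   by (rule cmean_radius[OF oS hS]) (use R t r0 inS in auto)
  also have "... = cmean R (%v. (\<Sum>k\<le>n. z ^ k * U k v) + z ^ Suc n * V v)"
  proof (rule cmean_cong)
   fix v :: complex assume v: "norm v = R"
   have p0: "\<psi> v ~= 0" "\<psi> v - z ~= 0" using nz[of v] inS[of v] v R by (auto simp: S_def)
   have geo: "1 / (\<psi> v - z) = (\<Sum>k\<le>n. z ^ k / \<psi> v ^ Suc k) + z ^ Suc n / (\<psi> v ^ Suc n * (\<psi> v - z))"
   proof (induction n)
    case 0
    show ?case using p0 by (simp add: field_simps)
   next
    case (Suc n)
    have "z ^ Suc n / (\<psi> v ^ Suc n * (\<psi> v - z))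
      = z ^ Suc n / \<psi> v ^ Suc (Suc n) + z ^ Suc (Suc n) / (\<psi> v ^ Suc (Suc n) * (\<psi> v - z))"
     using p0 by (simp add: divide_simps) (simp add: algebra_simps)
    thus ?case using Suc.IH by simp
   qed
   have "v * (v ^ Suc n * B v * deriv \<psi> v / (\<psi> v - z)) = (v * (v ^ Suc n * B v * deriv \<psi> v)) * (1 / (\<psi> v - z))"
    by simp
   also have "... = (\<Sum>k\<le>n. (v * (v ^ Suc n * B v * deriv \<psi> v)) * (z ^ k / \<psi> v ^ Suc k))
     + (v * (v ^ Suc n * B v * deriv \<psi> v)) * (z ^ Suc n / (\<psi> v ^ Suc n * (\<psi> v - z)))"
    unfolding geo by (simp only: distrib_left sum_distrib_left)
   finally show "v * (v ^ Suc n * B v * deriv \<psi> v / (\<psi> v - z))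
     = (\<Sum>k\<le>n. z ^ k * U k v) + z ^ Suc n * V v"
    by (simp add: U_def V_def mult_ac)
  qed (use R in auto)
  also have "... = cmean R (%v. \<Sum>k\<le>n. z ^ k * U k v) + cmean R (%v. z ^ Suc n * V v)"
   using R by (intro cmean_add continuous_intros cU cV) auto
  also have "cmean R (%v. z ^ Suc n * V v) = 0"
  proof -
   have "cmean R V = 0"
   proof (rule cmean_exterior)
    have "open (ext_disk t0 \<inter> \<psi> -` (- {0, z}))"
     by (rule continuous_open_preimage[OF c0 open_ext]) auto
    thus "open (ext_disk t0 \<inter> {v. \<psi> v ~= 0 \<and> \<psi> v ~= z})"
     by (rule back_subst[of "open"]) auto
    show "V holomorphic_on ext_disk t0 \<inter> {v. \<psi> v ~= 0 \<and> \<psi> v ~= z}"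
     unfolding V_def using sub t
     by (intro holomorphic_intros hol_subset[OF d\<psi>_hol] hol_subset[OF hol]
        hol_subset[OF B(1)]) (auto simp: ext_disk_def)
    show "v \<in> ext_disk t0 \<inter> {v. \<psi> v ~= 0 \<and> \<psi> v ~= z}" if "R <= norm v" for v
     using that R nz[of v] inS[of v] by (auto simp: S_def)
    have "((%v. (1 / (\<psi> v / v)) ^ Suc n * B v * (v * deriv \<psi> v / (\<psi> v - z))) \<longlongrightarrow> (1 / of_real c) ^ Suc n * 0 * 1) at_infinity"
     using c by (intro tendsto_intros \<psi>_over_v B(2) kernel_limit) auto
    moreover have "(1 / (\<psi> v / v)) ^ Suc n * B v * (v * deriv \<psi> v / (\<psi> v - z)) = V v" for v
     by (simp add: V_def power_divide)
    ultimately show "(V \<longlongrightarrow> 0) at_infinity" by simp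
   qed (use R in auto)
   thus ?thesis by (simp only: cmean_mult_left) simp
  qed
  also have "cmean R (%v. \<Sum>k\<le>n. z ^ k * U k v) = (\<Sum>k\<le>n. cmean R (%v. z ^ k * U k v))"
   using R by (intro cmean_sum continuous_intros cU) auto
  also have "... = (\<Sum>k\<le>n. cf k * z ^ k)"
   unfolding cf_def U_def by (simp only: cmean_mult_left) (simp add: mult.commute)
  also have "... + 0 = poly T z" by (simp add: T_def poly_sum poly_monom)
  finally show ?thesis .
 qed
 ultimately show ?thesis by (rule that)
qed

end

subsection \<open>Approximation of the orthogonal polynomials by a Cauchy integral\<close>

lemma continuous_sphere_bound:
 fixes f :: "complex \<Rightarrow> complex"
 assumes "continuous_on (sphere 0 r) f"
 obtains B where "0 < B" "!!v. norm v = r ==> norm (f v) <= B"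
proof -
 have "compact (f ` sphere 0 r)" by (rule compact_continuous_image[OF assms]) simp
 hence "bounded (f ` sphere 0 r)" by (rule compact_imp_bounded)
 then obtain B where "B > 0" "\<forall>x\<in>f ` sphere 0 r. norm x <= B" unfolding bounded_pos by blast
 thus ?thesis by (intro that[of B]) auto
qed

lemma cmean_cauchy_lim:
 assumes "continuous_on (sphere 0 r) f" "continuous_on (sphere 0 r) h" "0 <= r"
 shows "((%w. cmean r (%v. f v / (h v - w))) \<longlongrightarrow> 0) at_infinity"
proof -
 obtain B where B: "0 < B" "!!v. norm v = r ==> norm (f v) <= B"
  using continuous_sphere_bound[OF assms(1)] by blast
 obtain m where m: "0 < m" "!!v. norm v = r ==> norm (h v) <= m"
  using continuous_sphere_bound[OF assms(2)] by blast
 have bd: "norm (cmean r (%v. f v / (h v - w))) <= B / (norm w / 2)" if w: "2 * m <= norm w" for w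
 proof (rule cmean_bound)
  have far: "norm w / 2 <= norm (h v - w)" if "norm v = r" for v
   using norm_triangle_ineq2[of w "h v"] m(2)[OF that] w by (simp add: norm_minus_commute)
  have "h v - w ~= 0" if "norm v = r" for v using far[OF that] w m(1) by auto
  thus "continuous_on (sphere 0 r) (%v. f v / (h v - w))" by (intro continuous_intros assms) auto
  fix v :: complex assume v: "norm v = r"
  show "norm (f v / (h v - w)) <= B / (norm w / 2)"
   unfolding norm_divide using B(2)[OF v] far[OF v] w m(1) B(1) by (intro frac_le) auto
 qed (rule assms)
 have "filterlim (%w :: complex. norm w) at_infinity at_infinity"
  by (rule filterlim_mono[OF filterlim_norm_at_top at_top_le_at_infinity order_refl])
 hence "((%w :: complex. (2 * B) / norm w) \<longlongrightarrow> 0) at_infinity"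
  by (rule tendsto_divide_0[OF tendsto_const])
 hence lim: "((%w :: complex. B / (norm w / 2)) \<longlongrightarrow> 0) at_infinity" by (simp add: mult.commute)
 have "\<forall>\<^sub>F w in at_infinity. norm (cmean r (%v. f v / (h v - w))) <= B / (norm w / 2)"
  unfolding eventually_at_infinity using bd by blast
 thus ?thesis using lim by (rule Lim_null_comparison)
qed

text \<open>
 The data of the theorem in the exterior coordinate \<open>v\<close> and in the interior coordinate \<open>w\<close>:
 \<open>\<eta>\<close> is \<open>\<theta> \<circ> \<psi>\<close> continued across the unit circle, \<open>\<xi>\<close> inverts \<open>\<theta>\<close>, \<open>p\<close> and \<open>C\<close> are square
 roots of \<open>\<xi>'\<close> and \<open>\<psi>'\<close>, and \<open>D\<close>, \<open>Dh\<close> are the two Szego functions in these coordinates.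
\<close>

locale core = ext_map \<psi> \<phi> r0 c for \<psi> \<phi> r0 c +
 fixes \<sigma> \<rho> R1 R2 :: real and \<eta> \<xi> p Dh D C :: "complex \<Rightarrow> complex" and Dinf :: real
 assumes radii: "r0 < \<sigma>" "\<sigma> < \<rho>" "\<rho> < 1" "1 < R1" "1 < R2"
  and \<eta>_hol: "\<eta> holomorphic_on {v. \<sigma> < norm v \<and> norm v < R1}"
  and \<eta>_inj: "inj_on \<eta> {v. \<sigma> < norm v \<and> norm v < R1}"
  and \<eta>_lt: "!!v. \<sigma> < norm v ==> norm v < 1 ==> norm (\<eta> v) < 1"
  and \<eta>_eq: "!!v. norm v = 1 ==> norm (\<eta> v) = 1"
  and \<eta>_gt: "!!v. 1 < norm v ==> norm v < R1 ==> 1 < norm (\<eta> v)"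
  and \<eta>_R2: "!!v. \<sigma> < norm v ==> norm v < R1 ==> norm (\<eta> v) < R2"
  and \<xi>_hol: "\<xi> holomorphic_on ball 0 R2" and \<xi>_inj: "inj_on \<xi> (ball 0 R2)"
  and \<xi>_\<eta>: "!!v. \<sigma> < norm v ==> norm v < R1 ==> \<xi> (\<eta> v) = \<psi> v"
  and \<xi>_ball: "\<xi> ` ball 0 1 = interior_dom \<psi> 1"
  and p_hol: "p holomorphic_on ball 0 R2" and p_sq: "!!w. norm w < R2 ==> (p w)\<^sup>2 = deriv \<xi> w"
  and Dh_hol: "Dh holomorphic_on ball 0 R2" and Dh_nz: "!!w. norm w < R2 ==> Dh w ~= 0"
  and D_hol: "D holomorphic_on ext_disk \<rho>" and D_lim: "(D \<longlongrightarrow> of_real Dinf) at_infinity" and Dinf: "0 < Dinf"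
  and D_nz: "!!v. 1 <= norm v ==> D v ~= 0"
  and C_hol: "C holomorphic_on ext_disk r0" and C_sq: "!!v. r0 < norm v ==> (C v)\<^sup>2 = deriv \<psi> v"
  and C_lim: "(C \<longlongrightarrow> of_real (sqrt c)) at_infinity"
  and mod1: "!!v. norm v = 1 ==> norm (D v) * norm (Dh (\<eta> v)) = 1"
begin

abbreviation Ann where "Ann \<equiv> {v :: complex. \<sigma> < norm v \<and> norm v < R1}"

lemma open_annulus: "open {v :: complex. a < norm v \<and> norm v < b}"
 by (intro open_Collect_conj open_Collect_less continuous_intros)

lemma \<sigma>_pos: "0 < \<sigma>" using radii r0 by simp

lemma \<eta>_inR2: "v \<in> Ann ==> norm (\<eta> v) < R2" using \<eta>_R2 by auto

lemma \<eta>_iff: "v \<in> Ann ==> norm (\<eta> v) < 1 \<longleftrightarrow> norm v < 1"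
 using \<eta>_lt[of v] \<eta>_eq[of v] \<eta>_gt[of v] by (cases "norm v < 1"; cases "norm v = 1") auto

lemma \<xi>'_nz: "norm w < R2 ==> deriv \<xi> w ~= 0"
 using holomorphic_injective_imp_regular[OF \<xi>_hol open_ball \<xi>_inj] by simp

lemma p_nz: "norm w < R2 ==> p w ~= 0"
 using p_sq[of w] \<xi>'_nz[of w] by auto

lemma C_nz: "r0 < norm v ==> C v ~= 0"
 using C_sq[of v] d\<psi>_nz[of v] by auto

lemma \<eta>'_eq: assumes v: "v \<in> Ann" shows "(p (\<eta> v))\<^sup>2 * deriv \<eta> v = (C v)\<^sup>2"
proof -
 have vr: "r0 < norm v" using v radii by simp
 have "(\<eta> has_field_derivative deriv \<eta> v) (at v)"
  using holomorphic_derivI[OF \<eta>_hol open_annulus v] .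
 moreover have "(\<xi> has_field_derivative deriv \<xi> (\<eta> v)) (at (\<eta> v))"
  using holomorphic_derivI[OF \<xi>_hol open_ball] \<eta>_inR2[OF v] by simp
 ultimately have "(\<xi> \<circ> \<eta> has_field_derivative deriv \<xi> (\<eta> v) * deriv \<eta> v) (at v)"
  by (rule DERIV_chain[rotated])
 hence d: "deriv (\<xi> \<circ> \<eta>) v = deriv \<xi> (\<eta> v) * deriv \<eta> v" by (rule DERIV_imp_deriv)
 have "deriv (\<xi> \<circ> \<eta>) v = deriv \<psi> v"
 proof (rule deriv_cong_ev[OF _ refl])
  have "\<forall>\<^sub>F x in nhds v. x \<in> Ann" using v by (intro eventually_nhds_in_open open_annulus)
  thus "\<forall>\<^sub>F x in nhds v. (\<xi> \<circ> \<eta>) x = \<psi> x" by eventually_elim (simp add: \<xi>_\<eta>)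
 qed
 thus ?thesis using d p_sq[OF \<eta>_inR2[OF v]] C_sq[OF vr] by simp
qed

lemma on_ball: "f holomorphic_on ball 0 R2 ==> (%v. f (\<eta> v)) holomorphic_on Ann"
proof -
 assume f: "f holomorphic_on ball 0 R2"
 have "\<eta> ` Ann \<subseteq> ball 0 R2" using \<eta>_inR2 by auto
 from holomorphic_on_compose_gen[OF \<eta>_hol f this] show ?thesis by (simp add: o_def)
qed

text \<open>Equal to \<open>D / C * Dh * p * \<eta>'\<close>, because
  \<open>\<eta>' = C^2 / p^2\<close>. With it \<open>J\<close> below is the Cauchy transform, in the
  variable \<open>\<eta> v\<close>, of \<open>D / C * v ^ n\<close> multiplied by
  \<open>Dh * p\<close>.\<close>

definition M :: "complex \<Rightarrow> complex" where
 "M v = D v * C v * Dh (\<eta> v) / p (\<eta> v)"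

lemma M_hol: "M holomorphic_on {v. \<rho> < norm v \<and> norm v < R1}"
 unfolding M_def using radii p_nz[OF \<eta>_inR2]
 by (intro holomorphic_intros hol_subset[OF D_hol] hol_subset[OF C_hol]
    hol_subset[OF on_ball[OF Dh_hol]] hol_subset[OF on_ball[OF p_hol]])
   (auto simp: ext_disk_def)

definition J :: "real \<Rightarrow> nat \<Rightarrow> complex \<Rightarrow> complex" where
 "J r n w = cmean r (%v. v * (M v * v ^ n / (\<eta> v - w)))"

lemma sphere_sub: "\<rho> < r ==> r < R1 ==> sphere 0 r \<subseteq> {v. \<rho> < norm v \<and> norm v < R1}"
 by auto

lemma cont_M: "\<rho> < r ==> r < R1 ==> continuous_on (sphere 0 r) M"
 using hol_cont[OF M_hol sphere_sub] .

lemma cont_\<eta>: "\<sigma> < r ==> r < R1 ==> continuous_on (sphere 0 r) \<eta>"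
 by (rule hol_cont[OF \<eta>_hol]) auto

lemma J_hol:
 assumes "\<rho> < r" "r < R1" "open U" "!!v w. norm v = r ==> w \<in> U ==> \<eta> v ~= w"
 shows "J r n holomorphic_on U"
proof -
 have "(%w. cmean r (%v. v * M v * v ^ n / (\<eta> v - w))) holomorphic_on U"
  by (rule cmean_holomorphic_param)
    (use assms radii \<sigma>_pos in \<open>auto intro!: continuous_intros cont_M cont_\<eta>\<close>)
 thus ?thesis by (simp add: J_def[abs_def] mult_ac)
qed

lemma J_integrand_hol:
 assumes "!!v. v \<in> S ==> \<rho> < norm v \<and> norm v < R1 \<and> \<eta> v ~= w"
 shows "(%v. v * (M v * v ^ n / (\<eta> v - w))) holomorphic_on S"
proof -
 have s: "S \<subseteq> {v. \<rho> < norm v \<and> norm v < R1}" "S \<subseteq> Ann" using assms radii by (auto dest!: assms)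
 have "\<eta> v - w ~= 0" if "v \<in> S" for v using assms[OF that] by simp
 thus ?thesis
  by (intro holomorphic_intros hol_subset[OF M_hol s(1)] hol_subset[OF \<eta>_hol s(2)])
qed

lemma J_radius:
 assumes "\<rho> < r" "r <= r'" "r' < R1" "!!v. r <= norm v ==> norm v <= r' ==> \<eta> v ~= w"
 shows "J r n w = J r' n w"
proof -
 define S where "S = {v. \<rho> < norm v \<and> norm v < R1} \<inter> \<eta> -` (- {w})"
 have "continuous_on {v. \<rho> < norm v \<and> norm v < R1} \<eta>"
  by (rule hol_cont[OF \<eta>_hol]) (use radii in auto)
 hence "open S" unfolding S_def by (rule continuous_open_preimage) (auto intro: open_annulus)
 moreover have "(%v. v * (M v * v ^ n / (\<eta> v - w))) holomorphic_on S"
  by (rule J_integrand_hol) (auto simp: S_def)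
 ultimately show ?thesis unfolding J_def
  by (rule cmean_radius) (use assms radii \<sigma>_pos in "auto simp: S_def")
qed

text \<open>The residue at \<open>v = y\<close>, where \<open>\<eta>' = C\<^sup>2 / p\<^sup>2\<close>.\<close>

lemma J_jump:
 assumes "\<rho> < r" "r < norm y" "norm y < r'" "r' < R1"
 shows "J r' n (\<eta> y) = J r n (\<eta> y) + D y / C y * y ^ n * Dh (\<eta> y) * p (\<eta> y)"
proof -
 define S where "S = {v :: complex. \<rho> < norm v \<and> norm v < R1}"
 have SA: "S \<subseteq> Ann" using radii by (auto simp: S_def)
 have y: "y \<in> Ann" "y \<in> S" "r0 < norm y" using assms radii by (auto simp: S_def)
 have dq: "dquot \<eta> v y ~= 0" if "v \<in> S" for v
  using dquot_nz[OF open_annulus \<eta>_hol \<eta>_inj] that SA y by auto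
 have "(%v. if v = y then deriv \<eta> y else (\<eta> v - \<eta> y) / (v - y)) holomorphic_on Ann"
  by (rule holomorphic_removable_quotient[OF \<eta>_hol open_annulus y(1)])
 hence "(%v. dquot \<eta> v y) holomorphic_on Ann"
  by (rule holomorphic_transform) (auto simp: dquot_def)
 hence dqS: "(%v. dquot \<eta> v y) holomorphic_on S" using SA by (rule hol_subset)
 define N where "N v = M v * v ^ n / dquot \<eta> v y" for v
 have N: "N holomorphic_on S"
  unfolding N_def using dq M_hol by (intro holomorphic_intros dqS) (auto simp: S_def)
 have eq: "J t n (\<eta> y) = cmean t (%v. v * N v / (v - y))" if "norm y ~= t" "t \<ge> 0" for t
  unfolding J_def
 proof (rule cmean_cong)
  fix v :: complex assume "norm v = t"
  hence "v ~= y" using that by auto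
  thus "v * (M v * v ^ n / (\<eta> v - \<eta> y)) = v * N v / (v - y)" by (simp add: N_def dquot_def)
 qed (use that in auto)
 have "cmean r' (%v. v * N v / (v - y)) = cmean r (%v. v * N v / (v - y)) + N y"
  by (rule cmean_annulus_Cauchy[OF _ N]) (use assms radii \<sigma>_pos open_annulus in "auto simp: S_def")
 moreover have "N y = D y / C y * y ^ n * Dh (\<eta> y) * p (\<eta> y)"
 proof -
  have "deriv \<eta> y = (C y)\<^sup>2 / (p (\<eta> y))\<^sup>2"
   using \<eta>'_eq[OF y(1)] p_nz[OF \<eta>_inR2[OF y(1)]] by (simp add: field_simps)
  hence "N y = D y * C y * Dh (\<eta> y) / p (\<eta> y) * y ^ n / ((C y)\<^sup>2 / (p (\<eta> y))\<^sup>2)"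
   by (simp add: N_def dquot_def M_def)
  thus ?thesis
   using C_nz[OF y(3)] p_nz[OF \<eta>_inR2[OF y(1)]] by (simp add: field_simps power2_eq_square)
 qed
 ultimately show ?thesis using eq[of r] eq[of r'] assms radii \<sigma>_pos by simp
qed

lemma J_bound:
 assumes "\<rho> < r" "r < R1" "compact W" "!!v w. norm v = r ==> w \<in> W ==> \<eta> v ~= w"
 obtains K where "0 < K" "!!n w. w \<in> W ==> norm (J r n w) <= K * r ^ n"
proof -
 have r: "r > 0" using assms radii \<sigma>_pos by simp
 have "compact (\<eta> ` sphere 0 r)" using assms radii by (intro compact_continuous_image cont_\<eta>) auto
 moreover have "\<eta> v \<notin> W" if "norm v = r" for v using assms(4)[OF that, of "\<eta> v"] by blast
 hence "\<eta> ` sphere 0 r \<inter> W = {}" by auto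
 ultimately obtain d where d: "d > 0" "!!x w. x \<in> \<eta> ` sphere 0 r ==> w \<in> W ==> d <= dist x w"
  using separate_compact_closed compact_imp_closed[OF assms(3)] by metis
 have "compact (M ` sphere 0 r)" using assms by (intro compact_continuous_image cont_M) auto
 then obtain B where B: "B > 0" "!!v. norm v = r ==> norm (M v) <= B"
  using compact_imp_bounded bounded_pos by (metis imageI mem_sphere_0)
 show ?thesis
 proof (rule that[of "r * B / d"])
  fix n w assume w: "w \<in> W"
  show "norm (J r n w) <= r * B / d * r ^ n" unfolding J_def
  proof (rule cmean_bound)
   have "(%v. v * (M v * v ^ n / (\<eta> v - w))) holomorphic_on sphere 0 r"
    by (rule J_integrand_hol) (use assms w in auto)
   thus "continuous_on (sphere 0 r) (%v. v * (M v * v ^ n / (\<eta> v - w)))"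
    by (rule hol_imp_cont)
   fix v :: complex assume v: "norm v = r"
   have "norm (v * (M v * v ^ n / (\<eta> v - w))) = r * norm (M v) * r ^ n / norm (\<eta> v - w)"
    using v by (simp add: norm_mult norm_divide norm_power)
   also have "... <= r * B * r ^ n / d"
    using d(2)[of "\<eta> v" w] d(1) w v B r
    by (intro frac_le mult_mono mult_nonneg_nonneg) (auto simp: dist_norm)
   finally show "norm (v * (M v * v ^ n / (\<eta> v - w))) <= r * B / d * r ^ n" by (simp add: mult_ac)
  qed (use r in auto)
 qed (use r B d in auto)
qed

lemma \<eta>_bounded_below_1:
 assumes "\<sigma> < r" "r < 1" obtains m where "0 < m" "m < 1" "!!v. norm v = r ==> norm (\<eta> v) <= m"
proof -
 have "compact ((%v. norm (\<eta> v)) ` sphere 0 r)"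
  using assms radii by (intro compact_continuous_image continuous_intros cont_\<eta>) auto
 moreover have "(%v. norm (\<eta> v)) ` sphere (0::complex) r ~= {}" using assms \<sigma>_pos by auto
 ultimately obtain v0 where v0: "norm v0 = r" "!!v. norm v = r ==> norm (\<eta> v) <= norm (\<eta> v0)"
  using compact_attains_sup[of "(%v. norm (\<eta> v)) ` sphere 0 r"] by auto
 have "norm (\<eta> v0) < 1" using \<eta>_lt[of v0] v0 assms by simp
 thus ?thesis using v0 that[of "max (norm (\<eta> v0)) (1/2)"] by fastforce
qed

text \<open>\<open>J r n\<close> is analytic outside a disc of radius less than one and vanishes at infinity.\<close>

lemma J_orthogonal:
 assumes r: "\<rho> < r" "r < 1" and F: "F holomorphic_on ball 0 R2"
 shows "cip (J r n) F = 0"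
proof -
 obtain m where m: "0 < m" "m < 1" "!!v. norm v = r ==> norm (\<eta> v) <= m"
  using \<eta>_bounded_below_1[of r] r radii by auto
 define S where "S = {w :: complex. max m (1 / R2) < norm w}"
 have oS: "open S" unfolding S_def by (intro open_Collect_less continuous_intros)
 have JS: "J r n holomorphic_on S"
  by (rule J_hol) (use r radii m oS in "force simp: S_def")+
 have c: "cnj \<circ> F \<circ> cnj holomorphic_on ball 0 R2"
  by (rule holomorphic_on_compose_cnj_cnj) (auto intro!: hol_subset[OF F])
 have "(cnj \<circ> F \<circ> cnj) \<circ> (%w. 1 / w) holomorphic_on S"
 proof (rule holomorphic_on_compose_gen[OF _ c])
  show "(%w. 1 / w) holomorphic_on S" using m by (intro holomorphic_intros) (auto simp: S_def)
  show "(%w. 1 / w) ` S \<subseteq> ball 0 R2"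
  proof clarify
   fix w assume "w \<in> S"
   hence "m < norm w" "1 / R2 < norm w" by (auto simp: S_def)
   moreover from this have "0 < norm w" using m by linarith
   ultimately show "1 / w \<in> ball 0 R2" using radii by (simp add: norm_divide field_simps)
  qed
 qed
 hence FS: "(%w. cnj (F (cnj (1 / w)))) holomorphic_on S" by (simp add: o_def)
 have "cip (J r n) F = cmean 1 (%w. J r n w * cnj (F (cnj (1 / w))))"
  unfolding cip_def
 proof (rule cmean_cong)
  fix w :: complex assume w: "norm w = 1"
  hence "w * cnj w = 1" using complex_norm_square[of w] by simp
  hence "cnj w = 1 / w" by (metis mult_zero_left nonzero_mult_div_cancel_left zero_neq_one)
  hence "cnj (1 / w) = w" by (metis complex_cnj_cnj)
  thus "J r n w * cnj (F w) = J r n w * cnj (F (cnj (1 / w)))" by simp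
 qed auto
 also have "... = 0"
 proof (rule cmean_exterior[OF oS])
  show "(%w. J r n w * cnj (F (cnj (1 / w)))) holomorphic_on S" by (intro holomorphic_intros JS FS)
  have "1 / R2 < 1" using radii by simp
  thus "w \<in> S" if "1 <= norm w" for w :: complex using that m by (auto simp: S_def)
  have "isCont (cnj \<circ> F \<circ> cnj) 0"
   by (rule continuous_on_interior[OF hol_imp_cont[OF c]]) (use radii in "simp add: interior_open")
  from tendsto_at_infinity_inverse[OF this]
  have l1: "((%w. cnj (F (cnj (1 / w)))) \<longlongrightarrow> cnj (F 0)) at_infinity" by (simp add: o_def)
  have "((%w. cmean r (%v. v * (M v * v ^ n) / (\<eta> v - w))) \<longlongrightarrow> 0) at_infinity"
   using r radii \<sigma>_pos by (intro cmean_cauchy_lim continuous_intros cont_M cont_\<eta>) auto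
  hence "(J r n \<longlongrightarrow> 0) at_infinity" by (simp add: J_def[abs_def])
  from tendsto_mult[OF this l1]
  show "((%w. J r n w * cnj (F (cnj (1 / w)))) \<longlongrightarrow> 0) at_infinity" by simp
 qed auto
 finally show ?thesis .
qed

text \<open>Only boundary points need an argument: if \<open>\<xi> w\<close> were
  \<open>\<psi> v\<close> with \<open>norm v\<close> at least \<open>t\<close>, continuity would
  send points of the open disc near \<open>w\<close> to the exterior side.\<close>

lemma \<xi>_cball_sub: "norm w <= 1 ==> 1 < t ==> \<xi> w \<in> interior_dom \<psi> t"
proof -
 assume w: "norm w <= 1" and t: "1 < t"
 have r01: "r0 < 1" using radii by simp
 show ?thesis
 proof (cases "norm w < 1")
  case True
  hence "\<xi> w \<in> interior_dom \<psi> 1" using \<xi>_ball by auto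
  thus ?thesis using mem_interior_dom[OF r01 t] by blast
 next
  case False
  hence w1: "norm w = 1" using w by simp
  show ?thesis
  proof (rule ccontr)
   assume "\<xi> w \<notin> interior_dom \<psi> t"
   then obtain v where v: "\<xi> w = \<psi> v" "t <= norm v" using interior_dom_eq[of t] t r01 by auto
   define s where "s = (1 + t) / 2"
   have s: "1 < s" "s < t" using t by (auto simp: s_def)
   have "\<psi> v \<in> Omega \<psi> s" using v s OmegaI[of s v] by simp
   moreover have "open (Omega \<psi> s)" using s r01 by (intro open_Omega) simp
   ultimately obtain e where e: "e > 0" "ball (\<xi> w) e \<subseteq> Omega \<psi> s" using v open_contains_ball by metis
   have "isCont \<xi> w" using w1 radii
    by (intro continuous_on_interior[OF hol_imp_cont[OF \<xi>_hol]]) (auto simp: interior_open)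
   then obtain d where d: "d > 0" "!!x. dist x w < d ==> dist (\<xi> x) (\<xi> w) < e"
    unfolding continuous_at_eps_delta using e by blast
   define x where "x = of_real (1 - min d 1 / 2) * w"
   have "x - w = of_real (- min d 1 / 2) * w" by (simp add: x_def algebra_simps)
   hence nx: "norm (x - w) = \<bar>- min d 1 / 2\<bar> * norm w" by (simp only: norm_mult norm_of_real)
   have md: "min d 1 / 2 < d" "0 < min d 1 / 2" "min d 1 / 2 < 1" using d(1) by (auto simp: min_def)
   have "dist x w < d" unfolding dist_norm nx using md w1 by simp
   from d(2)[OF this] have "\<xi> x \<in> ball (\<xi> w) e" by (simp add: dist_commute)
   hence "\<xi> x \<in> Omega \<psi> s" using e(2) by blast
   moreover have "norm x < 1"
   proof -
    have "norm x = \<bar>1 - min d 1 / 2\<bar>" unfolding x_def norm_mult norm_of_real w1 by simp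
    thus ?thesis using md by simp
   qed
   hence "\<xi> x \<in> interior_dom \<psi> 1" using \<xi>_ball by auto
   ultimately show False using OmegaD[of "\<xi> x" s] interior_dom_iff[of "\<phi> (\<xi> x)" 1] s r01 by auto
  qed
 qed
qed

text \<open>For \<open>w\<close> on the circle, \<open>\<xi> w\<close> is outside the image of the
  open disc by injectivity, hence equals \<open>\<psi> v\<close> with
  \<open>1 <= norm v < R1\<close>. Then \<open>w = \<eta> v\<close>, and \<open>norm v > 1\<close>
  would force \<open>norm w > 1\<close>.\<close>

lemma \<eta>_onto: "\<eta> ` sphere 0 1 = sphere 0 1"
proof
 show "\<eta> ` sphere 0 1 \<subseteq> sphere 0 1" using \<eta>_eq by auto
 show "sphere 0 1 \<subseteq> \<eta> ` sphere 0 1"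
 proof
  fix w :: complex assume "w \<in> sphere 0 1"
  hence w: "norm w = 1" by simp
  have r01: "r0 < 1" using radii by simp
  consider "\<xi> w \<in> \<xi> ` ball 0 1" | v where "1 <= norm v" "norm v < R1" "\<xi> w = \<psi> v"
   using \<xi>_cball_sub[of w R1] mem_interior_dom[OF r01 radii(4)] w radii by (auto simp: \<xi>_ball)
  thus "w \<in> \<eta> ` sphere 0 1"
  proof cases
   case 1
   thus ?thesis using inj_onD[OF \<xi>_inj, of w] w radii by force
  next
   case 2
   hence v: "v \<in> Ann" using radii by auto
   hence "\<eta> v = w" using inj_onD[OF \<xi>_inj, of "\<eta> v" w] \<xi>_\<eta>[of v] \<eta>_inR2[OF v] 2 w radii by simp
   thus ?thesis using \<eta>_gt[of v] 2 w by (intro image_eqI[of _ _ v]) fastforce+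
  qed
 qed
qed

text \<open>The density is \<open>norm (deriv \<eta> v)\<close>; \<open>circle_reparam\<close>
  applies because \<eta> permutes the unit circle.\<close>

lemma transfer:
 assumes "continuous_on (sphere 0 1) H"
 shows "cmean 1 H = cmean 1 (%v. H (\<eta> v) * of_real ((norm (C v))\<^sup>2 / (norm (p (\<eta> v)))\<^sup>2))"
proof -
 have A: "v \<in> Ann" if "norm v = 1" for v using that radii by auto
 have "cmean 1 (%v. H (\<eta> v) * of_real (norm (deriv \<eta> v))) = cmean 1 H"
  unfolding cmean_def
  by (rule circle_reparam[OF open_annulus \<eta>_hol _ _ \<eta>_onto assms]) (use A in \<open>auto intro: inj_on_subset[OF \<eta>_inj]\<close>)
 moreover have "cmean 1 (%v. H (\<eta> v) * of_real (norm (deriv \<eta> v)))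
   = cmean 1 (%v. H (\<eta> v) * of_real ((norm (C v))\<^sup>2 / (norm (p (\<eta> v)))\<^sup>2))"
 proof (rule cmean_cong)
  fix v :: complex assume v: "norm v = 1"
  have "(norm (p (\<eta> v)))\<^sup>2 * norm (deriv \<eta> v) = (norm (C v))\<^sup>2"
   using arg_cong[OF \<eta>'_eq[OF A[OF v]], of norm] by (simp add: norm_mult norm_power)
  moreover have "norm (p (\<eta> v)) > 0" using p_nz \<eta>_eq[OF v] radii by simp
  ultimately have "norm (deriv \<eta> v) = (norm (C v))\<^sup>2 / (norm (p (\<eta> v)))\<^sup>2" by (simp add: field_simps)
  thus "H (\<eta> v) * of_real (norm (deriv \<eta> v)) = H (\<eta> v) * of_real ((norm (C v))\<^sup>2 / (norm (p (\<eta> v)))\<^sup>2)"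
   by simp
 qed auto
 ultimately show ?thesis by simp
qed

text \<open>On the unit circle the square of \<open>norm (Dh w)\<close> is the weight and that of
  \<open>norm (p w)\<close> is \<open>norm (deriv \<xi> w)\<close>, the arc length density. So
  \<open>trf\<close> preserves scalar products up to a constant.\<close>

definition trf :: "(complex \<Rightarrow> complex) \<Rightarrow> complex \<Rightarrow> complex" where
 "trf f w = f (\<xi> w) * Dh w * p w"

lemma trf_hol:
 assumes "f holomorphic_on UNIV" shows "trf f holomorphic_on ball 0 R2"
proof -
 have "f \<circ> \<xi> holomorphic_on ball 0 R2"
  by (rule holomorphic_on_compose[OF \<xi>_hol hol_subset[OF assms]]) simp
 hence "(%w. f (\<xi> w)) holomorphic_on ball 0 R2" by (simp add: o_def)
 thus ?thesis unfolding trf_def by (intro holomorphic_intros Dh_hol p_hol)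
qed

lemma cont_ball:
 assumes "f holomorphic_on ball 0 R2" shows "continuous_on (sphere 0 1) f"
 by (rule hol_cont[OF assms]) (use radii in auto)

lemma cont_trf: "continuous_on (sphere 0 1) (trf (poly f))"
proof (rule cont_ball[OF trf_hol])
 show "poly f holomorphic_on UNIV" by (intro holomorphic_intros)
qed

text \<open>On the unit circle \<open>E n\<close> is the transform of \<open>De * sqrt \<phi>' * \<phi> ^ n\<close>.\<close>

definition r3 :: real where "r3 = (1 + R1) / 2"
definition \<rho>1 :: real where "\<rho>1 = (1 + \<rho>) / 2"
definition E :: "nat \<Rightarrow> complex \<Rightarrow> complex" where "E n w = J r3 n w - J \<rho>1 n w"

lemma r3: "1 < r3" "r3 < R1" using radii by (auto simp: r3_def)
lemma \<rho>1: "\<rho> < \<rho>1" "\<rho>1 < 1" using radii by (auto simp: \<rho>1_def)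

lemma J3_hol_near: "open (ball 0 R2 - \<eta> ` sphere 0 r3)" "J r3 n holomorphic_on (ball 0 R2 - \<eta> ` sphere 0 r3)"
 "cball 0 1 \<subseteq> ball 0 R2 - \<eta> ` sphere 0 r3"
proof -
 have "compact (\<eta> ` sphere 0 r3)" using r3 radii by (intro compact_continuous_image cont_\<eta>) auto
 thus o: "open (ball 0 R2 - \<eta> ` sphere 0 r3)" by (intro open_Diff compact_imp_closed) auto
 show "J r3 n holomorphic_on (ball 0 R2 - \<eta> ` sphere 0 r3)"
  by (rule J_hol[OF _ _ o]) (use r3 radii in auto)
 show "cball 0 1 \<subseteq> ball 0 R2 - \<eta> ` sphere 0 r3"
 proof
  fix w :: complex assume w: "w \<in> cball 0 1"
  have "w \<notin> \<eta> ` sphere 0 r3"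
  proof
   assume "w \<in> \<eta> ` sphere 0 r3"
   then obtain v where "norm v = r3" "w = \<eta> v" by auto
   thus False using \<eta>_gt[of v] r3 w by simp
  qed
  thus "w \<in> ball 0 R2 - \<eta> ` sphere 0 r3" using w radii by auto
 qed
qed

lemma cont_J3: "continuous_on (cball 0 1) (J r3 n)"
 by (rule hol_cont[OF J3_hol_near(2) J3_hol_near(3)])

lemma cont_J1:
 assumes "\<rho> < r" "r < 1" shows "continuous_on (sphere 0 1) (J r n)"
proof -
 obtain m where m: "0 < m" "m < 1" "!!v. norm v = r ==> norm (\<eta> v) <= m"
  using \<eta>_bounded_below_1[of r] assms radii by auto
 have "open {w :: complex. m < norm w}" by (intro open_Collect_less continuous_intros)
 hence "J r n holomorphic_on {w. m < norm w}"
  by (rule J_hol[rotated 2]) (use m assms radii in force)+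
 hence "continuous_on {w. m < norm w} (J r n)" by (rule hol_imp_cont)
 thus ?thesis by (rule continuous_on_subset) (use m in auto)
qed

lemma cont_E: "continuous_on (sphere 0 1) (E n)"
proof -
 have "continuous_on (sphere 0 1) (J r3 n)" by (rule continuous_on_subset[OF cont_J3]) auto
 hence "continuous_on (sphere 0 1) (%w. J r3 n w - J \<rho>1 n w)"
  by (rule continuous_on_diff) (rule cont_J1[OF \<rho>1])
 thus ?thesis by (simp add: E_def[abs_def])
qed

lemma J1_eq:
 assumes "\<rho> < r" "r < 1" "1 <= norm w" shows "J r n w = J \<rho>1 n w"
proof -
 have *: "J s n w = J t n w" if "\<rho> < s" "s <= t" "t < 1" for s t
 proof (rule J_radius)
  fix v :: complex assume "s <= norm v" "norm v <= t"
  hence "norm (\<eta> v) < 1" using that radii by (intro \<eta>_lt) auto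
  thus "\<eta> v ~= w" using assms by auto
 qed (use that radii in auto)
 show ?thesis
 proof (cases "r <= \<rho>1")
  case True
  show ?thesis by (rule *[OF assms(1) True \<rho>1(2)])
 next
  case False
  hence "\<rho>1 <= r" by simp
  thus ?thesis by (rule *[OF \<rho>1(1) _ assms(2), symmetric])
 qed
qed

lemma E_\<eta>: "norm v = 1 ==> E n (\<eta> v) = D v / C v * v ^ n * Dh (\<eta> v) * p (\<eta> v)"
 using J_jump[of \<rho>1 v r3 n] \<rho>1 r3 by (simp add: E_def)

lemma nsq_E: "nsq (E n) = 1"
proof -
 have "of_real (nsq (E n)) = cmean 1 (%w. E n w * cnj (E n w))"
  using cip_self[OF cont_E] by (simp add: cip_def)
 also have "... = cmean 1 (%v. E n (\<eta> v) * cnj (E n (\<eta> v)) * of_real ((norm (C v))\<^sup>2 / (norm (p (\<eta> v)))\<^sup>2))"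
  by (rule transfer) (intro continuous_intros cont_E)
 also have "... = cmean 1 (%v. 1)"
 proof (rule cmean_cong)
  fix v :: complex assume v: "norm v = 1"
  have C: "norm (C v) > 0" using C_nz[of v] v radii by simp
  have p: "norm (p (\<eta> v)) > 0" using p_nz \<eta>_eq[OF v] radii by simp
  have "norm (E n (\<eta> v)) = norm (D v) * norm (Dh (\<eta> v)) * norm (p (\<eta> v)) / norm (C v)"
   unfolding E_\<eta>[OF v] by (simp add: norm_mult norm_divide norm_power v)
  also have "... = norm (p (\<eta> v)) / norm (C v)" using mod1[OF v] by simp
  finally have e: "norm (E n (\<eta> v)) = norm (p (\<eta> v)) / norm (C v)" .
  have X1: "(norm (E n (\<eta> v)))\<^sup>2 * ((norm (C v))\<^sup>2 / (norm (p (\<eta> v)))\<^sup>2) = 1"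
   unfolding e using C p by (simp add: power_divide)
  hence "complex_of_real ((norm (E n (\<eta> v)))\<^sup>2 * ((norm (C v))\<^sup>2 / (norm (p (\<eta> v)))\<^sup>2)) = 1"
   by (simp only: X1 of_real_1)
  thus "E n (\<eta> v) * cnj (E n (\<eta> v)) * of_real ((norm (C v))\<^sup>2 / (norm (p (\<eta> v)))\<^sup>2) = 1"
   by (simp only: of_real_mult complex_norm_square)
 qed auto
 finally have "complex_of_real (nsq (E n)) = 1" by simp
 thus ?thesis by (simp only: of_real_eq_1_iff)
qed

lemma poly_at_infinity:
 assumes "degree f <= n"
 shows "((%v. poly f (\<psi> v) / v ^ n) \<longlongrightarrow> coeff f n * of_real c ^ n) at_infinity"
proof -
 have "((%v. \<Sum>i\<le>n. coeff f i * ((\<psi> v / v) ^ i * (1 / v) ^ (n - i))) \<longlongrightarrow>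
     (\<Sum>i\<le>n. coeff f i * (of_real c ^ i * 0 ^ (n - i)))) at_infinity"
  by (intro tendsto_intros \<psi>_over_v tendsto_divide_0[OF tendsto_const] filterlim_ident)
 also have "(\<Sum>i\<le>n. coeff f i * (of_real c ^ i * 0 ^ (n - i))) = (\<Sum>i\<le>n. if i = n then coeff f n * of_real c ^ n else 0)"
  by (intro sum.cong) auto
 also have "... = coeff f n * of_real c ^ n" by simp
 finally have *: "((%v. \<Sum>i\<le>n. coeff f i * ((\<psi> v / v) ^ i * (1 / v) ^ (n - i))) \<longlongrightarrow> coeff f n * of_real c ^ n) at_infinity" .
 have "\<forall>\<^sub>F v in at_infinity. (\<Sum>i\<le>n. coeff f i * ((\<psi> v / v) ^ i * (1 / v) ^ (n - i))) = poly f (\<psi> v) / v ^ n"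
  unfolding eventually_at_infinity
 proof (intro exI[of _ 1] allI impI)
  fix v :: complex assume "1 <= norm v"
  hence v: "v ~= 0" by auto
  have "poly f (\<psi> v) = (\<Sum>i\<le>n. coeff f i * \<psi> v ^ i)"
   unfolding poly_altdef by (rule sum.mono_neutral_left) (use assms in "auto simp: coeff_eq_0")
  hence "poly f (\<psi> v) / v ^ n = (\<Sum>i\<le>n. coeff f i * \<psi> v ^ i / v ^ n)" by (simp add: sum_divide_distrib)
  also have "... = (\<Sum>i\<le>n. coeff f i * ((\<psi> v / v) ^ i * (1 / v) ^ (n - i)))"
  proof (rule sum.cong)
   fix i assume "i \<in> {..n}"
   hence "v ^ n = v ^ i * v ^ (n - i)" by (simp flip: power_add)
   thus "coeff f i * \<psi> v ^ i / v ^ n = coeff f i * ((\<psi> v / v) ^ i * (1 / v) ^ (n - i))"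
    using v by (simp add: power_divide)
  qed simp
  finally show "(\<Sum>i\<le>n. coeff f i * ((\<psi> v / v) ^ i * (1 / v) ^ (n - i))) = poly f (\<psi> v) / v ^ n" by simp
 qed
 from Lim_transform_eventually[OF * this] show ?thesis .
qed

text \<open>In the exterior coordinate \<open>mod1\<close> replaces the factors with conjugates by
  \<open>1 / D\<close>, and \<open>cnj v = 1 / v\<close>. What remains is holomorphic outside the
  circle, so its mean is the value at infinity, where only the leading coefficient survives.\<close>

lemma cip_E:
 assumes "degree f <= n"
 shows "cip (trf (poly f)) (E n) = coeff f n * of_real (c ^ n * sqrt c / Dinf)"
proof -
 have "cip (trf (poly f)) (E n) = cmean 1 (%v. trf (poly f) (\<eta> v) * cnj (E n (\<eta> v)) * of_real ((norm (C v))\<^sup>2 / (norm (p (\<eta> v)))\<^sup>2))"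
  unfolding cip_def by (rule transfer) (intro continuous_intros cont_E cont_trf)
 also have "... = cmean 1 (%v. poly f (\<psi> v) / v ^ n * C v / D v)"
 proof (rule cmean_cong)
  fix v :: complex assume v: "norm v = 1"
  have nz: "C v ~= 0" "p (\<eta> v) ~= 0" "D v ~= 0" "v ~= 0" "Dh (\<eta> v) ~= 0"
   using C_nz[of v] p_nz[of "\<eta> v"] Dh_nz[of "\<eta> v"] D_nz[of v] v \<eta>_eq[OF v] radii by auto
  have "v * cnj v = 1" using complex_norm_square[of v] v by simp
  hence cv: "cnj v = 1 / v" using nz by (simp add: field_simps)
  have "\<xi> (\<eta> v) = \<psi> v" using \<xi>_\<eta>[of v] v radii by auto
  hence "trf (poly f) (\<eta> v) * cnj (E n (\<eta> v)) * of_real ((norm (C v))\<^sup>2 / (norm (p (\<eta> v)))\<^sup>2)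
   = poly f (\<psi> v) * Dh (\<eta> v) * p (\<eta> v) * (cnj (D v) / cnj (C v) * (1 / v) ^ n * cnj (Dh (\<eta> v)) * cnj (p (\<eta> v)))
     * (C v * cnj (C v) / (p (\<eta> v) * cnj (p (\<eta> v))))"
  proof -
   have "complex_of_real ((norm (C v))\<^sup>2 / (norm (p (\<eta> v)))\<^sup>2) = C v * cnj (C v) / (p (\<eta> v) * cnj (p (\<eta> v)))"
    by (simp only: of_real_divide complex_norm_square)
   moreover have "cnj (E n (\<eta> v)) = cnj (D v) / cnj (C v) * (1 / v) ^ n * cnj (Dh (\<eta> v)) * cnj (p (\<eta> v))"
    unfolding E_\<eta>[OF v] by (simp add: cv)
   moreover have "trf (poly f) (\<eta> v) = poly f (\<psi> v) * Dh (\<eta> v) * p (\<eta> v)"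
    by (simp add: trf_def \<open>\<xi> (\<eta> v) = \<psi> v\<close>)
   ultimately show ?thesis by (simp only:)
  qed
  also have "... = poly f (\<psi> v) / v ^ n * C v * (cnj (D v) * (Dh (\<eta> v) * cnj (Dh (\<eta> v))))"
   using nz by (simp add: power_divide field_simps)
  also have "cnj (D v) * (Dh (\<eta> v) * cnj (Dh (\<eta> v))) = 1 / D v"
  proof -
   have "(D v * cnj (D v)) * (Dh (\<eta> v) * cnj (Dh (\<eta> v))) = of_real ((norm (D v) * norm (Dh (\<eta> v)))\<^sup>2)"
    by (simp only: power_mult_distrib of_real_mult complex_norm_square)
   hence "D v * (cnj (D v) * (Dh (\<eta> v) * cnj (Dh (\<eta> v)))) = 1" using mod1[OF v] by (simp add: mult_ac)
   thus ?thesis using nz by (simp add: field_simps)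
  qed
  finally show "trf (poly f) (\<eta> v) * cnj (E n (\<eta> v)) * of_real ((norm (C v))\<^sup>2 / (norm (p (\<eta> v)))\<^sup>2)
    = poly f (\<psi> v) / v ^ n * C v / D v" by simp
 qed auto
 also have "... = coeff f n * of_real c ^ n * of_real (sqrt c) / of_real Dinf"
 proof (rule cmean_exterior)
  have "open (ext_disk \<rho> \<inter> D -` (- {0}))"
   by (rule continuous_open_preimage[OF hol_imp_cont[OF D_hol] open_ext]) auto
  thus "open (ext_disk \<rho> \<inter> {v. D v ~= 0})" by (rule back_subst[of "open"]) auto
  have sub: "ext_disk \<rho> \<subseteq> ext_disk r0" using radii by (intro ext_mono) auto
  have "\<psi> holomorphic_on ext_disk \<rho> \<inter> {v. D v ~= 0}" using sub by (intro hol_subset[OF hol]) auto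
  thus "(%v. poly f (\<psi> v) / v ^ n * C v / D v) holomorphic_on ext_disk \<rho> \<inter> {v. D v ~= 0}"
   using sub radii \<sigma>_pos
   by (intro holomorphic_intros hol_subset[OF D_hol] hol_subset[OF C_hol])
     (auto simp: ext_disk_def)
  show "v \<in> ext_disk \<rho> \<inter> {v. D v ~= 0}" if "1 <= norm v" for v
   using that D_nz radii by (auto simp: ext_disk_def)
  show "((%v. poly f (\<psi> v) / v ^ n * C v / D v) \<longlongrightarrow> coeff f n * of_real c ^ n * of_real (sqrt c) / of_real Dinf) at_infinity"
   using Dinf by (intro tendsto_intros poly_at_infinity assms C_lim D_lim) auto
 qed auto
 finally show ?thesis by simp
qed

lemma compact_\<xi>: "compact (\<xi> ` cball 0 1)"
proof (rule compact_continuous_image)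
 have "cball 0 1 \<subseteq> ball (0 :: complex) R2" using radii by auto
 thus "continuous_on (cball 0 1) \<xi>"
  by (rule hol_cont[OF \<xi>_hol])
qed (rule compact_cball)

lemma \<xi>_\<psi>_cases:
 assumes "1 < t" "t < R1" "z \<in> interior_dom \<psi> t"
 obtains w where "norm w < R2" "z = \<xi> w" "norm w < 1 \<or> (\<exists>v. 1 <= norm v \<and> norm v < t \<and> w = \<eta> v)"
proof -
 have r01: "r0 < 1" using radii by simp
 from assms(3) mem_interior_dom[OF r01 assms(1)]
 consider "z \<in> interior_dom \<psi> 1" | v where "1 <= norm v" "norm v < t" "z = \<psi> v" by blast
 thus ?thesis
 proof cases
  case 1
  hence "z \<in> \<xi> ` ball 0 1" by (simp only: \<xi>_ball)
  then obtain w where "norm w < 1" "z = \<xi> w" by auto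
  thus ?thesis using that[of w] radii by auto
 next
  case 2
  hence "v \<in> Ann" using radii assms by auto
  thus ?thesis using that[of "\<eta> v"] 2 \<xi>_\<eta>[of v] \<eta>_inR2[of v] by auto
 qed
qed

end

section \<open>Polynomial approximation and comparison with the orthogonal polynomials\<close>

context core
begin

text \<open>In the exterior coordinate \<open>J r3 n\<close> divided by \<open>Dh * p\<close> is
  \<open>D / C * v ^ n\<close> plus an error \<open>O(\<rho>'^n)\<close>. After division by
  \<open>v ^ Suc n\<close> only the error enters the part \<open>A\<close> of the Laurent splitting,
  and \<open>polynomial_part\<close> turns the part \<open>B\<close> into \<open>T\<close>. The
  error is estimated on radius \<open>r2\<close> but evaluated on \<open>r1\<close>, and the ratio
  \<open>r1 / r2\<close> pushes the rate below \<open>\<rho>\<close>.\<close>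

lemma Q_approx:
 obtains K \<tau> where "0 < K" "0 < \<tau>" "\<tau> < \<rho>"
  "!!n. \<exists>T. degree T <= n \<and> (\<forall>w. norm w <= 1 \<longrightarrow> norm (J r3 n w - trf (poly T) w) <= K * \<tau> ^ n)"
proof -
 \<comment> \<open>Three circles between 1 and \<open>r3\<close>: the Laurent splitting uses
   \<open>rB\<close> and \<open>r2\<close>, and the Cauchy integral that yields the polynomial runs
   over \<open>r1\<close> between them.\<close>
 define rB where "rB = 1 + (r3 - 1) / 4"
 define r1 where "r1 = 1 + (r3 - 1) / 2"
 define r2 where "r2 = 1 + 3 * (r3 - 1) / 4"
 have rr: "1 < rB" "rB < r1" "r1 < r2" "r2 < r3" "r3 < R1" using r3 unfolding rB_def r1_def r2_def by (auto simp: field_simps)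
 have pos: "0 < rB" "0 < r1" "0 < r2" "0 < r3" using rr by auto
 have r01: "r0 < 1" "0 < \<rho>" using radii \<sigma>_pos by auto
 \<comment> \<open>The midpoints of \<open>\<rho>\<close> with 1 and with
   \<open>\<rho> * r2 / r1\<close>; hence \<open>\<rho> < \<rho>' < 1\<close> and
   \<open>\<rho>' * r1 / r2 < \<rho>\<close>.\<close>
 define \<rho>' where "\<rho>' = min ((1 + \<rho>) / 2) (\<rho> * (1 + r2 / r1) / 2)"
 have q21: "1 < r2 / r1" using rr pos by simp
 have "\<rho> * 1 < \<rho> * ((1 + r2 / r1) / 2)" using q21 r01 by (intro mult_strict_left_mono) auto
 moreover have "\<rho> < (1 + \<rho>) / 2" "(1 + \<rho>) / 2 < 1" using radii by auto
 ultimately have \<rho>': "\<rho> < \<rho>'" "\<rho>' < 1" unfolding \<rho>'_def by (auto simp only: min_less_iff_conj min_less_iff_disj mult_1_right times_divide_eq_right)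
 have "\<rho>' * (r1 / r2) < \<rho>"
 proof -
  have "\<rho>' <= \<rho> * ((1 + r2 / r1) / 2)" unfolding \<rho>'_def by (rule order_trans[OF min.cobounded2]) simp
  also have "(1 + t) / 2 < t" if "1 < t" for t :: real using that by simp
  from this[OF q21] have "(1 + r2 / r1) / 2 < r2 / r1" .
  hence "\<rho> * ((1 + r2 / r1) / 2) < \<rho> * (r2 / r1)" using r01(2) by (rule mult_strict_left_mono)
  finally show ?thesis using pos by (simp add: field_simps)
 qed
 define \<tau> where "\<tau> = \<rho>' * (r1 / r2)"
 have \<tau>: "0 < \<tau>" "\<tau> < \<rho>" using \<open>\<rho>' * (r1 / r2) < \<rho>\<close> \<rho>' r01 pos by (auto simp: \<tau>_def)
 define q where "q w = Dh w * p w" for w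
 have q_hol: "q holomorphic_on ball 0 R2" unfolding q_def by (intro holomorphic_intros Dh_hol p_hol)
 have q_nz: "q w ~= 0" if "norm w < R2" for w using Dh_nz p_nz that by (simp add: q_def)
 define W where "W = \<eta> ` ({v. 1 <= norm v} \<inter> cball 0 r2)"
 have cW0: "compact ({v :: complex. 1 <= norm v} \<inter> cball 0 r2)"
  by (intro closed_Int_compact closed_Collect_le continuous_intros compact_cball)
 have subA: "{v :: complex. 1 <= norm v} \<inter> cball 0 r2 \<subseteq> Ann" using rr radii by auto
 have cW: "compact W" unfolding W_def
  by (rule compact_continuous_image[OF hol_cont[OF \<eta>_hol subA] cW0])
 have W1: "1 <= norm w \<and> norm w < R2" if "w \<in> W" for w
  using that subA \<eta>_inR2 \<eta>_iff unfolding W_def by force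
 obtain K1 where K1: "0 < K1" "!!n w. w \<in> W ==> norm (J \<rho>' n w) <= K1 * \<rho>' ^ n"
 proof (rule J_bound[of \<rho>' W])
  fix v w :: complex assume "norm v = \<rho>'" "w \<in> W"
  thus "\<eta> v ~= w" using \<eta>_lt[of v] W1[of w] \<rho>' radii by auto
 qed (use \<rho>' cW radii in auto)
 obtain q0 where q0: "0 < q0" "!!w. w \<in> W ==> q0 <= norm (q w)"
 proof -
  have "compact (q ` W)"
   by (rule compact_continuous_image[OF hol_cont[OF q_hol] cW])
     (use W1 in auto)
  moreover have "0 \<notin> q ` W" using q_nz W1 by force
  ultimately obtain e where "e > 0" "!!x. x \<in> q ` W ==> e <= dist 0 x"
   using separate_point_closed[OF compact_imp_closed] by metis
  thus ?thesis using that[of e] by auto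
 qed
 obtain q1 where q1: "0 < q1" "!!w. norm w <= 1 ==> norm (q w) <= q1"
 proof -
  have "compact (q ` cball 0 1)"
   by (rule compact_continuous_image[OF hol_cont[OF q_hol]])
     (use radii in auto)
  hence "bounded (q ` cball 0 1)" by (rule compact_imp_bounded)
  then obtain b where "b > 0" "\<forall>x\<in>q ` cball 0 1. norm x <= b" unfolding bounded_pos by blast
  thus ?thesis by (intro that[of b]) auto
 qed
 have c\<psi>1: "continuous_on (sphere 0 r1) \<psi>" by (rule cont\<psi>) (use rr r01 in "auto simp: ext_disk_def")
 have cd\<psi>1: "continuous_on (sphere 0 r1) (deriv \<psi>)"
  by (rule hol_cont[OF d\<psi>_hol]) (use rr r01 in "auto simp: ext_disk_def")
 obtain \<Psi> where \<Psi>: "0 < \<Psi>" "!!v. norm v = r1 ==> norm (deriv \<psi> v) <= \<Psi>"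
  using continuous_sphere_bound[OF cd\<psi>1] by blast
 obtain d where d: "0 < d" "!!v w. norm v = r1 ==> norm w <= 1 ==> d <= norm (\<psi> v - \<xi> w)"
 proof -
  have "compact (\<psi> ` sphere 0 r1)" by (rule compact_continuous_image[OF c\<psi>1]) simp
  moreover have "\<psi> ` sphere 0 r1 \<inter> \<xi> ` cball 0 1 = {}"
  proof -
   have "\<psi> v ~= \<xi> w" if "norm v = r1" "norm w <= 1" for v w
    using outside_kernel[OF \<xi>_cball_sub[OF that(2)], of r1 v] that rr r01 by auto
   thus ?thesis by auto
  qed
  ultimately obtain e where "e > 0" "!!x y. x \<in> \<psi> ` sphere 0 r1 ==> y \<in> \<xi> ` cball 0 1 ==> e <= dist x y"
   using separate_compact_closed[OF _ compact_imp_closed[OF compact_\<xi>]] by metis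
  thus ?thesis by (intro that[of e]) (auto simp: dist_norm)
 qed
 define K where "K = r1 * r1 * (K1 / q0 / (r2 - r1)) * \<Psi> / d * q1"
 have "0 < K" unfolding K_def using pos K1 q0 rr \<Psi> d q1 by (intro mult_pos_pos divide_pos_pos) auto
 moreover have "\<exists>T. degree T <= n \<and> (\<forall>w. norm w <= 1 \<longrightarrow> norm (J r3 n w - trf (poly T) w) <= K * \<tau> ^ n)" for n
 proof -
  \<comment> \<open>The inverse of \<xi> carries \<open>J r3 n / q\<close> back to the plane of the
    curve, where the approximant is to be a polynomial in \<open>z\<close>.\<close>
  obtain th where th: "th holomorphic_on \<xi> ` ball 0 R2" "!!w. w \<in> ball 0 R2 ==> th (\<xi> w) = w"
   using holomorphic_has_inverse[OF \<xi>_hol open_ball \<xi>_inj] by metis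
  let ?a = "K1 / q0 / (r2 - r1) * (\<rho>' / r2) ^ n"
  define V where "V = ball 0 R2 - \<eta> ` sphere 0 r3"
  have mapV: "z \<in> \<xi> ` ball 0 R2 \<and> th z \<in> V" if z: "z \<in> interior_dom \<psi> r3" for z
  proof -
   obtain w where w: "norm w < R2" "z = \<xi> w" "norm w < 1 \<or> (\<exists>v. 1 <= norm v \<and> norm v < r3 \<and> w = \<eta> v)"
    using \<xi>_\<psi>_cases[OF r3(1,2) z] by blast
   have "w \<notin> \<eta> ` sphere 0 r3"
   proof
    assume "w \<in> \<eta> ` sphere 0 r3"
    then obtain v' where v': "norm v' = r3" "w = \<eta> v'" by auto
    from w(3) show False
    proof
     assume "norm w < 1"
     thus False using \<eta>_gt[of v'] v' r3 by simp
    next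
     assume "\<exists>v. 1 <= norm v \<and> norm v < r3 \<and> w = \<eta> v"
     then obtain v where v: "1 <= norm v" "norm v < r3" "w = \<eta> v" by blast
     have "v = v'" by (rule inj_onD[OF \<eta>_inj]) (use v v' r3 radii in auto)
     thus False using v v' by simp
    qed
   qed
   thus ?thesis using w th(2)[of w] by (auto simp: V_def)
  qed
  define Qz where "Qz z = J r3 n (th z) / q (th z)" for z
  have Jq: "(%w. J r3 n w / q w) holomorphic_on V"
   unfolding V_def by (intro holomorphic_intros J3_hol_near hol_subset[OF q_hol]) (use q_nz in auto)
  have "(%w. J r3 n w / q w) \<circ> th holomorphic_on interior_dom \<psi> r3"
   by (rule holomorphic_on_compose_gen[OF hol_subset[OF th(1)] Jq]) (use mapV in auto)
  hence Qhol: "Qz holomorphic_on interior_dom \<psi> r3" by (simp add: o_def Qz_def[abs_def])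
  have Q\<xi>: "Qz (\<xi> w) = J r3 n w / q w" if "norm w < R2" for w using th(2)[of w] that by (simp add: Qz_def)
  define Ez where "Ez v = J \<rho>' n (\<eta> v) / q (\<eta> v)" for v
  have Q\<psi>: "Qz (\<psi> v) = D v / C v * v ^ n + Ez v" if v: "\<rho>' < norm v" "norm v < r3" for v
  proof -
   have A: "v \<in> Ann" using v \<rho>' radii r3 by auto
   have "Qz (\<psi> v) = J r3 n (\<eta> v) / q (\<eta> v)" using Q\<xi>[OF \<eta>_inR2[OF A]] \<xi>_\<eta>[of v] A by simp
   also have "J r3 n (\<eta> v) = J \<rho>' n (\<eta> v) + D v / C v * v ^ n * q (\<eta> v)"
    using J_jump[of \<rho>' v r3 n] v \<rho>' r3 by (simp add: q_def mult.assoc)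
   finally show ?thesis using q_nz[OF \<eta>_inR2[OF A]] by (simp add: Ez_def add_divide_distrib)
  qed
  have EzB: "norm (Ez v) <= K1 * \<rho>' ^ n / q0" if "1 <= norm v" "norm v <= r2" for v
  proof -
   have "\<eta> v \<in> W" using that by (auto simp: W_def)
   thus ?thesis unfolding Ez_def norm_divide using K1 q0 \<rho>' r01 by (intro frac_le) auto
  qed
  define S where "S = {v :: complex. \<rho>' < norm v \<and> norm v < r3}"
  have oS: "open S" unfolding S_def by (rule open_annulus)
  have "Qz \<circ> \<psi> holomorphic_on S"
  proof (rule holomorphic_on_compose_gen[OF _ Qhol])
   show "\<psi> holomorphic_on S" by (rule hol_subset[OF hol]) (use \<rho>' radii in "auto simp: S_def ext_disk_def")
   show "\<psi> ` S \<subseteq> interior_dom \<psi> r3"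
   proof clarify
    fix v assume "v \<in> S"
    thus "\<psi> v \<in> interior_dom \<psi> r3" using interior_dom_iff[of v r3] \<rho>' radii r3 by (auto simp: S_def)
   qed
  qed
  hence QS: "(%v. Qz (\<psi> v)) holomorphic_on S" by (simp add: o_def)
  have S0: "v ~= 0" if "v \<in> S" for v using that \<rho>' r01 by (auto simp: S_def)
  define g where "g v = Qz (\<psi> v) / v ^ Suc n" for v
  have gS: "g holomorphic_on S" unfolding g_def using S0 by (intro holomorphic_intros QS) auto
  have cont_g: "continuous_on (sphere 0 t) g" if "\<rho>' < t" "t < r3" for t
   by (rule hol_cont[OF gS]) (use that in "auto simp: S_def")
  define A where "A v = cmean r2 (%z. z * g z / (z - v))" for v
  define B where "B v = - cmean rB (%z. z * g z / (z - v))" for v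
  have AB: "g v = A v + B v" if "rB < norm v" "norm v < r2" for v
   using cmean_annulus_Cauchy[OF oS gS, of rB v r2] that rr \<rho>' by (simp add: A_def B_def S_def)
  have B_hol: "B holomorphic_on ext_disk rB"
   unfolding B_def
   by (intro holomorphic_intros cmean_holomorphic_param open_ext continuous_intros cont_g)
     (use rr \<rho>' in "auto simp: ext_disk_def")
  have "((%v. - cmean rB (%z. z * g z / (z - v))) \<longlongrightarrow> - 0) at_infinity"
   using rr \<rho>' by (intro tendsto_minus cmean_cauchy_lim continuous_intros cont_g) auto
  hence B_lim: "(B \<longlongrightarrow> 0) at_infinity" by (simp add: B_def[abs_def])
  have A_bound: "norm (A v) <= ?a" if v: "norm v = r1" for v
  proof -
   have zv: "z - v ~= 0" if "norm z = r2" for z using that v rr by auto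
   have "continuous_on (sphere 0 r2) D" "continuous_on (sphere 0 r2) C"
    using rr r01 radii
    by (auto intro!: hol_cont[OF D_hol]
       hol_cont[OF C_hol] simp: ext_disk_def)
   moreover have C0: "C z ~= 0" if "norm z = r2" for z using C_nz[of z] that rr r01 by simp
   ultimately have c2: "continuous_on (sphere 0 r2) (%z. D z / C z / (z - v))"
    using zv by (intro continuous_intros) auto
   have c1: "continuous_on (sphere 0 r2) (%z. z * (Ez z / z ^ Suc n) / (z - v))"
   proof -
    have "continuous_on (sphere 0 r2) (%z. z * g z / (z - v) - D z / C z / (z - v))"
     using rr \<rho>' zv by (intro continuous_intros cont_g c2) auto
    thus ?thesis
    proof (rule continuous_on_eq)
     fix z :: complex assume "z \<in> sphere 0 r2"
     hence z: "norm z = r2" "z ~= 0" using pos by auto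
     have "g z = D z / C z / z + Ez z / z ^ Suc n"
      using Q\<psi>[of z] z rr \<rho>' by (simp add: g_def add_divide_distrib)
     hence "z * g z = D z / C z + z * (Ez z / z ^ Suc n)" using z by (simp add: distrib_left)
     thus "z * g z / (z - v) - D z / C z / (z - v) = z * (Ez z / z ^ Suc n) / (z - v)"
      by (simp only: add_divide_distrib) simp
    qed
   qed
   have "A v = cmean r2 (%z. z * (Ez z / z ^ Suc n) / (z - v) + D z / C z / (z - v))"
    unfolding A_def
   proof (rule cmean_cong)
    fix z :: complex assume "norm z = r2"
    hence z: "norm z = r2" "z ~= 0" using pos by auto
    have "g z = D z / C z / z + Ez z / z ^ Suc n"
     using Q\<psi>[of z] z rr \<rho>' by (simp add: g_def add_divide_distrib)
    hence "z * g z = z * (Ez z / z ^ Suc n) + D z / C z" using z by (simp add: distrib_left)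
    thus "z * g z / (z - v) = z * (Ez z / z ^ Suc n) / (z - v) + D z / C z / (z - v)"
     by (simp only: add_divide_distrib)
   qed (use pos in auto)
   also have "... = cmean r2 (%z. z * (Ez z / z ^ Suc n) / (z - v)) + cmean r2 (%z. D z / C z / (z - v))"
    using pos by (intro cmean_add c1 c2) auto
   \<comment> \<open>The leading term is holomorphic beyond \<open>r1\<close> and the kernel decays
     at infinity, so it leaves no trace in \<open>A\<close>.\<close>
   also have "cmean r2 (%z. D z / C z / (z - v)) = 0"
   proof (rule cmean_exterior[OF open_ext])
    have "ext_disk r1 \<subseteq> ext_disk \<rho>" "ext_disk r1 \<subseteq> ext_disk r0" using rr radii by (auto intro!: ext_mono)
    thus "(%z. D z / C z / (z - v)) holomorphic_on ext_disk r1"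
     using C_nz rr r01 v
     by (intro holomorphic_intros hol_subset[OF D_hol] hol_subset[OF C_hol])
       (auto simp: ext_disk_def)
    have "((%z. D z / C z * (1 / (z - v))) \<longlongrightarrow> of_real Dinf / of_real (sqrt c) * 0) at_infinity"
    proof (intro tendsto_intros D_lim C_lim)
     show "complex_of_real (sqrt c) ~= 0" using c by simp
     have "filterlim (%z. - v + z) at_infinity at_infinity"
      by (rule tendsto_add_filterlim_at_infinity[OF tendsto_const filterlim_ident])
     thus "((%z. 1 / (z - v)) \<longlongrightarrow> 0) at_infinity"
      by (intro tendsto_divide_0[OF tendsto_const]) simp
    qed
    thus "((%z. D z / C z / (z - v)) \<longlongrightarrow> 0) at_infinity" by simp
   qed (use rr pos in "auto simp: ext_disk_def")
   finally have "A v = cmean r2 (%z. z * (Ez z / z ^ Suc n) / (z - v))" by simp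
   also have "norm ... <= ?a"
   proof (rule cmean_bound[OF c1])
    fix z :: complex assume z: "norm z = r2"
    have "r2 - r1 <= norm (z - v)" using norm_triangle_ineq2[of z v] z v by simp
    moreover have "norm (z * (Ez z / z ^ Suc n)) <= r2 * (K1 * \<rho>' ^ n / q0 / r2 ^ Suc n)"
     unfolding norm_mult norm_divide norm_power z using EzB[of z] z rr pos
     by (intro mult_left_mono divide_right_mono) auto
    moreover have "0 <= r2 * (K1 * \<rho>' ^ n / q0 / r2 ^ Suc n)"
     using pos K1 q0 \<rho>' r01 by (intro mult_nonneg_nonneg divide_nonneg_nonneg) auto
    ultimately have "norm (z * (Ez z / z ^ Suc n)) / norm (z - v) <= (r2 * (K1 * \<rho>' ^ n / q0 / r2 ^ Suc n)) / (r2 - r1)"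
     using rr by (intro frac_le) auto
    also have "... = ?a" using pos by (simp add: power_divide)
    finally show "norm (z * (Ez z / z ^ Suc n) / (z - v)) <= ?a"
     by (simp only: norm_divide)
   qed (use pos in auto)
   finally show ?thesis .
  qed
  have rB0: "r0 < rB" using rr r01 by simp
  obtain T where T: "degree T <= n"
   "!!z. z \<in> interior_dom \<psi> r1 ==> cmean r1 (%v. v * (v ^ Suc n * B v * deriv \<psi> v / (\<psi> v - z))) = poly T z"
   using polynomial_part[OF rB0 rr(2) B_hol B_lim, of n] by blast
  have "norm (J r3 n w - trf (poly T) w) <= K * \<tau> ^ n" if w: "norm w <= 1" for w
  proof -
   define z where "z = \<xi> w"
   have z1: "z \<in> interior_dom \<psi> r1" unfolding z_def by (rule \<xi>_cball_sub[OF w]) (use rr in auto)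
   have ker0: "\<psi> v - z ~= 0" if "norm v = r1" for v using d(2)[OF that w] d(1) by (auto simp: z_def)
   have cB: "continuous_on (sphere 0 r1) B"
    by (rule hol_cont[OF B_hol]) (use rr in "auto simp: ext_disk_def")
   have "continuous_on (sphere 0 r1) (%v. g v - B v)" using rr \<rho>' by (intro continuous_intros cont_g cB) auto
   hence cA: "continuous_on (sphere 0 r1) A" by (rule continuous_on_eq) (use AB rr in auto)
   have "Qz z = cmean r1 (%v. v * (Qz (\<psi> v) * deriv \<psi> v / (\<psi> v - z)))"
    by (rule cauchy_interior[symmetric, OF _ _ Qhol z1]) (use rr r01 in auto)
   also have "... = cmean r1 (%v. v * (v ^ Suc n * A v * deriv \<psi> v / (\<psi> v - z)) + v * (v ^ Suc n * B v * deriv \<psi> v / (\<psi> v - z)))"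
   proof (rule cmean_cong)
    fix v :: complex assume v: "norm v = r1"
    hence "v ~= 0" using pos by auto
    hence "Qz (\<psi> v) = v ^ Suc n * (A v + B v)" using AB[of v] v rr by (simp add: g_def field_simps)
    hence "Qz (\<psi> v) * deriv \<psi> v = v ^ Suc n * A v * deriv \<psi> v + v ^ Suc n * B v * deriv \<psi> v"
     by (simp add: algebra_simps)
    thus "v * (Qz (\<psi> v) * deriv \<psi> v / (\<psi> v - z))
     = v * (v ^ Suc n * A v * deriv \<psi> v / (\<psi> v - z)) + v * (v ^ Suc n * B v * deriv \<psi> v / (\<psi> v - z))"
     by (simp only: add_divide_distrib distrib_left)
   qed (use pos in auto)
   also have "... = cmean r1 (%v. v * (v ^ Suc n * A v * deriv \<psi> v / (\<psi> v - z))) + poly T z"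
    unfolding T(2)[OF z1, symmetric]
    by (rule cmean_add) (use ker0 pos in \<open>auto intro!: continuous_intros cA cB c\<psi>1 cd\<psi>1\<close>)
   finally have "Qz z - poly T z = cmean r1 (%v. v * (v ^ Suc n * A v * deriv \<psi> v / (\<psi> v - z)))" by simp
   also have "norm ... <= r1 * (r1 ^ Suc n * ?a * \<Psi> / d)"
   proof (rule cmean_bound)
    show "continuous_on (sphere 0 r1) (%v. v * (v ^ Suc n * A v * deriv \<psi> v / (\<psi> v - z)))"
     using ker0 by (intro continuous_intros cA c\<psi>1 cd\<psi>1) auto
    fix v :: complex assume v: "norm v = r1"
    have "norm (v ^ Suc n * A v * deriv \<psi> v) <= r1 ^ Suc n * ?a * \<Psi>"
     unfolding norm_mult norm_power v using A_bound[OF v] \<Psi>(2)[OF v] pos K1 q0 rr \<rho>' r01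
     by (intro mult_mono mult_nonneg_nonneg) auto
    moreover have "d <= norm (\<psi> v - z)" using d(2)[OF v w] by (simp add: z_def)
    moreover have "0 <= r1 ^ Suc n * ?a * \<Psi>"
     using pos K1 q0 rr \<rho>' r01 \<Psi> by (intro mult_nonneg_nonneg) auto
    ultimately have "norm (v ^ Suc n * A v * deriv \<psi> v) / norm (\<psi> v - z)
      <= r1 ^ Suc n * ?a * \<Psi> / d"
     using d(1) by (intro frac_le) auto
    thus "norm (v * (v ^ Suc n * A v * deriv \<psi> v / (\<psi> v - z)))
     <= r1 * (r1 ^ Suc n * ?a * \<Psi> / d)"
     unfolding norm_mult[of v] norm_divide v using pos by (intro mult_left_mono) auto
   qed (use pos in auto)
   finally have QT: "norm (Qz z - poly T z) <= r1 * (r1 ^ Suc n * ?a * \<Psi> / d)" .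
   have wR: "norm w < R2" using w radii by simp
   have "J r3 n w - trf (poly T) w = (Qz z - poly T z) * q w"
    using Q\<xi>[OF wR] q_nz[OF wR] by (simp add: z_def trf_def q_def left_diff_distrib mult.assoc)
   hence "norm (J r3 n w - trf (poly T) w) = norm (Qz z - poly T z) * norm (q w)" by (simp add: norm_mult)
   also have "... <= (r1 * (r1 ^ Suc n * ?a * \<Psi> / d)) * q1"
    using QT q1(2)[OF w] by (rule mult_mono[OF _ _ order_trans[OF norm_ge_zero QT]]) simp
   also have "... = K * \<tau> ^ n"
    by (simp add: K_def \<tau>_def power_divide power_mult_distrib mult_ac)
   finally show ?thesis .
  qed
  thus ?thesis using T(1) by blast
 qed
 ultimately show ?thesis using \<tau> by (intro that) auto
qed

end

lemma cip_cong:
 assumes "!!w. norm w = 1 ==> F w = F' w" "!!w. norm w = 1 ==> G w = G' w"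
 shows "cip F G = cip F' G'"
 unfolding cip_def using assms by (intro cmean_cong) auto

lemma nsq_cong:
 assumes "!!w. norm w = 1 ==> F w = G w" shows "nsq F = nsq G"
 unfolding nsq_def using assms circlepath_norm[of 1] by (intro integral_cong) auto

context core
begin

lemma trf_diff: "trf (poly (f - g)) w = trf (poly f) w - trf (poly g) w"
 by (simp add: trf_def left_diff_distrib)

lemma trf_smult: "trf (poly (smult a f)) w = a * trf (poly f) w"
 by (simp add: trf_def)

lemma trf_poly_hol: "trf (poly f) holomorphic_on ball 0 R2"
 by (rule trf_hol) (intro holomorphic_intros)

lemma cip_trf_low:
 assumes F: "continuous_on (sphere 0 1) F" and f: "degree f < n"
  and orth: "!!m. m < n ==> cip F (trf (%z. z ^ m)) = 0"
 shows "cip F (trf (poly f)) = 0"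
proof -
 have cm: "continuous_on (sphere 0 1) (trf (%z. z ^ m))" for m
 proof -
  have "trf (%z. z ^ m) = trf (poly (monom 1 m))" by (simp add: trf_def poly_monom fun_eq_iff)
  thus ?thesis using cont_trf[of "monom 1 m"] by simp
 qed
 have "cip F (trf (poly f)) = cmean 1 (%w. \<Sum>i\<le>degree f. cnj (coeff f i) * (F w * cnj (trf (%z. z ^ i) w)))"
  unfolding cip_def
  by (rule cmean_cong)
    (simp_all add: trf_def poly_altdef sum_distrib_left sum_distrib_right mult_ac)
 also have "... = (\<Sum>i\<le>degree f. cmean 1 (%w. cnj (coeff f i) * (F w * cnj (trf (%z. z ^ i) w))))"
  by (intro cmean_sum) (auto intro!: continuous_intros cm F)
 also have "... = (\<Sum>i\<le>degree f. cnj (coeff f i) * cip F (trf (%z. z ^ i)))"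
  by (simp add: cmean_mult_left cip_def)
 also have "... = 0" using f orth by (intro sum.neutral) auto
 finally show ?thesis .
qed

text \<open>Equal to \<open>\<Delta>_e(\<infinity>) / [\<phi>'(\<infinity>)]^(-n-1/2)\<close>, the
  factor on the left of the theorem, and reciprocal to the constant in \<open>cip_E\<close>.\<close>

definition kap :: "nat \<Rightarrow> real" where "kap n = Dinf / (c ^ n * sqrt c)"

lemma kap_pos: "0 < kap n" using c Dinf by (simp add: kap_def)

text \<open>Put \<open>A = kap n * trf P_n\<close>. By orthogonality and \<open>cip_E\<close>,
  \<open>t * A\<close> with \<open>t = 1 / nsq A\<close> is the projection of \<open>E n\<close>
  onto the transformed polynomials of degree at most \<open>n\<close>. Since \<open>J r3 n\<close>
  differs from \<open>E n\<close> by a function orthogonal to these, \<open>t * A\<close> is at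
  least as close to the approximant \<open>T\<close> as \<open>J r3 n\<close> is.\<close>

lemma main_approx:
 fixes P :: "nat \<Rightarrow> complex poly"
 assumes P: "!!n. degree (P n) = n" "!!n. lead_coeff (P n) = 1"
  and orth: "!!n m. m < n ==> cip (trf (poly (P n))) (trf (%z. z ^ m)) = 0"
 obtains K \<tau> N where "0 < K" "0 < \<tau>" "\<tau> < \<rho>"
  "!!n w. N <= n ==> norm w < 1 ==>
   (norm (of_real (kap n) * trf (poly (P n)) w - J r3 n w))\<^sup>2 <= (K * \<tau> ^ n)\<^sup>2 / (1 - norm w)"
proof -
 have \<rho>0: "0 < \<rho>" using radii \<sigma>_pos by simp
 obtain K \<tau> where K: "0 < K" "0 < \<tau>" "\<tau> < \<rho>"
  "!!n. \<exists>T. degree T <= n \<and> (\<forall>w. norm w <= 1 \<longrightarrow> norm (J r3 n w - trf (poly T) w) <= K * \<tau> ^ n)"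
  using Q_approx by blast
 \<comment> \<open>Between \<open>\<rho>\<close> and \<open>sqrt \<rho>\<close>: the inner part
   \<open>Jm\<close> decays like \<open>\<rho>'^n\<close>, and it is the square of its norm that
   must beat \<open>\<rho>^n\<close>.\<close>
 define \<rho>' where "\<rho>' = (\<rho> + sqrt \<rho>) / 2"
 have "\<rho>\<^sup>2 < \<rho>" using \<rho>0 radii by (simp add: power2_eq_square)
 hence "\<rho> < sqrt \<rho>" by (rule real_less_rsqrt)
 moreover have "sqrt \<rho> < 1" using radii \<rho>0 by (simp add: real_less_lsqrt)
 ultimately have \<rho>': "\<rho> < \<rho>'" "\<rho>' < 1" "\<rho>' < sqrt \<rho>" "0 < \<rho>'" using \<rho>0 by (auto simp: \<rho>'_def simp del: real_sqrt_lt_1_iff)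
 have "\<rho>'\<^sup>2 < (sqrt \<rho>)\<^sup>2" using \<rho>' by (intro power_strict_mono) auto
 hence \<rho>'2: "\<rho>'\<^sup>2 < \<rho>" using \<rho>0 by simp
 obtain K1 where K1: "0 < K1" "!!n w. w \<in> sphere 0 1 ==> norm (J \<rho>' n w) <= K1 * \<rho>' ^ n"
 proof (rule J_bound[of \<rho>' "sphere 0 1"])
  fix v w :: complex assume "norm v = \<rho>'" "w \<in> sphere 0 1"
  thus "\<eta> v ~= w" using \<eta>_lt[of v] \<rho>' radii by auto
 qed (use \<rho>' radii in auto)
 define \<tau>' where "\<tau>' = max \<tau> (\<rho>'\<^sup>2)"
 have \<tau>': "0 < \<tau>'" "\<tau>' < \<rho>" "\<tau> <= \<tau>'" "\<rho>'\<^sup>2 <= \<tau>'" "\<tau>' < 1" using K \<rho>'2 radii by (auto simp: \<tau>'_def)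
 define B where "B = 6 * K\<^sup>2 + 3 * K1\<^sup>2"
 have B: "0 < B" using K K1 by (simp add: B_def add_pos_pos)
 have "(%n. B * \<tau>' ^ n) \<longlonglongrightarrow> B * 0" using \<tau>' by (intro tendsto_intros LIMSEQ_power_zero) auto
 hence "\<forall>\<^sub>F n in sequentially. B * \<tau>' ^ n < 1 / 2" by (rule order_tendstoD) simp
 \<comment> \<open>From \<open>N\<close> on \<open>1 - t\<close> is below one half, so that
   \<open>nsq A\<close> is at most 2.\<close>
 then obtain N where N: "!!n. N <= n ==> B * \<tau>' ^ n < 1 / 2" unfolding eventually_sequentially by blast
 define K2 where "K2 = sqrt (6 * K\<^sup>2 + 6 * B\<^sup>2)"
 have K2: "0 < K2" "K2\<^sup>2 = 6 * K\<^sup>2 + 6 * B\<^sup>2" using K B by (auto simp: K2_def add_pos_pos)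
 show ?thesis
 proof (rule that[of K2 \<tau>' N])
  fix n :: nat and w :: complex assume n: "N <= n" and w: "norm w < 1"
  obtain T where T: "degree T <= n" "!!w. norm w <= 1 ==> norm (J r3 n w - trf (poly T) w) <= K * \<tau> ^ n"
   using K(4)[of n] by blast
  define NP where "NP = smult (of_real (kap n)) (P n)"
  let ?Kt = "(K * \<tau> ^ n)\<^sup>2"
  let ?JT = "%w. J r3 n w - trf (poly T) w"
  define A where "A = trf (poly NP)"
  have degNP: "degree NP = n" using P(1)[of n] kap_pos[of n] by (simp add: NP_def)
  have cNP: "coeff NP n = of_real (kap n)" using P(1)[of n] P(2)[of n] by (simp add: NP_def)
  have cA: "continuous_on (sphere 0 1) A" unfolding A_def by (rule cont_trf)
  have A_low: "cip A (trf (poly f)) = 0" if "degree f < n" for f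
  proof (rule cip_trf_low[OF cA that])
   fix m assume "m < n"
   have "A = (%w. of_real (kap n) * trf (poly (P n)) w)" by (simp add: A_def NP_def trf_smult fun_eq_iff)
   hence "cip A (trf (%z. z ^ m)) = of_real (kap n) * cip (trf (poly (P n))) (trf (%z. z ^ m))"
    by (simp only: cip_scale_left)
   thus "cip A (trf (%z. z ^ m)) = 0" using orth[OF \<open>m < n\<close>] by simp
  qed
  have kk: "kap n * (c ^ n * sqrt c / Dinf) = 1" using c Dinf by (simp add: kap_def)
  have AE: "cip A (E n) = 1"
   using cip_E[of NP n] degNP kk by (simp add: A_def cNP flip: of_real_mult)
  define a where "a = nsq A"
  have AA: "cip A A = of_real a" unfolding a_def by (rule cip_self[OF cA])
  have EA: "cip (E n) A = 1" using cip_cnj[OF cA cont_E[of n]] AE by simp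
  have "0 <= nsq (%w. E n w - A w)" by (rule nsq_nonneg)
  also have "... = 1 - 2 + a" using nsq_diff[OF cont_E cA] by (simp add: EA nsq_E a_def)
  finally have a1: "1 <= a" by simp
  define t where "t = 1 / a"
  have t: "0 < t" "t <= 1" "t * a = 1" using a1 by (auto simp: t_def)
  have proj: "cip (trf (poly f)) A = coeff f n / of_real (kap n) * of_real a" if f: "degree f <= n" for f
  proof -
   define b where "b = coeff f n / of_real (kap n)"
   have kn: "complex_of_real (kap n) ~= 0" using kap_pos[of n] by simp
   \<comment> \<open>Subtracting this multiple of the orthogonal polynomial lowers the degree below
     \<open>n\<close>, where \<open>A\<close> is orthogonal to everything.\<close>
   define g where "g = f - smult b NP"
   have "cip A (trf (poly g)) = 0"
   proof (cases "g = 0")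
    case True
    thus ?thesis by (simp add: trf_def cip_def)
   next
    case False
    have "degree g <= n" unfolding g_def using f degNP
     by (intro degree_diff_le) (auto intro: order_trans[OF degree_smult_le])
    moreover have "coeff g n = 0" using kn by (simp add: g_def cNP b_def)
    ultimately have "degree g < n" using False by (metis leading_coeff_0_iff le_neq_implies_less)
    thus ?thesis by (rule A_low)
   qed
   hence 0: "cip (trf (poly g)) A = 0" using cip_cnj[OF cA cont_trf[of g]] by simp
   have "trf (poly g) = (%w. trf (poly f) w - b * A w)"
    by (simp add: g_def trf_diff trf_smult A_def fun_eq_iff)
   hence "cip (trf (poly g)) A = cip (trf (poly f)) A - cip (%w. b * A w) A"
    using cip_diff_left[OF cA cont_trf[of f], of "%w. b * A w"] cA by (simp add: continuous_intros)
   thus ?thesis using 0 by (simp only: cip_scale_left AA b_def) simp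
  qed
  define Jm where "Jm = J \<rho>' n"
  have cJm: "continuous_on (sphere 0 1) Jm" unfolding Jm_def using \<rho>' by (intro cont_J1) auto
  have c3: "continuous_on (sphere 0 1) (J r3 n)" by (rule continuous_on_subset[OF cont_J3]) auto
  have E_eq: "E n w = J r3 n w - Jm w" if "norm w = 1" for w
   using J1_eq[of \<rho>' w n] \<rho>' that by (simp add: E_def Jm_def)
  define f where "f = smult (of_real t) NP - T"
  define g where "g = trf (poly f)"
  have degf: "degree f <= n" unfolding f_def using T degNP
   by (intro degree_diff_le) (auto intro: order_trans[OF degree_smult_le])
  have g: "g w = of_real t * A w - trf (poly T) w" for w by (simp add: g_def f_def trf_diff trf_smult A_def)
  have cg: "continuous_on (sphere 0 1) g" unfolding g_def by (rule cont_trf)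
  have cT: "continuous_on (sphere 0 1) ?JT" by (intro continuous_intros c3 cont_trf)
  have ctA: "continuous_on (sphere 0 1) (%w. of_real t * A w)" by (intro continuous_intros cA)
  \<comment> \<open>\<open>J r3 n - T\<close> is \<open>g\<close> plus two functions orthogonal to
    \<open>g\<close>: the defect \<open>E n - t * A\<close> of the projection and the inner part
    \<open>Jm\<close>.\<close>
  have "cip g g = cip g (%w. (J r3 n w - trf (poly T) w) - (E n w - of_real t * A w) - Jm w)"
   by (rule cip_cong) (simp_all add: g E_eq)
  also have "... = cip g ?JT - (cip g (E n) - cip g (%w. of_real t * A w)) - cip g Jm"
   using cip_diff_right[OF cg _ cJm, of "%w. (J r3 n w - trf (poly T) w) - (E n w - of_real t * A w)"]
    cip_diff_right[OF cg cT, of "%w. E n w - of_real t * A w"] cip_diff_right[OF cg cont_E[of n] ctA]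
    continuous_on_diff[OF cT continuous_on_diff[OF cont_E[of n] ctA]] continuous_on_diff[OF cont_E[of n] ctA]
   by simp
  also have "cip g (%w. of_real t * A w) = coeff f n / of_real (kap n)"
  proof -
   have "cip g (%w. of_real t * A w) = of_real t * (coeff f n / of_real (kap n) * of_real a)"
    using proj[OF degf] by (simp add: cip_scale_right g_def)
   also have "... = coeff f n / of_real (kap n) * of_real (t * a)" by simp
   finally show ?thesis using t by simp
  qed
  also have "cip g (E n) = coeff f n / of_real (kap n)"
  proof -
   have "complex_of_real (c ^ n * sqrt c / Dinf) = 1 / of_real (kap n)" by (simp add: kap_def)
   thus ?thesis using cip_E[OF degf] by (simp only: g_def) simp
  qed
  also have "cip g Jm = 0"
  proof -
   have "cip Jm g = 0" unfolding Jm_def g_def using \<rho>' by (intro J_orthogonal trf_poly_hol) auto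
   thus ?thesis using cip_cnj[OF cJm cg] by simp
  qed
  finally have gg: "cip g g = cip g ?JT" by simp
  have JT: "nsq ?JT <= ?Kt"
   by (rule nsq_mono[OF cT]) (use T in auto)
  hence g2: "nsq g <= ?Kt" using nsq_projection[OF cg cT gg] by simp
  have "nsq (%w. of_real t * A w) = t * (t * a)"
   unfolding nsq_scale a_def by (simp add: power2_eq_square)
  \<comment> \<open>The loss of norm is a squared distance; this is where \<open>\<rho>'^2\<close>
    comes from.\<close>
  hence "1 - t = nsq (%w. E n w - of_real t * A w)"
   using nsq_diff[OF cont_E ctA] t by (simp add: cip_scale_right EA nsq_E)
  also have "... = nsq (%w. (J r3 n w - trf (poly T) w) + (- 1) * g w + (- 1) * Jm w)"
   by (rule nsq_cong) (simp add: E_eq g)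
  also have "... <= 3 * (nsq ?JT + nsq (%w. (- 1) * g w) + nsq (%w. (- 1) * Jm w))"
   by (rule nsq_add3) (intro continuous_intros cg cJm cT)+
  also have "... <= 3 * (?Kt + ?Kt + (K1 * \<rho>' ^ n)\<^sup>2)"
  proof -
   have "nsq Jm <= (K1 * \<rho>' ^ n)\<^sup>2" by (rule nsq_mono[OF cJm]) (use K1 in "auto simp: Jm_def")
   thus ?thesis using JT g2 unfolding nsq_scale by simp
  qed
  also have "... <= B * \<tau>' ^ n"
  proof -
   have "(\<tau> ^ n)\<^sup>2 <= \<tau>' ^ n"
   proof -
    have "(\<tau> ^ n)\<^sup>2 = \<tau> ^ n * \<tau> ^ n" by (simp add: power2_eq_square)
    also have "... <= \<tau>' ^ n * 1" using K \<tau>' by (intro mult_mono power_mono power_le_one) auto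
    finally show ?thesis by simp
   qed
   hence 1: "K\<^sup>2 * (\<tau> ^ n)\<^sup>2 <= K\<^sup>2 * \<tau>' ^ n" by (rule mult_left_mono) simp
   have "(\<rho>' ^ n)\<^sup>2 = (\<rho>'\<^sup>2) ^ n" by (simp add: mult.commute flip: power_mult)
   also have "... <= \<tau>' ^ n" using \<tau>' by (intro power_mono) auto
   finally have 2: "K1\<^sup>2 * (\<rho>' ^ n)\<^sup>2 <= K1\<^sup>2 * \<tau>' ^ n" by (rule mult_left_mono) simp
   show ?thesis using 1 2 by (simp add: B_def power_mult_distrib algebra_simps)
  qed
  finally have t1: "1 - t <= B * \<tau>' ^ n" .
  hence "1 / 2 <= t" using N[OF n] by simp
  hence a2: "a <= 2" using mult_right_mono[of "1 / 2" t a] a1 t by simp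
  define F where "F w = A w - J r3 n w" for w
  have "nsq F = nsq (%w. g w + (- 1) * (J r3 n w - trf (poly T) w) + of_real (1 - t) * A w)"
   by (rule nsq_cong) (simp add: F_def g algebra_simps)
  also have "... <= 3 * (nsq g + nsq (%w. (- 1) * (J r3 n w - trf (poly T) w)) + nsq (%w. of_real (1 - t) * A w))"
   by (rule nsq_add3) (intro continuous_intros cg cA cT)+
  also have "... <= 3 * (?Kt + ?Kt + (B * \<tau>' ^ n)\<^sup>2 * 2)"
  proof -
   have "nsq (%w. of_real (1 - t) * A w) = (1 - t)\<^sup>2 * a"
    unfolding nsq_scale a_def norm_of_real power2_abs ..
   also have "... <= (B * \<tau>' ^ n)\<^sup>2 * 2" using t t1 a1 a2 by (intro mult_mono power_mono) auto
   finally show ?thesis using JT g2 unfolding nsq_scale by simp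
  qed
  also have "... <= (K2 * \<tau>' ^ n)\<^sup>2"
  proof -
   have "?Kt <= (K * \<tau>' ^ n)\<^sup>2" using K \<tau>' by (intro power_mono mult_left_mono) auto
   thus ?thesis by (simp add: power_mult_distrib K2(2) algebra_simps)
  qed
  finally have F2: "nsq F <= (K2 * \<tau>' ^ n)\<^sup>2" .
  have "F holomorphic_on (ball 0 R2 - \<eta> ` sphere 0 r3)"
   unfolding F_def A_def by (intro holomorphic_intros J3_hol_near hol_subset[OF trf_poly_hol]) auto
  from pointwise_le_nsq[OF J3_hol_near(1) this J3_hol_near(3) w]
  have "(norm (F w))\<^sup>2 <= (K2 * \<tau>' ^ n)\<^sup>2 / (1 - norm w)"
   by (rule order_trans) (use F2 w in "intro divide_right_mono, auto")
  thus "(norm (of_real (kap n) * trf (poly (P n)) w - J r3 n w))\<^sup>2 <= (K2 * \<tau>' ^ n)\<^sup>2 / (1 - norm w)"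
   by (simp add: F_def A_def NP_def trf_smult)
 qed (use K2 \<tau>' in auto)
qed

end

subsection \<open>Darboux expansions with a kernel close to the critical circle\<close>

lemma segment_dist:
 fixes b x :: complex
 assumes "norm b <= norm x" "d <= dist x b" "0 <= s" "s <= 1"
 shows "d / 2 <= dist x (of_real s * b)"
proof -
 have "b - of_real s * b = of_real (1 - s) * b" by (simp add: algebra_simps)
 hence "norm (b - of_real s * b) = (1 - s) * norm b" using assms by (simp only: norm_mult norm_of_real)
 hence 1: "d - (1 - s) * norm b <= dist x (of_real s * b)"
  using dist_triangle[of x b "of_real s * b"] assms(2) by (simp add: dist_norm norm_minus_commute)
 have "norm x - s * norm b <= dist x (of_real s * b)"
  using norm_triangle_ineq2[of x "of_real s * b"] assms by (simp add: dist_norm norm_mult)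
 hence 2: "(1 - s) * norm b <= dist x (of_real s * b)" using assms(1) by (simp add: left_diff_distrib)
 show ?thesis using 1 2 by linarith
qed

lemma bpow_bound:
 assumes "0 < \<rho>" "norm b = \<rho>" "0 < e" "e <= dist v b" "\<rho> / 2 <= norm v" "norm v <= \<rho> + 1"
 shows "norm (bpow b x v) <= (e / (\<rho> + 1)) powr (- x) + (2 * (2 * \<rho> + 1) / \<rho>) powr (- x)"
 unfolding norm_bpow
proof (rule powr_between)
 have v: "0 < norm v" using assms(1,5) by linarith
 hence "1 - b / v = (v - b) / v" by (auto simp: field_simps)
 hence eq: "norm (1 - b / v) = dist v b / norm v" by (simp add: norm_divide dist_norm)
 show "e / (\<rho> + 1) <= norm (1 - b / v)" unfolding eq using assms v by (intro frac_le) auto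
 have "dist v b <= 2 * \<rho> + 1" using norm_triangle_ineq4[of v b] assms by (simp add: dist_norm)
 hence "dist v b / norm v <= (2 * \<rho> + 1) / (\<rho> / 2)" using assms v by (intro frac_le) auto
 thus "norm (1 - b / v) <= 2 * (2 * \<rho> + 1) / \<rho>" unfolding eq by simp
 show "0 < e / (\<rho> + 1)" using assms by simp
qed

text \<open>The separation is four times the radius: \<open>segment_dist\<close> halves it for the
  cuts, and moving by \<open>e\<close> inside the ball still leaves distance
  \<open>e\<close>.\<close>

lemma ball_off_segments:
 fixes b :: "'k \<Rightarrow> complex"
 assumes "finite K" "0 < \<rho>" "!!k. k \<in> K ==> norm (b k) = \<rho>" "0 < e" "e <= \<rho> / 2"
  and x: "\<rho> <= norm x" "norm x + e <= \<rho> + 1" "!!k. k \<in> K ==> 4 * e <= dist x (b k)"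
 shows "(%v. \<Prod>k\<in>K. bpow (b k) (\<mu> k) v) holomorphic_on ball x e"
  and "!!v. v \<in> ball x e ==> norm (\<Prod>k\<in>K. bpow (b k) (\<mu> k) v) <=
   (\<Prod>k\<in>K. (e / (\<rho> + 1)) powr (- \<mu> k) + (2 * (2 * \<rho> + 1) / \<rho>) powr (- \<mu> k))"
proof -
 have v: "\<rho> / 2 <= norm v \<and> norm v <= \<rho> + 1" if "v \<in> ball x e" for v
  using that norm_triangle_ineq2[of x v] norm_triangle_ineq2[of v x] assms x
  by (auto simp: dist_norm norm_minus_commute)
 have far: "e <= dist v (of_real s * b k)" if "v \<in> ball x e" "k \<in> K" "0 <= s" "s <= 1" for v k s
 proof -
  have "4 * e / 2 <= dist x (of_real s * b k)" using that x assms(3)[of k] by (intro segment_dist) auto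
  thus ?thesis using dist_triangle[of x "of_real s * b k" v] that(1) by simp
 qed
 show "(%v. \<Prod>k\<in>K. bpow (b k) (\<mu> k) v) holomorphic_on ball x e"
 proof (intro holomorphic_on_prod bpow_holomorphic bpow_off_segment)
  fix k v s assume k: "k \<in> K" and vx: "v \<in> ball x e"
  show "v ~= 0" "v ~= 0" using v[OF vx] assms(2) by auto
  assume "0 <= s" "s <= (1 :: real)"
  thus "v ~= of_real s * b k" using far[OF vx k] assms(4) by fastforce
 qed
 fix u assume u: "u \<in> ball x e"
 show "norm (\<Prod>k\<in>K. bpow (b k) (\<mu> k) u) <=
   (\<Prod>k\<in>K. (e / (\<rho> + 1)) powr (- \<mu> k) + (2 * (2 * \<rho> + 1) / \<rho>) powr (- \<mu> k))"
  unfolding prod_norm[symmetric]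
 proof (rule prod_mono, rule conjI)
  fix k assume k: "k \<in> K"
  show "norm (bpow (b k) (\<mu> k) u) <= (e / (\<rho> + 1)) powr (- \<mu> k) + (2 * (2 * \<rho> + 1) / \<rho>) powr (- \<mu> k)"
   using v[OF u] far[OF u k, of 1] assms k by (intro bpow_bound) auto
 qed simp
qed

text \<open>The factor \<open>k\<close> stands for a regular function times a Cauchy kernel whose
  pole may come within about \<open>t\<close> of the critical circle but stays away from the branch
  points. So it is bounded by \<open>B\<close> near the latter and by \<open>B / t\<close> along the
  circle. The result is polynomial in \<open>1 / t\<close>, with \<open>A\<close> and
  \<open>q\<close> independent of \<open>k\<close>, \<open>n\<close> and \<open>t\<close>.\<close>

lemma darboux_kernel:
 fixes b :: "'k \<Rightarrow> complex" and \<mu> :: "'k \<Rightarrow> real"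
 assumes K: "finite K" and \<rho>: "0 < \<rho>" and b: "!!k. k \<in> K ==> norm (b k) = \<rho>"
  and \<delta>: "0 < \<delta>" "\<delta> <= \<rho> / 2" "\<delta> <= 1" and sep: "!!k l. k \<in> K ==> l \<in> K ==> k ~= l ==> 4 * \<delta> <= dist (b k) (b l)"
  and p: "!!k. k \<in> K ==> \<mu> k <= p"
 obtains A q where "0 < A" "0 < q"
  "!!k n t B. 1 <= n ==> 0 < t ==> t <= 1 ==> t <= \<rho> ==> 0 <= B ==>
   k holomorphic_on {v. \<rho> - t < norm v \<and> norm v < \<rho> + t} ==>
   (!!l. l \<in> K ==> k holomorphic_on ball (b l) \<delta>) ==>
   (!!l v. l \<in> K ==> v \<in> ball (b l) \<delta> ==> norm (k v) <= B) ==>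
   (!!v. \<bar>norm v - \<rho>\<bar> < 3 * t / 4 ==> norm (k v) <= B / t) ==>
   norm (cmean (\<rho> + t / (2 * real n)) (%v. (\<Prod>l\<in>K. bpow (b l) (\<mu> l) v) * k v * v ^ Suc n)
    - (\<Sum>l\<in>K. (\<Prod>i\<in>K - {l}. bpow (b i) (\<mu> i) (b l)) * k (b l) *
       of_real (pochhammer (\<mu> l) (Suc n) / fact (Suc n)) * b l ^ Suc n))
    <= A * B * \<rho> ^ n * real n powr (p - 2) / t ^ q"
proof -
 \<comment> \<open>Large enough for every exponent to reach the value 3 demanded by
   \<open>darboux_bound\<close>; its size affects only \<open>A\<close> and \<open>q\<close>,
   because \<open>n^(p + m - 2) / n^m\<close> is free of \<open>m\<close>.\<close>
 define m where "m = nat \<lceil>3 + \<bar>p\<bar> + (\<Sum>k\<in>K. \<bar>\<mu> k\<bar>)\<rceil>"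
 have "3 + \<bar>p\<bar> + (\<Sum>k\<in>K. \<bar>\<mu> k\<bar>) <= real m" unfolding m_def by (rule real_nat_ceiling_ge)
 moreover have "\<bar>\<mu> k\<bar> <= (\<Sum>k\<in>K. \<bar>\<mu> k\<bar>)" if "k \<in> K" for k using that K by (intro member_le_sum) auto
 moreover have "0 <= (\<Sum>k\<in>K. \<bar>\<mu> k\<bar>)" by (intro sum_nonneg) auto
 ultimately have m: "3 <= \<mu> k + real m" if "k \<in> K" for k using that by force
 have m': "3 <= p + real m"
  using \<open>3 + \<bar>p\<bar> + _ <= _\<close> \<open>0 <= (\<Sum>k\<in>K. \<bar>\<mu> k\<bar>)\<close> by linarith
 have sep': "\<delta> <= dist (b k) (b l)" if "k \<in> K" "l \<in> K" "k ~= l" for k l using sep[OF that] \<delta> by simp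
 show ?thesis
 proof (rule darboux_bound[OF K \<rho> b \<delta>(1) sep' m p m'], assumption, assumption, assumption, assumption, assumption, assumption, goal_cases)
 case (1 A0)
 note A0 = 1(1) and dar = 1(2)
 define e where "e = p + real m - 2"
 have e: "1 <= e" using m' by (simp add: e_def)
 define q0 where "q0 = nat \<lceil>e\<rceil>"
 have q0: "e <= real q0" unfolding q0_def by (rule real_nat_ceiling_ge)
 \<comment> \<open>\<open>\<epsilon> * t\<close> is the radius of the Cauchy discs away from the
   branch points; twice this radius still fits into the ring where \<open>k\<close> is bounded and
   into the balls that avoid the cuts.\<close>
 define \<epsilon> where "\<epsilon> = min (1 / 16) (\<delta> / 16)"
 have \<epsilon>: "0 < \<epsilon>" "\<epsilon> <= 1 / 16" "\<epsilon> <= \<delta> / 16" using \<delta> by (auto simp: \<epsilon>_def)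
 define \<beta> where "\<beta> d S = (\<Prod>k\<in>S. (d / (\<rho> + 1)) powr (- \<mu> k) + (2 * (2 * \<rho> + 1) / \<rho>) powr (- \<mu> k))" for d S
 have \<beta>0: "0 <= \<beta> d S" for d S unfolding \<beta>_def by (intro prod_nonneg) auto
 define C2 where "C2 = (\<Sum>l\<in>K. \<beta> \<delta> (K - {l}))"
 have C2: "0 <= C2" "!!l. l \<in> K ==> \<beta> \<delta> (K - {l}) <= C2"
  unfolding C2_def using K \<beta>0 by (auto intro!: sum_nonneg member_le_sum)
 define C3 where "C3 = \<beta> (\<delta> / 8) K"
 have C3: "0 <= C3" using \<beta>0 by (simp add: C3_def)
 define C' where "C' = C2 + fact m * C3 / \<epsilon> ^ m"
 have C': "0 <= C'" "C2 <= C'" "fact m * C3 / \<epsilon> ^ m <= C'" using C2 C3 \<epsilon> by (auto simp: C'_def)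
 define A where "A = A0 * (C' + 1) * exp (1 / \<rho>) * 2 powr e"
 define q where "q = m + 1 + q0"
 show ?thesis
 proof (rule that[of A q])
  show "0 < A" "0 < q" using A0 C' by (auto simp: A_def q_def)
  fix k :: "complex \<Rightarrow> complex" and n :: nat and t B :: real
  assume n: "1 <= n" and t: "0 < t" "t <= 1" "t <= \<rho>" and B: "0 <= B"
   and k1: "k holomorphic_on {v. \<rho> - t < norm v \<and> norm v < \<rho> + t}"
   and k2: "!!l. l \<in> K ==> k holomorphic_on ball (b l) \<delta>"
   and k3: "!!l v. l \<in> K ==> v \<in> ball (b l) \<delta> ==> norm (k v) <= B"
   and k4: "!!v. \<bar>norm v - \<rho>\<bar> < 3 * t / 4 ==> norm (k v) <= B / t"
  define r where "r = \<rho> + t / (2 * real n)"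
  have n0: "0 < real n" using n by simp
  have "t / (2 * real n) <= t / 2" using n t by (intro divide_left_mono) auto
  hence r: "\<rho> < r" "r <= \<rho> + t / 2" using t n0 by (auto simp: r_def)
  define f where "f v = (\<Prod>l\<in>K. bpow (b l) (\<mu> l) v) * k v" for v
  define g where "g l v = (\<Prod>i\<in>K - {l}. bpow (b i) (\<mu> i) v) * k v" for l v
  define C where "C = C' * B / t ^ (m + 1)"
  have tm: "0 < t ^ (m + 1)" "t ^ (m + 1) <= 1" using t power_le_one[of t "m + 1"] by auto
  have C: "0 <= C" "C' * B <= C"
  proof -
   show "0 <= C" using C' B t by (simp add: C_def)
   have "C' * B * t ^ (m + 1) <= C' * B * 1" using C' B tm by (intro mult_left_mono) auto
   thus "C' * B <= C" using tm by (simp add: C_def field_simps)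
  qed
  have near: "(%v. \<Prod>i\<in>K - {l}. bpow (b i) (\<mu> i) v) holomorphic_on ball (b l) \<delta>"
   "!!v. v \<in> ball (b l) \<delta> ==> norm (\<Prod>i\<in>K - {l}. bpow (b i) (\<mu> i) v) <= \<beta> \<delta> (K - {l})" if l: "l \<in> K" for l
   using ball_off_segments[where K = "K - {l}" and \<rho> = \<rho> and b = b and e = \<delta> and x = "b l" and \<mu> = \<mu>] K \<rho> b l \<delta> sep unfolding \<beta>_def by auto
  have "norm (cmean r (%v. f v * v ^ Suc n)
       - (\<Sum>l\<in>K. g l (b l) * of_real (pochhammer (\<mu> l) (Suc n) / fact (Suc n)) * b l ^ Suc n))
     <= A0 * C * r ^ n / real (Suc n) ^ m * (r - \<rho>) powr (- (p + real m - 2))"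
  proof (rule dar[where r' = "\<rho> + t"])
   show "r < \<rho> + t" "r <= \<rho> + 1" using r t by auto
   show "f holomorphic_on {v. \<rho> < norm v \<and> norm v < \<rho> + t}"
    unfolding f_def using t b
    by (intro holomorphic_intros bpow_holomorphic_ext[of _ \<rho>] hol_subset[OF k1]) auto
   show "g l holomorphic_on ball (b l) \<delta>" if "l \<in> K" for l
    unfolding g_def using that by (intro holomorphic_on_mult near k2)
   show "norm (g l v) <= C" if "l \<in> K" "v \<in> ball (b l) \<delta>" for l v
   proof -
    have "norm (g l v) <= C' * B"
     unfolding g_def norm_mult
     using near(2)[OF that] C2(2)[OF that(1)] C' k3[OF that] by (intro mult_mono) auto
    thus ?thesis using C by simp
   qed
   show "f v = bpow (b l) (\<mu> l) v * g l v" if "l \<in> K" for l v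
    unfolding f_def g_def using that K by (simp add: prod.remove mult.assoc)
   fix v assume v: "norm v = r" and far: "!!l. l \<in> K ==> \<delta> / 2 <= dist v (b l)"
   define s where "s = \<epsilon> * t"
   have s: "0 < s" "2 * s <= t / 8" "2 * s <= \<delta> / 8"
   proof -
    show "0 < s" using \<epsilon> t by (simp add: s_def)
    have "\<epsilon> * t <= 1 / 16 * t" using \<epsilon> t by (intro mult_right_mono) auto
    thus "2 * s <= t / 8" by (simp add: s_def)
    have "\<epsilon> * t <= \<delta> / 16 * 1" using \<epsilon> t \<delta> by (intro mult_mono) auto
    thus "2 * s <= \<delta> / 8" by (simp add: s_def)
   qed
   have d8: "\<delta> / 8 <= \<rho> / 2" "norm v + \<delta> / 8 <= \<rho> + 1" using v r t \<delta> by auto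
   have ks: "4 * (\<delta> / 8) <= dist v (b l)" if "l \<in> K" for l using far[OF that] by simp
   have "\<rho> <= norm v" using v r by simp
   hence N: "(%v. \<Prod>l\<in>K. bpow (b l) (\<mu> l) v) holomorphic_on ball v (\<delta> / 8)"
    "!!x. x \<in> ball v (\<delta> / 8) ==> norm (\<Prod>l\<in>K. bpow (b l) (\<mu> l) x) <= C3"
    using ball_off_segments[where K = K and \<rho> = \<rho> and b = b and e = "\<delta> / 8" and x = v and \<mu> = \<mu>]
     K \<rho> b \<delta> d8 ks unfolding C3_def \<beta>_def by auto
   have nx: "\<bar>norm x - \<rho>\<bar> < 3 * t / 4" if "x \<in> ball v (2 * s)" for x
    using that norm_triangle_ineq2[of x v] norm_triangle_ineq2[of v x] v r s t
    by (auto simp: dist_norm norm_minus_commute abs_if)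
   have sub: "ball v (2 * s) \<subseteq> ball v (\<delta> / 8)" using s by (intro subset_ball)
   have "k holomorphic_on ball v (2 * s)"
    by (rule hol_subset[OF k1]) (use nx t in "force simp: abs_if split: if_splits")
   hence fh: "f holomorphic_on ball v (2 * s)" unfolding f_def by (intro holomorphic_on_mult hol_subset[OF N(1) sub])
   have "norm ((deriv ^^ m) f v) <= fact m * (C3 * (B / t)) / s ^ m"
   proof (rule Cauchy_inequality)
    show "f holomorphic_on ball v s" using fh by (rule hol_subset) (use s in auto)
    show "continuous_on (cball v s) f"
     by (rule hol_cont[OF fh]) (use s in auto)
    fix x assume "norm (v - x) = s"
    hence x: "x \<in> ball v (2 * s)" using s by (simp add: dist_norm)
    hence x8: "x \<in> ball v (\<delta> / 8)" using sub by blast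
    show "norm (f x) <= C3 * (B / t)"
     unfolding f_def norm_mult using k4[OF nx[OF x]] N(2)[OF x8] C3
     by (intro mult_mono) auto
   qed (rule s)
   also have "... = fact m * C3 / \<epsilon> ^ m * B / t ^ (m + 1)"
    using t \<epsilon> by (simp add: s_def power_mult_distrib field_simps)
   also have "... <= C" unfolding C_def using C' B tm by (intro divide_right_mono mult_right_mono) auto
   finally show "norm ((deriv ^^ m) f v) <= C" .
  qed (use C r in auto)
  also have "... <= A * B * \<rho> ^ n * real n powr (p - 2) / t ^ q"
  proof -
   have rn: "r ^ n <= \<rho> ^ n * exp (1 / \<rho>)"
   proof -
    have "1 + t / (2 * real n * \<rho>) <= exp (t / (2 * real n * \<rho>))" by (rule exp_ge_add_one_self)
    hence "\<rho> * (1 + t / (2 * real n * \<rho>)) <= \<rho> * exp (t / (2 * real n * \<rho>))"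
     using \<rho> by (intro mult_left_mono) auto
    moreover have "\<rho> * (1 + t / (2 * real n * \<rho>)) = r" using \<rho> by (simp add: r_def field_simps)
    ultimately have "r <= \<rho> * exp (t / (2 * real n * \<rho>))" by simp
    hence "r ^ n <= (\<rho> * exp (t / (2 * real n * \<rho>))) ^ n" using r \<rho> by (intro power_mono) auto
    also have "... = \<rho> ^ n * exp (t / (2 * \<rho>))"
     using n0 \<rho> by (simp add: power_mult_distrib flip: exp_of_nat_mult)
    also have "... <= \<rho> ^ n * exp (1 / \<rho>)"
     using t \<rho> by (intro mult_left_mono) (auto simp: field_simps)
    finally show ?thesis .
   qed
   have pw: "(r - \<rho>) powr (- e) <= 2 powr e * real n powr e / t ^ q0"
   proof -
    have "(r - \<rho>) powr (- e) = t powr (- e) * (2 powr e * real n powr e)"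
     using t n0 by (simp add: r_def powr_divide powr_mult powr_minus_divide)
    moreover have "t powr (- e) <= 1 / t ^ q0"
    proof -
     have "t powr (- e) <= t powr (- real q0)" using q0 t by (intro powr_mono') auto
     thus ?thesis using t by (simp add: powr_minus_divide powr_realpow)
    qed
    ultimately show ?thesis
     using mult_right_mono[of "t powr (- e)" "1 / t ^ q0" "2 powr e * real n powr e"] by simp
   qed
   have "A0 * C * r ^ n / real (Suc n) ^ m * (r - \<rho>) powr (- e)
    <= A0 * C * (\<rho> ^ n * exp (1 / \<rho>)) / real n ^ m * (2 powr e * real n powr e / t ^ q0)"
    using A0 C rn pw r n0 \<rho> by (intro mult_mono frac_le power_mono) auto
   also have "... = A0 * C' * exp (1 / \<rho>) * 2 powr e * B * \<rho> ^ n * (real n powr e / real n ^ m) / t ^ q"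
    by (simp add: C_def q_def power_add mult_ac)
   also have "real n powr e / real n ^ m = real n powr (p - 2)"
    using n0 by (simp add: e_def powr_diff powr_add powr_realpow)
   also have "A0 * C' * exp (1 / \<rho>) * 2 powr e * B * \<rho> ^ n * real n powr (p - 2) / t ^ q
     <= A * B * \<rho> ^ n * real n powr (p - 2) / t ^ q"
    unfolding A_def using A0 B \<rho> t C' by (intro divide_right_mono mult_right_mono mult_left_mono) auto
   finally show ?thesis by (simp add: e_def)
  qed
  finally show "norm (cmean (\<rho> + t / (2 * real n)) (%v. (\<Prod>l\<in>K. bpow (b l) (\<mu> l) v) * k v * v ^ Suc n)
    - (\<Sum>l\<in>K. (\<Prod>i\<in>K - {l}. bpow (b i) (\<mu> i) (b l)) * k (b l) *
       of_real (pochhammer (\<mu> l) (Suc n) / fact (Suc n)) * b l ^ Suc n))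
    <= A * B * \<rho> ^ n * real n powr (p - 2) / t ^ q"
   by (simp only: f_def g_def r_def)
 qed
 qed
qed

lemma exp_minus_le_power:
 fixes x :: real
 assumes "0 < x" shows "exp (- x) <= fact q / x ^ q"
proof -
 have "x ^ q / fact q <= exp x"
 proof -
  have s: "(%n. x ^ n /\<^sub>R fact n) sums exp x" by (rule exp_converges)
  have "(\<Sum>n\<in>{q}. x ^ n /\<^sub>R fact n) <= exp x"
   unfolding exp_def using assms by (intro sum_le_suminf sums_summable[OF s]) auto
  thus ?thesis by (simp add: divide_inverse mult.commute)
 qed
 thus ?thesis using assms by (simp add: exp_minus field_simps)
qed

section \<open>Singular expansion of the Cauchy integral at the branch points\<close>

locale core2 = core \<psi> \<phi> r0 c \<sigma> \<rho> R1 R2 \<eta> \<xi> p Dh D C Dinf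
 for \<psi> \<phi> r0 c \<sigma> \<rho> R1 R2 \<eta> \<xi> p Dh D C Dinf +
 fixes K :: "nat set" and b :: "nat \<Rightarrow> complex" and lam :: "nat \<Rightarrow> real" and D0 :: "complex \<Rightarrow> complex" and \<Lambda> :: real
 assumes K: "finite K" and b: "!!k. k \<in> K ==> norm (b k) = \<rho>" and b_inj: "inj_on b K"
  and D0_hol: "D0 holomorphic_on ext_disk \<sigma>"
  and D_eq: "!!v. \<rho> < norm v ==> D v = D0 v * (\<Prod>k\<in>K. bpow (b k) (lam k) v)"
  and lam_le: "!!k. k \<in> K ==> lam k <= \<Lambda>"
begin

text \<open>The continuation of \<open>D\<close> across the critical circle; outside that circle the
  two agree.\<close>

definition DD where "DD v = D0 v * (\<Prod>k\<in>K. bpow (b k) (lam k) v)"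

definition H where "H v = D0 v * C v * Dh (\<eta> v) / p (\<eta> v)"

definition N :: "nat \<Rightarrow> complex" where "N l = (\<Prod>i\<in>K - {l}. bpow (b i) (lam i) (b l))"

text \<open>The coefficient of \<open>b ^ Suc n\<close> in \<open>cmean_bpow\<close>; the index
  \<open>Suc n\<close> results from the factor \<open>v\<close> in front of the kernel of
  \<open>J\<close>.\<close>

definition cf :: "real \<Rightarrow> nat \<Rightarrow> real" where "cf x n = pochhammer x (Suc n) / fact (Suc n)"

text \<open>The Darboux prediction for \<open>J\<close>: \<open>N l * H (b l)\<close> is the value
  at \<open>b l\<close> of all factors of \<open>M\<close> except the singular one.\<close>

definition Sm :: "nat \<Rightarrow> complex \<Rightarrow> complex" where
 "Sm n w = (\<Sum>l\<in>K. N l * (H (b l) / (\<eta> (b l) - w)) * of_real (cf (lam l) n) * b l ^ Suc n)"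

lemma \<rho>_pos: "0 < \<rho>" using radii \<sigma>_pos by simp

lemma b_Ann: "k \<in> K ==> b k \<in> Ann" using b[of k] radii by auto

lemma H_hol: "H holomorphic_on Ann"
 unfolding H_def using radii p_nz[OF \<eta>_inR2]
 by (intro holomorphic_intros hol_subset[OF D0_hol] hol_subset[OF C_hol]
    hol_subset[OF on_ball[OF Dh_hol]] hol_subset[OF on_ball[OF p_hol]])
   (auto simp: ext_disk_def)

lemma M_eq: "\<rho> < norm v ==> M v = (\<Prod>k\<in>K. bpow (b k) (lam k) v) * H v"
 by (simp add: M_def D_eq H_def)

text \<open>The ring \<open>\<sigma>1 <= |v| <= r3\<close> contains all the contours, and \<open>t1\<close>, \<open>\<delta>1\<close> measure the room in it.\<close>

definition \<sigma>1 where "\<sigma>1 = (\<sigma> + \<rho>) / 2"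
definition ring where "ring = cball 0 r3 - ball (0 :: complex) \<sigma>1"
definition t1 where "t1 = min (\<rho> - \<sigma>1) (1 - \<rho>)"

lemma \<sigma>1: "\<sigma> < \<sigma>1" "\<sigma>1 < \<rho>" "0 < \<sigma>1" using radii \<sigma>_pos by (auto simp: \<sigma>1_def)

lemma t1: "0 < t1" "t1 <= 1" "t1 <= \<rho>" "t1 <= \<rho> - \<sigma>1" "t1 <= 1 - \<rho>"
 using \<sigma>1 radii by (auto simp: t1_def)

lemma ring: "compact ring" "ring \<subseteq> Ann"
 using \<sigma>1 r3 by (auto simp: ring_def intro!: compact_diff)

lemma ringI: "\<sigma>1 <= norm v ==> norm v <= 1 ==> v \<in> ring"
 using r3 by (simp add: ring_def)

lemma bounded_on_compact:
 assumes "compact W" "f holomorphic_on S" "W \<subseteq> S"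
 obtains B where "0 < B" "!!v. v \<in> W ==> norm (f v :: complex) <= B"
proof -
 have "compact (f ` W)"
  by (intro compact_continuous_image hol_cont[OF assms(2) assms(3)] assms(1))
 hence "bounded (f ` W)" by (rule compact_imp_bounded)
 then obtain B where "B > 0" "\<forall>x\<in>f ` W. norm x <= B" unfolding bounded_pos by blast
 thus ?thesis by (intro that[of B]) auto
qed

lemma separation:
 assumes "0 < d0"
 obtains \<delta> where "0 < \<delta>" "\<delta> <= d0" "\<delta> <= t1" "\<delta> <= \<rho> / 2"
  "!!k l. k \<in> K ==> l \<in> K ==> k ~= l ==> 4 * \<delta> <= dist (b k) (b l)"
proof -
 define S where "S = insert 1 ((%(k, l). dist (b k) (b l)) ` ({(k, l). k ~= l} \<inter> K \<times> K))"
 have S: "finite S" "S ~= {}" using K by (auto simp: S_def)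
 have pos: "0 < x" if "x \<in> S" for x
  using that b_inj by (auto simp: S_def inj_on_eq_iff)
 define e where "e = Min S"
 have e: "0 < e" "!!x. x \<in> S ==> e <= x"
  using pos[OF Min_in[OF S]] Min_le[OF S(1)] by (auto simp: e_def)
 show ?thesis
 proof (rule that[of "min (min d0 t1) (min (\<rho> / 2) (e / 4))"])
  fix k l assume "k \<in> K" "l \<in> K" "k ~= l"
  hence "dist (b k) (b l) \<in> S" unfolding S_def by force
  hence "e <= dist (b k) (b l)" by (rule e(2))
  thus "4 * min (min d0 t1) (min (\<rho> / 2) (e / 4)) <= dist (b k) (b l)" by linarith
 qed (use assms t1 e \<rho>_pos in auto)
qed

lemma J_as_kernel:
 assumes "\<rho> < r" "!!v. norm v = r ==>
  (\<Prod>l\<in>K. bpow (b l) (lam l) v) * H v / (\<eta> v - w) = (\<Prod>l\<in>K. bpow (b l) (\<mu> l) v) * k v"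
 shows "J r n w = cmean r (%v. (\<Prod>l\<in>K. bpow (b l) (\<mu> l) v) * k v * v ^ Suc n)"
 unfolding J_def
proof (rule cmean_cong)
 fix v :: complex assume v: "norm v = r"
 hence "M v = (\<Prod>k\<in>K. bpow (b k) (lam k) v) * H v" using M_eq assms(1) by simp
 hence "v * (M v * v ^ n / (\<eta> v - w)) = (\<Prod>l\<in>K. bpow (b l) (lam l) v) * H v / (\<eta> v - w) * v ^ Suc n"
  by (simp add: mult_ac)
 thus "v * (M v * v ^ n / (\<eta> v - w)) = (\<Prod>l\<in>K. bpow (b l) (\<mu> l) v) * k v * v ^ Suc n"
  unfolding assms(2)[OF v] .
qed (use assms \<rho>_pos in auto)

text \<open>The kernel has no pole in the ring here, so \<open>t\<close> can be the fixed width
  \<open>t1\<close> and no residue occurs. In the theorem this is the case of points of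
  \<open>Gs\<close>.\<close>

lemma asym_off:
 assumes w0: "norm w0 < 1" "w0 \<notin> \<eta> ` Ann"
 obtains e A where "0 < e" "0 < A"
  "!!n w. 1 <= n ==> w \<in> ball w0 e ==> norm (J r3 n w - Sm n w) <= A * \<rho> ^ n * real n powr (\<Lambda> - 2)"
  "!!w v. w \<in> ball w0 e ==> v \<in> ring ==> e <= norm (\<eta> v - w)"
proof -
 have cr: "compact (\<eta> ` ring)"
  by (intro compact_continuous_image hol_cont[OF \<eta>_hol] ring)
 moreover have "w0 \<notin> \<eta> ` ring" using w0 ring by blast
 ultimately obtain d where d: "0 < d" "!!x. x \<in> \<eta> ` ring ==> d <= dist w0 x"
  using separate_point_closed[OF compact_imp_closed] by metis
 define e where "e = d / 2"
 have e: "0 < e" using d by (simp add: e_def)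
 have far: "e <= norm (\<eta> v - w)" if "w \<in> ball w0 e" "v \<in> ring" for w v
  using d(2)[of "\<eta> v"] that dist_triangle[of w0 "\<eta> v" w] unfolding e_def by (auto simp: dist_norm norm_minus_commute)
 obtain HB where HB: "0 < HB" "!!v. v \<in> ring ==> norm (H v) <= HB"
  using bounded_on_compact[OF ring(1) H_hol ring(2)] by blast
 obtain \<delta> where \<delta>: "0 < \<delta>" "\<delta> <= 1" "\<delta> <= t1" "\<delta> <= \<rho> / 2"
  "!!k l. k \<in> K ==> l \<in> K ==> k ~= l ==> 4 * \<delta> <= dist (b k) (b l)"
  using separation[of 1] by auto
 have t1ring: "v \<in> ring" if "\<bar>norm v - \<rho>\<bar> <= t1" for v using that t1 by (intro ringI) auto
 have bring: "v \<in> ring" if "v \<in> ball (b l) \<delta>" "l \<in> K" for v l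
  using that b[of l] norm_triangle_ineq3[of v "b l"] \<delta> by (intro t1ring) (auto simp: dist_norm norm_minus_commute)
 show ?thesis
 proof (rule darboux_kernel[OF K \<rho>_pos b \<delta>(1,4,2,5) lam_le], assumption, assumption, assumption, assumption, assumption, goal_cases)
  case (1 A q)
  show ?thesis
  proof (rule that[OF e _ _ far])
   show "0 < A * (HB / e) / t1 ^ q" using 1 HB e t1 by simp
   fix n :: nat and w assume n: "1 <= n" and w: "w \<in> ball w0 e"
   define r where "r = \<rho> + t1 / (2 * real n)"
   have "t1 / (2 * real n) <= t1 / 2" using n t1 by (intro divide_left_mono) auto
   hence r: "\<rho> < r" "r < 1" using t1 n by (auto simp: r_def)
   have ne: "\<eta> v - w ~= 0" if "v \<in> ring" for v using far[OF w that] e by auto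
   have sub: "{v. \<rho> - t1 < norm v \<and> norm v < \<rho> + t1} \<subseteq> ring" by (auto intro!: t1ring)
   have kh: "(%v. H v / (\<eta> v - w)) holomorphic_on S" if "S \<subseteq> ring" for S
    using that ring ne by (intro holomorphic_intros hol_subset[OF H_hol] hol_subset[OF \<eta>_hol]) auto
   have kb: "norm (H v / (\<eta> v - w)) <= HB / e" if "v \<in> ring" for v
    unfolding norm_divide using HB(2)[OF that] far[OF w that] e HB by (intro frac_le) auto
   have "J r3 n w = J r n w"
   proof (rule J_radius[symmetric])
    fix v :: complex assume "r <= norm v" "norm v <= r3"
    hence "v \<in> ring" using r \<sigma>1 by (simp add: ring_def)
    thus "\<eta> v ~= w" using ne by auto
   qed (use r r3 in auto)
   also have "... = cmean r (%v. (\<Prod>l\<in>K. bpow (b l) (lam l) v) * (H v / (\<eta> v - w)) * v ^ Suc n)"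
    by (rule J_as_kernel[OF r(1)]) simp
   finally have Jr: "J r3 n w = cmean r (%v. (\<Prod>l\<in>K. bpow (b l) (lam l) v) * (H v / (\<eta> v - w)) * v ^ Suc n)" .
   have "norm (cmean r (%v. (\<Prod>l\<in>K. bpow (b l) (lam l) v) * (H v / (\<eta> v - w)) * v ^ Suc n)
    - (\<Sum>l\<in>K. (\<Prod>i\<in>K - {l}. bpow (b i) (lam i) (b l)) * (H (b l) / (\<eta> (b l) - w)) *
       of_real (pochhammer (lam l) (Suc n) / fact (Suc n)) * b l ^ Suc n))
    <= A * (HB / e) * \<rho> ^ n * real n powr (\<Lambda> - 2) / t1 ^ q"
    unfolding r_def
   proof (rule 1(3)[OF n])
    show "norm (H v / (\<eta> v - w)) <= HB / e / t1" if "\<bar>norm v - \<rho>\<bar> < 3 * t1 / 4" for v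
    proof -
     have "v \<in> ring" using that t1 by (intro t1ring) auto
     moreover have "HB / e * 1 <= HB / e * (1 / t1)" using HB e t1 by (intro mult_left_mono) auto
     ultimately show ?thesis using kb[of v] by simp
    qed
    show "(%v. H v / (\<eta> v - w)) holomorphic_on ball (b l) \<delta>" if "l \<in> K" for l
     using bring[OF _ that] by (intro kh) blast
   qed (use t1 HB e kh sub kb bring in auto)
   thus "norm (J r3 n w - Sm n w) <= A * (HB / e) / t1 ^ q * \<rho> ^ n * real n powr (\<Lambda> - 2)"
    unfolding Jr by (simp add: Sm_def N_def cf_def)
  qed
 qed
qed

text \<open>One formula must hold on both sides of the critical circle. Outside, the term with
  \<open>DD\<close> is the residue. Inside there is no residue, but the term is negligible there,
  since \<open>norm y ^ n\<close> is at most \<open>\<rho> ^ n * exp (- n * t / \<rho>)\<close>.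
  Both estimates degenerate as \<open>t\<close> tends to 0, and \<open>bound_across_circle\<close>
  repairs them on smaller balls.\<close>

lemma asym_on:
 assumes U: "open U" "y0 \<in> U" "!!y. y \<in> U ==> \<sigma> < norm y \<and> norm y < 1" "!!k. k \<in> K ==> b k \<notin> U"
  and DU: "DD holomorphic_on U"
 obtains e A where "0 < e" "0 < A" "cball y0 e \<subseteq> U"
  "!!n y. 1 <= n ==> y \<in> ball y0 e ==>
   norm (J r3 n (\<eta> y) - DD y / C y * y ^ n * (Dh (\<eta> y) * p (\<eta> y)) - Sm n (\<eta> y)) <= A * \<rho> ^ n * real n powr (\<Lambda> - 2)"
proof -
 \<comment> \<open>Room for circles of radius \<open>d\<close> about every point of
   \<open>ball y0 d\<close>, still away from the branch points.\<close>
 obtain d where d: "0 < d" "cball y0 (2 * d) \<subseteq> U" "!!k. k \<in> K ==> 4 * d <= dist y0 (b k)"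
 proof -
  obtain d1 where d1: "0 < d1" "cball y0 d1 \<subseteq> U" using U open_contains_cball by blast
  have "d1 <= dist y0 (b k)" if "k \<in> K" for k using d1 U(4)[OF that] by (meson linorder_le_cases mem_cball subsetD)
  thus ?thesis using d1 by (intro that[of "d1 / 4"]) auto
 qed
 define Y where "Y = cball y0 (2 * d)"
 have Y: "compact Y" "Y \<subseteq> U" using d by (auto simp: Y_def)
 have UA: "U \<subseteq> Ann"
 proof
  fix y assume "y \<in> U"
  thus "y \<in> Ann" using U(3)[of y] radii by simp
 qed
 note Y = Y UA
 obtain \<delta> where \<delta>: "0 < \<delta>" "\<delta> <= min 1 d" "\<delta> <= t1" "\<delta> <= \<rho> / 2"
  "!!k l. k \<in> K ==> l \<in> K ==> k ~= l ==> 4 * \<delta> <= dist (b k) (b l)"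
  using separation[of "min 1 d"] d by auto
 have \<delta>1: "\<delta> <= 1" using \<delta> by simp
 have t1ring: "v \<in> ring" if "\<bar>norm v - \<rho>\<bar> <= t1" for v using that t1 by (intro ringI) auto
 have bring: "v \<in> ring" if "v \<in> ball (b l) \<delta>" "l \<in> K" for v l
  using that b[of l] norm_triangle_ineq3[of v "b l"] \<delta> by (intro t1ring) (auto simp: dist_norm norm_minus_commute)
 have bY: "\<delta> <= dist v y" if "v \<in> ball (b l) \<delta>" "l \<in> K" "y \<in> Y" for v l y
  using d(3)[OF that(2)] that(1,3) dist_triangle[of y0 "b l" y] dist_triangle[of y "b l" v] \<delta> d
  by (auto simp: Y_def dist_commute)
 \<comment> \<open>The positive minimum of the difference quotient of \<eta> on a compact product;
   it compares \<open>norm (\<eta> v - \<eta> y)\<close> with \<open>dist v y\<close> even when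
   \<open>y\<close> lies in the ring.\<close>
 obtain c0 where c0: "0 < c0" "!!v y. v \<in> ring ==> y \<in> Y ==> c0 * dist v y <= norm (\<eta> v - \<eta> y)"
 proof -
  have "compact ((%p. dquot \<eta> (fst p) (snd p)) ` (ring \<times> Y))"
   by (intro compact_continuous_image compact_Times ring Y
     continuous_on_subset[OF continuous_on_dquot[OF open_annulus \<eta>_hol]]) (use ring Y in auto)
  moreover have "0 \<notin> (%p. dquot \<eta> (fst p) (snd p)) ` (ring \<times> Y)"
   using dquot_nz[OF open_annulus \<eta>_hol \<eta>_inj] ring Y by force
  ultimately obtain c0 where c0: "0 < c0" "!!x. x \<in> (%p. dquot \<eta> (fst p) (snd p)) ` (ring \<times> Y) ==> c0 <= dist 0 x"
   using separate_point_closed[OF compact_imp_closed] by metis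
  show ?thesis
  proof (rule that[OF c0(1)])
   fix v y assume "v \<in> ring" "y \<in> Y"
   hence "c0 <= norm (dquot \<eta> v y)" using c0(2)[of "dquot \<eta> v y"] by force
   moreover have "\<eta> v - \<eta> y = dquot \<eta> v y * (v - y)" by (simp add: dquot_def)
   ultimately show "c0 * dist v y <= norm (\<eta> v - \<eta> y)"
    by (simp add: norm_mult dist_norm mult_right_mono)
  qed
 qed
 obtain HB where HB: "0 < HB" "!!v. v \<in> ring ==> norm (H v) <= HB"
  using bounded_on_compact[OF ring(1) H_hol ring(2)] by blast
 define X where "X y = DD y / C y * (Dh (\<eta> y) * p (\<eta> y))" for y
 have "r0 < norm y" if "y \<in> U" for y using U(3)[OF that] radii by simp
 hence X_hol: "X holomorphic_on U" unfolding X_def using C_nz Y(3)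
  by (intro holomorphic_intros DU hol_subset[OF C_hol] hol_subset[OF on_ball[OF Dh_hol]]
    hol_subset[OF on_ball[OF p_hol]]) (auto simp: ext_disk_def)
 obtain XB where XB: "0 < XB" "!!y. y \<in> Y ==> norm (X y) <= XB"
  using bounded_on_compact[OF Y(1) X_hol Y(2)] by blast
 define B where "B = HB / c0 * (1 / \<delta> + 4)"
 have B: "0 < B" "HB / (c0 * \<delta>) <= B" "4 * HB / c0 <= B" using HB c0 \<delta>
  by (auto simp: B_def field_simps add_pos_pos)
 \<comment> \<open>Makes \<open>n^(-q1)\<close> at most \<open>n^(\<Lambda>-2)\<close>, so that
   exponential decay inside the circle yields the required power of \<open>n\<close> at the price
   \<open>t^(-q1)\<close>.\<close>
 define q1 where "q1 = Suc (nat \<lceil>2 - \<Lambda>\<rceil>)"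
 have q1: "- real q1 <= \<Lambda> - 2" "0 < q1" unfolding q1_def by linarith+
 define F where "F n y = J r3 n (\<eta> y) - X y * y ^ n - Sm n (\<eta> y)" for n y
 show ?thesis
 proof (rule darboux_kernel[OF K \<rho>_pos b \<delta>(1,4) \<delta>1 \<delta>(5) lam_le], assumption, assumption, assumption, assumption, assumption, goal_cases)
  case (1 A q)
  note dk = 1(3)
  define A' where "A' = A * B + XB * (fact q1 * \<rho> ^ q1)"
  have A': "0 < A'" unfolding A'_def using 1 B XB \<rho>_pos by (intro add_pos_pos mult_pos_pos) auto
  have bdt: "norm (F n y) <= A' * \<rho> ^ n * real n powr (\<Lambda> - 2) / t ^ (q + q1)"
   if n: "1 <= n" and y: "y \<in> Y" "norm y ~= \<rho>" and t: "t = min \<bar>norm y - \<rho>\<bar> t1" for n y t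
  proof -
   have n0: "0 < real n" using n by simp
   have yU: "y \<in> U" "y \<in> Ann" "norm y < 1" using y Y U(3)[of y] by auto
   have t0: "0 < t" "t <= t1" "t <= \<bar>norm y - \<rho>\<bar>" using t y t1 by auto
   have tle: "t <= 1" "t <= \<rho>" using t0 t1 by auto
   define r where "r = \<rho> + t / (2 * real n)"
   have "t / (2 * real n) <= t / 2" using n t0 by (intro divide_left_mono) auto
   hence r: "\<rho> < r" "r <= \<rho> + t / 2" "r < 1" using t0 t1 n0 by (auto simp: r_def)
   define k where "k v = H v / (\<eta> v - \<eta> y)" for v
   have ne: "\<eta> v - \<eta> y ~= 0" if "v \<in> ring" "v ~= y" for v
    using that ring yU \<eta>_inj by (auto simp: inj_on_eq_iff)
   have kh: "k holomorphic_on S" if "S \<subseteq> ring" "y \<notin> S" for S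
    unfolding k_def using that ring ne
    by (intro holomorphic_intros hol_subset[OF H_hol] hol_subset[OF \<eta>_hol]) auto
   have kb: "norm (k v) <= HB / (c0 * x)" if "v \<in> ring" "x <= dist v y" "0 < x" for v x
   proof -
    have "c0 * x <= c0 * dist v y" using that c0 by (intro mult_left_mono) auto
    hence "c0 * x <= norm (\<eta> v - \<eta> y)" using c0(2)[OF that(1) y(1)] by simp
    thus ?thesis unfolding k_def norm_divide using HB(2)[OF that(1)] HB c0 that(3) by (intro frac_le) auto
   qed
   have Jk: "J r n (\<eta> y) = cmean r (%v. (\<Prod>l\<in>K. bpow (b l) (lam l) v) * k v * v ^ Suc n)"
    by (rule J_as_kernel[OF r(1)]) (simp add: k_def)
   have "norm (cmean r (%v. (\<Prod>l\<in>K. bpow (b l) (lam l) v) * k v * v ^ Suc n)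
    - (\<Sum>l\<in>K. (\<Prod>i\<in>K - {l}. bpow (b i) (lam i) (b l)) * k (b l) *
       of_real (pochhammer (lam l) (Suc n) / fact (Suc n)) * b l ^ Suc n))
    <= A * B * \<rho> ^ n * real n powr (\<Lambda> - 2) / t ^ q"
    unfolding r_def
   proof (rule dk[OF n t0(1) tle])
    show "k holomorphic_on {v. \<rho> - t < norm v \<and> norm v < \<rho> + t}"
    proof (rule kh)
     show "{v. \<rho> - t < norm v \<and> norm v < \<rho> + t} \<subseteq> ring" using t0 by (auto intro!: t1ring)
     show "y \<notin> {v. \<rho> - t < norm v \<and> norm v < \<rho> + t}" using t0 by auto
    qed
    show "k holomorphic_on ball (b l) \<delta>" if "l \<in> K" for l
    proof (rule kh)
     show "ball (b l) \<delta> \<subseteq> ring" using bring[OF _ that] by blast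
     show "y \<notin> ball (b l) \<delta>" using bY[OF _ that y(1), of y] \<delta> by auto
    qed
    show "norm (k v) <= B" if "l \<in> K" "v \<in> ball (b l) \<delta>" for l v
     using kb[OF bring[OF that(2,1)] bY[OF that(2,1) y(1)] \<delta>(1)] B by simp
    show "norm (k v) <= B / t" if v: "\<bar>norm v - \<rho>\<bar> < 3 * t / 4" for v
    proof -
     have vr: "v \<in> ring" using v t0 by (intro t1ring) auto
     have "t / 4 <= dist v y"
      using v t0 norm_triangle_ineq3[of v y] by (auto simp: dist_norm abs_if split: if_splits)
     from kb[OF vr this] have "norm (k v) <= 4 * HB / c0 / t" using t0 by (simp add: mult_ac)
     also have "... <= B / t" using B t0 by (intro divide_right_mono) auto
     finally show ?thesis .
    qed
   qed (use B in auto)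
   hence main: "norm (J r n (\<eta> y) - Sm n (\<eta> y)) <= A * B * \<rho> ^ n * real n powr (\<Lambda> - 2) / t ^ q"
    unfolding Jk by (simp add: Sm_def N_def cf_def k_def)
   have c1: "0 <= \<rho> ^ n * real n powr (\<Lambda> - 2)" using \<rho>_pos by simp
   have tq: "1 / t ^ q <= 1 / t ^ (q + q1)" "1 / t ^ q1 <= 1 / t ^ (q + q1)"
    using t0 tle by (auto intro!: divide_left_mono power_decreasing)
   have m1: "A * B * \<rho> ^ n * real n powr (\<Lambda> - 2) / t ^ q <= A * B * \<rho> ^ n * real n powr (\<Lambda> - 2) / t ^ (q + q1)"
    using mult_left_mono[OF tq(1), of "A * B * (\<rho> ^ n * real n powr (\<Lambda> - 2))"] 1 B c1 by (simp add: mult.assoc)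
   have split: "A' * \<rho> ^ n * real n powr (\<Lambda> - 2) / t ^ (q + q1) = A * B * \<rho> ^ n * real n powr (\<Lambda> - 2) / t ^ (q + q1)
     + XB * (fact q1 * \<rho> ^ q1) * \<rho> ^ n * real n powr (\<Lambda> - 2) / t ^ (q + q1)"
    by (simp add: A'_def algebra_simps add_divide_distrib)
   have x0: "0 <= XB * (fact q1 * \<rho> ^ q1) * \<rho> ^ n * real n powr (\<Lambda> - 2) / t ^ (q + q1)"
    using XB \<rho>_pos t0 by simp
   show ?thesis
   proof (cases "\<rho> < norm y")
    case True
    have ry: "r < norm y" using True r t0 by simp
    have "J r3 n (\<eta> y) = J r n (\<eta> y) + D y / C y * y ^ n * Dh (\<eta> y) * p (\<eta> y)"
     using yU r3 by (intro J_jump r ry) auto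
    also have "D y = DD y" using D_eq[OF True] by (simp add: DD_def)
    finally have "F n y = J r n (\<eta> y) - Sm n (\<eta> y)" by (simp add: F_def X_def mult_ac)
    thus ?thesis using main m1 split x0 by simp
   next
    case False
    hence yl: "norm y <= \<rho> - t" using t0 by simp
    have "J r3 n (\<eta> y) = J r n (\<eta> y)"
    proof (rule J_radius[symmetric])
     fix v :: complex assume v: "r <= norm v" "norm v <= r3"
     hence "v \<in> Ann" using r r3 radii by auto
     moreover have "v ~= y" using v r yl t0 by auto
     ultimately show "\<eta> v ~= \<eta> y" using \<eta>_inj yU by (auto simp: inj_on_eq_iff)
    qed (use r r3 in auto)
    hence "F n y = (J r n (\<eta> y) - Sm n (\<eta> y)) - X y * y ^ n" by (simp add: F_def)
    hence "norm (F n y) <= norm (J r n (\<eta> y) - Sm n (\<eta> y)) + norm (X y * y ^ n)"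
     by (simp add: norm_triangle_ineq4)
    moreover have "norm (X y * y ^ n) <= XB * (fact q1 * \<rho> ^ q1) * \<rho> ^ n * real n powr (\<Lambda> - 2) / t ^ (q + q1)"
    proof -
     have "norm (y ^ n) <= (\<rho> - t) ^ n" unfolding norm_power using yl by (intro power_mono) auto
     also have "\<rho> - t = \<rho> * (1 + (- t / \<rho>))" using \<rho>_pos by (simp add: field_simps)
     also have "(\<rho> * (1 + (- t / \<rho>))) ^ n <= (\<rho> * exp (- t / \<rho>)) ^ n"
      using tle \<rho>_pos by (intro power_mono mult_left_mono exp_ge_add_one_self) (auto simp: field_simps)
     also have "... = \<rho> ^ n * exp (- (real n * t / \<rho>))" by (simp add: power_mult_distrib flip: exp_of_nat_mult)
     also have "... <= \<rho> ^ n * (fact q1 / (real n * t / \<rho>) ^ q1)"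
      using \<rho>_pos n0 t0 by (intro mult_left_mono exp_minus_le_power) auto
     also have "... = fact q1 * \<rho> ^ q1 * \<rho> ^ n * (real n powr (- real q1)) * (1 / t ^ q1)"
      using n0 by (simp add: power_mult_distrib power_divide powr_minus_divide powr_realpow mult_ac)
     also have "... <= fact q1 * \<rho> ^ q1 * \<rho> ^ n * (real n powr (\<Lambda> - 2)) * (1 / t ^ (q + q1))"
      using q1 n \<rho>_pos t0 tq by (intro mult_mono mult_left_mono powr_mono) auto
     finally have "norm (y ^ n) <= fact q1 * \<rho> ^ q1 * \<rho> ^ n * (real n powr (\<Lambda> - 2)) * (1 / t ^ (q + q1))" .
     hence "norm (X y) * norm (y ^ n) <= XB * (fact q1 * \<rho> ^ q1 * \<rho> ^ n * (real n powr (\<Lambda> - 2)) * (1 / t ^ (q + q1)))"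
      using XB(2)[OF y(1)] XB by (intro mult_mono) auto
     thus ?thesis by (simp add: norm_mult mult_ac)
    qed
    ultimately show ?thesis using main m1 split by simp
   qed
  qed
  \<comment> \<open>Holomorphy across the critical circle holds because \<open>DD\<close> is
    holomorphic on \<open>U\<close> and no \<open>b k\<close> lies there; only the bound
    \<open>bdt\<close> is restricted to \<open>norm y ~= \<rho>\<close>.\<close>
  have Fhol: "F n holomorphic_on U" for n
  proof -
   have jh: "J r3 n holomorphic_on ball 0 1"
    by (rule hol_subset[OF J3_hol_near(2) order_trans[OF _ J3_hol_near(3)]]) auto
   have "\<eta> ` U \<subseteq> ball 0 1" using U(3) \<eta>_lt by auto
   from holomorphic_on_compose_gen[OF hol_subset[OF \<eta>_hol Y(3)] jh this]
   have 1: "(%y. J r3 n (\<eta> y)) holomorphic_on U" by (simp add: o_def)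
   have "\<eta> (b l) - \<eta> y ~= 0" if "l \<in> K" "y \<in> U" for l y
    using that U(4)[OF that(1)] Y(3) b_Ann[OF that(1)] \<eta>_inj by (auto simp: inj_on_eq_iff)
   hence 2: "(%y. Sm n (\<eta> y)) holomorphic_on U"
    unfolding Sm_def by (intro holomorphic_intros hol_subset[OF \<eta>_hol Y(3)]) auto
   show ?thesis unfolding F_def by (intro holomorphic_intros 1 2 X_hol)
  qed
  define G where "G = A' / t1 ^ (q + q1) * (2 / (d * \<sigma>)) ^ (q + q1)"
  show ?thesis
  proof (rule that[of d G])
   show "0 < d" "0 < G" using d A' t1 \<sigma>_pos by (auto simp: G_def)
   show "cball y0 d \<subseteq> U" using d by (intro order_trans[OF _ d(2)] subset_cball) auto
   fix n :: nat and y assume n: "1 <= n" and y: "y \<in> ball y0 d"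
   have sub: "cball y d \<subseteq> Y" unfolding Y_def
   proof
    fix x assume "x \<in> cball y d"
    thus "x \<in> cball y0 (2 * d)" using y dist_triangle[of y0 x y] by simp
   qed
   have "y \<in> Y" using sub d by auto
   hence ny: "\<sigma> < norm y" using Y(2) U(3)[of y] by blast
   have "norm (F n y) <= (A' / t1 ^ (q + q1) * \<rho> ^ n * real n powr (\<Lambda> - 2)) * (2 / (d * norm y)) ^ (q + q1)"
   proof (rule bound_across_circle[OF Fhol U(1) order_trans[OF sub Y(2)] d(1)])
    show "y ~= 0" "0 <= \<rho>" using ny \<sigma>_pos \<rho>_pos by auto
    show "0 <= A' / t1 ^ (q + q1) * \<rho> ^ n * real n powr (\<Lambda> - 2)" using A' t1 \<rho>_pos by simp
    show "0 < q + q1" using q1 by simp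
    fix x assume "dist x y = d"
    hence xY: "x \<in> Y" using sub by (auto simp: dist_commute)
    hence x1: "norm x < 1" using Y U(3)[of x] by auto
    thus "norm x + \<rho> <= 2" using radii by simp
    assume xr: "norm x ~= \<rho>"
    define t where "t = min \<bar>norm x - \<rho>\<bar> t1"
    have "\<bar>norm x - \<rho>\<bar> <= 1" using x1 \<rho>_pos radii(3) norm_ge_zero[of x] by linarith
    hence a: "0 < \<bar>norm x - \<rho>\<bar>" "\<bar>norm x - \<rho>\<bar> <= 1" using xr by auto
    have "t1 * \<bar>norm x - \<rho>\<bar> <= t"
     unfolding t_def using a t1 mult_mono[of t1 1 "\<bar>norm x - \<rho>\<bar>" "\<bar>norm x - \<rho>\<bar>"] mult_mono[of t1 t1 "\<bar>norm x - \<rho>\<bar>" 1]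
     by simp
    hence "(t1 * \<bar>norm x - \<rho>\<bar>) ^ (q + q1) <= t ^ (q + q1)" using a t1 by (intro power_mono) auto
    hence "A' * \<rho> ^ n * real n powr (\<Lambda> - 2) / t ^ (q + q1) <= A' * \<rho> ^ n * real n powr (\<Lambda> - 2) / (t1 * \<bar>norm x - \<rho>\<bar>) ^ (q + q1)"
     using A' \<rho>_pos a t1 by (intro divide_left_mono mult_pos_pos) (auto simp: t_def)
    also have "... = A' / t1 ^ (q + q1) * \<rho> ^ n * real n powr (\<Lambda> - 2) / \<bar>norm x - \<rho>\<bar> ^ (q + q1)"
     by (simp add: power_mult_distrib)
    finally show "norm (F n x) <= A' / t1 ^ (q + q1) * \<rho> ^ n * real n powr (\<Lambda> - 2) / \<bar>norm x - \<rho>\<bar> ^ (q + q1)"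
     using bdt[OF n xY xr t_def] by simp
   qed
   also have "... <= (A' / t1 ^ (q + q1) * \<rho> ^ n * real n powr (\<Lambda> - 2)) * (2 / (d * \<sigma>)) ^ (q + q1)"
    using A' t1 \<rho>_pos d \<sigma>_pos ny by (intro mult_left_mono power_mono divide_left_mono mult_pos_pos) auto
   also have "... = G * \<rho> ^ n * real n powr (\<Lambda> - 2)" by (simp add: G_def)
   finally show "norm (J r3 n (\<eta> y) - DD y / C y * y ^ n * (Dh (\<eta> y) * p (\<eta> y)) - Sm n (\<eta> y)) <= G * \<rho> ^ n * real n powr (\<Lambda> - 2)"
    by (simp add: F_def X_def mult_ac)
  qed
 qed
qed

text \<open>The pole of the kernel sits on the branch point. The product of kernel and singular
  factor is again a model power, with exponent raised by one, times a regular function, so the same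
  Darboux estimate applies with \<open>lam j + 1\<close> at \<open>j\<close>.\<close>

lemma asym_at:
 assumes j: "j \<in> K"
 obtains A where "0 < A"
  "!!n. 1 <= n ==> norm (J r3 n (\<eta> (b j)) - N j * (H (b j) / (b j * deriv \<eta> (b j))) * of_real (cf (lam j + 1) n) * b j ^ Suc n
    - (\<Sum>l\<in>K - {j}. N l * (H (b l) / (\<eta> (b l) - \<eta> (b j))) * of_real (cf (lam l) n) * b l ^ Suc n))
    <= A * \<rho> ^ n * real n powr (max (lam j + 1) \<Lambda> - 2)"
proof -
 define y where "y = b j"
 have y: "y \<in> Ann" "norm y = \<rho>" "y ~= 0" using b_Ann[OF j] b[OF j] \<rho>_pos by (auto simp: y_def)
 define \<mu> where "\<mu> = lam(j := lam j + 1)"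
 have \<mu>: "\<mu> l <= max (lam j + 1) \<Lambda>" if "l \<in> K" for l using lam_le[OF that] by (auto simp: \<mu>_def)
 \<comment> \<open>After \<open>1 - y / v\<close> is absorbed by the raised power, the denominator
   \<open>\<eta> v - \<eta> y\<close> leaves \<open>v\<close> times the difference quotient, which
   has no zeros.\<close>
 define k where "k v = H v / (v * dquot \<eta> v y)" for v
 have dq: "dquot \<eta> v y ~= 0" if "v \<in> Ann" for v using dquot_nz[OF open_annulus \<eta>_hol \<eta>_inj] that y by auto
 have "(%v. if v = y then deriv \<eta> y else (\<eta> v - \<eta> y) / (v - y)) holomorphic_on Ann"
  by (rule holomorphic_removable_quotient[OF \<eta>_hol open_annulus y(1)])
 hence "(%v. dquot \<eta> v y) holomorphic_on Ann"
  by (rule holomorphic_transform) (auto simp: dquot_def)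
 hence kA: "k holomorphic_on Ann" unfolding k_def using dq \<sigma>_pos by (intro holomorphic_intros H_hol) auto
 obtain B where B: "0 < B" "!!v. v \<in> ring ==> norm (k v) <= B"
  using bounded_on_compact[OF ring(1) kA ring(2)] by blast
 obtain \<delta> where \<delta>: "0 < \<delta>" "\<delta> <= 1" "\<delta> <= t1" "\<delta> <= \<rho> / 2"
  "!!k l. k \<in> K ==> l \<in> K ==> k ~= l ==> 4 * \<delta> <= dist (b k) (b l)"
  using separation[of 1] by auto
 have t1ring: "v \<in> ring" if "\<bar>norm v - \<rho>\<bar> <= t1" for v using that t1 by (intro ringI) auto
 have bring: "v \<in> ring" if "v \<in> ball (b l) \<delta>" "l \<in> K" for v l
  using that b[of l] norm_triangle_ineq3[of v "b l"] \<delta> by (intro t1ring) (auto simp: dist_norm norm_minus_commute)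
 have bp: "bpow y (lam j) v * (H v / (\<eta> v - \<eta> y)) = bpow y (lam j + 1) v * k v" if "v \<in> Ann" "v ~= y" for v
 proof -
  have v0: "v ~= 0" using that \<sigma>_pos by auto
  have f: "1 - y / v = (v - y) / v" using v0 by (simp add: diff_divide_distrib)
  hence "bpow y (lam j) v = bpow y (lam j + 1) v * ((v - y) / v)" using bpow_add_one[of y v "lam j"] that v0 by simp
  moreover have "\<eta> v - \<eta> y = dquot \<eta> v y * (v - y)" by (simp add: dquot_def)
  ultimately show ?thesis using v0 that dq[OF that(1)] by (simp add: k_def)
 qed
 show ?thesis
 proof (rule darboux_kernel[OF K \<rho>_pos b \<delta>(1,4,2,5) \<mu>], assumption, assumption, assumption, assumption, assumption, goal_cases)
  case (1 A q)
  show ?thesis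
  proof (rule that)
   show "0 < A * B / t1 ^ q" using 1 B t1 by simp
   fix n :: nat assume n: "1 <= n"
   let ?T = "%l. (\<Prod>i\<in>K - {l}. bpow (b i) (\<mu> i) (b l)) * k (b l) * of_real (pochhammer (\<mu> l) (Suc n) / fact (Suc n)) * b l ^ Suc n"
   define r where "r = \<rho> + t1 / (2 * real n)"
   have "t1 / (2 * real n) <= t1 / 2" using n t1 by (intro divide_left_mono) auto
   hence r: "\<rho> < r" "r < 1" using t1 n by (auto simp: r_def)
   have "J r3 n (\<eta> y) = J r n (\<eta> y)"
   proof (rule J_radius[symmetric])
    fix v :: complex assume v: "r <= norm v" "norm v <= r3"
    hence "v \<in> Ann" using r r3 radii by auto
    moreover have "v ~= y" using v r y by auto
    ultimately show "\<eta> v ~= \<eta> y" using \<eta>_inj y by (auto simp: inj_on_eq_iff)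
   qed (use r r3 in auto)
   also have "... = cmean r (%v. (\<Prod>l\<in>K. bpow (b l) (\<mu> l) v) * k v * v ^ Suc n)"
   proof (rule J_as_kernel[OF r(1)])
    fix v :: complex assume v: "norm v = r"
    hence vA: "v \<in> Ann" "v ~= y" using r radii y by auto
    have "(\<Prod>l\<in>K. bpow (b l) (lam l) v) = bpow y (lam j) v * (\<Prod>l\<in>K - {j}. bpow (b l) (lam l) v)"
     using j K by (simp add: prod.remove y_def)
    moreover have "(\<Prod>l\<in>K. bpow (b l) (\<mu> l) v) = bpow y (lam j + 1) v * (\<Prod>l\<in>K - {j}. bpow (b l) (lam l) v)"
     using j K by (simp add: prod.remove y_def \<mu>_def)
    ultimately have "(\<Prod>l\<in>K. bpow (b l) (lam l) v) * H v / (\<eta> v - \<eta> y)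
      = (bpow y (lam j) v * (H v / (\<eta> v - \<eta> y))) * (\<Prod>l\<in>K - {j}. bpow (b l) (lam l) v)"
     "(\<Prod>l\<in>K. bpow (b l) (\<mu> l) v) * k v = (bpow y (lam j + 1) v * k v) * (\<Prod>l\<in>K - {j}. bpow (b l) (lam l) v)"
     by (simp_all add: mult_ac)
    thus "(\<Prod>l\<in>K. bpow (b l) (lam l) v) * H v / (\<eta> v - \<eta> y) = (\<Prod>l\<in>K. bpow (b l) (\<mu> l) v) * k v"
     by (simp only: bp[OF vA])
   qed
   finally have Jr: "J r3 n (\<eta> y) = cmean r (%v. (\<Prod>l\<in>K. bpow (b l) (\<mu> l) v) * k v * v ^ Suc n)" .
   have bd: "norm (cmean r (%v. (\<Prod>l\<in>K. bpow (b l) (\<mu> l) v) * k v * v ^ Suc n)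
    - (\<Sum>l\<in>K. ?T l))
    <= A * B * \<rho> ^ n * real n powr (max (lam j + 1) \<Lambda> - 2) / t1 ^ q"
    unfolding r_def
   proof (rule 1(3)[OF n])
    have sub: "{v. \<rho> - t1 < norm v \<and> norm v < \<rho> + t1} \<subseteq> ring" by (auto intro!: t1ring)
    show "k holomorphic_on {v. \<rho> - t1 < norm v \<and> norm v < \<rho> + t1}"
     by (rule hol_subset[OF kA order_trans[OF sub ring(2)]])
    show "k holomorphic_on ball (b l) \<delta>" if "l \<in> K" for l
     by (rule hol_subset[OF kA]) (use bring[OF _ that] ring in blast)
    show "norm (k v) <= B" if "l \<in> K" "v \<in> ball (b l) \<delta>" for l v using bring that B by blast
    show "norm (k v) <= B / t1" if "\<bar>norm v - \<rho>\<bar> < 3 * t1 / 4" for v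
    proof -
     have "v \<in> ring" using that t1 by (intro t1ring) auto
     moreover have "B * 1 <= B * (1 / t1)" using B t1 by (intro mult_left_mono) auto
     ultimately show ?thesis using B(2)[of v] by simp
    qed
   qed (use t1 B in auto)
   have "(\<Sum>l\<in>K. ?T l)
    = (\<Prod>i\<in>K - {j}. bpow (b i) (\<mu> i) (b j)) * k (b j) * of_real (pochhammer (\<mu> j) (Suc n) / fact (Suc n)) * b j ^ Suc n
     + (\<Sum>l\<in>K - {j}. ?T l)"
    by (rule sum.remove[OF K j])
   also have "(\<Prod>i\<in>K - {j}. bpow (b i) (\<mu> i) (b j)) = N j" unfolding N_def by (rule prod.cong) (auto simp: \<mu>_def)
   also have "k (b j) = H (b j) / (b j * deriv \<eta> (b j))" by (simp add: k_def y_def dquot_def)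
   \<comment> \<open>At the other branch points the raised exponent and the modified kernel
     recombine to the original product.\<close>
   also have "(\<Sum>l\<in>K - {j}. ?T l)
     = (\<Sum>l\<in>K - {j}. N l * (H (b l) / (\<eta> (b l) - \<eta> (b j))) * of_real (cf (lam l) n) * b l ^ Suc n)"
   proof (rule sum.cong)
    fix l assume l: "l \<in> K - {j}"
    have jl: "j \<in> K - {l}" using j l by auto
    have lA: "b l \<in> Ann" "b l ~= y" using b_Ann l b_inj j by (auto simp: y_def inj_on_eq_iff)
    have fin: "finite (K - {l})" using K by simp
    have "N l = bpow y (lam j) (b l) * (\<Prod>i\<in>K - {l} - {j}. bpow (b i) (lam i) (b l))"
     unfolding N_def y_def by (rule prod.remove[OF fin jl])
    moreover have "(\<Prod>i\<in>K - {l}. bpow (b i) (\<mu> i) (b l)) = bpow y (lam j + 1) (b l) * (\<Prod>i\<in>K - {l} - {j}. bpow (b i) (lam i) (b l))"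
     unfolding prod.remove[OF fin jl] y_def by (auto simp: \<mu>_def intro!: prod.cong)
    ultimately have "(\<Prod>i\<in>K - {l}. bpow (b i) (\<mu> i) (b l)) * k (b l)
      = (bpow y (lam j + 1) (b l) * k (b l)) * (\<Prod>i\<in>K - {l} - {j}. bpow (b i) (lam i) (b l))"
     "N l * (H (b l) / (\<eta> (b l) - \<eta> y))
      = (bpow y (lam j) (b l) * (H (b l) / (\<eta> (b l) - \<eta> y))) * (\<Prod>i\<in>K - {l} - {j}. bpow (b i) (lam i) (b l))"
     by (simp_all add: mult_ac)
    hence "(\<Prod>i\<in>K - {l}. bpow (b i) (\<mu> i) (b l)) * k (b l) = N l * (H (b l) / (\<eta> (b l) - \<eta> y))"
     by (simp only: bp[OF lA])
    moreover have "\<mu> l = lam l" using l by (simp add: \<mu>_def)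
    ultimately show "?T l
      = N l * (H (b l) / (\<eta> (b l) - \<eta> (b j))) * of_real (cf (lam l) n) * b l ^ Suc n"
     by (simp add: cf_def y_def)
   qed simp
   finally have S: "(\<Sum>l\<in>K. ?T l)
     = N j * (H (b j) / (b j * deriv \<eta> (b j))) * of_real (cf (lam j + 1) n) * b j ^ Suc n
     + (\<Sum>l\<in>K - {j}. N l * (H (b l) / (\<eta> (b l) - \<eta> (b j))) * of_real (cf (lam l) n) * b l ^ Suc n)"
    by (simp add: \<mu>_def cf_def)
   show "norm (J r3 n (\<eta> (b j)) - N j * (H (b j) / (b j * deriv \<eta> (b j))) * of_real (cf (lam j + 1) n) * b j ^ Suc n
    - (\<Sum>l\<in>K - {j}. N l * (H (b l) / (\<eta> (b l) - \<eta> (b j))) * of_real (cf (lam l) n) * b l ^ Suc n))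
    <= A * B / t1 ^ q * \<rho> ^ n * real n powr (max (lam j + 1) \<Lambda> - 2)"
    using bd unfolding S Jr[symmetric] by (simp add: y_def diff_diff_eq)
  qed
 qed
qed

end

section \<open>Negligible terms and the passage to binomial coefficients\<close>

lemma geometric_le_powr:
 fixes \<tau> \<rho> e :: real
 assumes "0 < \<tau>" "\<tau> < \<rho>"
 obtains A where "0 < A" "!!n. 1 <= n ==> \<tau> ^ n <= A * \<rho> ^ n * real n powr e"
proof -
 define s where "s = ln (\<rho> / \<tau>)"
 have s: "0 < s" using assms by (simp add: s_def)
 have "exp s = \<rho> / \<tau>" using assms by (simp add: s_def)
 hence es: "\<tau> = \<rho> * exp (- s)" using assms by (simp add: exp_minus field_simps)
 define q where "q = nat \<lceil>- e\<rceil>"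
 have q: "- real q <= e" unfolding q_def by linarith
 show ?thesis
 proof (rule that[of "fact q / s ^ q"])
  fix n :: nat assume n: "1 <= n"
  have "\<tau> ^ n = \<rho> ^ n * exp (- (real n * s))"
   by (subst es) (simp add: power_mult_distrib flip: exp_of_nat_mult)
  also have "... <= \<rho> ^ n * (fact q / (real n * s) ^ q)"
   using s n assms by (intro mult_left_mono exp_minus_le_power) auto
  also have "... = fact q / s ^ q * \<rho> ^ n * real n powr (- real q)"
   using n by (simp add: power_mult_distrib powr_minus_divide powr_realpow mult_ac)
  also have "... <= fact q / s ^ q * \<rho> ^ n * real n powr e"
   using q n s assms by (intro mult_left_mono powr_mono) auto
  finally show "\<tau> ^ n <= fact q / s ^ q * \<rho> ^ n * real n powr e" .
 qed (use s in simp)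
qed

lemma powr_quotient_null_mono:
 fixes f :: "nat \<Rightarrow> real"
 assumes "(%n. f n / real n powr x) \<longlonglongrightarrow> 0" "x <= y"
 shows "(%n. f n / real n powr y) \<longlonglongrightarrow> 0"
proof (rule Lim_null_comparison)
 show "(%n. \<bar>f n / real n powr x\<bar>) \<longlonglongrightarrow> 0" using assms(1) by (rule tendsto_rabs_zero)
 have "norm (f n / real n powr y) <= \<bar>f n / real n powr x\<bar>" if "1 <= n" for n
 proof -
  have "\<bar>f n\<bar> / real n powr y <= \<bar>f n\<bar> / real n powr x"
   using that assms(2) by (intro divide_left_mono powr_mono mult_pos_pos) auto
  thus ?thesis by simp
 qed
 thus "\<forall>\<^sub>F n in sequentially. norm (f n / real n powr y) <= \<bar>f n / real n powr x\<bar>"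
  unfolding eventually_sequentially by blast
qed

lemma uniform_limit_null:
 fixes f :: "nat \<Rightarrow> 'a \<Rightarrow> complex"
 assumes "!!n x. N <= n ==> x \<in> S ==> norm (f n x) <= c n" "c \<longlonglongrightarrow> 0"
 shows "uniform_limit S f (%_. 0) sequentially"
proof (rule uniform_limitI)
 fix e :: real assume "0 < e"
 with assms(2) have "\<forall>\<^sub>F n in sequentially. c n < e" by (rule order_tendstoD)
 hence "\<forall>\<^sub>F n in sequentially. c n < e \<and> N <= n" using eventually_ge_at_top[of N] by (rule eventually_conj)
 thus "\<forall>\<^sub>F n in sequentially. \<forall>x\<in>S. dist (f n x) 0 < e"
 proof eventually_elim
  fix n assume "c n < e \<and> N <= n"
  thus "\<forall>x\<in>S. dist (f n x) 0 < e" using assms(1)[of n] by fastforce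
 qed
qed

context core2
begin

definition bn :: "nat \<Rightarrow> real" where "bn n = gen_binomial (real n) (\<Lambda> - 1)"

definition cd :: "real \<Rightarrow> nat \<Rightarrow> real" where "cd x n = cf x n - (if x = \<Lambda> then bn n else 0)"

definition top_ind :: "nat set" where "top_ind = {l \<in> K. lam l = \<Lambda>}"

text \<open>The constant \<open>\<alpha> k\<close> of the theorem in the exterior coordinate;
  \<open>szego_const_eq\<close> identifies the two.\<close>

definition \<alpha>c :: "nat \<Rightarrow> complex" where "\<alpha>c l = N l * D0 (b l) * C (b l)"

lemma bn_asymp: "(%n. bn n / real n powr (\<Lambda> - 1)) \<longlonglongrightarrow> rGamma \<Lambda>"
 unfolding bn_def by (rule gen_binomial_asymp)

lemma cf_asymp: "(%n. cf x n / real n powr (x - 1)) \<longlonglongrightarrow> rGamma x"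
 unfolding cf_def by (rule pochhammer_fact_asymp)

text \<open>For the top exponent the leading terms cancel, since both have the limit
  \<open>rGamma \<Lambda>\<close>; a smaller exponent gives lower order by itself.\<close>

lemma cd_null:
 assumes "x <= \<Lambda>" shows "(%n. cd x n / real n powr (\<Lambda> - 1)) \<longlonglongrightarrow> 0"
proof (cases "x = \<Lambda>")
 case True
 have "(%n. cf \<Lambda> n / real n powr (\<Lambda> - 1) - bn n / real n powr (\<Lambda> - 1)) \<longlonglongrightarrow> rGamma \<Lambda> - rGamma \<Lambda>"
  by (intro tendsto_diff cf_asymp bn_asymp)
 thus ?thesis using True by (simp add: cd_def diff_divide_distrib)
next
 case False
 have 1: "(%n. cf x n / real n powr (x - 1) * (real n powr (x - 1) / real n powr (\<Lambda> - 1))) \<longlonglongrightarrow> rGamma x * 0"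
  using False assms by (intro tendsto_mult cf_asymp powr_ratio_tendsto_0) auto
 have 2: "\<forall>\<^sub>F n in sequentially. cf x n / real n powr (x - 1) * (real n powr (x - 1) / real n powr (\<Lambda> - 1))
   = cd x n / real n powr (\<Lambda> - 1)"
  using eventually_gt_at_top[of 0] by eventually_elim (simp add: cd_def False)
 show ?thesis using Lim_transform_eventually[OF 1 2] by simp
qed

lemma cf_succ_null: "(%n. (cf (x + 1) n - gen_binomial (real n) x) / real n powr x) \<longlonglongrightarrow> 0"
proof -
 have "(%n. cf (x + 1) n / real n powr (x + 1 - 1) - gen_binomial (real n) (x + 1 - 1) / real n powr (x + 1 - 1))
   \<longlonglongrightarrow> rGamma (x + 1) - rGamma (x + 1)"
  by (intro tendsto_diff cf_asymp gen_binomial_asymp)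
 thus ?thesis by (simp add: diff_divide_distrib)
qed

text \<open>Away from the poles of the Gamma function \<open>rGamma \<Lambda>\<close> is nonzero, so
  \<open>bn n\<close> has the exact order \<open>n^(\<Lambda>-1)\<close>.\<close>

lemma divide_bn_null:
 assumes "(%n. f n / real n powr (\<Lambda> - 1)) \<longlonglongrightarrow> 0" "\<Lambda> \<notin> \<int>\<^sub>\<le>\<^sub>0"
 shows "(%n. f n / bn n) \<longlonglongrightarrow> 0"
proof -
 have "rGamma \<Lambda> ~= 0" using assms(2) by (simp add: rGamma_eq_zero_iff)
 hence 1: "(%n. (f n / real n powr (\<Lambda> - 1)) / (bn n / real n powr (\<Lambda> - 1))) \<longlonglongrightarrow> 0 / rGamma \<Lambda>"
  by (intro tendsto_divide assms bn_asymp)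
 have 2: "\<forall>\<^sub>F n in sequentially. (f n / real n powr (\<Lambda> - 1)) / (bn n / real n powr (\<Lambda> - 1)) = f n / bn n"
  using eventually_gt_at_top[of 0] by eventually_elim simp
 show ?thesis using Lim_transform_eventually[OF 1 2] by simp
qed

lemma bn_nz: "\<Lambda> \<notin> \<int>\<^sub>\<le>\<^sub>0 ==> \<forall>\<^sub>F n in sequentially. bn n ~= 0"
proof -
 assume "\<Lambda> \<notin> \<int>\<^sub>\<le>\<^sub>0"
 hence "rGamma \<Lambda> ~= 0" by (simp add: rGamma_eq_zero_iff)
 from tendsto_imp_eventually_ne[OF bn_asymp this]
 show ?thesis by eventually_elim auto
qed

text \<open>The equation in (a) solved for \<open>r_n\<close>, with \<open>x\<close> for the
  exterior term. The kernel \<open>W\<close> takes this form because \<open>p\<close> is reciprocal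
  to the square root of \<open>\<theta>'\<close>.\<close>

definition rr :: "(nat \<Rightarrow> complex poly) \<Rightarrow> nat \<Rightarrow> complex \<Rightarrow> complex \<Rightarrow> complex" where
 "rr P n w x = ((of_real (kap n) * poly (P n) (\<xi> w) - x) * Dh w / of_real (bn n)
   - (\<Sum>l\<in>top_ind. \<alpha>c l * Dh (\<eta> (b l)) * (1 / (p w * p (\<eta> (b l)) * (\<eta> (b l) - w))) * b l ^ Suc n)) / of_real \<rho> ^ n"

lemma main_approx_powr:
 fixes P :: "nat \<Rightarrow> complex poly"
 assumes P: "!!n. degree (P n) = n" "!!n. lead_coeff (P n) = 1"
  and orth: "!!n m. m < n ==> cip (trf (poly (P n))) (trf (%z. z ^ m)) = 0"
  and m: "m < 1"
 obtains A N where "0 < A" "1 <= N"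
  "!!n w. N <= n ==> norm w <= m ==>
   norm (of_real (kap n) * trf (poly (P n)) w - J r3 n w) <= A * \<rho> ^ n * real n powr e"
proof -
 obtain K' \<tau> N where K': "0 < K'" "0 < \<tau>" "\<tau> < \<rho>"
  "!!n w. N <= n ==> norm w < 1 ==>
   (norm (of_real (kap n) * trf (poly (P n)) w - J r3 n w))\<^sup>2 <= (K' * \<tau> ^ n)\<^sup>2 / (1 - norm w)"
  using main_approx[OF P orth] by metis
 obtain A where A: "0 < A" "!!n. 1 <= n ==> \<tau> ^ n <= A * \<rho> ^ n * real n powr e"
  using geometric_le_powr[OF K'(2,3)] by metis
 show ?thesis
 proof (rule that[of "K' / sqrt (1 - m) * A" "max N 1"])
  show "0 < K' / sqrt (1 - m) * A" using K' A m by simp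
  fix n w assume n: "max N 1 <= n" and w: "norm (w :: complex) <= m"
  have "(norm (of_real (kap n) * trf (poly (P n)) w - J r3 n w))\<^sup>2 <= (K' * \<tau> ^ n)\<^sup>2 / (1 - norm w)"
   using n w m by (intro K'(4)) auto
  also have "... <= (K' * \<tau> ^ n)\<^sup>2 / (1 - m)" using w m by (intro divide_left_mono) auto
  also have "... = (K' / sqrt (1 - m) * \<tau> ^ n)\<^sup>2" using m by (simp add: power_divide power_mult_distrib)
  finally have "norm (of_real (kap n) * trf (poly (P n)) w - J r3 n w) <= K' / sqrt (1 - m) * \<tau> ^ n"
   by (rule power2_le_imp_le) (use K' m in simp)
  also have "... <= K' / sqrt (1 - m) * (A * \<rho> ^ n * real n powr e)"
   using n K' m A(2)[of n] by (intro mult_left_mono) auto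
  finally show "norm (of_real (kap n) * trf (poly (P n)) w - J r3 n w) <= K' / sqrt (1 - m) * A * \<rho> ^ n * real n powr e"
   by (simp add: mult.assoc)
 qed simp
qed

text \<open>Three errors add up: polynomial against \<open>J\<close>, \<open>J\<close> against its
  Darboux sum, and coefficient against binomial. The index \<open>i\<close> lets the exterior term
  be a function of the point in the plane of the curve.\<close>

lemma uniform_remainder:
 fixes P :: "nat \<Rightarrow> complex poly" and w :: "'i \<Rightarrow> complex" and Xr :: "nat \<Rightarrow> 'i \<Rightarrow> complex"
 assumes P: "!!n. degree (P n) = n" "!!n. lead_coeff (P n) = 1"
  and orth: "!!n m. m < n ==> cip (trf (poly (P n))) (trf (%z. z ^ m)) = 0"
  and \<Lambda>: "\<Lambda> \<notin> \<int>\<^sub>\<le>\<^sub>0"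
  and m: "m < 1" "!!i. i \<in> T ==> norm (w i) <= m"
  and d: "0 < d" "!!i l. i \<in> T ==> l \<in> K ==> d <= norm (\<eta> (b l) - w i)"
  and A: "!!n i. 1 <= n ==> i \<in> T ==>
   norm (J r3 n (w i) - Xr n i * (Dh (w i) * p (w i)) - Sm n (w i)) <= A * \<rho> ^ n * real n powr (\<Lambda> - 2)"
 shows "uniform_limit T (%n i. rr P n (w i) (Xr n i)) (%_. 0) sequentially"
proof -
 obtain A1 N1 where A1: "0 < A1" "1 <= N1" "!!n w. N1 <= n ==> norm w <= m ==>
   norm (of_real (kap n) * trf (poly (P n)) w - J r3 n w) <= A1 * \<rho> ^ n * real n powr (\<Lambda> - 2)"
  using main_approx_powr[OF P orth m(1)] by metis
 obtain pb where pb: "0 < pb" "!!v. v \<in> cball 0 m ==> norm (1 / p v) <= pb"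
 proof (rule bounded_on_compact)
  show "(%v. 1 / p v) holomorphic_on ball 0 R2" using p_nz by (intro holomorphic_intros p_hol) auto
  show "compact (cball (0 :: complex) m)" by simp
  show "cball 0 m \<subseteq> ball (0 :: complex) R2" using m radii by auto
 qed blast
 define h where "h l = N l * H (b l)" for l
 have heq: "h l = \<alpha>c l * Dh (\<eta> (b l)) / p (\<eta> (b l))" for l
  by (simp add: h_def H_def \<alpha>c_def)
 define c where "c n = pb * ((A1 + A) * \<bar>real n powr (\<Lambda> - 2) / bn n\<bar> + (\<Sum>l\<in>K. norm (h l) / d * \<rho> * \<bar>cd (lam l) n / bn n\<bar>))" for n
 have "(%n. real n powr (\<Lambda> - 2) / real n powr (\<Lambda> - 1)) \<longlonglongrightarrow> 0" by (rule powr_ratio_tendsto_0) simp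
 hence "c \<longlonglongrightarrow> pb * ((A1 + A) * 0 + (\<Sum>l\<in>K. norm (h l) / d * \<rho> * 0))"
  unfolding c_def[abs_def] using lam_le
  by (intro tendsto_intros tendsto_rabs_zero divide_bn_null[OF _ \<Lambda>] cd_null)
 hence c0: "c \<longlonglongrightarrow> 0" by simp
 obtain N2 where N2: "!!n. N2 <= n ==> bn n ~= 0"
  using bn_nz[OF \<Lambda>] unfolding eventually_sequentially by blast
 show ?thesis
 proof (rule uniform_limit_null[OF _ c0])
  fix n i assume n': "max N1 N2 <= n" and i: "i \<in> T"
  have n: "N1 <= n" and b0: "bn n ~= 0" using n' N2[of n] by auto
  define v where "v = w i"
  have v1: "norm v <= m" "norm v < R2" using m(2)[OF i] m(1) radii by (auto simp: v_def)
  have nz: "p v ~= 0" using p_nz v1 by blast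
  define V where "V = of_real (kap n) * trf (poly (P n)) v - J r3 n v"
  define U where "U = J r3 n v - Xr n i * (Dh v * p v) - Sm n v"
  have rn: "0 < \<rho> ^ n" using \<rho>_pos by simp
  have VU: "norm (V + U) <= (A1 + A) * \<rho> ^ n * real n powr (\<Lambda> - 2)"
   using norm_triangle_ineq[of V U] A1(3)[OF n v1(1)] A[of n i] i n A1(2) unfolding V_def U_def v_def
   by (simp add: distrib_right)
  have dne: "\<eta> (b l) - v ~= 0" if "l \<in> K" for l using d(1) d(2)[OF i that] by (auto simp: v_def)
  let ?Y = "%i. h i / (\<eta> (b i) - v) / p v * b i ^ Suc n"
  have Tsub: "(\<Sum>l\<in>top_ind. \<alpha>c l * Dh (\<eta> (b l)) * (1 / (p v * p (\<eta> (b l)) * (\<eta> (b l) - v))) * b l ^ Suc n)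
    = (\<Sum>l\<in>K. if lam l = \<Lambda> then (?Y l) else 0)"
  proof -
   have "(\<Sum>l\<in>K. if lam l = \<Lambda> then (?Y l) else 0)
     = (\<Sum>l\<in>top_ind. (?Y l))"
    unfolding top_ind_def using K by (intro sum.inter_filter[symmetric])
   thus ?thesis by (simp add: heq mult_ac)
  qed
  have e1: "(of_real (kap n) * poly (P n) (\<xi> v) - Xr n i) * Dh v = (V + U + Sm n v) / p v"
   using nz by (simp add: V_def U_def trf_def field_simps)
  have e2: "Sm n v / p v / of_real (bn n) - (\<Sum>l\<in>K. if lam l = \<Lambda> then (?Y l) else 0)
    = (\<Sum>l\<in>K. (?Y l) * (of_real (cf (lam l) n / bn n) - (if lam l = \<Lambda> then 1 else 0)))"
   unfolding Sm_def sum_divide_distrib sum_subtractf[symmetric]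
  proof (rule sum.cong)
   fix l
   define Y where "Y = (?Y l)"
   have "N l * (H (b l) / (\<eta> (b l) - v)) * of_real (cf (lam l) n) * b l ^ Suc n / p v / of_real (bn n)
     = Y * of_real (cf (lam l) n / bn n)" by (simp add: Y_def h_def)
   thus "N l * (H (b l) / (\<eta> (b l) - v)) * of_real (cf (lam l) n) * b l ^ Suc n / p v / of_real (bn n)
     - (if lam l = \<Lambda> then (?Y l) else 0)
     = (?Y l) * (of_real (cf (lam l) n / bn n) - (if lam l = \<Lambda> then 1 else 0))"
    unfolding Y_def[symmetric] by (cases "lam l = \<Lambda>") (simp_all only: if_True if_False right_diff_distrib mult_1_right mult_zero_right diff_zero simp_thms)
  qed simp
  have "rr P n v (Xr n i) = ((V + U) / p v / of_real (bn n) +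
    (\<Sum>l\<in>K. (?Y l) * (of_real (cf (lam l) n / bn n) - (if lam l = \<Lambda> then 1 else 0)))) / of_real \<rho> ^ n"
   unfolding rr_def e1 Tsub e2[symmetric] by (simp only: add_divide_distrib diff_divide_distrib add_diff_eq)
  also have "norm ... <= c n"
  proof -
   have t: "norm ((?Y l) * (of_real (cf (lam l) n / bn n) - (if lam l = \<Lambda> then 1 else 0)))
     <= pb * (norm (h l) / d * \<rho> * \<bar>cd (lam l) n / bn n\<bar>) * \<rho> ^ n" if l: "l \<in> K" for l
   proof -
    have "complex_of_real (cf (lam l) n / bn n) - (if lam l = \<Lambda> then 1 else 0) = of_real (cd (lam l) n / bn n)"
     using b0 by (simp add: cd_def diff_divide_distrib)
    hence "norm ((?Y l) * (of_real (cf (lam l) n / bn n) - (if lam l = \<Lambda> then 1 else 0)))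
      = norm (h l) / norm (\<eta> (b l) - v) * norm (1 / p v) * \<rho> ^ Suc n * \<bar>cd (lam l) n / bn n\<bar>"
     by (simp only: norm_mult norm_divide norm_power b[OF l] norm_of_real norm_one) simp
    also have "... <= norm (h l) / d * pb * \<rho> ^ Suc n * \<bar>cd (lam l) n / bn n\<bar>"
     using d(1) d(2)[OF i l] pb(2)[of v] pb(1) v1 \<rho>_pos
     by (intro mult_mono divide_left_mono mult_nonneg_nonneg divide_nonneg_nonneg mult_pos_pos) (auto simp: v_def)
    finally show ?thesis by (simp add: mult_ac)
   qed
   have "norm ((V + U) / p v / of_real (bn n)) = norm (1 / p v) * norm (V + U) / \<bar>bn n\<bar>"
    by (simp add: norm_divide norm_mult)
   also have "... <= pb * ((A1 + A) * \<rho> ^ n * real n powr (\<Lambda> - 2)) / \<bar>bn n\<bar>"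
    using VU pb(2)[of v] pb(1) v1 by (intro divide_right_mono mult_mono) auto
   also have "... = pb * ((A1 + A) * \<bar>real n powr (\<Lambda> - 2) / bn n\<bar>) * \<rho> ^ n" by simp
   finally have "norm ((V + U) / p v / of_real (bn n)) <= pb * ((A1 + A) * \<bar>real n powr (\<Lambda> - 2) / bn n\<bar>) * \<rho> ^ n" .
   moreover have "norm (\<Sum>l\<in>K. (?Y l) * (of_real (cf (lam l) n / bn n) - (if lam l = \<Lambda> then 1 else 0)))
     <= (\<Sum>l\<in>K. pb * (norm (h l) / d * \<rho> * \<bar>cd (lam l) n / bn n\<bar>) * \<rho> ^ n)"
    by (rule order_trans[OF norm_sum sum_mono[OF t]])
   ultimately have "norm ((V + U) / p v / of_real (bn n) +
    (\<Sum>l\<in>K. (?Y l) * (of_real (cf (lam l) n / bn n) - (if lam l = \<Lambda> then 1 else 0))))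
    <= pb * ((A1 + A) * \<bar>real n powr (\<Lambda> - 2) / bn n\<bar>) * \<rho> ^ n + (\<Sum>l\<in>K. pb * (norm (h l) / d * \<rho> * \<bar>cd (lam l) n / bn n\<bar>) * \<rho> ^ n)"
    by (intro norm_triangle_le add_mono)
   also have "... = c n * \<rho> ^ n"
    by (simp add: c_def distrib_left distrib_right sum_distrib_left sum_distrib_right)
   finally show ?thesis
    unfolding norm_divide[of _ "of_real \<rho> ^ n"] norm_power norm_of_real abs_of_pos[OF \<rho>_pos] pos_divide_le_eq[OF rn] .
  qed
  finally show "norm (rr P n (w i) (Xr n i)) <= c n" by (simp add: v_def)
 qed
qed

lemma asymptotics_at_singularity:
 fixes P :: "nat \<Rightarrow> complex poly"
 assumes P: "!!n. degree (P n) = n" "!!n. lead_coeff (P n) = 1"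
  and orth: "!!n m. m < n ==> cip (trf (poly (P n))) (trf (%z. z ^ m)) = 0"
  and j: "j \<in> K"
 shows "(%n. norm (of_real (kap n) * poly (P n) (\<xi> (\<eta> (b j)))
   - of_real (gen_binomial (real n) (lam j)) * \<alpha>c j * (1 / (C (b j))\<^sup>2) * b j ^ n
   - of_real (bn n) * inverse (Dh (\<eta> (b j))) *
    (\<Sum>l\<in>top_ind - {j}. \<alpha>c l * Dh (\<eta> (b l)) * (1 / (p (\<eta> (b j)) * p (\<eta> (b l)) * (\<eta> (b l) - \<eta> (b j)))) * b l ^ Suc n)))
  \<in> o(%n. real n powr max (lam j) (\<Lambda> - 1) * \<rho> ^ n)"
proof -
 define w where "w = \<eta> (b j)"
 define mx where "mx = max (lam j) (\<Lambda> - 1)"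
 \<comment> \<open>The error exponent of \<open>asym_at\<close> is exactly one below the comparison
   exponent.\<close>
 have mx: "max (lam j + 1) \<Lambda> - 2 = mx - 1" "lam j <= mx" "\<Lambda> - 1 <= mx" by (auto simp: mx_def)
 have bA: "b j \<in> Ann" "norm (b j) < 1" "b j ~= 0" "r0 < norm (b j)"
  using b_Ann[OF j] b[OF j] radii \<rho>_pos by auto
 have w: "norm w < 1" "norm w < R2" using \<eta>_lt[of "b j"] \<eta>_inR2[OF bA(1)] bA by (auto simp: w_def)
 have nz: "p w ~= 0" "Dh w ~= 0" "C (b j) ~= 0" using p_nz Dh_nz w C_nz[OF bA(4)] by auto
 define g where "g = Dh w * p w"
 have g: "g ~= 0" using nz by (simp add: g_def)
 obtain A1 N1 where A1: "0 < A1" "1 <= N1" "!!n v. N1 <= n ==> norm v <= norm w ==>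
   norm (of_real (kap n) * trf (poly (P n)) v - J r3 n v) <= A1 * \<rho> ^ n * real n powr (mx - 1)"
  using main_approx_powr[OF P orth w(1), of "mx - 1"] by metis
 obtain A where A0: "0 < A" "!!n. 1 <= n ==> norm (J r3 n (\<eta> (b j)) - N j * (H (b j) / (b j * deriv \<eta> (b j))) * of_real (cf (lam j + 1) n) * b j ^ Suc n
    - (\<Sum>l\<in>K - {j}. N l * (H (b l) / (\<eta> (b l) - \<eta> (b j))) * of_real (cf (lam l) n) * b l ^ Suc n))
    <= A * \<rho> ^ n * real n powr (max (lam j + 1) \<Lambda> - 2)"
  using asym_at[OF j] by blast
 note A = A0[unfolded mx(1)]
 define F where "F l = N l * (H (b l) / (\<eta> (b l) - w)) / g" for l
 have F: "F l = inverse (Dh w) * (\<alpha>c l * Dh (\<eta> (b l)) * (1 / (p w * p (\<eta> (b l)) * (\<eta> (b l) - w))))" for l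
  by (simp add: F_def g_def H_def \<alpha>c_def divide_inverse mult_ac)
 define f0 where "f0 = \<alpha>c j * (1 / (C (b j))\<^sup>2)"
 have "deriv \<eta> (b j) = (C (b j))\<^sup>2 / (p w)\<^sup>2"
  using \<eta>'_eq[OF bA(1)] nz by (simp add: w_def field_simps)
 \<comment> \<open>Since \<open>\<eta>' = C^2 / p^2\<close>, the coefficient from
   \<open>asym_at\<close> collapses to \<open>\<alpha>c j / C^2\<close>, that is
   \<open>\<alpha> j * \<phi>'(a_j)\<close>; the spare factor \<open>b j\<close> lowers the power
   from \<open>Suc n\<close> to \<open>n\<close>.\<close>
 hence f0: "N j * (H (b j) / (b j * deriv \<eta> (b j))) * b j / g = f0" using nz bA by (simp add: f0_def \<alpha>c_def H_def g_def w_def[symmetric] power2_eq_square field_simps)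
 define E1 where "E1 n = of_real (kap n) * poly (P n) (\<xi> w)
   - of_real (gen_binomial (real n) (lam j)) * \<alpha>c j * (1 / (C (b j))\<^sup>2) * b j ^ n
   - of_real (bn n) * inverse (Dh w) *
    (\<Sum>l\<in>top_ind - {j}. \<alpha>c l * Dh (\<eta> (b l)) * (1 / (p w * p (\<eta> (b l)) * (\<eta> (b l) - w))) * b l ^ Suc n)" for n
 define V where "V n = of_real (kap n) * trf (poly (P n)) w - J r3 n w" for n
 define U where "U n = J r3 n w - N j * (H (b j) / (b j * deriv \<eta> (b j))) * of_real (cf (lam j + 1) n) * b j ^ Suc n
    - (\<Sum>l\<in>K - {j}. N l * (H (b l) / (\<eta> (b l) - w)) * of_real (cf (lam l) n) * b l ^ Suc n)" for n
 have dec: "E1 n = (V n + U n) / g + f0 * b j ^ n * of_real (cf (lam j + 1) n - gen_binomial (real n) (lam j))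
   + (\<Sum>l\<in>K - {j}. F l * b l ^ Suc n * of_real (cd (lam l) n))" for n
 proof -
  have "of_real (kap n) * poly (P n) (\<xi> w) = of_real (kap n) * trf (poly (P n)) w / g"
   using nz by (simp add: trf_def g_def)
  also have "of_real (kap n) * trf (poly (P n)) w = V n + U n + N j * (H (b j) / (b j * deriv \<eta> (b j))) * of_real (cf (lam j + 1) n) * b j ^ Suc n
    + (\<Sum>l\<in>K - {j}. N l * (H (b l) / (\<eta> (b l) - w)) * of_real (cf (lam l) n) * b l ^ Suc n)"
   by (simp add: V_def U_def)
  also have "... / g = (V n + U n) / g + (N j * (H (b j) / (b j * deriv \<eta> (b j))) * b j / g) * of_real (cf (lam j + 1) n) * b j ^ n
    + (\<Sum>l\<in>K - {j}. F l * b l ^ Suc n * of_real (cf (lam l) n))"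
   by (simp add: add_divide_distrib sum_divide_distrib F_def mult_ac)
  finally have 1: "of_real (kap n) * poly (P n) (\<xi> w) = (V n + U n) / g + f0 * of_real (cf (lam j + 1) n) * b j ^ n
    + (\<Sum>l\<in>K - {j}. F l * b l ^ Suc n * of_real (cf (lam l) n))" by (simp only: f0)
  have "of_real (bn n) * inverse (Dh w) *
    (\<Sum>l\<in>top_ind - {j}. \<alpha>c l * Dh (\<eta> (b l)) * (1 / (p w * p (\<eta> (b l)) * (\<eta> (b l) - w))) * b l ^ Suc n)
    = (\<Sum>l\<in>top_ind - {j}. F l * b l ^ Suc n * of_real (bn n))"
   unfolding F sum_distrib_left by (simp add: mult_ac)
  also have "(\<Sum>l\<in>top_ind - {j}. F l * b l ^ Suc n * of_real (bn n))
    = (\<Sum>l\<in>K - {j}. if lam l = \<Lambda> then F l * b l ^ Suc n * of_real (bn n) else 0)"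
  proof -
   have "top_ind - {j} = {l \<in> K - {j}. lam l = \<Lambda>}" by (auto simp: top_ind_def)
   thus ?thesis using K by (simp only: sum.inter_filter finite_Diff)
  qed
  finally have 2: "of_real (bn n) * inverse (Dh w) *
    (\<Sum>l\<in>top_ind - {j}. \<alpha>c l * Dh (\<eta> (b l)) * (1 / (p w * p (\<eta> (b l)) * (\<eta> (b l) - w))) * b l ^ Suc n)
    = (\<Sum>l\<in>K - {j}. if lam l = \<Lambda> then F l * b l ^ Suc n * of_real (bn n) else 0)" .
  have 3: "(\<Sum>l\<in>K - {j}. F l * b l ^ Suc n * of_real (cf (lam l) n)) - (\<Sum>l\<in>K - {j}. if lam l = \<Lambda> then F l * b l ^ Suc n * of_real (bn n) else 0)
    = (\<Sum>l\<in>K - {j}. F l * b l ^ Suc n * of_real (cd (lam l) n))"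
   unfolding sum_subtractf[symmetric] by (rule sum.cong) (auto simp: cd_def algebra_simps)
  have 4: "of_real (gen_binomial (real n) (lam j)) * \<alpha>c j * (1 / (C (b j))\<^sup>2) * b j ^ n
    = f0 * b j ^ n * of_real (gen_binomial (real n) (lam j))" by (simp add: f0_def)
  show ?thesis unfolding E1_def 1 2 4 3[symmetric] by (simp add: algebra_simps)
 qed
 define c where "c n = (A1 + A) / norm g * (real n powr (mx - 1) / real n powr mx)
   + norm f0 * \<bar>(cf (lam j + 1) n - gen_binomial (real n) (lam j)) / real n powr mx\<bar>
   + (\<Sum>l\<in>K - {j}. norm (F l) * \<rho> * \<bar>cd (lam l) n / real n powr mx\<bar>)" for n
 have "c \<longlonglongrightarrow> (A1 + A) / norm g * 0 + norm f0 * 0 + (\<Sum>l\<in>K - {j}. norm (F l) * \<rho> * 0)"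
  unfolding c_def[abs_def] using lam_le
  by (intro tendsto_intros tendsto_rabs_zero powr_ratio_tendsto_0 powr_quotient_null_mono[OF cf_succ_null mx(2)]
     powr_quotient_null_mono[OF cd_null mx(3)]) auto
 hence c0: "c \<longlonglongrightarrow> 0" by simp
 have bound: "norm (E1 n) <= c n * (real n powr mx * \<rho> ^ n)" if n: "N1 <= n" for n
 proof -
  have n0: "0 < real n" using n A1(2) by simp
  hence px: "0 < real n powr mx" by simp
  have "norm (V n + U n) <= (A1 + A) * \<rho> ^ n * real n powr (mx - 1)"
   using norm_triangle_ineq[of "V n" "U n"] A1(3)[OF n order_refl] A(2)[of n] n A1(2) unfolding V_def U_def w_def
   by (simp add: distrib_right)
  hence "norm ((V n + U n) / g) <= (A1 + A) * \<rho> ^ n * real n powr (mx - 1) / norm g"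
   using g by (simp add: norm_divide divide_right_mono)
  moreover have "norm (f0 * b j ^ n * of_real (cf (lam j + 1) n - gen_binomial (real n) (lam j)))
    = norm f0 * \<rho> ^ n * \<bar>cf (lam j + 1) n - gen_binomial (real n) (lam j)\<bar>"
   by (simp only: norm_mult norm_power norm_of_real b[OF j])
  moreover have "norm (\<Sum>l\<in>K - {j}. F l * b l ^ Suc n * of_real (cd (lam l) n)) <= (\<Sum>l\<in>K - {j}. norm (F l) * \<rho> ^ Suc n * \<bar>cd (lam l) n\<bar>)"
   by (rule order_trans[OF norm_sum sum_mono]) (simp add: norm_mult norm_power b)
  ultimately have "norm (E1 n) <= (A1 + A) * \<rho> ^ n * real n powr (mx - 1) / norm g
    + norm f0 * \<rho> ^ n * \<bar>cf (lam j + 1) n - gen_binomial (real n) (lam j)\<bar>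
    + (\<Sum>l\<in>K - {j}. norm (F l) * \<rho> ^ Suc n * \<bar>cd (lam l) n\<bar>)"
   unfolding dec by (intro norm_triangle_le add_mono) simp_all
  also have "... = c n * (real n powr mx * \<rho> ^ n)"
  proof -
   have "(\<Sum>l\<in>K - {j}. norm (F l) * \<rho> * \<bar>cd (lam l) n / real n powr mx\<bar>) * (real n powr mx * \<rho> ^ n)
     = (\<Sum>l\<in>K - {j}. norm (F l) * \<rho> ^ Suc n * \<bar>cd (lam l) n\<bar>)"
    unfolding sum_distrib_right using px n0 by (intro sum.cong) auto
   moreover have "(A1 + A) / norm g * (real n powr (mx - 1) / real n powr mx) * (real n powr mx * \<rho> ^ n)
     = (A1 + A) * \<rho> ^ n * real n powr (mx - 1) / norm g" using px by simp
   moreover have "norm f0 * \<bar>(cf (lam j + 1) n - gen_binomial (real n) (lam j)) / real n powr mx\<bar> * (real n powr mx * \<rho> ^ n)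
     = norm f0 * \<rho> ^ n * \<bar>cf (lam j + 1) n - gen_binomial (real n) (lam j)\<bar>" using px by simp
   ultimately show ?thesis unfolding c_def distrib_right by (simp only:)
  qed
  finally show ?thesis .
 qed
 have "(%n. norm (E1 n)) \<in> o(%n. real n powr mx * \<rho> ^ n)"
 proof (rule landau_o.smallI)
  fix e :: real assume "0 < e"
  with c0 have "\<forall>\<^sub>F n in sequentially. c n < e" by (rule order_tendstoD)
  thus "\<forall>\<^sub>F n in sequentially. norm (norm (E1 n)) <= e * norm (real n powr mx * \<rho> ^ n)"
   using eventually_ge_at_top[of N1]
  proof eventually_elim
   fix n assume "c n < e" "N1 <= n"
   moreover have "0 <= real n powr mx * \<rho> ^ n" using \<rho>_pos by simp
   ultimately have "norm (E1 n) <= e * (real n powr mx * \<rho> ^ n)"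
    using bound[of n] mult_right_mono[of "c n" e "real n powr mx * \<rho> ^ n"] by simp
   thus "norm (norm (E1 n)) <= e * norm (real n powr mx * \<rho> ^ n)" using \<rho>_pos by simp
  qed
 qed
 thus ?thesis by (simp add: E1_def[abs_def] w_def mx_def)
qed

end

subsection \<open>Continuation of the conformal maps across the curve\<close>

text \<open>Values of modulus below and above one rule out a constant, so the open mapping theorem
  applies.\<close>

lemma open_map_meets:
 fixes f :: "complex \<Rightarrow> complex"
 assumes f: "f holomorphic_on ball x d" "!!v. v \<in> ball x d ==> norm v < 1 ==> norm (f v) < 1"
  "!!v. v \<in> ball x d ==> 1 < norm v ==> 1 < norm (f v)" and x: "norm x = 1" "0 < d"
 shows "open (f ` ball x d)"
proof (rule open_mapping_thm[OF f(1)])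
 define e where "e = min (d / 2) (1 / 2)"
 have e: "0 < e" "e < d" "e <= 1 / 2" using x by (auto simp: e_def)
 define y z where "y = of_real (1 - e) * x" and "z = of_real (1 + e) * x"
 have nyz: "norm y = 1 - e" "norm z = 1 + e" using e x by (auto simp: y_def z_def norm_mult abs_if simp del: of_real_diff of_real_add)
 have "x - y = of_real e * x" "x - z = of_real (- e) * x" by (auto simp: y_def z_def algebra_simps)
 hence "norm (x - y) = e" "norm (x - z) = e" using e x by (auto simp: norm_mult)
 hence yz: "y \<in> ball x d" "z \<in> ball x d" using e by (auto simp: dist_norm)
 hence "norm (f y) < 1" "1 < norm (f z)" using f(2)[of y] f(3)[of z] nyz e by auto
 thus "\<not> f constant_on ball x d" using yz unfolding constant_on_def by (metis less_asym)
qed auto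

context ext_map
begin

lemma \<psi>_lim_at: "r0 < norm v ==> ((%t. \<psi> (of_real t * v)) \<longlongrightarrow> \<psi> v) (at (1 :: real) within S)"
proof -
 assume "r0 < norm v"
 hence "v \<in> ext_disk r0" by (simp add: ext_disk_def)
 hence "isCont \<psi> v"
  using continuous_on_eq_continuous_at[OF open_ext[of r0]] hol_imp_cont[OF hol] by blast
 moreover have "((%t. of_real t * v) \<longlongrightarrow> of_real 1 * v) (at (1 :: real) within S)" by (intro tendsto_intros)
 ultimately show ?thesis using isCont_tendsto_compose[of v \<psi>] by simp
qed

lemma circle_in_closure:
 assumes "r0 < 1" "norm v = 1" shows "\<psi> v \<in> closure (interior_dom \<psi> 1)"
proof (rule Lim_in_closed_set)
 show "((%t. \<psi> (of_real t * v)) \<longlongrightarrow> \<psi> v) (at_left 1)" by (rule \<psi>_lim_at) (use assms in simp)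
 have "\<forall>\<^sub>F t in at_left (1 :: real). t \<in> {max r0 0<..<1}"
  using assms r0 by (intro eventually_at_left_real) auto
 thus "\<forall>\<^sub>F t in at_left (1 :: real). \<psi> (of_real t * v) \<in> closure (interior_dom \<psi> 1)"
 proof eventually_elim
  fix t :: real assume "t \<in> {max r0 0<..<1}"
  hence "norm (of_real t * v) = t" "r0 < t" "t < 1" using assms by (auto simp: norm_mult)
  thus "\<psi> (of_real t * v) \<in> closure (interior_dom \<psi> 1)"
   using interior_dom_iff[of "of_real t * v" 1] assms closure_subset by auto
 qed
qed auto

lemma bounded_interior_dom: assumes "r0 < t" shows "bounded (interior_dom \<psi> t)"
proof -
 obtain R where "0 < R" "!!z. R <= norm z ==> z \<in> Omega \<psi> t" using large_in_Omega[OF assms] by blast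
 hence "interior_dom \<psi> t \<subseteq> ball 0 R"
  using closure_subset[of "Omega \<psi> t"] by (force simp: interior_dom_def not_le)
 thus ?thesis using bounded_subset bounded_ball by blast
qed

text \<open>The modulus of \<open>\<theta> \<circ> \<psi>\<close> tends to one at the circle because
  \<theta> is proper, so the map reflects to a full ring. The continuation is injective and extends
  \<theta> conformally past the curve; \<xi> is the inverse. The target \<open>V\<close> is carried
  along so that the interior Szego function can be pulled back.\<close>

lemma interior_extension:
 assumes \<sigma>: "r0 < \<sigma>" "\<sigma> < 1" and \<theta>: "conformal_onto_disk (interior_dom \<psi> 1) \<theta>"
  and V: "open V" "closure (interior_dom \<psi> 1) \<subseteq> V"
 obtains R1 R2 \<eta> \<xi> where "1 < R1" "1 < R2"
  "\<eta> holomorphic_on {v. \<sigma> < norm v \<and> norm v < R1}" "inj_on \<eta> {v. \<sigma> < norm v \<and> norm v < R1}"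
  "!!v. \<sigma> < norm v ==> norm v < 1 ==> \<eta> v = \<theta> (\<psi> v)" "!!v. norm v = 1 ==> norm (\<eta> v) = 1"
  "!!v. 1 < norm v ==> norm v < R1 ==> 1 < norm (\<eta> v)"
  "!!v. \<sigma> < norm v ==> norm v < R1 ==> norm (\<eta> v) < R2"
  "\<xi> holomorphic_on ball 0 R2" "inj_on \<xi> (ball 0 R2)"
  "!!v. \<sigma> < norm v ==> norm v < R1 ==> \<xi> (\<eta> v) = \<psi> v"
  "!!z. z \<in> interior_dom \<psi> 1 ==> \<xi> (\<theta> z) = z" "\<xi> ` ball 0 R2 \<subseteq> V"
proof -
 define G where "G = interior_dom \<psi> 1"
 have r01: "r0 < 1" using \<sigma> by simp
 have \<sigma>0: "0 < \<sigma>" using \<sigma> r0 by simp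
 have th: "\<theta> holomorphic_on G" "inj_on \<theta> G" "\<theta> ` G = ball 0 1" using \<theta> by (auto simp: conformal_onto_disk_def G_def)
 have oG: "open G" unfolding G_def by (rule open_interior_dom)
 have \<psi>G: "\<psi> v \<in> G \<longleftrightarrow> norm v < 1" if "r0 < norm v" for v unfolding G_def using interior_dom_iff[OF that r01] .
 define F where "F v = \<theta> (\<psi> v)" for v
 have "\<theta> \<circ> \<psi> holomorphic_on {v. r0 < norm v \<and> norm v < 1}"
  by (rule holomorphic_on_compose_gen[OF hol_subset[OF hol] th(1)]) (use \<psi>G in "auto simp: ext_disk_def")
 hence F_hol: "F holomorphic_on {v. r0 < norm v \<and> norm v < 1}" by (simp add: o_def F_def[abs_def])
 have F_lt: "norm (F v) < 1" if "r0 < norm v" "norm v < 1" for v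
 proof -
  have "\<theta> (\<psi> v) \<in> \<theta> ` G" using \<psi>G that by blast
  thus ?thesis unfolding th(3) F_def by simp
 qed
 have F_inj: "x = y" if "F x = F y" "r0 < norm x" "norm x < 1" "r0 < norm y" "norm y < 1" for x y
 proof -
  have "\<psi> x = \<psi> y" using th(2) that \<psi>G by (auto simp: F_def inj_on_def)
  thus ?thesis using inj that by (auto simp: inj_on_def ext_disk_def)
 qed
 \<comment> \<open>Reflection divides by \<open>F\<close>; being injective, \<open>F\<close> has at
   most one zero, and \<open>s\<close> is chosen beyond it.\<close>
 obtain s where s: "\<sigma> < s" "s < 1" "!!v. s < norm v ==> norm v < 1 ==> F v ~= 0"
 proof (cases "\<exists>v. r0 < norm v \<and> norm v < 1 \<and> F v = 0")
  case True
  then obtain v0 where v0: "r0 < norm v0" "norm v0 < 1" "F v0 = 0" by blast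
  show ?thesis
  proof (rule that[of "(max \<sigma> (norm v0) + 1) / 2"])
   fix v :: complex assume v: "(max \<sigma> (norm v0) + 1) / 2 < norm v" "norm v < 1"
   hence "norm v ~= norm v0" "r0 < norm v" using v0 \<sigma> by auto
   thus "F v ~= 0" using F_inj[of v v0] v v0 by auto
  qed (use v0 \<sigma> in auto)
 next
  case False
  show ?thesis by (rule that[of "(\<sigma> + 1) / 2"]) (use False \<sigma> in "auto simp: field_simps")
 qed
 define s2 where "s2 = (s + 1) / 2"
 have s2: "s < s2" "s2 < 1" "0 < s2" "\<sigma> < s2" using s \<sigma>0 by (auto simp: s2_def)
 have s2': "1 < 1 / s2" using s2 by simp
 \<comment> \<open>The preimage under \<theta> of the closed disc of radius \<open>1 - e\<close> is
   compact in the open domain, so the curve has a neighbourhood that misses it.\<close>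
 have F_lim: "\<exists>d>0. \<forall>v. 1 - d < norm v \<and> norm v < 1 \<longrightarrow> \<bar>norm (F v) - 1\<bar> <= e" if e: "e > 0" for e
 proof -
  obtain ti where ti: "ti holomorphic_on ball 0 1" "!!z. z \<in> G ==> ti (\<theta> z) = z"
   using holomorphic_has_inverse[OF th(1) oG th(2)] th(3) by metis
  define Kc where "Kc = ti ` cball 0 (1 - e)"
  have sub: "cball 0 (1 - e) \<subseteq> ball (0 :: complex) 1" using e by auto
  have "compact Kc" unfolding Kc_def
   by (rule compact_continuous_image[OF hol_cont[OF ti(1) sub]]) simp
  moreover have "Kc \<subseteq> G"
  proof
   fix z assume "z \<in> Kc"
   then obtain w where "w \<in> ball 0 1" "z = ti w" using sub by (auto simp: Kc_def)
   thus "z \<in> G" using th(3) ti(2) by (metis imageE)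
  qed
  moreover have "open (ext_disk r0 \<inter> \<psi> -` (- Kc))"
   using \<open>compact Kc\<close> by (intro continuous_open_preimage cont\<psi> open_ext) (auto intro: compact_imp_closed)
  moreover have "sphere 0 1 \<subseteq> ext_disk r0 \<inter> \<psi> -` (- Kc)"
  proof
   fix v :: complex assume "v \<in> sphere 0 1"
   hence "r0 < norm v" "\<not> norm v < 1" using r01 by auto
   thus "v \<in> ext_disk r0 \<inter> \<psi> -` (- Kc)" using \<psi>G[of v] \<open>Kc \<subseteq> G\<close> by (auto simp: ext_disk_def)
  qed
  ultimately obtain d where d: "0 < d" "d < 1"
   "!!v. 1 - d < norm v ==> norm v < 1 + d ==> v \<in> ext_disk r0 \<inter> \<psi> -` (- Kc)"
   using open_contains_annulus[of "ext_disk r0 \<inter> \<psi> -` (- Kc)" 1] by auto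
  show ?thesis
  proof (intro exI[of _ d] conjI allI impI d(1))
   fix v :: complex assume v: "1 - d < norm v \<and> norm v < 1"
   hence vv: "r0 < norm v" "\<psi> v \<notin> Kc" using d(3)[of v] d(1) by (auto simp: ext_disk_def)
   hence "\<psi> v \<in> G" using \<psi>G v by simp
   hence "F v \<notin> cball 0 (1 - e)" using vv(2) ti(2)[of "\<psi> v"] unfolding Kc_def F_def by (metis image_eqI)
   thus "\<bar>norm (F v) - 1\<bar> <= e" using F_lt[OF vv(1)] v by auto
  qed
 qed
 obtain E where E: "E holomorphic_on {v. s2 < norm v \<and> norm v < 1 / s2}"
  "!!v. s2 < norm v ==> norm v < 1 ==> E v = F v"
  "!!v. 1 < norm v ==> norm v < 1 / s2 ==> E v = 1 / cnj (F (1 / cnj v))"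
 proof (rule reflection_extend[of s s2 F])
  show "F holomorphic_on {v. s < norm v \<and> norm v < 1}" by (rule hol_subset[OF F_hol]) (use s \<sigma> in auto)
 qed (use s s2 \<sigma>0 F_lim in auto)
 define \<eta> where "\<eta> v = (if norm v < 1 then F v else E v)" for v
 define An where "An = {v :: complex. \<sigma> < norm v \<and> norm v < 1 / s2}"
 have oA: "open {v :: complex. a < norm v \<and> norm v < b}" for a b
  by (intro open_Collect_conj open_Collect_less continuous_intros)
 have \<eta>E: "\<eta> v = E v" if "s2 < norm v" for v using E(2) that by (simp add: \<eta>_def)
 have \<eta>_hol: "\<eta> holomorphic_on An"
 proof -
  have 1: "\<eta> holomorphic_on {v. \<sigma> < norm v \<and> norm v < 1}"
   by (rule holomorphic_transform[OF hol_subset[OF F_hol]]) (use \<sigma> in \<open>auto simp: \<eta>_def\<close>)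
  have 2: "\<eta> holomorphic_on {v. s2 < norm v \<and> norm v < 1 / s2}"
   by (rule holomorphic_transform[OF E(1)]) (simp add: \<eta>E)
  have "An = {v. \<sigma> < norm v \<and> norm v < 1} \<union> {v. s2 < norm v \<and> norm v < 1 / s2}"
   using s2 s2' by (auto simp: An_def intro: less_trans[OF _ s2'])
  thus ?thesis using holomorphic_on_Un[OF 1 2 oA oA] by simp
 qed
 have \<eta>_lt: "norm (\<eta> v) < 1" if "\<sigma> < norm v" "norm v < 1" for v
  using F_lt[of v] that \<sigma> by (simp add: \<eta>_def)
 have inv: "s2 < norm (1 / cnj v)" "norm (1 / cnj v) < 1" if "1 < norm v" "norm v < 1 / s2" for v
 proof -
  have nv: "norm (1 / cnj v) = 1 / norm v" by (simp add: norm_divide)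
  have "norm v * s2 < 1" using that s2 by (simp add: pos_less_divide_eq)
  moreover have "0 < norm v" using that by linarith
  ultimately show "s2 < norm (1 / cnj v)" "norm (1 / cnj v) < 1"
   unfolding nv using that by (simp_all add: pos_less_divide_eq pos_divide_less_eq mult.commute)
 qed
 have \<eta>_gt: "1 < norm (\<eta> v)" if v: "1 < norm v" "norm v < 1 / s2" for v
 proof -
  have "norm (F (1 / cnj v)) < 1" "F (1 / cnj v) ~= 0" using inv[OF v] F_lt s(3) s2 \<sigma> by auto
  moreover have "norm (\<eta> v) = 1 / norm (F (1 / cnj v))" using E(3)[OF v] v by (simp add: \<eta>_def norm_divide)
  ultimately show ?thesis by simp
 qed
 have \<eta>_eq: "norm (\<eta> v) = 1" if v: "norm v = 1" for v
 proof -
  have vA: "v \<in> An" using v \<sigma> s2' by (simp add: An_def)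
  have "isCont \<eta> v"
   using continuous_on_eq_continuous_at[OF oA[of \<sigma> "1 / s2"]] hol_imp_cont[OF \<eta>_hol] vA
   unfolding An_def by blast
  moreover have tv: "((%t. of_real t * v) \<longlongrightarrow> v) (at (1 :: real) within S)" for S
   using tendsto_mult[OF tendsto_of_real[OF tendsto_ident_at] tendsto_const[of v], of 1 S] by simp
  ultimately have lim: "((%t. norm (\<eta> (of_real t * v))) \<longlongrightarrow> norm (\<eta> v)) (at (1 :: real) within S)" for S
   by (intro tendsto_norm isCont_tendsto_compose[of v \<eta>])
  have "norm (\<eta> v) <= 1"
  proof (rule tendsto_upperbound[OF lim])
   have "\<forall>\<^sub>F t in at_left (1 :: real). t \<in> {\<sigma><..<1}" using \<sigma> by (intro eventually_at_left_real) auto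
   thus "\<forall>\<^sub>F t in at_left (1 :: real). norm (\<eta> (of_real t * v)) <= 1"
   proof eventually_elim
    fix t :: real assume "t \<in> {\<sigma><..<1}"
    thus "norm (\<eta> (of_real t * v)) <= 1" using \<eta>_lt[of "of_real t * v"] v \<sigma>0 by (simp add: norm_mult)
   qed
  qed simp
  moreover have "1 <= norm (\<eta> v)"
  proof (rule tendsto_lowerbound[OF lim])
   have "\<forall>\<^sub>F t in at_right (1 :: real). t \<in> {1<..<1 / s2}" using s2' by (intro eventually_at_right_real) auto
   thus "\<forall>\<^sub>F t in at_right (1 :: real). 1 <= norm (\<eta> (of_real t * v))"
   proof eventually_elim
    fix t :: real assume "t \<in> {1<..<1 / s2}"
    thus "1 <= norm (\<eta> (of_real t * v))" using \<eta>_gt[of "of_real t * v"] v by (simp add: norm_mult)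
   qed
  qed simp
  ultimately show ?thesis by simp
 qed
 have \<eta>_iff: "norm (\<eta> v) < 1 \<longleftrightarrow> norm v < 1" "1 < norm (\<eta> v) \<longleftrightarrow> 1 < norm v" if "v \<in> An" for v
 proof -
  have "norm v < 1 \<or> norm v = 1 \<or> 1 < norm v" by linarith
  thus "norm (\<eta> v) < 1 \<longleftrightarrow> norm v < 1" "1 < norm (\<eta> v) \<longleftrightarrow> 1 < norm v"
   using \<eta>_lt[of v] \<eta>_eq[of v] \<eta>_gt[of v] that unfolding An_def by auto
 qed
 have \<eta>_inj: "inj_on \<eta> An"
 proof (rule inj_onI)
  fix x y assume xy: "x \<in> An" "y \<in> An" "\<eta> x = \<eta> y"
  consider "norm x < 1" "norm y < 1" | "1 < norm x" "1 < norm y" | "norm x = 1" "norm y = 1"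
   using \<eta>_iff[OF xy(1)] \<eta>_iff[OF xy(2)] xy(3) by (metis linorder_neqE)
  thus "x = y"
  proof cases
   case 1
   thus ?thesis using xy F_inj[of x y] \<sigma> by (auto simp: \<eta>_def An_def)
  next
   case 2
   hence a: "norm x < 1 / s2" "norm y < 1 / s2" using xy by (auto simp: An_def)
   have "cnj (F (1 / cnj x)) = cnj (F (1 / cnj y))"
    using xy(3) E(3)[OF 2(1) a(1)] E(3)[OF 2(2) a(2)] 2 by (simp add: \<eta>_def)
   hence Feq: "F (1 / cnj x) = F (1 / cnj y)" by simp
   have r: "r0 < norm (1 / cnj x)" using inv(1)[OF 2(1) a(1)] s2 \<sigma> by linarith
   have "r0 < norm (1 / cnj y)" using inv(1)[OF 2(2) a(2)] s2 \<sigma> by linarith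
   hence "1 / cnj x = 1 / cnj y" by (rule F_inj[OF Feq r inv(2)[OF 2(1) a(1)] _ inv(2)[OF 2(2) a(2)]])
   thus ?thesis by simp
  next
   \<comment> \<open>If two points of the circle had the same image, disjoint neighbourhoods of them
     would have open images that share a point of modulus below one, against injectivity
     inside.\<close>
   case 3
   show ?thesis
   proof (rule ccontr)
    assume ne: "x ~= y"
    have oAn: "open An" unfolding An_def by (rule oA)
    obtain d1 where d1: "0 < d1" "ball x d1 \<subseteq> An" using oAn xy(1) open_contains_ball by blast
    obtain d2 where d2: "0 < d2" "ball y d2 \<subseteq> An" using oAn xy(2) open_contains_ball by blast
    define d where "d = min (min d1 d2) (dist x y / 2)"
    have d: "0 < d" "ball x d \<subseteq> An" "ball y d \<subseteq> An" "d <= dist x y / 2" using d1 d2 ne by (auto simp: d_def)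
    have op: "open (\<eta> ` ball z d)" if "norm z = 1" "ball z d \<subseteq> An" for z
     by (rule open_map_meets[OF hol_subset[OF \<eta>_hol that(2)]]) (use \<eta>_iff that d in "auto dest!: subsetD")
    have "open (\<eta> ` ball x d \<inter> \<eta> ` ball y d)" using op 3 d by (intro open_Int) auto
    moreover have "\<eta> x \<in> \<eta> ` ball x d \<inter> \<eta> ` ball y d" using d(1) xy(3) by (metis IntI centre_in_ball imageI)
    ultimately obtain \<epsilon> where \<epsilon>: "0 < \<epsilon>" "ball (\<eta> x) \<epsilon> \<subseteq> \<eta> ` ball x d \<inter> \<eta> ` ball y d"
     using open_contains_ball by blast
    define e where "e = min (\<epsilon> / 2) (1 / 2)"
    have e: "0 < e" "e < \<epsilon>" "e <= 1 / 2" using \<epsilon> by (auto simp: e_def)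
    define w where "w = of_real (1 - e) * \<eta> x"
    have nw: "norm w < 1" using \<eta>_eq[OF 3(1)] e by (simp add: w_def norm_mult del: of_real_diff)
    have "\<eta> x - w = of_real e * \<eta> x" by (simp add: w_def algebra_simps)
    hence "w \<in> ball (\<eta> x) \<epsilon>" using \<eta>_eq[OF 3(1)] e by (simp add: dist_norm norm_mult)
    then obtain x' y' where x': "x' \<in> ball x d" "w = \<eta> x'" and y': "y' \<in> ball y d" "w = \<eta> y'" using \<epsilon>(2) by blast
    have A: "x' \<in> An" "y' \<in> An" using x' y' d by auto
    have "norm x' < 1" using \<eta>_iff(1)[OF A(1)] nw x' by simp
    moreover have "norm y' < 1" using \<eta>_iff(1)[OF A(2)] nw y' by simp
    ultimately
    have "x' = y'" using A x' y' F_inj[of x' y'] \<sigma> by (auto simp: \<eta>_def An_def)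
    thus False using x' y' d(4) dist_triangle[of x y x'] by (simp add: dist_commute)
   qed
  qed
 qed
 define \<Theta> where "\<Theta> z = (if z \<in> G then \<theta> z else \<eta> (\<phi> z))" for z
 define Dm where "Dm = (G \<union> \<psi> ` An) \<inter> V"
 have An0: "An \<subseteq> ext_disk r0" using \<sigma> by (auto simp: An_def ext_disk_def)
 have \<phi>An: "r0 < norm v" if "v \<in> An" for v using that An0 by (auto simp: ext_disk_def)
 have o\<psi>: "open (\<psi> ` An)" using An0 oA unfolding An_def by (intro open_image) auto
 have \<Theta>\<psi>: "\<Theta> (\<psi> v) = \<eta> v" if "v \<in> An" for v
  using \<psi>G[OF \<phi>An[OF that]] \<phi>An[OF that] by (simp add: \<Theta>_def \<eta>_def F_def)
 have \<Theta>_hol: "\<Theta> holomorphic_on G \<union> \<psi> ` An"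
 proof (rule holomorphic_on_Un[OF _ _ oG o\<psi>])
  show "\<Theta> holomorphic_on G" by (rule holomorphic_transform[OF th(1)]) (simp add: \<Theta>_def)
  have "\<eta> \<circ> \<phi> holomorphic_on \<psi> ` An"
  proof (rule holomorphic_on_compose_gen[OF _ \<eta>_hol])
   show "\<phi> holomorphic_on \<psi> ` An" by (rule hol_subset[OF \<phi>_hol]) (use An0 in "auto simp: Omega_def")
  qed (use \<phi>An in auto)
  thus "\<Theta> holomorphic_on \<psi> ` An" by (rule holomorphic_transform) (use \<Theta>\<psi> \<phi>An in auto)
 qed
 have \<Theta>G: "norm (\<Theta> z) < 1 \<longleftrightarrow> z \<in> G" if zD: "z \<in> G \<union> \<psi> ` An" for z
 proof (cases "z \<in> G")
  case True
  hence "\<theta> z \<in> ball 0 1" using th(3) by blast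
  thus ?thesis using True by (simp add: \<Theta>_def)
 next
  case False
  then obtain v where "v \<in> An" "z = \<psi> v" using zD by blast
  thus ?thesis using False \<Theta>\<psi> \<eta>_iff \<psi>G \<phi>An by simp
 qed
 have \<Theta>_inj: "inj_on \<Theta> (G \<union> \<psi> ` An)"
 proof (rule inj_onI)
  fix x y assume xy: "x \<in> G \<union> \<psi> ` An" "y \<in> G \<union> \<psi> ` An" "\<Theta> x = \<Theta> y"
  hence iff: "x \<in> G \<longleftrightarrow> y \<in> G" using \<Theta>G by metis
  show "x = y"
  proof (cases "x \<in> G")
   case True
   thus ?thesis using iff xy th(2) by (auto simp: \<Theta>_def inj_on_def)
  next
   case False
   then obtain v v' where "v \<in> An" "x = \<psi> v" "v' \<in> An" "y = \<psi> v'" using iff xy by blast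
   thus ?thesis using xy(3) \<Theta>\<psi> \<eta>_inj by (auto simp: inj_on_def)
  qed
 qed
 have circ: "sphere 0 1 \<subseteq> An" using \<sigma> s2' by (auto simp: An_def)
 \<comment> \<open>The closed domain. Its image is compact and contains the open disc, hence the
   closed disc; the open image of the neighbourhood \<open>Dm\<close> then contains a larger
   disc.\<close>
 define Z where "Z = G \<union> \<psi> ` sphere 0 1"
 have "G \<subseteq> V" "\<psi> ` sphere 0 1 \<subseteq> V" using V(2) closure_subset[of G] circle_in_closure[OF r01] by (auto simp: G_def)
 hence Zsub: "Z \<subseteq> Dm" using circ unfolding Z_def Dm_def by blast
 have oD: "open Dm" unfolding Dm_def by (intro open_Int open_Un oG o\<psi> V)
 have Dsub: "Dm \<subseteq> G \<union> \<psi> ` An" by (auto simp: Dm_def)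
 have "compact Z"
 proof -
  have Geq: "G = - \<psi> ` {v. 1 <= norm v}" unfolding G_def by (rule interior_dom_eq[OF r01])
  have "Z = - Omega \<psi> 1"
  proof
   have "G \<subseteq> - Omega \<psi> 1" unfolding Geq Omega_def ext_disk_def by auto
   moreover have "\<psi> v \<notin> Omega \<psi> 1" if "norm v = 1" for v
    using Omega_iff[of v 1] that r01 by simp
   ultimately show "Z \<subseteq> - Omega \<psi> 1" unfolding Z_def by auto
   show "- Omega \<psi> 1 \<subseteq> Z"
   proof
    fix z assume z: "z \<in> - Omega \<psi> 1"
    show "z \<in> Z"
    proof (cases "z \<in> G")
     case False
     then obtain v where v: "1 <= norm v" "z = \<psi> v" unfolding Geq by blast
     hence "norm v = 1" using z OmegaI[of 1 v] by force
     thus ?thesis using v by (simp add: Z_def)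
    qed (simp add: Z_def)
   qed
  qed
  hence "closed Z" using open_Omega[of 1] r01 by auto
  moreover have "bounded Z"
  proof -
   have "compact (\<psi> ` sphere 0 1)"
    by (rule compact_continuous_image[OF cont\<psi>]) (use r01 in "auto simp: ext_disk_def")
   from compact_imp_bounded[OF this] bounded_interior_dom[OF r01]
   show ?thesis by (simp add: Z_def G_def bounded_Un)
  qed
  ultimately show ?thesis by (simp add: compact_eq_bounded_closed)
 qed
 have "compact (\<Theta> ` Z)"
  by (rule compact_continuous_image[OF hol_cont[OF \<Theta>_hol] \<open>compact Z\<close>])
    (rule order_trans[OF Zsub Dsub])
 hence "closed (\<Theta> ` Z)" by (rule compact_imp_closed)
 moreover have "ball 0 1 \<subseteq> \<Theta> ` Z"
 proof -
  have "\<theta> ` G = \<Theta> ` G" by (rule image_cong) (simp_all add: \<Theta>_def)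
  moreover have "\<Theta> ` G \<subseteq> \<Theta> ` Z" by (rule image_mono) (simp add: Z_def)
  ultimately show ?thesis unfolding th(3)[symmetric] by (simp only:)
 qed
 ultimately have "closure (ball 0 1) \<subseteq> \<Theta> ` Z" by (rule closure_minimal[rotated])
 hence "cball 0 1 \<subseteq> \<Theta> ` Z" by simp
 hence cb: "cball 0 1 \<subseteq> \<Theta> ` Dm" using image_mono[OF Zsub] by (rule order_trans)
 have oT: "open (\<Theta> ` Dm)"
  using open_mapping_thm3[OF hol_subset[OF \<Theta>_hol Dsub] oD inj_on_subset[OF \<Theta>_inj Dsub]] .
 obtain R2 where R2: "1 < R2" "ball 0 R2 \<subseteq> \<Theta> ` Dm"
 proof -
  have "sphere 0 1 \<subseteq> \<Theta> ` Dm" using cb by auto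
  then obtain d where d: "0 < d" "!!v. 1 - d < norm v ==> norm v < 1 + d ==> v \<in> \<Theta> ` Dm"
   using open_contains_annulus[OF oT] by (metis zero_less_one)
  show ?thesis
  proof (rule that[of "1 + d"])
   show "ball 0 (1 + d) \<subseteq> \<Theta> ` Dm"
   proof
    fix w :: complex assume "w \<in> ball 0 (1 + d)"
    thus "w \<in> \<Theta> ` Dm" using d cb by (cases "norm w <= 1") auto
   qed
  qed (use d in simp)
 qed
 obtain \<xi> where \<xi>: "\<xi> holomorphic_on \<Theta> ` Dm" "!!z. z \<in> Dm ==> \<xi> (\<Theta> z) = z"
  using holomorphic_has_inverse[OF hol_subset[OF \<Theta>_hol Dsub] oD inj_on_subset[OF \<Theta>_inj Dsub]] by metis
 \<comment> \<open>The outer radius is reduced until \<eta> stays in the domain of \<xi> and \<psi>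
   stays where \<xi> inverts \<open>\<Theta>\<close>.\<close>
 obtain R1 where R1: "1 < R1" "R1 <= 1 / s2" "!!v. \<sigma> < norm v ==> norm v < R1 ==> norm (\<eta> v) < R2 \<and> \<psi> v \<in> Dm"
 proof -
  have oAn: "open An" unfolding An_def by (rule oA)
  have "continuous_on An (%v. norm (\<eta> v))"
   by (rule continuous_on_norm[OF hol_imp_cont[OF \<eta>_hol]])
  hence "open (An \<inter> (%v. norm (\<eta> v)) -` {..<R2})" by (rule continuous_open_preimage[OF _ oAn open_lessThan])
  moreover have "open (An \<inter> \<psi> -` Dm)" by (rule continuous_open_preimage[OF cont\<psi>[OF An0] oAn oD])
  ultimately have "open ((An \<inter> (%v. norm (\<eta> v)) -` {..<R2}) \<inter> (An \<inter> \<psi> -` Dm))" by (rule open_Int)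
  moreover have "sphere 0 1 \<subseteq> (An \<inter> (%v. norm (\<eta> v)) -` {..<R2}) \<inter> (An \<inter> \<psi> -` Dm)"
  proof
   fix v :: complex assume v: "v \<in> sphere 0 1"
   hence "\<psi> v \<in> Dm" "v \<in> An" using Zsub circ unfolding Z_def by auto
   thus "v \<in> (An \<inter> (%v. norm (\<eta> v)) -` {..<R2}) \<inter> (An \<inter> \<psi> -` Dm)" using v \<eta>_eq[of v] R2 by auto
  qed
  ultimately obtain d where d0: "0 < d" "!!v. 1 - d < norm v ==> norm v < 1 + d ==>
    v \<in> (An \<inter> (%v. norm (\<eta> v)) -` {..<R2}) \<inter> (An \<inter> \<psi> -` Dm)"
   using open_contains_annulus by (metis zero_less_one)
  have d: "0 < d" "!!v. 1 - d < norm v ==> norm v < 1 + d ==> norm (\<eta> v) < R2 \<and> \<psi> v \<in> Dm"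
   using d0 by auto
  show ?thesis
  proof (rule that[of "min (1 + d) (1 / s2)"])
   fix v :: complex assume v: "\<sigma> < norm v" "norm v < min (1 + d) (1 / s2)"
   show "norm (\<eta> v) < R2 \<and> \<psi> v \<in> Dm"
   proof (cases "norm v < 1")
    case True
    hence "\<psi> v \<in> G" "norm (\<eta> v) < 1" using \<psi>G[of v] \<eta>_lt[of v] v \<sigma> by auto
    moreover from this have "\<psi> v \<in> Dm" using Zsub by (auto simp: Z_def)
    ultimately show ?thesis using R2 by auto
   next
    case False
    thus ?thesis using d v by auto
   qed
  qed (use d s2' in auto)
 qed
 have R1A: "v \<in> An" if "\<sigma> < norm v" "norm v < R1" for v using that R1 by (simp add: An_def)
 show ?thesis
 proof (rule that[of R1 R2 \<eta> \<xi>])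
  show "1 < R1" "1 < R2" using R1 R2 by auto
  have sA: "{v. \<sigma> < norm v \<and> norm v < R1} \<subseteq> An" using R1A by auto
  show "\<eta> holomorphic_on {v. \<sigma> < norm v \<and> norm v < R1}" "inj_on \<eta> {v. \<sigma> < norm v \<and> norm v < R1}"
   using hol_subset[OF \<eta>_hol sA] inj_on_subset[OF \<eta>_inj sA] by auto
  show "\<eta> v = \<theta> (\<psi> v)" if "\<sigma> < norm v" "norm v < 1" for v using that by (simp add: \<eta>_def F_def)
  show "norm (\<eta> v) = 1" if "norm v = 1" for v using \<eta>_eq that .
  show "1 < norm (\<eta> v)" if "1 < norm v" "norm v < R1" for v using \<eta>_gt that R1 by simp
  show "norm (\<eta> v) < R2" if "\<sigma> < norm v" "norm v < R1" for v using R1 that by blast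
  show "\<xi> holomorphic_on ball 0 R2" by (rule hol_subset[OF \<xi>(1) R2(2)])
  show "inj_on \<xi> (ball 0 R2)"
  proof (rule inj_onI)
   fix x y assume xy: "x \<in> ball 0 R2" "y \<in> ball 0 R2" "\<xi> x = \<xi> y"
   then obtain a b where "x = \<Theta> a" "a \<in> Dm" "y = \<Theta> b" "b \<in> Dm" using R2(2) by blast
   thus "x = y" using xy(3) \<xi>(2) by simp
  qed
  show "\<xi> (\<eta> v) = \<psi> v" if "\<sigma> < norm v" "norm v < R1" for v
   using \<xi>(2)[of "\<psi> v"] R1(3)[OF that] \<Theta>\<psi>[OF R1A[OF that]] by simp
  show "\<xi> (\<theta> z) = z" if "z \<in> interior_dom \<psi> 1" for z
   using \<xi>(2)[of z] that Zsub by (auto simp: Z_def \<Theta>_def G_def)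
  show "\<xi> ` ball 0 R2 \<subseteq> V"
  proof
   fix z assume "z \<in> \<xi> ` ball 0 R2"
   then obtain x where "x \<in> Dm" "z = \<xi> (\<Theta> x)" using R2(2) by blast
   thus "z \<in> V" using \<xi>(2) by (simp add: Dm_def)
  qed
 qed
qed

lemma sqrt_of_derivative:
 assumes "\<xi> holomorphic_on ball 0 R" "inj_on \<xi> (ball 0 R)" "0 < R"
 obtains p where "p holomorphic_on ball 0 R" "!!w. norm w < R ==> (p w)\<^sup>2 = deriv \<xi> w"
proof -
 have nz: "deriv \<xi> w ~= 0" if "w \<in> ball 0 R" for w
  using holomorphic_injective_imp_regular[OF assms(1) open_ball assms(2) that] .
 have d: "deriv \<xi> holomorphic_on ball 0 R" by (intro holomorphic_deriv assms open_ball)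
 obtain l where l: "l holomorphic_on ball 0 R" "!!x. x \<in> ball 0 R ==> exp (l x) = deriv \<xi> x"
  using holomorphic_log_normalized[OF convex_ball open_ball d nz, of "Ln (deriv \<xi> 0)"] nz[of 0] assms(3) by auto
 show ?thesis
 proof (rule that[of "%w. exp (l w / 2)"])
  show "(%w. exp (l w / 2)) holomorphic_on ball 0 R" by (intro holomorphic_intros l) auto
  show "(exp (l w / 2))\<^sup>2 = deriv \<xi> w" if "norm w < R" for w
   using l(2)[of w] that by (simp flip: exp_double)
 qed
qed

end

subsection \<open>The exterior Szego function\<close>

lemma bpow_eq_exp: "1 - b / v ~= 0 ==> bpow b x v = exp (- of_real x * Ln (1 - b / v))"
 by (simp add: bpow_def powr_def)

lemma bpow_lim: "(bpow b x \<longlongrightarrow> 1) at_infinity"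
proof -
 have "isCont (%x'. (1 - b * x') powr (- of_real x)) 0"
  by (intro continuous_intros) auto
 from tendsto_at_infinity_inverse[OF this] show ?thesis by (simp add: bpow_def[abs_def])
qed

text \<open>For natural exponents the cut disappears and only the point \<open>b\<close> is
  singular; this is why such points are removed from the slit domain without a slit.\<close>

lemma bpow_nat_holomorphic:
 assumes "x \<in> \<nat>" "!!v. v \<in> S ==> v ~= 0 \<and> 1 - b / v ~= 0"
 shows "bpow b x holomorphic_on S" "bpow b (- x) holomorphic_on S"
proof -
 obtain m where x: "x = real m" using assms(1) by (auto elim: Nats_cases)
 have e: "bpow b (- x) v = (1 - b / v) ^ m" "bpow b x v = inverse ((1 - b / v) ^ m)" if "v \<in> S" for v
  using assms(2)[OF that] by (auto simp: bpow_def x powr_nat powr_minus)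
 have h: "(%v. (1 - b / v) ^ m) holomorphic_on S" using assms(2) by (intro holomorphic_intros) auto
 show "bpow b (- x) holomorphic_on S" by (rule holomorphic_transform[OF h]) (simp add: e)
 have "(%v. inverse ((1 - b / v) ^ m)) holomorphic_on S" using assms(2) by (intro holomorphic_intros h) auto
 thus "bpow b x holomorphic_on S" by (rule holomorphic_transform) (simp add: e)
qed

lemma prod_powr_real:
 fixes g :: "'k \<Rightarrow> real"
 assumes "!!k. 0 <= g k" shows "(\<Prod>k\<in>S. g k) powr y = (\<Prod>k\<in>S. g k powr y)"
 by (induction S rule: infinite_finite_induct) (auto simp: powr_mult prod_nonneg assms)

locale setting = ext_map \<psi> \<phi> r0 c for \<psi> \<phi> r0 c +
 fixes \<sigma> \<rho> :: real and s :: nat and a :: "nat \<Rightarrow> complex" and lam :: "nat \<Rightarrow> real"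
  and \<omega> :: "complex \<Rightarrow> complex" and co :: real and Lp :: "complex \<Rightarrow> complex" and Lb :: "complex \<Rightarrow> complex \<Rightarrow> complex"
 assumes radii: "r0 < \<sigma>" "\<sigma> < \<rho>" "\<rho> < 1"
  and a_inj: "inj_on a {1..s}" and a_lev: "!!k. k \<in> {1..s} ==> a k \<in> level_curve \<psi> \<rho>"
  and \<omega>_an: "\<omega> analytic_on closure (Omega \<psi> \<sigma>)" and \<omega>_nz: "!!z. z \<in> closure (Omega \<psi> 1) ==> \<omega> z ~= 0"
  and \<omega>_lim: "(\<omega> \<longlongrightarrow> of_real co) at_infinity" and co: "0 < co"
  and Lp_hol: "Lp holomorphic_on ext_disk r0" and Lp_exp: "!!v. r0 < norm v ==> exp (Lp v) = 1 / deriv \<psi> v"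
  and Lp_lim: "(Lp \<longlongrightarrow> of_real (- ln c)) at_infinity"
  and Lb_hol: "!!b. r0 < norm b ==> Lb b holomorphic_on ext_disk r0"
  and Lb_exp: "!!b v. r0 < norm b ==> r0 < norm v ==> v ~= b ==> exp (Lb b v) = (v - b) / (\<psi> v - \<psi> b)"
  and Lb_lim: "!!b. r0 < norm b ==> (Lb b \<longlongrightarrow> of_real (- ln c)) at_infinity"
  and Lb_diag: "!!b. r0 < norm b ==> Lb b b = Lp b"
begin

abbreviation Ks where "Ks \<equiv> {1..s}"

definition b where "b k = \<phi> (a k)"

text \<open>The regular factor of the Szego function. With \<open>v = \<phi> z\<close>, the quotient
  \<open>\<phi> z / (z - a k)\<close> is \<open>(v - b k) / (\<psi> v - a k)\<close> times
  \<open>v / (v - b k)\<close>: the logarithm \<open>Lb\<close> handles the former,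
  \<open>bpow\<close> in \<open>D\<close> the latter.\<close>

definition D0 where "D0 v = \<omega> (\<psi> v) * (\<Prod>k\<in>Ks. exp (of_real (lam k) * Lb (b k) v))"

definition D where "D v = D0 v * (\<Prod>k\<in>Ks. bpow (b k) (lam k) v)"

definition Dinf where "Dinf = co * (\<Prod>k\<in>Ks. exp (- (lam k * ln c)))"

definition C where "C v = exp (- (Lp v / 2))"

definition V where "V = {v. \<sigma> < norm v \<and> v \<notin> slit_set \<phi> \<sigma> s a lam}"

lemma pos: "0 < \<sigma>" "0 < \<rho>" using radii r0 by auto

lemma b: assumes "k \<in> Ks" shows "norm (b k) = \<rho>" "\<psi> (b k) = a k" "r0 < norm (b k)" "b k ~= 0"
proof -
 have "a k \<in> \<psi> ` sphere 0 \<rho>" using a_lev[OF assms] frontier_Omega[of \<rho>] radii by (simp add: level_curve_def)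
 then obtain v where v: "norm v = \<rho>" "a k = \<psi> v" by auto
 thus "norm (b k) = \<rho>" "\<psi> (b k) = a k" "r0 < norm (b k)" "b k ~= 0" using radii pos by (auto simp: b_def)
qed

lemma b_inj: "inj_on b Ks"
proof (rule inj_onI)
 fix k l assume "k \<in> Ks" "l \<in> Ks" "b k = b l"
 hence "a k = a l" using b(2) by metis
 thus "k = l" using a_inj \<open>k \<in> Ks\<close> \<open>l \<in> Ks\<close> by (auto dest: inj_onD)
qed

lemma D0_hol: "D0 holomorphic_on ext_disk \<sigma>"
proof -
 have "\<omega> holomorphic_on Omega \<psi> \<sigma>"
  using \<omega>_an analytic_on_subset[OF _ closure_subset] analytic_imp_holomorphic by blast
 hence "\<omega> \<circ> \<psi> holomorphic_on ext_disk \<sigma>"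
  by (rule holomorphic_on_compose_gen[rotated])
    (use radii in "auto intro!: hol_subset[OF hol] ext_mono simp: Omega_def")
 hence 1: "(%v. \<omega> (\<psi> v)) holomorphic_on ext_disk \<sigma>" by (simp add: o_def)
 have 2: "Lb (b k) holomorphic_on ext_disk \<sigma>" if "k \<in> Ks" for k
  by (rule hol_subset[OF Lb_hol[OF b(3)[OF that]] ext_mono]) (use radii in simp)
 show ?thesis unfolding D0_def by (intro holomorphic_intros 1 2)
qed

lemma D_lim: "(D \<longlongrightarrow> of_real Dinf) at_infinity"
proof -
 have o: "((%v. \<omega> (\<psi> v)) \<longlongrightarrow> of_real co) at_infinity" by (rule filterlim_compose[OF \<omega>_lim lim])
 have "(D \<longlongrightarrow> of_real co * (\<Prod>k\<in>Ks. exp (of_real (lam k) * of_real (- ln c))) * (\<Prod>k\<in>Ks. 1)) at_infinity"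
  unfolding D_def[abs_def] D0_def by (intro tendsto_intros o Lb_lim b bpow_lim)
 moreover have "of_real co * (\<Prod>k\<in>Ks. exp (of_real (lam k) * of_real (- ln c))) * (\<Prod>k\<in>Ks. 1) = complex_of_real Dinf"
  by (simp add: Dinf_def exp_of_real[symmetric])
 ultimately show ?thesis by simp
qed

lemma Dinf: "0 < Dinf" using co by (simp add: Dinf_def prod_pos)

lemma D_hol: "D holomorphic_on ext_disk \<rho>"
 unfolding D_def using radii b(1)
 by (intro holomorphic_intros hol_subset[OF D0_hol] ext_mono bpow_holomorphic_ext[of _ \<rho>])
   (auto simp: ext_disk_def)

lemma factor_nz: "norm v ~= \<rho> \<or> v ~= b k ==> k \<in> Ks ==> v ~= 0 ==> 1 - b k / v ~= 0"
 using b(1)[of k] by auto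

lemma D_nz: assumes "1 <= norm v" shows "D v ~= 0"
proof -
 have "\<psi> v \<in> closure (Omega \<psi> 1)" using closure_Omega[of 1] radii assms by auto
 hence "\<omega> (\<psi> v) ~= 0" by (rule \<omega>_nz)
 moreover have "bpow (b k) (lam k) v ~= 0" if "k \<in> Ks" for k
  using factor_nz[OF _ that, of v] assms radii by (intro bpow_nz) auto
 ultimately show ?thesis by (simp add: D_def D0_def)
qed

lemma norm_D: assumes "norm v = 1" shows "norm (D v) powr (-2) = weight \<omega> s a lam (\<psi> v)"
proof -
 have f: "norm (exp (of_real (lam k) * Lb (b k) v) * bpow (b k) (lam k) v) = norm (\<psi> v - a k) powr (- lam k)" if k: "k \<in> Ks" for k
 proof -
  have vb: "v ~= b k" "r0 < norm v" "v ~= 0" using b(1)[OF k] assms radii by auto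
  have e: "exp (Lb (b k) v) = (v - b k) / (\<psi> v - a k)"
   using Lb_exp[OF b(3)[OF k] vb(2,1)] b(2)[OF k] by simp
  have ne: "\<psi> v ~= a k" using inj_onD[OF inj, of v "b k"] b(2,3)[OF k] vb by (auto simp: ext_disk_def)
  have "norm (exp (of_real (lam k) * Lb (b k) v)) = exp (Re (Lb (b k) v)) powr lam k"
   by (simp add: powr_def)
  also have "exp (Re (Lb (b k) v)) = norm (v - b k) / norm (\<psi> v - a k)"
   unfolding norm_exp_eq_Re[symmetric] e by (simp add: norm_divide)
  finally have 1: "norm (exp (of_real (lam k) * Lb (b k) v)) = (norm (v - b k) / norm (\<psi> v - a k)) powr lam k" .
  have "1 - b k / v = (v - b k) / v" using vb by (simp add: field_simps)
  hence "norm (1 - b k / v) = norm (v - b k)" using assms by (simp add: norm_divide)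
  hence "norm (bpow (b k) (lam k) v) = norm (v - b k) powr (- lam k)" by (simp add: norm_bpow)
  thus ?thesis unfolding norm_mult 1 using vb ne by (simp add: powr_divide powr_minus field_simps)
 qed
 have "norm (D v) = norm (\<omega> (\<psi> v)) * (\<Prod>k\<in>Ks. norm (exp (of_real (lam k) * Lb (b k) v) * bpow (b k) (lam k) v))"
  by (simp only: D_def D0_def norm_mult prod.distrib prod_norm[symmetric] mult.assoc)
 also have "... = norm (\<omega> (\<psi> v)) * (\<Prod>k\<in>Ks. norm (\<psi> v - a k) powr (- lam k))"
  by (simp only: prod.cong[OF refl f])
 also have "... powr (-2) = weight \<omega> s a lam (\<psi> v)"
 proof -
  have "(\<Prod>k\<in>Ks. norm (\<psi> v - a k) powr (- lam k)) powr (-2) = (\<Prod>k\<in>Ks. (norm (\<psi> v - a k) powr (- lam k)) powr (-2))"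
   by (rule prod_powr_real) simp
  thus ?thesis by (simp add: weight_def powr_mult prod_nonneg powr_powr mult.commute)
 qed
 finally show ?thesis .
qed

subsection \<open>The slit domain\<close>

lemma slit_end:
 assumes "k \<in> Ks" shows "rcis \<sigma> (Arg2pi (b k)) = of_real (\<sigma> / \<rho>) * b k"
proof -
 define x where "x = Arg2pi (b k)"
 have e: "b k = of_real \<rho> * cis x"
  using Arg2pi[of "b k"] b(1)[OF assms] by (simp add: is_Arg_def cis_conv_exp x_def)
 have "rcis \<sigma> x = of_real (\<sigma> / \<rho>) * b k" unfolding e rcis_def using pos by simp
 thus ?thesis by (simp only: x_def)
qed

lemma slit_in:
 assumes k: "k \<in> Ks" "lam k \<notin> \<nat> - {0}" and v: "\<sigma> < norm v" "v = of_real t * b k" "0 <= t" "t <= 1"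
 shows "v \<in> slit_set \<phi> \<sigma> s a lam"
proof -
 note rc = slit_end[OF k(1)]
 have nt: "norm v = t * \<rho>" using v b(1)[OF k(1)] by (simp add: norm_mult)
 define x where "x = (t - \<sigma> / \<rho>) / (1 - \<sigma> / \<rho>)"
 have sr: "0 < 1 - \<sigma> / \<rho>" "\<sigma> / \<rho> < t" using pos radii v(1) nt by (auto simp: field_simps)
 hence x: "0 <= x" "x <= 1" using v by (auto simp: x_def)
 have "y / d * d = y" if "0 < d" for y d :: real using that by simp
 from this[OF sr(1)] have "x * (1 - \<sigma> / \<rho>) = t - \<sigma> / \<rho>" unfolding x_def .
 hence "(1 - x) * (\<sigma> / \<rho>) + x = t" unfolding left_diff_distrib right_diff_distrib mult_1 mult_1_right by linarith
 hence "complex_of_real t = of_real (1 - x) * of_real (\<sigma> / \<rho>) + of_real x"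
  by (metis of_real_add of_real_mult)
 hence "v = (1 - x) *\<^sub>R (of_real (\<sigma> / \<rho>) * b k) + x *\<^sub>R b k"
  unfolding v(2) scaleR_conv_of_real by (simp only: distrib_right mult.assoc)
 hence "v \<in> closed_segment (rcis \<sigma> (Arg2pi (b k))) (b k)"
  unfolding rc closed_segment_def using x by blast
 thus ?thesis using k unfolding slit_set_def b_def by blast
qed

lemma slit_cases [consumes 2, case_names pole slit]:
 assumes "v \<in> slit_set \<phi> \<sigma> s a lam" "\<sigma> < norm v"
 obtains k where "k \<in> Ks" "lam k \<in> \<nat> - {0}" "v = b k"
  | k where "k \<in> Ks" "lam k \<notin> \<nat> - {0}" "v \<in> closed_segment (rcis \<sigma> (Arg2pi (b k))) (b k)"
 using assms unfolding slit_set_def b_def by auto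

lemma seg_radial:
 assumes k: "k \<in> Ks" and v: "v \<in> closed_segment (rcis \<sigma> (Arg2pi (b k))) (b k)"
 obtains t where "0 <= t" "t <= 1" "v = of_real t * b k"
proof -
 note rc = slit_end[OF k]
 obtain x where x: "0 <= x" "x <= 1" "v = (1 - x) *\<^sub>R (of_real (\<sigma> / \<rho>) * b k) + x *\<^sub>R b k"
  using v unfolding rc closed_segment_def by blast
 show ?thesis
 proof (rule that[of "(1 - x) * (\<sigma> / \<rho>) + x"])
  show "0 <= (1 - x) * (\<sigma> / \<rho>) + x" using x pos by simp
  have "(1 - x) * (\<sigma> / \<rho>) <= (1 - x) * 1" using x pos radii by (intro mult_left_mono) auto
  thus "(1 - x) * (\<sigma> / \<rho>) + x <= 1" by simp
  show "v = of_real ((1 - x) * (\<sigma> / \<rho>) + x) * b k"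
   unfolding x(3) scaleR_conv_of_real by (simp add: distrib_right)
 qed
qed

lemma ext_V: "\<rho> < norm v ==> v \<in> V"
proof (rule ccontr)
 assume v: "\<rho> < norm v" "v \<notin> V"
 hence "v \<in> slit_set \<phi> \<sigma> s a lam" "\<sigma> < norm v" using radii by (auto simp: V_def)
 thus False
 proof (cases rule: slit_cases)
  case (pole k)
  thus ?thesis using b(1) v by simp
 next
  case (slit k)
  then obtain t where t: "0 <= t" "t <= 1" "v = of_real t * b k" using seg_radial by blast
  hence "norm v = t * \<rho>" using b(1)[OF slit(1)] by (simp add: norm_mult)
  also have "... <= 1 * \<rho>" using t pos by (intro mult_right_mono) auto
  finally show ?thesis using v by simp
 qed
qed

text \<open>The points with natural exponents are left in, since their removal would interrupt the
  outward rays used for connectedness.\<close>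

definition V1 where "V1 = {v. \<sigma> < norm v} - (\<Union>k\<in>{k \<in> Ks. lam k \<notin> \<nat> - {0}}. closed_segment (rcis \<sigma> (Arg2pi (b k))) (b k))"

lemma V_eq: "V = V1 - b ` {k \<in> Ks. lam k \<in> \<nat> - {0}}"
 unfolding V_def V1_def slit_set_def b_def by auto

lemma open_V1: "open V1" unfolding V1_def
 by (intro open_Diff open_Collect_less closed_UN continuous_intros) auto

lemma open_V: "open V" unfolding V_eq by (intro open_Diff open_V1 finite_imp_closed) auto

text \<open>The slits are radial and reach down to radius \<open>\<sigma>\<close>, so every outward
  ray from a point of \<open>V1\<close> stays in \<open>V1\<close> and meets the exterior disc of
  radius \<open>\<rho>\<close>. Deleting finitely many points keeps an open connected set
  connected.\<close>

lemma connected_V: "connected V"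
proof -
 have ray: "of_real t * v \<in> V1" if v: "v \<in> V1" "1 <= t" for v t
 proof (rule ccontr)
  assume n: "of_real t * v \<notin> V1"
  have nv: "\<sigma> < norm v" using v by (simp add: V1_def)
  have "norm v <= t * norm v" using v(2) mult_right_mono[of 1 t "norm v"] by simp
  hence "\<sigma> < norm (of_real t * v)" using nv v(2) by (simp add: norm_mult)
  then obtain k where k: "k \<in> Ks" "lam k \<notin> \<nat> - {0}" "of_real t * v \<in> closed_segment (rcis \<sigma> (Arg2pi (b k))) (b k)"
   using n by (auto simp: V1_def)
  obtain x where x: "0 <= x" "x <= 1" "of_real t * v = of_real x * b k" using seg_radial[OF k(1,3)] by blast
  have "v = of_real (x / t) * b k" using x(3) v(2) by (simp add: field_simps)
  moreover have "0 <= x / t" "x / t <= 1" using x v(2) by (auto simp: field_simps)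
  ultimately have "v \<in> slit_set \<phi> \<sigma> s a lam" using slit_in[OF k(1,2) nv] by blast
  from this nv show False
  proof (cases rule: slit_cases)
   case (pole l)
   have "norm v = x / t * \<rho>" using \<open>v = of_real (x / t) * b k\<close> \<open>0 <= x / t\<close> b(1)[OF k(1)] by (simp only: norm_mult norm_of_real abs_of_nonneg)
   moreover have "norm v = \<rho>" unfolding pole(3) by (rule b(1)[OF pole(1)])
   ultimately have xt: "x / t * \<rho> = \<rho>" by (simp only:)
   have "x / t = x / t * \<rho> / \<rho>" using pos by (intro nonzero_mult_div_cancel_right[symmetric]) auto
   also have "... = 1" unfolding xt using pos by simp
   finally have "v = b k" using \<open>v = of_real (x / t) * b k\<close> by (simp only: of_real_1 mult_1)
   hence "b k = b l" using pole(3) by (simp only:)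
   hence "k = l" by (rule inj_onD[OF b_inj _ k(1) pole(1)])
   thus ?thesis using pole(2) k(2) by simp
  next
   case (slit l)
   thus ?thesis using v(1) by (auto simp: V1_def)
  qed
 qed
 have extV1: "ext_disk \<rho> \<subseteq> V1" using ext_V V_eq by (auto simp: ext_disk_def)
 define R where "R v = (%t. of_real t * v) ` {1::real..} \<union> ext_disk \<rho>" for v
 have "connected (R v)" if "v \<in> V1" for v
 proof -
  have nv: "0 < norm v" using that pos by (auto simp: V1_def)
  have "connected ((%t. of_real t * v) ` {1::real..})" by (intro connected_continuous_image continuous_intros) auto
  moreover have "of_real (1 + \<rho> / norm v) * v \<in> (%t. of_real t * v) ` {1::real..} \<inter> ext_disk \<rho>"
  proof
   show "of_real (1 + \<rho> / norm v) * v \<in> (%t. of_real t * v) ` {1::real..}" using pos nv by (intro imageI) auto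
   have "norm (of_real (1 + \<rho> / norm v) * v) = norm v + \<rho>"
    using nv pos by (simp add: norm_mult distrib_right del: of_real_add of_real_divide)
   thus "of_real (1 + \<rho> / norm v) * v \<in> ext_disk \<rho>" using nv by (simp add: ext_disk_def)
  qed
  ultimately show ?thesis unfolding R_def using pos by (intro connected_Un connected_ext) auto
 qed
 moreover have "V1 = \<Union> (R ` V1)"
 proof
  show "V1 \<subseteq> \<Union> (R ` V1)"
  proof
   fix v assume "v \<in> V1"
   moreover have "v \<in> R v" unfolding R_def by (rule UnI1, rule image_eqI[of _ _ 1]) auto
   ultimately show "v \<in> \<Union> (R ` V1)" by blast
  qed
  show "\<Union> (R ` V1) \<subseteq> V1" using ray extV1 by (auto simp: R_def)
 qed
 moreover have "\<Inter> (R ` V1) ~= {}"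
 proof -
  have "of_real 1 \<in> ext_disk \<rho>" using radii by (simp add: ext_disk_def)
  hence "1 \<in> \<Inter> (R ` V1)" by (auto simp: R_def)
  thus ?thesis by blast
 qed
 ultimately have "connected V1" using connected_Union[of "R ` V1"] by (metis imageE)
 thus ?thesis unfolding V_eq by (intro connected_open_delete_finite open_V1) auto
qed

lemma V_sub: "V \<subseteq> ext_disk \<sigma>" "V \<subseteq> ext_disk r0" using radii by (auto simp: V_def ext_disk_def)

lemma b_notin_V: "k \<in> Ks ==> b k \<notin> V"
proof
 assume k: "k \<in> Ks" "b k \<in> V"
 hence n: "b k \<notin> slit_set \<phi> \<sigma> s a lam" "\<sigma> < norm (b k)" by (auto simp: V_def)
 show False
 proof (cases "lam k \<in> \<nat> - {0}")
  case True
  thus ?thesis using n(1) k(1) unfolding slit_set_def b_def by blast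
 next
  case False
  thus ?thesis using slit_in[OF k(1) False n(2), of 1] n(1) by simp
 qed
qed

lemma bpow_V:
 assumes k: "k \<in> Ks"
 shows "v \<in> V ==> v ~= 0 \<and> 1 - b k / v ~= 0" "bpow (b k) (lam k) holomorphic_on V" "bpow (b k) (- lam k) holomorphic_on V"
proof -
 have nz: "v ~= 0 \<and> 1 - b k / v ~= 0" if "v \<in> V" for v
  using that b_notin_V[OF k] pos by (auto simp: V_def)
 thus "v \<in> V ==> v ~= 0 \<and> 1 - b k / v ~= 0" .
 have "bpow (b k) (lam k) holomorphic_on V \<and> bpow (b k) (- lam k) holomorphic_on V"
 proof (cases "lam k \<in> \<nat> - {0}")
  case True
  thus ?thesis using bpow_nat_holomorphic[of "lam k" V "b k"] nz by auto
 next
  case False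
  have "1 - b k / v \<notin> \<real>\<^sub>\<le>\<^sub>0" if v: "v \<in> V" for v
  proof (rule bpow_off_segment)
   show "v ~= 0" using nz v by blast
   fix t :: real assume "0 <= t" "t <= 1"
   thus "v ~= of_real t * b k" using slit_in[OF k False, of v t] v by (auto simp: V_def)
  qed
  thus ?thesis using nz by (intro conjI bpow_holomorphic) auto
 qed
 thus "bpow (b k) (lam k) holomorphic_on V" "bpow (b k) (- lam k) holomorphic_on V" by auto
qed

lemma D_hol_V: "D holomorphic_on V"
 unfolding D_def using V_sub by (intro holomorphic_intros hol_subset[OF D0_hol] bpow_V)

abbreviation Sig where "Sig \<equiv> slit_domain \<psi> \<phi> \<sigma> s a lam"

lemma Sig_eq: "Sig = \<psi> ` V"
proof -
 have "Sig = {z \<in> Omega \<psi> \<sigma>. \<phi> z \<in> V}"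
  using OmegaD[of _ \<sigma>] radii by (auto simp: slit_domain_def V_def)
 also have "... = \<psi> ` V"
 proof
  show "{z \<in> Omega \<psi> \<sigma>. \<phi> z \<in> V} \<subseteq> \<psi> ` V"
  proof
   fix z assume "z \<in> {z \<in> Omega \<psi> \<sigma>. \<phi> z \<in> V}"
   hence "z = \<psi> (\<phi> z)" "\<phi> z \<in> V" using OmegaD[of z \<sigma>] radii by auto
   thus "z \<in> \<psi> ` V" by blast
  qed
  show "\<psi> ` V \<subseteq> {z \<in> Omega \<psi> \<sigma>. \<phi> z \<in> V}" using OmegaI radii by (auto simp: V_def)
 qed
 finally show ?thesis .
qed

lemma open_Sig: "open Sig" unfolding Sig_eq by (rule open_image[OF open_V V_sub(2)])

lemma connected_Sig: "connected Sig"
 unfolding Sig_eq by (rule connected_continuous_image[OF cont\<psi>[OF V_sub(2)] connected_V])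

lemma Sig_D: "z \<in> Sig ==> \<phi> z \<in> V \<and> \<psi> (\<phi> z) = z"
 using V_sub(2) by (auto simp: Sig_eq ext_disk_def)

lemma comp_Sig: "f holomorphic_on V ==> (%z. f (\<phi> z)) holomorphic_on Sig"
proof -
 assume f: "f holomorphic_on V"
 have "f \<circ> \<phi> holomorphic_on Sig"
 proof (rule holomorphic_on_compose_gen[OF _ f])
  show "\<phi> holomorphic_on Sig" by (rule hol_subset[OF \<phi>_hol]) (use V_sub in "auto simp: Sig_eq Omega_def")
 qed (use Sig_D in auto)
 thus ?thesis by (simp add: o_def)
qed

lemma Omega1_Sig: "Omega \<psi> 1 \<subseteq> Sig"
 unfolding Sig_eq Omega_def using ext_V radii by (intro image_mono) (auto simp: ext_disk_def)

lemma large_Sig: obtains R where "!!z. R < norm z ==> z \<in> Sig"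
proof -
 obtain R where "0 < R" "!!z. R <= norm z ==> z \<in> Omega \<psi> 1" using large_in_Omega[of 1] radii by auto
 thus ?thesis using Omega1_Sig by (intro that[of R]) auto
qed

text \<open>The quotient of the two candidates, read in \<open>x = 1 / v\<close>, is a zero-free
  function \<open>f\<close> on the closed disc with modulus one on the circle and
  \<open>f 0 = l > 0\<close>. On the circle the squared modulus of \<open>f - 1\<close> is
  \<open>2 - f - 1 / f\<close>; its mean \<open>2 - l - 1 / l\<close> is nonpositive, so
  \<open>f = 1\<close>. Analytic continuation carries the equality to \<open>Sig\<close>.\<close>

lemma De_eq:
 assumes De: "exterior_szego L (Omega \<psi> 1) Sig h De" and L: "L = \<psi> ` sphere 0 1" and h: "h = weight \<omega> s a lam"
  and z: "z \<in> Sig"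
 shows "De z = D (\<phi> z)"
proof -
 have De': "De holomorphic_on Sig" "De analytic_on closure (Omega \<psi> 1)" "!!z. z \<in> closure (Omega \<psi> 1) ==> De z ~= 0"
  "pos_at_inf De" "!!z. z \<in> L ==> norm (De z) powr (-2) = h z"
  using De by (auto simp: exterior_szego_def)
 obtain d where d: "0 < d" "(De \<longlongrightarrow> of_real d) at_infinity" using De'(4) by (auto simp: pos_at_inf_def)
 obtain T where T: "open T" "closure (Omega \<psi> 1) \<subseteq> T" "De holomorphic_on T"
  using De'(2) unfolding analytic_on_holomorphic by blast
 have r01: "r0 < 1" using radii by simp
 have cl: "\<psi> v \<in> closure (Omega \<psi> 1)" if "1 <= norm v" for v using closure_Omega[OF r01] that by auto
 define N where "N = (ext_disk \<rho> \<inter> \<psi> -` T) \<inter> (ext_disk \<rho> \<inter> D -` (- {0}))"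
 have \<rho>r: "ext_disk \<rho> \<subseteq> ext_disk r0" using radii by (intro ext_mono) auto
 have oN: "open N" unfolding N_def
  by (intro open_Int continuous_open_preimage[OF cont\<psi>[OF \<rho>r] open_ext T(1)]
    continuous_open_preimage[OF hol_imp_cont[OF D_hol] open_ext]) auto
 have N1: "v \<in> N" if "1 <= norm v" for v
  using that cl[OF that] T(2) D_nz[OF that] radii by (auto simp: N_def ext_disk_def)
 define R where "R v = De (\<psi> v) / D v" for v
 have "De \<circ> \<psi> holomorphic_on N"
  by (rule holomorphic_on_compose_gen[OF hol_subset[OF hol] T(3)]) (use \<rho>r in "auto simp: N_def")
 hence "(%v. De (\<psi> v)) holomorphic_on N" by (simp add: o_def)
 hence R_hol: "R holomorphic_on N" unfolding R_def by (intro holomorphic_intros hol_subset[OF D_hol]) (auto simp: N_def)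
 define l where "l = d / Dinf"
 have l: "0 < l" using d Dinf by (simp add: l_def)
 have R_lim: "(R \<longlongrightarrow> of_real l) at_infinity"
  unfolding R_def[abs_def] l_def of_real_divide
  by (intro tendsto_divide D_lim filterlim_compose[OF d(2) lim]) (use Dinf in simp)
 have Rnz: "R v ~= 0" if "1 <= norm v" for v using De'(3)[OF cl[OF that]] D_nz[OF that] by (simp add: R_def)
 have R1: "norm (R v) = 1" if v: "norm v = 1" for v
 proof -
  have "norm (De (\<psi> v)) powr (-2) = norm (D v) powr (-2)" using De'(5)[of "\<psi> v"] norm_D[OF v] v by (simp add: L h)
  hence "norm (De (\<psi> v)) = norm (D v)"
   using De'(3)[OF cl] D_nz[of v] v by (simp add: powr_minus_divide)
  thus ?thesis using D_nz[of v] v by (simp add: R_def norm_divide)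
 qed
 define S where "S = ball (0 :: complex) 1 \<union> ((- {0}) \<inter> (%x. 1 / x) -` N)"
 have oS: "open S" unfolding S_def
  by (intro open_Un open_ball continuous_open_preimage continuous_intros oN) auto
 have SN: "1 / x \<in> N" if "x \<in> S" "x ~= 0" for x using that N1[of "1 / x"] by (auto simp: S_def norm_divide)
 have cS: "cball 0 1 \<subseteq> S"
 proof
  fix x :: complex assume "x \<in> cball 0 1"
  thus "x \<in> S" using N1[of "1 / x"] by (cases "x = 0") (auto simp: S_def norm_divide)
 qed
 define f where "f x = (if x = 0 then of_real l else R (1 / x))" for x
 have f_hol: "f holomorphic_on S"
 proof -
  have "R \<circ> (%x. 1 / x) holomorphic_on S - {0}"
   by (rule holomorphic_on_compose_gen[OF _ R_hol]) (use SN in "auto intro!: holomorphic_intros")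
  moreover have "((%x. R (inverse x)) \<longlongrightarrow> of_real l) (at 0)"
   using filterlim_compose[OF R_lim filterlim_inverse_at_infinity] .
  ultimately have "(%x. if x = 0 then of_real l else R (1 / x)) holomorphic_on S"
   by (intro removable_singularity[OF _ oS]) (simp_all add: o_def inverse_eq_divide)
  thus ?thesis by (simp add: f_def[abs_def])
 qed
 have fnz: "f x ~= 0" if "x \<in> cball 0 1" for x
  using that l Rnz[of "1 / x"] by (auto simp: f_def norm_divide)
 define F where "F x = f x - 1" for x
 have F_hol: "F holomorphic_on S" unfolding F_def by (intro holomorphic_intros f_hol)
 have cF: "continuous_on (sphere 0 1) F" and cf: "continuous_on (sphere 0 1) f"
  using hol_cont[OF F_hol]
   hol_cont[OF f_hol] cS by (auto simp: subset_iff)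
 have cg: "continuous_on (sphere 0 1) (%x. 1 / f x)" using fnz by (intro continuous_intros cf) auto
 have m1: "cmean 1 f = of_real l" using cmean_Cauchy_0[OF oS f_hol _ cS] by (simp add: f_def)
 have m2: "cmean 1 (%x. 1 / f x) = of_real (1 / l)"
 proof -
  have "open (S \<inter> f -` (- {0}))" by (rule continuous_open_preimage[OF hol_imp_cont[OF f_hol] oS]) auto
  moreover have "(%x. 1 / f x) holomorphic_on S \<inter> f -` (- {0})"
   by (intro holomorphic_intros hol_subset[OF f_hol]) auto
  moreover have "cball 0 1 \<subseteq> S \<inter> f -` (- {0})" using cS fnz by auto
  ultimately have "cmean 1 (%x. 1 / f x) = 1 / f 0" by (intro cmean_Cauchy_0) auto
  thus ?thesis by (simp add: f_def)
 qed
 have "of_real (nsq F) = cip F F" by (rule cip_self[OF cF, symmetric])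
 also have "... = cmean 1 (%x. (2 - f x) - 1 / f x)"
  unfolding cip_def
 proof (rule cmean_cong)
  fix x :: complex assume x: "norm x = 1"
  hence "norm (f x) = 1" using R1[of "1 / x"] by (auto simp: f_def norm_divide)
  hence n1: "f x * cnj (f x) = 1" using complex_norm_square[of "f x"] by simp
  hence c1: "cnj (f x) = 1 / f x" using fnz[of x] x by (simp add: field_simps)
  have "F x * cnj (F x) = f x * cnj (f x) - f x - cnj (f x) + 1" by (simp add: F_def algebra_simps)
  also have "... = (2 - f x) - 1 / f x" unfolding n1 unfolding c1 by simp
  finally show "F x * cnj (F x) = (2 - f x) - 1 / f x" .
 qed simp
 also have "... = 2 - of_real l - of_real (1 / l)"
  using cmean_diff[of 1 "%x. 2 - f x" "%x. 1 / f x"] cmean_diff[of 1 "%x. 2" f] cf cg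
  by (simp add: m1 m2 continuous_on_diff)
 also have "... = of_real (2 - l - 1 / l)" by simp
 finally have "nsq F = 2 - l - 1 / l" by (simp only: of_real_eq_iff)
 also have "... <= 0"
 proof -
  have "0 <= (l - 1)\<^sup>2 / l" using l by simp
  also have "(l - 1)\<^sup>2 / l = l + 1 / l - 2" using l by (simp add: power2_eq_square field_simps)
  finally show ?thesis by simp
 qed
 finally have nF: "nsq F <= 0" .
 have F0: "F x = 0" if "norm x < 1" for x
 proof -
  have "(norm (F x))\<^sup>2 <= nsq F / (1 - norm x)" by (rule pointwise_le_nsq[OF oS F_hol cS that])
  also have "... <= 0" using nF that by (intro divide_nonpos_pos) auto
  finally show ?thesis by simp
 qed
 have ext: "De y = D (\<phi> y)" if "y \<in> Omega \<psi> 1" for y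
 proof -
  have y: "1 < norm (\<phi> y)" "\<psi> (\<phi> y) = y" using OmegaD[OF that] r01 by auto
  have "1 / norm (\<phi> y) < 1" by (subst divide_less_eq_1_pos) (use y in auto)
  hence "norm (1 / \<phi> y) < 1" "1 / \<phi> y ~= 0" using y by (auto simp: norm_divide)
  from F0[OF this(1)] this(2) have "R (\<phi> y) = 1" by (simp add: F_def f_def)
  thus ?thesis using D_nz[of "\<phi> y"] y by (simp add: R_def)
 qed
 show ?thesis
 proof (rule analytic_continuation_open[OF open_Omega open_Sig _ connected_Sig Omega1_Sig De'(1) comp_Sig[OF D_hol_V] ext z])
  show "Omega \<psi> 1 ~= {}" using OmegaI[of 1 2] by auto
 qed (use r01 in auto)
qed

lemma De_lim:
 assumes "exterior_szego L (Omega \<psi> 1) Sig h De" "L = \<psi> ` sphere 0 1" "h = weight \<omega> s a lam"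
 shows "val_inf De = of_real Dinf"
proof -
 have "((%z. D (\<phi> z)) \<longlongrightarrow> of_real Dinf) at_infinity" by (rule filterlim_compose[OF D_lim \<phi>_lim])
 moreover have "\<forall>\<^sub>F z in at_infinity. D (\<phi> z) = De z"
  using ev_Omega[of 1] radii Omega1_Sig by (auto elim!: eventually_mono simp: De_eq[OF assms])
 ultimately have "(De \<longlongrightarrow> of_real Dinf) at_infinity" by (rule Lim_transform_eventually)
 thus ?thesis unfolding val_inf_def by (rule tendsto_Lim[OF trivial_limit_at_infinity])
qed

subsection \<open>The constants\<close>

text \<open>\<open>power_branch\<close> is a choice; uniqueness identifies it with the explicit
  exponential.\<close>

lemma pb_deriv:
 assumes "z \<in> Omega \<psi> r0"
 shows "power_branch (Omega \<psi> r0) (deriv \<phi>) x z = exp (of_real x * Lp (\<phi> z))"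
proof -
 obtain R where R: "0 < R" "!!z. R <= norm z ==> z \<in> Omega \<psi> \<sigma>" using large_in_Omega[of \<sigma>] radii by auto
 have sub: "Omega \<psi> \<sigma> \<subseteq> Omega \<psi> r0" unfolding Omega_def using radii by (intro image_mono ext_mono) auto
 show ?thesis
 proof (rule power_branch_eq[OF _ _ _ assms, of R])
  show "connected (Omega \<psi> r0)" unfolding Omega_def
   by (rule connected_continuous_image[OF cont\<psi> connected_ext[OF r0]]) simp
  show "z \<in> Omega \<psi> r0" if "R < norm z" for z using R(2)[of z] sub that by auto
  show "is_power_branch (Omega \<psi> r0) (deriv \<phi>) x (%z. exp (of_real x * Lp (\<phi> z)))"
   unfolding is_power_branch_def
  proof (intro conjI ballI)
   have "Lp \<circ> \<phi> holomorphic_on Omega \<psi> r0"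
    by (rule holomorphic_on_compose_gen[OF \<phi>_hol Lp_hol]) (use OmegaD in "auto simp: ext_disk_def")
   hence "(%z. Lp (\<phi> z)) holomorphic_on Omega \<psi> r0" by (simp add: o_def)
   thus "(%z. exp (of_real x * Lp (\<phi> z))) holomorphic_on Omega \<psi> r0" by (intro holomorphic_intros)
   fix y assume "y \<in> Omega \<psi> r0"
   hence "r0 < norm (\<phi> y)" "\<psi> (\<phi> y) = y" using OmegaD[of y r0] by auto
   hence "exp (Lp (\<phi> y)) = deriv \<phi> y" using Lp_exp[of "\<phi> y"] d\<phi>[of "\<phi> y"] by simp
   thus "\<exists>l. exp l = deriv \<phi> y \<and> exp (of_real x * Lp (\<phi> y)) = exp (of_real x * l)" by blast
  next
   have "((%z. exp (of_real x * Lp (\<phi> z))) \<longlongrightarrow> exp (of_real x * of_real (- ln c))) at_infinity"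
    by (intro tendsto_intros filterlim_compose[OF Lp_lim \<phi>_lim])
   moreover have "exp (of_real x * of_real (- ln c)) = complex_of_real (exp (x * - ln c))"
    by (simp only: of_real_mult[symmetric] exp_of_real)
   ultimately show "pos_at_inf (%z. exp (of_real x * Lp (\<phi> z)))" unfolding pos_at_inf_def by (metis exp_gt_zero)
  qed
 qed
qed

lemma pb_quot:
 assumes k: "k \<in> Ks" and z: "z \<in> Sig"
 shows "power_branch Sig (%z. \<phi> z / (z - a k)) (- lam k) z
   = bpow (b k) (- lam k) (\<phi> z) * exp (of_real (- lam k) * Lb (b k) (\<phi> z))"
proof -
 obtain R where R: "!!z. R < norm z ==> z \<in> Sig" using large_Sig by blast
 show ?thesis
 proof (rule power_branch_eq[OF connected_Sig R _ z])
  show "is_power_branch Sig (%z. \<phi> z / (z - a k)) (- lam k)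
    (%z. bpow (b k) (- lam k) (\<phi> z) * exp (of_real (- lam k) * Lb (b k) (\<phi> z)))"
   unfolding is_power_branch_def
  proof (intro conjI ballI)
   have "(%v. bpow (b k) (- lam k) v * exp (of_real (- lam k) * Lb (b k) v)) holomorphic_on V"
    by (intro holomorphic_intros bpow_V[OF k] hol_subset[OF Lb_hol[OF b(3)[OF k]] V_sub(2)])
   thus "(%z. bpow (b k) (- lam k) (\<phi> z) * exp (of_real (- lam k) * Lb (b k) (\<phi> z))) holomorphic_on Sig"
    by (rule comp_Sig)
   fix y assume y: "y \<in> Sig"
   define v where "v = \<phi> y"
   have v: "v \<in> V" "\<psi> v = y" "r0 < norm v" using Sig_D[OF y] V_sub by (auto simp: v_def ext_disk_def)
   have vb: "v ~= b k" using v b_notin_V[OF k] by blast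
   have nz: "v ~= 0" "1 - b k / v ~= 0" using bpow_V(1)[OF k v(1)] by auto
   have "exp (- Ln (1 - b k / v) + Lb (b k) v) = inverse (1 - b k / v) * ((v - b k) / (y - a k))"
    unfolding exp_add exp_minus exp_Ln[OF nz(2)] Lb_exp[OF b(3)[OF k] v(3) vb] b(2)[OF k] v(2) ..
   also have "... = v / (y - a k)"
   proof -
    have "1 - b k / v = (v - b k) / v" using nz by (simp add: field_simps)
    thus ?thesis using vb by simp
   qed
   finally have "exp (- Ln (1 - b k / v) + Lb (b k) v) = v / (y - a k)" .
   moreover have "bpow (b k) (- lam k) v * exp (of_real (- lam k) * Lb (b k) v)
     = exp (of_real (- lam k) * (- Ln (1 - b k / v) + Lb (b k) v))"
    unfolding bpow_eq_exp[OF nz(2)] by (simp add: exp_add[symmetric] algebra_simps)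
   ultimately show "\<exists>l. exp l = \<phi> y / (y - a k) \<and>
     bpow (b k) (- lam k) (\<phi> y) * exp (of_real (- lam k) * Lb (b k) (\<phi> y)) = exp (of_real (- lam k) * l)"
    unfolding v_def by blast
  next
   have "((%z. bpow (b k) (- lam k) (\<phi> z) * exp (of_real (- lam k) * Lb (b k) (\<phi> z)))
     \<longlongrightarrow> 1 * exp (of_real (- lam k) * of_real (- ln c))) at_infinity"
    by (intro tendsto_intros filterlim_compose[OF bpow_lim \<phi>_lim] filterlim_compose[OF Lb_lim[OF b(3)[OF k]] \<phi>_lim])
   moreover have "1 * exp (of_real (- lam k) * of_real (- ln c)) = complex_of_real (exp (- lam k * - ln c))"
    by (simp only: mult_1 of_real_mult[symmetric] exp_of_real)
   ultimately show "pos_at_inf (%z. bpow (b k) (- lam k) (\<phi> z) * exp (of_real (- lam k) * Lb (b k) (\<phi> z)))"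
    unfolding pos_at_inf_def by (metis exp_gt_zero)
  qed
 qed
qed

text \<open>The model power and the power of \<open>exp Lb\<close> at index \<open>k\<close> cancel,
  and what is left is continuous at \<open>b k\<close>. The equality of \<open>Lb (b k)\<close> and
  \<open>Lp\<close> at \<open>b k\<close> turns the power \<open>lam k\<close> of
  \<open>\<phi>'\<close> into the missing factor of \<open>D0\<close>, and the exponent
  \<open>-1/2\<close> gives \<open>C\<close>.\<close>

lemma szego_const_eq:
 assumes De: "exterior_szego L (Omega \<psi> 1) Sig h De" "L = \<psi> ` sphere 0 1" "h = weight \<omega> s a lam" and k: "k \<in> Ks"
 shows "szego_const (Omega \<psi> r0) Sig \<phi> De (a k) (lam k)
  = (\<Prod>i\<in>Ks - {k}. bpow (b i) (lam i) (b k)) * D0 (b k) * C (b k)"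
proof -
 define T where "T v = \<omega> (\<psi> v) * (\<Prod>i\<in>Ks - {k}. exp (of_real (lam i) * Lb (b i) v)) * (\<Prod>i\<in>Ks - {k}. bpow (b i) (lam i) v)" for v
 have kA: "b k \<in> ext_disk \<sigma>" using b(1)[OF k] radii by (simp add: ext_disk_def)
 have D0_split: "D0 v = \<omega> (\<psi> v) * (\<Prod>i\<in>Ks - {k}. exp (of_real (lam i) * Lb (b i) v)) * exp (of_real (lam k) * Lb (b k) v)" for v
  unfolding D0_def prod.remove[OF finite_atLeastAtMost k] by (simp add: mult_ac)
 have eq: "power_branch Sig (%z. \<phi> z / (z - a k)) (- lam k) z * De z = T (\<phi> z)" if z: "z \<in> Sig" for z
 proof -
  have nz: "1 - b k / \<phi> z ~= 0" using bpow_V(1)[OF k] Sig_D[OF z] by blast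
  have 1: "bpow (b k) (- lam k) (\<phi> z) * bpow (b k) (lam k) (\<phi> z) = 1"
   unfolding bpow_eq_exp[OF nz] by (simp flip: exp_add)
  have 2: "exp (of_real (- lam k) * Lb (b k) (\<phi> z)) * exp (of_real (lam k) * Lb (b k) (\<phi> z)) = 1"
   by (simp flip: exp_add)
  have "D (\<phi> z) = T (\<phi> z) * (exp (of_real (lam k) * Lb (b k) (\<phi> z)) * bpow (b k) (lam k) (\<phi> z))"
   unfolding D_def D0_split T_def prod.remove[OF finite_atLeastAtMost k, of "%i. bpow (b i) (lam i) (\<phi> z)"]
   by (simp add: mult_ac)
  hence "power_branch Sig (%z. \<phi> z / (z - a k)) (- lam k) z * De z
    = T (\<phi> z) * (bpow (b k) (- lam k) (\<phi> z) * bpow (b k) (lam k) (\<phi> z))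
     * (exp (of_real (- lam k) * Lb (b k) (\<phi> z)) * exp (of_real (lam k) * Lb (b k) (\<phi> z)))"
   unfolding pb_quot[OF k z] De_eq[OF De z] by (simp add: mult_ac)
  thus ?thesis unfolding 1 2 by simp
 qed
 have off: "1 - b i / b k \<notin> \<real>\<^sub>\<le>\<^sub>0" if i: "i \<in> Ks - {k}" for i
 proof (rule bpow_off_segment[OF b(4)[OF k]])
  fix t :: real assume t: "0 <= t" "t <= 1"
  show "b k ~= of_real t * b i"
  proof
   assume e: "b k = of_real t * b i"
   hence "\<rho> = t * \<rho>" using b(1)[OF k] b(1)[of i] i t by (metis DiffD1 abs_of_nonneg norm_mult norm_of_real)
   hence "t = 1" using pos by simp
   hence "b k = b i" using e by simp
   hence "k = i" by (rule inj_onD[OF b_inj _ k]) (use i in simp)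
   thus False using i by simp
  qed
 qed
 have "isCont T (b k)"
 proof -
  have o: "isCont (%v. \<omega> (\<psi> v)) (b k)"
  proof -
   have "\<omega> analytic_on {\<psi> (b k)}"
    by (rule analytic_on_subset[OF \<omega>_an]) (use closure_subset[of "Omega \<psi> \<sigma>"] OmegaI[of \<sigma> "b k"] kA in "auto simp: ext_disk_def")
   hence "isCont \<omega> (\<psi> (b k))" by (rule analytic_at_imp_isCont)
   moreover have "isCont \<psi> (b k)"
    using continuous_on_eq_continuous_at[OF open_ext[of r0]] hol_imp_cont[OF hol] b(3)[OF k]
    by (auto simp: ext_disk_def)
   ultimately show ?thesis using isCont_o2 by blast
  qed
  have Lc: "isCont (Lb (b i)) (b k)" if "i \<in> Ks" for i
   using continuous_on_eq_continuous_at[OF open_ext[of r0]] hol_imp_cont[OF Lb_hol[OF b(3)[OF that]]] b(3)[OF k]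
   by (auto simp: ext_disk_def)
  have bc: "isCont (bpow (b i) (lam i)) (b k)" if "i \<in> Ks - {k}" for i
   unfolding bpow_def[abs_def] using b(4)[OF k] off[OF that] by (intro continuous_intros) auto
  show ?thesis unfolding T_def[abs_def] by (intro continuous_intros o Lc bc) auto
 qed
 moreover have \<phi>c: "(\<phi> \<longlongrightarrow> b k) (at (a k) within Sig)"
 proof -
  have ak: "a k \<in> Omega \<psi> r0" using OmegaI[OF b(3)[OF k]] b(2)[OF k] by simp
  have "isCont \<phi> (a k)"
   using continuous_on_eq_continuous_at[OF open_Omega[OF order_refl]] hol_imp_cont[OF \<phi>_hol] ak by blast
  thus ?thesis unfolding b_def isCont_def by (rule Lim_at_imp_Lim_at_within)
 qed
 ultimately have "((%z. T (\<phi> z)) \<longlongrightarrow> T (b k)) (at (a k) within Sig)" by (rule isCont_tendsto_compose)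
 hence "((%z. power_branch Sig (%z. \<phi> z / (z - a k)) (- lam k) z * De z) \<longlongrightarrow> T (b k)) (at (a k) within Sig)"
  by (rule Lim_transform_eventually) (auto simp: eq eventually_at_filter)
 \<comment> \<open>The limit is meaningful because \<open>a k\<close> is approached radially from
   outside.\<close>
 moreover have "at (a k) within Sig ~= bot"
 proof -
  have "((%t. \<psi> (of_real t * b k)) \<longlongrightarrow> a k) (at_right (1 :: real))" using \<psi>_lim_at[OF b(3)[OF k]] b(2)[OF k] by simp
  moreover have "\<forall>\<^sub>F t in at_right (1 :: real). \<psi> (of_real t * b k) \<in> Sig"
  proof -
   have "\<forall>\<^sub>F t in at_right (1 :: real). t \<in> {1<..<2}" by (intro eventually_at_right_real) auto
   thus ?thesis
   proof eventually_elim
    fix t :: real assume t: "t \<in> {1<..<2}"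
    hence "1 * \<rho> < t * \<rho>" using pos by (intro mult_strict_right_mono) auto
    hence "\<rho> < norm (of_real t * b k)" using t b(1)[OF k] by (simp add: norm_mult)
    thus "\<psi> (of_real t * b k) \<in> Sig" using ext_V by (auto simp: Sig_eq)
   qed
  qed
  hence "\<forall>\<^sub>F t in at_right (1 :: real). \<psi> (of_real t * b k) \<in> closure Sig"
   by (rule eventually_mono) (use closure_subset[of Sig] in blast)
  ultimately have "a k \<in> closure Sig" by (intro Lim_in_closed_set[OF closed_closure]) auto
  moreover have "a k \<notin> Sig"
  proof
   assume "a k \<in> Sig"
   thus False using Sig_D[of "a k"] b_notin_V[OF k] by (simp add: b_def)
  qed
  ultimately show ?thesis by (simp add: closure_def trivial_limit_within)
 qed
 ultimately have lim: "Lim (at (a k) within Sig) (%z. power_branch Sig (%z. \<phi> z / (z - a k)) (- lam k) z * De z) = T (b k)"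
  by (intro tendsto_Lim)
 have ak: "a k \<in> Omega \<psi> r0" using OmegaI[OF b(3)[OF k]] b(2)[OF k] by simp
 have "szego_const (Omega \<psi> r0) Sig \<phi> De (a k) (lam k) = exp (of_real (lam k - 1 / 2) * Lp (b k)) * T (b k)"
  unfolding szego_const_def lim pb_deriv[OF ak] by (simp add: b_def)
 also have "exp (of_real (lam k - 1 / 2) * Lp (b k)) = exp (of_real (lam k) * Lb (b k) (b k)) * C (b k)"
  unfolding C_def Lb_diag[OF b(3)[OF k]] by (simp add: exp_add[symmetric] algebra_simps)
 finally show ?thesis by (simp add: D0_split T_def mult_ac)
qed

lemma C_hol: "C holomorphic_on ext_disk r0" unfolding C_def by (intro holomorphic_intros Lp_hol) auto

lemma C_sq: "r0 < norm v ==> (C v)\<^sup>2 = deriv \<psi> v"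
 using Lp_exp[of v] by (simp add: C_def exp_minus field_simps flip: exp_double)

lemma C_lim: "(C \<longlongrightarrow> of_real (sqrt c)) at_infinity"
proof -
 have "(C \<longlongrightarrow> exp (- (of_real (- ln c) / 2))) at_infinity"
  unfolding C_def[abs_def] by (intro tendsto_intros Lp_lim) auto
 moreover have "exp (- (of_real (- ln c) / 2)) = complex_of_real (exp (ln c / 2))" by (simp add: exp_of_real[symmetric])
 moreover have "exp (ln c / 2) = sqrt c" using c by (simp add: powr_half_sqrt[symmetric] powr_def)
 ultimately show ?thesis by simp
qed

end

subsection \<open>Strong asymptotics\<close>

text \<open>A root of the derivative of \<xi> is determined up to sign; its product with
  \<open>q \<circ> \<xi>\<close> has square one on the connected disc, hence is a constant sign that
  can be absorbed.\<close>

lemma (in ext_map) normalized_root: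
 assumes \<theta>: "conformal_onto_disk (interior_dom \<psi> 1) \<theta>" and q: "is_sqrt_deriv (interior_dom \<psi> 1) \<theta> q"
  and \<xi>: "\<xi> holomorphic_on ball 0 R" "inj_on \<xi> (ball 0 R)" "1 < R"
  and inv: "!!z. z \<in> interior_dom \<psi> 1 ==> \<xi> (\<theta> z) = z"
 obtains p where "p holomorphic_on ball 0 R" "!!w. norm w < R ==> (p w)\<^sup>2 = deriv \<xi> w"
  "!!z. z \<in> interior_dom \<psi> 1 ==> q z * p (\<theta> z) = 1"
proof -
 define G where "G = interior_dom \<psi> 1"
 have oG: "open G" unfolding G_def by (rule open_interior_dom)
 have th: "\<theta> holomorphic_on G" "\<theta> ` G = ball 0 1" using \<theta> by (auto simp: conformal_onto_disk_def G_def)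
 have qq: "q holomorphic_on G" "!!z. z \<in> G ==> (q z)\<^sup>2 = deriv \<theta> z" using q by (auto simp: is_sqrt_deriv_def G_def)
 have sub: "ball (0 :: complex) 1 \<subseteq> ball 0 R" using \<xi>(3) by auto
 have \<xi>G: "\<xi> w \<in> G \<and> \<theta> (\<xi> w) = w" if w: "w \<in> ball 0 1" for w
 proof -
  obtain z where "z \<in> G" "w = \<theta> z" using w th(2) by blast
  thus ?thesis using inv by (simp add: G_def)
 qed
 obtain p0 where p0: "p0 holomorphic_on ball 0 R" "!!w. norm w < R ==> (p0 w)\<^sup>2 = deriv \<xi> w"
  using sqrt_of_derivative[OF \<xi>(1,2)] \<xi>(3) by auto
 define f where "f w = q (\<xi> w) * p0 w" for w
 have f2: "(f w)\<^sup>2 = 1" if w: "w \<in> ball 0 1" for w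
 proof -
  have "(\<xi> has_field_derivative deriv \<xi> w) (at w)" using holomorphic_derivI[OF \<xi>(1) open_ball] sub w by blast
  moreover have "(\<theta> has_field_derivative deriv \<theta> (\<xi> w)) (at (\<xi> w))" using holomorphic_derivI[OF th(1) oG] \<xi>G[OF w] by blast
  ultimately have "(\<theta> \<circ> \<xi> has_field_derivative deriv \<theta> (\<xi> w) * deriv \<xi> w) (at w)" by (rule DERIV_chain[rotated])
  moreover have "(\<theta> \<circ> \<xi> has_field_derivative 1) (at w)"
  proof (rule has_field_derivative_transform_within_open[OF DERIV_ident open_ball w])
   show "x = (\<theta> \<circ> \<xi>) x" if "x \<in> ball 0 1" for x using \<xi>G[OF that] by simp
  qed
  ultimately have "deriv \<theta> (\<xi> w) * deriv \<xi> w = 1" by (rule DERIV_unique)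
  thus ?thesis using qq(2)[of "\<xi> w"] \<xi>G[OF w] p0(2)[of w] w \<xi>(3) by (simp add: f_def power_mult_distrib)
 qed
 have "q \<circ> \<xi> holomorphic_on ball 0 1"
  by (rule holomorphic_on_compose_gen[OF hol_subset[OF \<xi>(1) sub] qq(1)]) (use \<xi>G in auto)
 hence "(%w. q (\<xi> w)) holomorphic_on ball 0 1" by (simp add: o_def)
 hence "f holomorphic_on ball 0 1" unfolding f_def by (intro holomorphic_intros hol_subset[OF p0(1) sub])
 hence fc: "continuous_on (ball 0 1) f" by (rule hol_imp_cont)
 have "f ` ball 0 1 \<subseteq> {1, -1}"
 proof
  fix y assume "y \<in> f ` ball 0 1"
  hence "y\<^sup>2 = 1" using f2 by blast
  thus "y \<in> {1, -1}" by (simp add: power2_eq_1_iff)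
 qed
 hence fin: "finite (f ` ball 0 1)" by (rule finite_subset) simp
 have "f constant_on ball 0 1" by (rule continuous_finite_range_constant[OF connected_ball fc fin])
 then obtain \<epsilon> where \<epsilon>: "!!w. w \<in> ball 0 1 ==> f w = \<epsilon>" by (auto simp: constant_on_def)
 have \<epsilon>2: "\<epsilon>\<^sup>2 = 1" using f2[of 0] \<epsilon>[of 0] by simp
 show ?thesis
 proof (rule that[of "%w. \<epsilon> * p0 w"])
  show "(%w. \<epsilon> * p0 w) holomorphic_on ball 0 R" by (intro holomorphic_intros p0)
  show "(\<epsilon> * p0 w)\<^sup>2 = deriv \<xi> w" if "norm w < R" for w
   using p0(2)[OF that] \<epsilon>2 by (simp add: power_mult_distrib)
  fix z assume z: "z \<in> interior_dom \<psi> 1"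
  hence "\<theta> z \<in> ball 0 1" using th(2) by (auto simp: G_def)
  from \<epsilon>[OF this] have "q z * p0 (\<theta> z) = \<epsilon>" by (simp add: f_def inv[OF z])
  thus "q z * (\<epsilon> * p0 (\<theta> z)) = 1" using \<epsilon>2 by (simp add: power2_eq_square mult.left_commute)
 qed
qed

text \<open>By the Jordan curve theorem the curve is the frontier of its outside, which
  \<open>frontier_Omega\<close> computes.\<close>

lemma (in ext_map) curve_eq:
 assumes \<gamma>: "analytic_jordan_curve \<gamma>" and out: "\<psi> ` ext_disk 1 = outside (path_image \<gamma>)" and r01: "r0 < 1"
 shows "path_image \<gamma> = \<psi> ` sphere 0 1"
proof -
 obtain g S where g: "open S" "sphere 0 1 \<subseteq> S" "g holomorphic_on S" "inj_on g S" "\<gamma> = g \<circ> circlepath 0 1"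
  using \<gamma> by (auto simp: analytic_jordan_curve_def)
 have "simple_path \<gamma>" unfolding g(5) using g
  by (intro simple_path_continuous_image simple_path_circlepath[THEN iffD2])
    (auto intro: inj_on_subset continuous_on_subset hol_imp_cont)
 moreover have "pathfinish \<gamma> = pathstart \<gamma>" by (simp add: g(5) pathfinish_compose pathstart_compose)
 ultimately have "frontier (outside (path_image \<gamma>)) = path_image \<gamma>" by (meson Jordan_inside_outside)
 thus ?thesis using frontier_Omega[OF r01] out by (simp add: Omega_def)
qed

text \<open>Parametrizing the curve by \<open>\<psi>\<close> instead changes the parameter by \<open>g\<inverse> \<circ> \<psi>\<close>, a circle map.\<close>

lemma (in ext_map) arclength_integral_exterior:
 assumes \<gamma>: "analytic_jordan_curve \<gamma>" and L: "path_image \<gamma> = \<psi> ` sphere 0 1" and r01: "r0 < 1"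
  and f: "continuous_on (path_image \<gamma>) f"
 shows "arclength_integral \<gamma> f = 2 * of_real pi * cmean 1 (%v. f (\<psi> v) * of_real (norm (deriv \<psi> v)))"
proof -
 obtain g S where g: "open S" "sphere 0 1 \<subseteq> S" "g holomorphic_on S" "inj_on g S" "\<gamma> = g \<circ> circlepath 0 1"
  using \<gamma> by (auto simp: analytic_jordan_curve_def)
 obtain gi where gi: "gi holomorphic_on g ` S" "!!z. z \<in> S ==> deriv g z * deriv gi (g z) = 1" "!!z. z \<in> S ==> gi (g z) = z"
  using holomorphic_has_inverse[OF g(3,1,4)] by blast
 have L': "\<psi> ` sphere 0 1 = g ` sphere 0 1" using L by (simp add: g(5) path_image_compose)
 have ogS: "open (g ` S)" by (rule open_mapping_thm3[OF g(3,1,4)])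
 define Z where "Z = ext_disk r0 \<inter> \<psi> -` (g ` S)"
 have oZ: "open Z" unfolding Z_def
  by (rule continuous_open_preimage[OF hol_imp_cont[OF hol] open_ext ogS])
 have circ: "\<exists>u. norm u = 1 \<and> u \<in> S \<and> \<psi> v = g u" if "norm v = 1" for v
 proof -
  have "\<psi> v \<in> g ` sphere 0 1" unfolding L'[symmetric] using that by simp
  thus ?thesis using g(2) by auto
 qed
 have Z1: "sphere 0 1 \<subseteq> Z" using circ r01 by (force simp: Z_def ext_disk_def)
 define k where "k v = gi (\<psi> v)" for v
 have kg: "norm (k v) = 1 \<and> k v \<in> S \<and> g (k v) = \<psi> v" if "norm v = 1" for v using circ[OF that] gi(3) by (auto simp: k_def)
 have k_hol: "k holomorphic_on Z"
  using holomorphic_on_compose_gen[OF hol_subset[OF hol] gi(1), of Z] by (auto simp: Z_def k_def[abs_def] o_def)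
 have k': "norm (deriv g (k v)) * norm (deriv k v) = norm (deriv \<psi> v)" if v: "norm v = 1" for v
 proof -
  have vZ: "v \<in> Z" "v \<in> ext_disk r0" using Z1 v r01 by (auto simp: ext_disk_def)
  have "(gi \<circ> \<psi> has_field_derivative deriv gi (\<psi> v) * deriv \<psi> v) (at v)"
   by (rule DERIV_chain[OF holomorphic_derivI[OF gi(1) ogS] holomorphic_derivI[OF hol open_ext vZ(2)]])
     (use vZ in "auto simp: Z_def")
  hence "deriv k v = deriv gi (\<psi> v) * deriv \<psi> v" by (simp add: DERIV_imp_deriv k_def[abs_def] o_def)
  moreover have "deriv g (k v) * deriv gi (\<psi> v) = 1" using gi(2)[of "k v"] kg[OF v] by simp
  ultimately have 1: "deriv g (k v) * deriv k v = deriv \<psi> v" by (simp flip: mult.assoc)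
  thus ?thesis by (simp flip: norm_mult)
 qed
 define H where "H u = f (g u) * of_real (norm (deriv g u))" for u
 have H: "continuous_on (sphere 0 1) H"
  unfolding H_def using g
  by (intro continuous_intros continuous_on_compose2[OF f]
    hol_cont[OF holomorphic_deriv[OF g(3,1)]]
    hol_cont[OF g(3)]) (auto simp: path_image_compose)
 have kinj: "inj_on k (sphere 0 1)"
 proof (rule inj_onI)
  fix x y assume xy: "x \<in> sphere 0 1" "y \<in> sphere 0 1" "k x = k y"
  hence "\<psi> x = \<psi> y" using kg[of x] kg[of y] by simp
  thus "x = y" using inj_onD[OF inj] xy r01 by (auto simp: ext_disk_def)
 qed
 have konto: "k ` sphere 0 1 = sphere 0 1"
 proof
  show "k ` sphere 0 1 \<subseteq> sphere 0 1" using kg by auto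
  show "sphere 0 1 \<subseteq> k ` sphere 0 1"
  proof
   fix u :: complex assume u: "u \<in> sphere 0 1"
   hence "g u \<in> \<psi> ` sphere 0 1" unfolding L' by (rule imageI)
   then obtain x where "x \<in> sphere 0 1" "g u = \<psi> x" by blast
   thus "u \<in> k ` sphere 0 1" using gi(3)[of u] u g(2) by (intro image_eqI[of _ _ x]) (auto simp: k_def)
  qed
 qed
 have "arclength_integral \<gamma> f = integral {0..1} (%t. 2 * of_real pi * H (circlepath 0 1 t))"
  unfolding arclength_integral_def
 proof (rule integral_cong)
  fix t :: real assume t: "t \<in> {0..1}"
  have S: "circlepath 0 1 t \<in> S" using g(2) circlepath_in_sphere[of 1 t] by auto
  have "(g has_field_derivative deriv g (circlepath 0 1 t)) (at (circlepath 0 1 t) within circlepath 0 1 ` {0..1})"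
   by (rule has_field_derivative_at_within[OF holomorphic_derivI[OF g(3,1) S]])
  hence "(\<gamma> has_vector_derivative (2 * of_real pi * \<i> * circlepath 0 1 t) * deriv g (circlepath 0 1 t)) (at t within {0..1})"
   unfolding g(5)
   by (rule field_vector_diff_chain_within[rotated])
     (use has_vector_derivative_circlepath[of 0 1 t] in "auto simp: circlepath")
  hence "vector_derivative \<gamma> (at t within {0..1}) = (2 * of_real pi * \<i> * circlepath 0 1 t) * deriv g (circlepath 0 1 t)"
   using t by (intro vector_derivative_within_cbox[of 0 1, unfolded box_real]) auto
  thus "f (\<gamma> t) * of_real (norm (vector_derivative \<gamma> (at t within {0..1}))) = 2 * of_real pi * H (circlepath 0 1 t)"
   by (simp add: H_def g(5) norm_mult circlepath_norm)
 qed
 also have "... = 2 * of_real pi * integral {0..1} (%t. H (k (circlepath 0 1 t)) * of_real (norm (deriv k (circlepath 0 1 t))))"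
  using circle_reparam[OF oZ k_hol Z1 kinj konto H] by simp
 also have "integral {0..1} (%t. H (k (circlepath 0 1 t)) * of_real (norm (deriv k (circlepath 0 1 t))))
   = cmean 1 (%v. f (\<psi> v) * of_real (norm (deriv \<psi> v)))"
  unfolding cmean_def
 proof (rule integral_cong)
  fix t :: real
  have v: "norm (circlepath 0 1 t) = 1" by (simp add: circlepath_norm)
  show "H (k (circlepath 0 1 t)) * of_real (norm (deriv k (circlepath 0 1 t)))
    = f (\<psi> (circlepath 0 1 t)) * of_real (norm (deriv \<psi> (circlepath 0 1 t)))"
   using kg[OF v] by (simp add: H_def k'[OF v, symmetric])
 qed
 finally show ?thesis .
qed

text \<open>Translates the orthogonality relations on the curve: \<open>Dh\<close> supplies the
  weight, and the factor from \<open>p\<close> in \<open>trf\<close> cancels against the density of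
  \<open>transfer\<close>, leaving \<open>norm (deriv \<psi> v)\<close>.\<close>

lemma (in core) arclength_integral_cip:
 assumes \<gamma>: "analytic_jordan_curve \<gamma>" "path_image \<gamma> = \<psi> ` sphere 0 1" and h: "continuous_on (path_image \<gamma>) h"
  "!!v. norm v = 1 ==> h (\<psi> v) = (norm (Dh (\<eta> v)))\<^sup>2"
 shows "arclength_integral \<gamma> (%z. poly f z * cnj (z ^ m) * of_real (h z)) = 2 * of_real pi * cip (trf (poly f)) (trf (%z. z ^ m))"
proof -
 define F where "F z = poly f z * cnj (z ^ m) * of_real (h z)" for z
 have r01: "r0 < 1" using radii by simp
 have F: "continuous_on (path_image \<gamma>) F" unfolding F_def by (intro continuous_intros h)
 have "(%z :: complex. z ^ m) holomorphic_on UNIV" by (intro holomorphic_intros)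
 hence "continuous_on (sphere 0 1) (%w. trf (poly f) w * cnj (trf (%z. z ^ m) w))"
  by (intro continuous_intros cont_trf cont_ball[OF trf_hol])
 hence "cip (trf (poly f)) (trf (%z. z ^ m)) = cmean 1 (%v. trf (poly f) (\<eta> v) * cnj (trf (%z. z ^ m) (\<eta> v)) *
   of_real ((norm (C v))\<^sup>2 / (norm (p (\<eta> v)))\<^sup>2))"
  unfolding cip_def by (rule transfer)
 also have "... = cmean 1 (%v. F (\<psi> v) * of_real (norm (deriv \<psi> v)))"
 proof (rule cmean_cong)
  fix v :: complex assume v: "norm v = 1"
  have vr: "v \<in> Ann" "r0 < norm v" using v radii by auto
  have pn: "p (\<eta> v) ~= 0" using p_nz \<eta>_inR2[OF vr(1)] by blast
  have "norm (deriv \<psi> v) = (norm (C v))\<^sup>2" using C_sq[OF vr(2)] by (simp flip: norm_power)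
  moreover have "trf (poly f) (\<eta> v) * cnj (trf (%z. z ^ m) (\<eta> v)) = F (\<psi> v) * of_real ((norm (p (\<eta> v)))\<^sup>2)"
   using vr(1) by (simp add: trf_def F_def h(2)[OF v] \<xi>_\<eta> complex_norm_square mult_ac del: of_real_power)
  ultimately show "trf (poly f) (\<eta> v) * cnj (trf (%z. z ^ m) (\<eta> v)) * of_real ((norm (C v))\<^sup>2 / (norm (p (\<eta> v)))\<^sup>2)
    = F (\<psi> v) * of_real (norm (deriv \<psi> v))" using pn by simp
 qed simp
 finally show ?thesis using arclength_integral_exterior[OF \<gamma> r01 F] by (simp only: F_def[abs_def])
qed

section \<open>Points off the frontier of the slit domain\<close>

lemma interior_finite_span: "finite A ==> interior (\<Union>x\<in>A. span {x :: complex}) = {}"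
proof (induction A rule: finite_induct)
 case (insert x A)
 have "dim (span {x}) <= 1" by (simp add: dim_insert)
 hence "interior (span {x}) = {}" by (intro empty_interior_lowdim) simp
 thus ?case
  using insert interior_closed_Un_empty_interior[of "span {x}" "\<Union>x\<in>A. span {x}"] closed_span by simp
qed simp

text \<open>The slits and removed points lie on finitely many real lines through 0, which have empty
  interior, so their removal does not change the closure.\<close>

lemma (in setting) closure_Sig: "\<psi> ` {v. \<sigma> <= norm v} \<subseteq> closure Sig"
proof -
 define F where "F = (\<Union>x\<in>b ` Ks. span {x})"
 have "closure (- F) = UNIV"
  using interior_finite_span[of "b ` Ks"] closure_complement[of F] by (simp add: F_def)
 hence 1: "closure (ext_disk \<sigma> \<inter> - F) = closure (ext_disk \<sigma>)"
  using open_ext by (intro closure_open_Int_superset) auto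
 have "ext_disk \<sigma> \<inter> - F \<subseteq> V"
 proof
  fix v assume v: "v \<in> ext_disk \<sigma> \<inter> - F"
  show "v \<in> V"
  proof (rule ccontr)
   assume "v \<notin> V"
   hence "v \<in> slit_set \<phi> \<sigma> s a lam" "\<sigma> < norm v" using v by (auto simp: V_def ext_disk_def)
   hence "\<exists>k\<in>Ks. \<exists>t. v = of_real t * b k"
   proof (cases rule: slit_cases)
    case (pole k)
    thus ?thesis by (intro bexI[of _ k] exI[of _ 1]) auto
   next
    case (slit k)
    thus ?thesis using seg_radial by blast
   qed
   then obtain k t where "k \<in> Ks" "v = of_real t * b k" by blast
   hence "v \<in> F" unfolding F_def
    by (intro UN_I[of "b k"]) (auto simp: scaleR_conv_of_real[symmetric] intro: span_scale span_base)
   thus False using v by blast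
  qed
 qed
 from closure_mono[OF this] have "{v. \<sigma> <= norm v} \<subseteq> closure V" by (simp add: 1 closure_ext)
 moreover have "\<psi> ` ({v. \<sigma> <= norm v} \<inter> closure V) \<subseteq> closure (\<psi> ` V)"
 proof clarify
  fix v assume v: "\<sigma> <= norm v" "v \<in> closure V"
  then obtain x where x: "!!n. x n \<in> V" "x \<longlonglongrightarrow> v" by (auto simp: closure_sequential)
  have "v \<in> ext_disk r0" using v radii by (auto simp: ext_disk_def)
  hence "isCont \<psi> v"
   using continuous_on_eq_continuous_at[OF open_ext[of r0]] hol_imp_cont[OF hol] by blast
  hence "(%n. \<psi> (x n)) \<longlonglongrightarrow> \<psi> v" using x(2) by (rule isCont_tendsto_compose)
  thus "\<psi> v \<in> closure (\<psi> ` V)" using x(1) by (auto simp: closure_sequential intro!: exI[of _ "%n. \<psi> (x n)"])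
 qed
 ultimately show ?thesis unfolding Sig_eq by blast
qed

lemma (in setting) off_frontier:
 assumes "z \<in> interior_dom \<psi> 1" "z \<notin> frontier Sig"
 shows "z \<in> Sig \<or> z \<in> interior_dom \<psi> \<sigma>"
proof (rule disjCI)
 assume "z \<notin> interior_dom \<psi> \<sigma>"
 hence "z \<in> closure Sig" using closure_Sig interior_dom_eq[of \<sigma>] radii by auto
 thus "z \<in> Sig" using assms(2) interior_open[OF open_Sig] by (simp add: frontier_def)
qed

text \<open>For nonincreasing exponents the indices with the top value form an initial segment,
  which is thus determined by its cardinality.\<close>

lemma down_closed_eq:
 assumes "A \<subseteq> {1..s :: nat}" "!!j k. k \<in> A ==> 1 <= j ==> j <= k ==> j \<in> A"
 shows "A = {1..card A}"
proof (cases "A = {}")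
 case False
 have fin: "finite A" using assms(1) finite_subset by blast
 have "A = {1..Max A}" using assms Max_in[OF fin False] Max_ge[OF fin] by force
 thus ?thesis by (metis card_atLeastAtMost diff_Suc_1)
qed simp

theorem theorem1p5:
  fixes \<gamma> :: "real \<Rightarrow> complex"
    and \<psi> \<phi> \<omega> De Di \<theta> q sqrt_dphi :: "complex \<Rightarrow> complex"
    and rho_hat \<sigma> \<rho> :: real
    and s u :: nat
    and a :: "nat \<Rightarrow> complex"
    and lam :: "nat \<Rightarrow> real"
    and h :: "complex \<Rightarrow> real"
    and P :: "nat \<Rightarrow> complex poly"
    and L G1 Gs Sig :: "complex set"
    and \<alpha> :: "nat \<Rightarrow> complex"
    and W :: "complex \<Rightarrow> complex \<Rightarrow> complex"
    and lhs :: "nat \<Rightarrow> complex \<Rightarrow> complex"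
  assumes "analytic_jordan_curve \<gamma>" and "L = path_image \<gamma>"
    and "exterior_map L \<psi>"
    and "minimal_univalence_radius \<psi> rho_hat"
    and "\<phi> = inv_into (ext_disk rho_hat) \<psi>"
    and "sqrt_dphi = power_branch (Omega \<psi> rho_hat) (deriv \<phi>) (1/2)"
    and "rho_hat < \<sigma>" and "\<sigma> < \<rho>" and "\<rho> < 1"
    and "1 \<le> s"
    and "inj_on a {1..s}" and "\<forall>k\<in>{1..s}. a k \<in> level_curve \<psi> \<rho>"
    and "\<forall>j\<in>{1..s}. \<forall>k\<in>{1..s}. j \<le> k \<longrightarrow> lam k \<le> lam j"
    and "\<forall>k\<in>{1..s}. lam k \<notin> \<int>\<^sub>\<le>\<^sub>0"
    and "u = card {k\<in>{1..s}. lam k = lam 1}"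
    and "\<omega> analytic_on closure (Omega \<psi> \<sigma>)" and "pos_at_inf \<omega>"
    and "\<forall>z \<in> closure (Omega \<psi> 1) \<union> a ` {1..s}. \<omega> z \<noteq> 0"
    and "h = weight \<omega> s a lam"
    and "\<forall>n. monic_orthogonal_poly \<gamma> h n (P n)"
    and "G1 = interior_dom \<psi> 1" and "Gs = interior_dom \<psi> \<sigma>"
    and "Sig = slit_domain \<psi> \<phi> \<sigma> s a lam"
    and "exterior_szego L (Omega \<psi> 1) Sig h De"
    and "interior_szego L G1 h Di"
    and "conformal_onto_disk G1 \<theta>" and "is_sqrt_deriv G1 \<theta> q" and "W = kernel_W \<theta> q"
    and "\<forall>k\<in>{1..s}. \<alpha> k = szego_const (Omega \<psi> rho_hat) Sig \<phi> De (a k) (lam k)"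
    and "\<forall>n z. lhs n z =
           val_inf De * poly (P n) z / val_inf (deriv \<phi>) powr (- of_nat n - 1/2)"
  shows
    "(\<exists>r :: nat \<Rightarrow> complex \<Rightarrow> complex.
        (\<forall>\<^sub>F n in sequentially.
           of_real (gen_binomial (real n) (lam 1 - 1)) \<noteq> (0 :: complex) \<and>
           (\<forall>z \<in> G1 - frontier Sig.
              (z \<in> G1 \<inter> Sig \<or> z \<in> Gs) \<and>
              lhs n z =
                (if z \<in> Sig then De z * sqrt_dphi z * \<phi> z ^ n else 0)
                + of_real (gen_binomial (real n) (lam 1 - 1)) * inverse (Di z) *
                  ((\<Sum>k=1..u. \<alpha> k * Di (a k) * W (a k) z * \<phi> (a k) ^ (n + 1))
                   + of_real \<rho> ^ n * r n z))) \<and>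
        locally_uniform_limit (G1 - frontier Sig) r (\<lambda>_. 0)) \<and>
     (\<forall>j\<in>{1..s}.
        (\<lambda>n. norm
           (lhs n (a j)
            - of_real (gen_binomial (real n) (lam j)) * \<alpha> j * deriv \<phi> (a j) * \<phi> (a j) ^ n
            - of_real (gen_binomial (real n) (lam 1 - 1)) * inverse (Di (a j)) *
              (\<Sum>k\<in>{1..u} - {j}. \<alpha> k * Di (a k) * W (a k) (a j) * \<phi> (a k) ^ (n + 1))))
        \<in> o(\<lambda>n. real n powr max (lam j) (lam 1 - 1) * \<rho> ^ n))"
proof -
 note A = assms and [simp] = assms(21,22,23)
 let ?S = "%n z. \<Sum>k=1..u. \<alpha> k * Di (a k) * W (a k) z * \<phi> (a k) ^ (n + 1)"
 let ?b = "%n. complex_of_real (gen_binomial (real n) (lam 1 - 1))"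
 let ?X = "%n z. if z \<in> Sig then De z * sqrt_dphi z * \<phi> z ^ n else 0"
 have conf: "\<theta> holomorphic_on G1" "inj_on \<theta> G1" "\<theta> ` G1 = ball 0 1" using A(26) by (auto simp: conformal_onto_disk_def)
 obtain c where c: "0 < c" "(deriv \<psi> \<longlongrightarrow> complex_of_real c) at_infinity"
  using A(3) by (auto simp: exterior_map_def pos_at_inf_def)
 interpret ext_map \<psi> \<phi> rho_hat c
  using A(3,4,5) c by unfold_locales (auto simp: exterior_map_def minimal_univalence_radius_def)
 have r01: "rho_hat < 1" using A(7-9) by simp
 have L: "L = \<psi> ` sphere 0 1" using curve_eq[OF A(1) _ r01] A(2,3) by (simp add: exterior_map_def)
 obtain Lp Lb where logs:
  "Lp holomorphic_on ext_disk rho_hat" "!!v. rho_hat < norm v ==> exp (Lp v) = 1 / deriv \<psi> v"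
  "(Lp \<longlongrightarrow> of_real (- ln c)) at_infinity"
  "!!b. rho_hat < norm b ==> Lb b holomorphic_on ext_disk rho_hat"
  "!!b v. rho_hat < norm b ==> rho_hat < norm v ==> v ~= b ==> exp (Lb b v) = (v - b) / (\<psi> v - \<psi> b)"
  "!!b. rho_hat < norm b ==> (Lb b \<longlongrightarrow> of_real (- ln c)) at_infinity"
  "!!b. rho_hat < norm b ==> Lb b b = Lp b"
 proof (rule log_branches, goal_cases)
  case (1 Lp Lb)
  from 1(2-) show ?thesis by (rule 1(1))
 qed
 obtain co where co: "0 < co" "(\<omega> \<longlongrightarrow> complex_of_real co) at_infinity" using A(17) by (auto simp: pos_at_inf_def)
 interpret set: setting \<psi> \<phi> rho_hat c \<sigma> \<rho> s a lam \<omega> co Lp Lb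
  by unfold_locales (fact A(7) A(8) A(9) A(11) A(16) co logs | use A(12,18) in blast)+
 have Di: "Di analytic_on closure G1" "!!z. z \<in> closure G1 ==> Di z ~= 0" "!!z. z \<in> L ==> (norm (Di z))\<^sup>2 = h z"
  using A(25) by (auto simp: interior_szego_def)
 obtain V0 where V0: "open V0" "closure G1 \<subseteq> V0" "Di holomorphic_on V0" using Di(1) by (auto simp: analytic_on_holomorphic)
 \<comment> \<open>Zeros of the continued interior Szego function are cut away, so that
   \<open>Dh\<close> has none on the disc of radius \<open>R2\<close>.\<close>
 define V where "V = V0 \<inter> Di -` (- {0})"
 have V: "open V" "closure G1 \<subseteq> V" "Di holomorphic_on V" "!!z. z \<in> V ==> Di z ~= 0"
  using V0 Di(2) continuous_open_preimage[OF hol_imp_cont[OF V0(3)] V0(1), of "- {0}"]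
  by (auto simp: V_def intro: hol_subset)
 obtain R1 R2 \<eta> \<xi> where R: "1 < R1" "1 < R2"
  and \<eta>: "\<eta> holomorphic_on {v. \<sigma> < norm v \<and> norm v < R1}" "inj_on \<eta> {v. \<sigma> < norm v \<and> norm v < R1}"
  "!!v. \<sigma> < norm v ==> norm v < 1 ==> \<eta> v = \<theta> (\<psi> v)" "!!v. norm v = 1 ==> norm (\<eta> v) = 1"
  "!!v. 1 < norm v ==> norm v < R1 ==> 1 < norm (\<eta> v)"
  "!!v. \<sigma> < norm v ==> norm v < R1 ==> norm (\<eta> v) < R2"
  and \<xi>: "\<xi> holomorphic_on ball 0 R2" "inj_on \<xi> (ball 0 R2)"
  "!!v. \<sigma> < norm v ==> norm v < R1 ==> \<xi> (\<eta> v) = \<psi> v"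
  "!!z. z \<in> interior_dom \<psi> 1 ==> \<xi> (\<theta> z) = z" "\<xi> ` ball 0 R2 \<subseteq> V"
 proof (rule interior_extension[OF A(7) less_trans[OF A(8,9)] A(26)[unfolded A(21)] V(1) V(2)[unfolded A(21)]], goal_cases)
  case (1 R1 R2 \<eta> \<xi>)
  from 1(2-) show ?thesis by (rule 1(1))
 qed
 obtain p where p: "p holomorphic_on ball 0 R2" "!!w. norm w < R2 ==> (p w)\<^sup>2 = deriv \<xi> w" "!!z. z \<in> G1 ==> q z * p (\<theta> z) = 1"
 proof (rule normalized_root[OF A(26)[unfolded A(21)] A(27)[unfolded A(21)] \<xi>(1,2) R(2) \<xi>(4)], goal_cases)
  case (2 p)
  from 2(2-) show ?thesis by (intro 2(1)) (simp_all only: A(21))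
 qed
 define Dh where "Dh w = Di (\<xi> w)" for w
 have \<psi>G: "\<psi> v \<in> G1 \<longleftrightarrow> norm v < 1" if "rho_hat < norm v" for v using interior_dom_iff[OF that r01] by simp
 have \<theta>1: "norm (\<theta> z) < 1" if "z \<in> G1" for z using conf(3) that by auto
 have Dh: "Dh holomorphic_on ball 0 R2" "!!w. norm w < R2 ==> Dh w ~= 0"
 proof -
  show "Dh holomorphic_on ball 0 R2" using holomorphic_on_compose_gen[OF \<xi>(1) V(3) \<xi>(5)] by (simp add: Dh_def[abs_def] o_def)
  show "Dh w ~= 0" if "norm w < R2" for w using that V(4)[of "\<xi> w"] \<xi>(5) by (auto simp: Dh_def image_subset_iff)
 qed
 have Dh\<eta>: "Dh (\<eta> v) = Di (\<psi> v)" if "\<sigma> < norm v" "norm v < R1" for v using \<xi>(3)[OF that] by (simp add: Dh_def)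
 have \<psi>L: "\<psi> v \<in> L" if "norm v = 1" for v unfolding L using that by simp
 interpret cor: core2 \<psi> \<phi> rho_hat c \<sigma> \<rho> R1 R2 \<eta> \<xi> p Dh set.D set.C set.Dinf "{1..s}" set.b lam set.D0 "lam 1"
 proof unfold_locales
  show "norm (\<eta> v) < 1" if "\<sigma> < norm v" "norm v < 1" for v
   using \<eta>(3)[OF that] \<theta>1[of "\<psi> v"] \<psi>G[of v] that A(7) by simp
  show "\<xi> ` ball 0 1 = interior_dom \<psi> 1"
  proof -
   have "\<xi> ` \<theta> ` G1 = G1" using \<xi>(4) by (simp add: image_image cong: image_cong)
   thus ?thesis by (simp add: conf(3)[simplified])
  qed
  show "norm (set.D v) * norm (Dh (\<eta> v)) = 1" if v: "norm v = 1" for v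
  proof -
   have nz: "0 < norm (set.D v)" using set.D_nz[of v] v by simp
   have "(norm (Dh (\<eta> v)))\<^sup>2 = norm (set.D v) powr (-2)"
    using Di(3)[OF \<psi>L[OF v]] set.norm_D[OF v] Dh\<eta>[of v] v R A(8,9,19) by simp
   hence "(norm (set.D v) * norm (Dh (\<eta> v)))\<^sup>2 = 1"
    using nz by (simp add: power_mult_distrib powr_minus_divide powr_numeral)
   thus ?thesis by (intro power2_eq_imp_eq[of _ 1]) simp_all
  qed
  show "set.D v = set.D0 v * (\<Prod>k\<in>{1..s}. bpow (set.b k) (lam k) v)" for v by (simp add: set.D_def)
  show "!!k. k \<in> {1..s} ==> lam k <= lam 1" using bspec[OF A(13), of 1] A(10) by simp
 qed (fact A(7) A(8) A(9) R \<eta> \<xi> p(1,2) Dh set.D_hol set.D_lim set.Dinf set.D_nz set.C_hol set.C_sq set.C_lim set.b(1) set.b_inj set.D0_hol finite_atLeastAtMost)+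
 have P: "degree (P n) = n" "lead_coeff (P n) = 1" for n using spec[OF A(20), of n] unfolding monic_orthogonal_poly_def by blast+
 have orth: "cip (cor.trf (poly (P n))) (cor.trf (%z. z ^ m)) = 0" if m: "m < n" for n m
 proof -
  have "L \<subseteq> closure G1" using circle_in_closure[OF r01] by (auto simp: L)
  hence "continuous_on L Di" using V(2) by (intro hol_cont[OF V(3)]) simp
  hence "continuous_on L (%z. (norm (Di z))\<^sup>2)" by (intro continuous_intros)
  hence h: "continuous_on L h" by (rule continuous_on_eq) (rule Di(3))
  have "h (\<psi> v) = (norm (Dh (\<eta> v)))\<^sup>2" if "norm v = 1" for v
   using Di(3)[OF \<psi>L[OF that]] Dh\<eta>[of v] that R A(8,9) by simp
  from cor.arclength_integral_cip[OF A(1) L[unfolded A(2)] h[unfolded A(2)] this, of "P n" m]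
  show ?thesis using A(20) m by (simp add: monic_orthogonal_poly_def)
 qed
 have De: "exterior_szego L (Omega \<psi> 1) set.Sig h De" using A(24) by simp
 \<comment> \<open>The value of \<open>\<phi>'\<close> at infinity is \<open>1 / c\<close>, and the
   principal power of a positive number is real, so the normalization is
   \<open>kap n\<close>.\<close>
 have lhs: "lhs n z = of_real (cor.kap n) * poly (P n) z" for n z
 proof -
  have vd: "val_inf (deriv \<phi>) = of_real (1 / c)" unfolding val_inf_def by (rule tendsto_Lim[OF trivial_limit_at_infinity d\<phi>_lim])
  have "complex_of_real (1 / c) powr (- of_nat n - 1/2) = of_real ((1 / c) powr (- real n - 1/2))"
   using c(1) by (simp add: powr_of_real[symmetric])
  also have "(1 / c) powr (- real n - 1/2) = c powr (real n + 1/2)" using c(1) by (simp add: powr_divide powr_minus_divide[symmetric] powr_def ln_div algebra_simps)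
  also have "... = c ^ n * sqrt c" using c(1) by (simp add: powr_add powr_realpow powr_half_sqrt)
  finally show ?thesis using A(30) set.De_lim[OF De L A(19)] by (simp add: vd cor.kap_def)
 qed
 have k1: "1 \<in> {1..s}" using A(10) by simp
 have top: "cor.top_ind = {1..u}"
 proof -
  have "{k\<in>{1..s}. lam k = lam 1} = {1..card {k\<in>{1..s}. lam k = lam 1}}"
  proof (rule down_closed_eq)
   fix j k assume k: "k \<in> {k\<in>{1..s}. lam k = lam 1}" "1 <= j" "j <= k"
   thus "j \<in> {k\<in>{1..s}. lam k = lam 1}"
    using bspec[OF bspec[OF A(13), of j], of k] bspec[OF bspec[OF A(13) k1], of j] by auto
  qed blast
  thus ?thesis unfolding cor.top_ind_def A(15) .
 qed
 have usub: "k \<in> {1..s}" if "k \<in> {1..u}" for k using that unfolding top[symmetric] cor.top_ind_def by blast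
 have ak: "set.b k = \<phi> (a k)" "\<alpha> k = cor.\<alpha>c k" "Di (a k) = Dh (\<eta> (set.b k))" "\<theta> (a k) = \<eta> (set.b k)" "a k \<in> G1"
  "\<psi> (set.b k) = a k" "q (a k) = 1 / p (\<eta> (set.b k))" if k: "k \<in> {1..s}" for k
 proof -
  note b = set.b[OF k]
  show "set.b k = \<phi> (a k)" by (simp add: set.b_def)
  show "\<alpha> k = cor.\<alpha>c k"
   using bspec[OF A(29) k] set.szego_const_eq[OF De L A(19) k] by (simp only: cor.\<alpha>c_def cor.N_def A(23))
  show "Di (a k) = Dh (\<eta> (set.b k))" using Dh\<eta>[of "set.b k"] b A(8,9) R by simp
  show 1: "\<theta> (a k) = \<eta> (set.b k)" using \<eta>(3)[of "set.b k"] b A(8,9) by simp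
  show 2: "a k \<in> G1" using \<psi>G[of "set.b k"] b A(9) by simp
  show "\<psi> (set.b k) = a k" by (rule b)
  show "q (a k) = 1 / p (\<eta> (set.b k))" using p(3)[OF 2] by (auto simp: 1 eq_divide_eq)
 qed
 have W: "W (a k) z = 1 / (p (\<theta> z) * p (\<eta> (set.b k)) * (\<eta> (set.b k) - \<theta> z))" if "k \<in> {1..s}" "z \<in> G1" for k z
 proof -
  have "q z = 1 / p (\<theta> z)" using p(3)[OF that(2)] by (auto simp: eq_divide_eq)
  thus ?thesis by (simp add: A(28) kernel_W_def ak[OF that(1)])
 qed
 have G1: "\<xi> (\<theta> z) = z" "Dh (\<theta> z) = Di z" "Di z ~= 0" if "z \<in> G1" for z
  using \<xi>(4) that closure_subset[of G1] Di(2) by (auto simp: Dh_def)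
 have SigD: "\<sigma> < norm (\<phi> z)" "\<psi> (\<phi> z) = z" "\<phi> z \<in> set.V" if "z \<in> Sig" for z
  using set.Sig_D[of z] that by (auto simp: set.V_def)
 have Sig1: "norm (\<phi> z) < 1" "\<theta> z = \<eta> (\<phi> z)" if "z \<in> Sig" "z \<in> G1" for z
 proof -
  show 1: "norm (\<phi> z) < 1" using \<psi>G[of "\<phi> z"] SigD[OF that(1)] that(2) A(7) by simp
  show "\<theta> z = \<eta> (\<phi> z)" using \<eta>(3)[OF SigD(1)[OF that(1)] 1] SigD(2)[OF that(1)] by simp
 qed
 have DD: "cor.DD = set.D" by (rule ext) (simp only: cor.DD_def set.D_def)
 have Sig_val: "De z * sqrt_dphi z * \<phi> z ^ n = cor.DD (\<phi> z) / set.C (\<phi> z) * \<phi> z ^ n" if "z \<in> Sig" for z n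
 proof -
  have "z \<in> Omega \<psi> rho_hat" using OmegaI[of rho_hat "\<phi> z"] SigD[OF that] A(7) by simp
  hence "sqrt_dphi z = 1 / set.C (\<phi> z)"
   by (simp add: A(6) set.pb_deriv set.C_def exp_minus inverse_eq_divide)
  thus ?thesis unfolding DD using set.De_eq[OF De L A(19)] that by simp
 qed
 \<comment> \<open>A function of \<open>z\<close> rather than of \<open>\<theta> z\<close>, and zero
   off \<open>Sig\<close>, so that both regions share one formula.\<close>
 define Xr where "Xr n z = ?X n z" for n z
 let ?J = "%n z. norm (cor.J cor.r3 n (\<theta> z) - Xr n z * (Dh (\<theta> z) * p (\<theta> z)) - cor.Sm n (\<theta> z))"
 define r where "r n z = cor.rr P n (\<theta> z) (Xr n z)" for n z
 have \<Lambda>: "lam 1 \<notin> \<int>\<^sub>\<le>\<^sub>0" using A(14) k1 by blast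
 have bn: "\<forall>\<^sub>F n in sequentially. cor.bn n ~= 0" by (rule cor.bn_nz[OF \<Lambda>])
 have bne: "gen_binomial (real n) (lam 1 - 1) = cor.bn n" for n by (simp only: cor.bn_def)
 have dich: "z \<in> Sig \<or> z \<in> Gs" if "z \<in> G1 - frontier Sig" for z using set.off_frontier[of z] that by auto
 have \<rho>0: "0 < \<rho>" by (rule cor.\<rho>_pos)
 have form: "lhs n z = Xr n z + of_real (cor.bn n) * inverse (Di z) *
   (?S n z + of_real \<rho> ^ n * r n z)"
  if n: "cor.bn n ~= 0" and z: "z \<in> G1" for n z
 proof -
  have S: "?S n z = (\<Sum>l\<in>cor.top_ind. cor.\<alpha>c l * Dh (\<eta> (set.b l)) *
    (1 / (p (\<theta> z) * p (\<eta> (set.b l)) * (\<eta> (set.b l) - \<theta> z))) * set.b l ^ Suc n)"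
   unfolding top using usub z by (intro sum.cong refl) (simp add: ak W)
  have "of_real \<rho> ^ n * r n z = (lhs n z - Xr n z) * Di z / of_real (cor.bn n)
    - ?S n z"
   unfolding r_def cor.rr_def S using \<rho>0 z by (simp add: G1 lhs)
  thus ?thesis using n G1(3)[OF z] by (simp add: field_simps)
 qed
 have unif: "locally_uniform_limit (G1 - frontier Sig) r (%_. 0)"
  unfolding locally_uniform_limit_def
 proof
  fix z0 assume z0: "z0 \<in> G1 - frontier Sig"
  define w0 where "w0 = \<theta> z0"
  have w0: "norm w0 < 1" using \<theta>1 z0 by (simp add: w0_def)
  \<comment> \<open>The points \<open>a k\<close> lie in neither \<open>Sig\<close> nor
    \<open>Gs\<close>, so \<open>z0\<close> differs from them and the kernels stay bounded near
    it.\<close>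
  have "\<eta> (set.b k) ~= w0" if k: "k \<in> {1..s}" for k
  proof
   assume "\<eta> (set.b k) = w0"
   hence "\<theta> (a k) = \<theta> z0" by (simp add: ak[OF k] w0_def)
   hence "z0 = a k" using inj_onD[OF conf(2)] ak(5)[OF k] z0 by blast
   hence "a k \<in> Sig \<or> a k \<in> Gs" using dich[OF z0] by simp
   thus False
    using set.b_notin_V[OF k] SigD(3)[of "a k"] ak(1,6)[OF k] interior_dom_iff[of "set.b k" \<sigma>] set.b[OF k] A(7,8) by auto
  qed
  then obtain d where d: "0 < d" "!!k. k \<in> {1..s} ==> d <= dist w0 (\<eta> (set.b k))"
   using finite_set_avoid[of "(%k. \<eta> (set.b k)) ` {1..s}" w0] by auto
  define m where "m = (1 + norm w0) / 2"
  define e1 where "e1 = min (d / 2) (m - norm w0)"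
  have e1: "0 < e1" "e1 <= d / 2" "norm w0 + e1 <= m" "m < 1" using d w0 by (auto simp: e1_def m_def min_def field_simps)
  have ctw: "\<exists>e'>0. \<forall>z\<in>ball z0 e'. z \<in> G1 \<and> \<theta> z \<in> ball w0 e2" if "0 < e2" for e2
  proof -
   have "open (G1 \<inter> \<theta> -` ball w0 e2)"
    by (rule continuous_open_preimage[OF hol_imp_cont[OF conf(1)]]) (simp_all add: open_interior_dom)
   moreover have "z0 \<in> G1 \<inter> \<theta> -` ball w0 e2" using z0 that by (simp add: w0_def)
   ultimately show ?thesis unfolding open_contains_ball by blast
  qed
  \<comment> \<open>With this reduction only a local estimate of \<open>J\<close> near
    \<open>z0\<close> is missing, which comes from \<open>asym_on\<close> or \<open>asym_off\<close>
    according to the region.\<close>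
  have key: "\<exists>e'>0. uniform_limit (ball z0 e' \<inter> (G1 - frontier Sig)) r (%_. 0) sequentially"
   if e3: "0 < e3" and bd: "!!n z. 1 <= n ==> z \<in> ball z0 e3 ==> z \<in> G1 ==>
    ?J n z <= B * \<rho> ^ n * real n powr (lam 1 - 2)" for e3 B
  proof -
   obtain e' where e': "0 < e'" "!!z. z \<in> ball z0 e' ==> z \<in> G1 \<and> \<theta> z \<in> ball w0 e1" using ctw[OF e1(1)] by blast
   define T where "T = ball z0 (min e' e3) \<inter> (G1 - frontier Sig)"
   have near: "norm (w0 - \<theta> z) < e1" if "z \<in> T" for z using e'(2)[of z] that by (auto simp: T_def dist_norm)
   have "uniform_limit T r (%_. 0) sequentially"
    unfolding r_def[abs_def]
   proof (rule cor.uniform_remainder[OF P orth \<Lambda> e1(4)])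
    show "norm (\<theta> z) <= m" if "z \<in> T" for z
     using near[OF that] e1(3) norm_triangle_ineq3[of w0 "\<theta> z"] by simp
    show "0 < d / 2" using d by simp
    show "d / 2 <= norm (\<eta> (set.b l) - \<theta> z)" if "z \<in> T" "l \<in> {1..s}" for z l
     using near[OF that(1)] d(2)[OF that(2)] e1(2) norm_triangle_ineq[of "w0 - \<theta> z" "\<theta> z - \<eta> (set.b l)"]
     by (simp add: dist_norm norm_minus_commute)
    show "?J n z <= B * \<rho> ^ n * real n powr (lam 1 - 2)"
     if "1 <= n" "z \<in> T" for n z using bd that by (simp add: T_def)
   qed
   thus ?thesis using e'(1) e3 unfolding T_def by (intro exI[of _ "min e' e3"]) auto
  qed
  show "\<exists>e>0. uniform_limit (ball z0 e \<inter> (G1 - frontier Sig)) r (%_. 0) sequentially"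
  proof (cases "z0 \<in> Sig")
   case True
   define U where "U = set.V \<inter> ball 0 1"
   obtain e A' where eA: "0 < e" "0 < A'" "cball (\<phi> z0) e \<subseteq> U"
    "!!n y. 1 <= n ==> y \<in> ball (\<phi> z0) e ==>
     norm (cor.J cor.r3 n (\<eta> y) - cor.DD y / set.C y * y ^ n * (Dh (\<eta> y) * p (\<eta> y)) - cor.Sm n (\<eta> y)) <= A' * \<rho> ^ n * real n powr (lam 1 - 2)"
   proof (rule cor.asym_on[of U "\<phi> z0"])
    show "open U" unfolding U_def by (intro open_Int set.open_V open_ball)
    show "\<phi> z0 \<in> U" using SigD[OF True] Sig1[OF True] z0 by (simp add: U_def)
    show "\<sigma> < norm y \<and> norm y < 1" if "y \<in> U" for y using that by (auto simp: U_def set.V_def)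
    show "set.b k \<notin> U" if "k \<in> {1..s}" for k using set.b_notin_V[OF that] by (simp add: U_def)
    show "cor.DD holomorphic_on U" unfolding DD U_def by (intro hol_subset[OF set.D_hol_V]) blast
   qed blast
   have "continuous_on Sig \<phi>" using set.comp_Sig[of "%v. v"] by (simp add: hol_imp_cont)
   from continuous_open_preimage[OF this _ open_ball] set.open_Sig
   have "open (Sig \<inter> \<phi> -` ball (\<phi> z0) e)" by simp
   then obtain e3 where e3: "0 < e3" "ball z0 e3 \<subseteq> Sig \<inter> \<phi> -` ball (\<phi> z0) e"
    using True eA(1) by (metis IntI openE vimageI centre_in_ball)
   show ?thesis
   proof (rule key[OF e3(1)])
    fix n :: nat and z assume n: "1 <= n" and z: "z \<in> ball z0 e3" "z \<in> G1"
    have zS: "z \<in> Sig" "\<phi> z \<in> ball (\<phi> z0) e" using e3(2) z by auto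
    show "?J n z <= A' * \<rho> ^ n * real n powr (lam 1 - 2)"
     using eA(4)[OF n zS(2)] zS(1) Sig_val[OF zS(1)] by (simp add: Xr_def Sig1(2)[OF zS(1) z(2)])
   qed
  next
   case False
   hence zs: "z0 \<in> Gs" using dich[OF z0] by blast
   \<comment> \<open>A point of \<open>Gs\<close> is not of the form \<open>\<psi> v\<close> with
     \<open>norm v > \<sigma>\<close>, so its image avoids the range of \<eta>.\<close>
   have "w0 \<notin> \<eta> ` cor.Ann"
   proof
    assume "w0 \<in> \<eta> ` cor.Ann"
    then obtain v where v: "\<sigma> < norm v" "norm v < R1" "\<theta> z0 = \<eta> v" by (auto simp: w0_def)
    hence "z0 = \<psi> v" using G1(1)[of z0] \<xi>(3)[OF v(1,2)] z0 by simp
    thus False using interior_dom_iff[of v \<sigma>] v zs A(7) by simp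
   qed
   from cor.asym_off[OF w0 this] obtain e A' where eA: "0 < e" "0 < A'"
    "!!n w. 1 <= n ==> w \<in> ball w0 e ==> norm (cor.J cor.r3 n w - cor.Sm n w) <= A' * \<rho> ^ n * real n powr (lam 1 - 2)"
    by metis
   obtain e2 where e2: "0 < e2" "!!z. z \<in> ball z0 e2 ==> z \<in> G1 \<and> \<theta> z \<in> ball w0 e" using ctw[OF eA(1)] by blast
   obtain e4 where e4: "0 < e4" "ball z0 e4 \<subseteq> Gs" using openE[of Gs z0] open_interior_dom zs by (metis A(22))
   show ?thesis
   proof (rule key)
    show "0 < min e2 e4" using e2 e4 by simp
    fix n :: nat and z assume n: "1 <= n" and z: "z \<in> ball z0 (min e2 e4)" "z \<in> G1"
    have "z \<in> Gs" using z e4 by auto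
    hence "z \<notin> Sig" using SigD(1,2)[of z] interior_dom_iff[of "\<phi> z" \<sigma>] A(7) by auto
    thus "?J n z <= A' * \<rho> ^ n * real n powr (lam 1 - 2)"
     using eA(3)[OF n] e2(2)[of z] z by (simp add: Xr_def)
   qed
  qed
 qed
 show ?thesis
 proof (intro conjI exI[of _ r] ballI)
  show "\<forall>\<^sub>F n in sequentially. ?b n ~= (0 :: complex) \<and>
    (\<forall>z \<in> G1 - frontier Sig. (z \<in> G1 \<inter> Sig \<or> z \<in> Gs) \<and>
     lhs n z = ?X n z
      + ?b n * inverse (Di z) *
       (?S n z + of_real \<rho> ^ n * r n z))"
   using bn
  proof eventually_elim
   case (elim n)
   show ?case
   proof (intro conjI ballI)
    show "?b n ~= (0 :: complex)" using elim by (simp only: bne of_real_eq_0_iff not_False_eq_True)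
    fix z assume z: "z \<in> G1 - frontier Sig"
    show "z \<in> G1 \<inter> Sig \<or> z \<in> Gs" using dich[OF z] z by blast
    show "lhs n z = ?X n z
      + ?b n * inverse (Di z) *
       (?S n z + of_real \<rho> ^ n * r n z)"
     unfolding bne using form[OF elim] z by (simp only: Xr_def DiffD1)
   qed
  qed
  show "locally_uniform_limit (G1 - frontier Sig) r (%_. 0)" by (rule unif)
  fix j assume j: "j \<in> {1..s}"
  have \<xi>a: "\<xi> (\<eta> (set.b j)) = a j" using \<xi>(3)[of "set.b j"] set.b[OF j] A(8,9) R by simp
  have d\<phi>a: "deriv \<phi> (a j) = 1 / (set.C (set.b j))\<^sup>2" using d\<phi>[of "set.b j"] set.C_sq[of "set.b j"] set.b[OF j] by simp
  have S: "(\<Sum>k\<in>{1..u} - {j}. \<alpha> k * Di (a k) * W (a k) (a j) * \<phi> (a k) ^ (n + 1)) = (\<Sum>l\<in>cor.top_ind - {j}. cor.\<alpha>c l * Dh (\<eta> (set.b l)) *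
    (1 / (p (\<eta> (set.b j)) * p (\<eta> (set.b l)) * (\<eta> (set.b l) - \<eta> (set.b j)))) * set.b l ^ Suc n)" for n
   unfolding top using usub ak(5)[OF j] by (intro sum.cong refl) (simp add: ak W ak(4)[OF j])
  show "(%n. norm (lhs n (a j) - of_real (gen_binomial (real n) (lam j)) * \<alpha> j * deriv \<phi> (a j) * \<phi> (a j) ^ n
      - ?b n * inverse (Di (a j)) *
       (\<Sum>k\<in>{1..u} - {j}. \<alpha> k * Di (a k) * W (a k) (a j) * \<phi> (a k) ^ (n + 1))))
    \<in> o(%n. real n powr max (lam j) (lam 1 - 1) * \<rho> ^ n)"
   using cor.asymptotics_at_singularity[OF P orth j]
   unfolding S lhs bne d\<phi>a ak(2,3)[OF j] ak(1)[OF j, symmetric] \<xi>a .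
 qed
qed

end
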